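(* There is a unique constant $\lambda\in\mathbb R$ such that $-\lambda$ is the uniform limit of $\delta_n\mathcal V_{\delta_n}(\cdot)$ along some sequence $\delta_n\to 0^+$. The convergence does not depend on a subsequence, i.e. $\delta\mathcal V_\delta(\cdot)\to-\lambda$ uniformly on $\mathcal P(\mathbb T^d)$ as $\delta\to0^+$. Moreover, $\frac1T\,\mathcal U(T,\cdot)$ converges uniformly on $\mathcal P(\mathbb T^d)$ to $-\lambda$ as $T\to+\infty$.
   Context: $\mathbb T^d=\mathbb R^d/\mathbb Z^d$. $\mathcal P(\mathbb T^d)$ is the set of Borel probability measures on $\mathbb T^d$ with the distance $\mathbf d(\mu,\nu)=\sup\{\int_{\mathbb T^d}\phi\,d(\mu-\nu):\phi:\mathbb T^d\to\mathbb R,\ \mathrm{Lip}(\phi)\le1\}$. Derivatives: $\Phi:\mathcal P(\mathbb T^d)\to\mathbb R$ is $C^1$ if there is a continuous $\frac{\delta\Phi}{\delta m}:\mathcal P(\mathbb T^d)\times\mathbb T^d\to\mathbb R$ with $\Phi(m_2)-\Phi(m_1)=\int_0^1\int_{\mathbb T^d}\frac{\delta\Phi}{\delta m}((1-t)m_1+tm_2,x)(m_2-m_1)(dx)\,dt$ for all $m_1,m_2$, normalized by $\int_{\mathbb T^d}\frac{\delta\Phi}{\delta m}(m,x)\,m(dx)=0$; $C^2$ is understood in the same sense. Standing assumptions. (1) $H:\mathbb T^d\times\mathbb R^d\to\mathbb R$ is $C^2$, $p\mapsto D_{pp}H(x,p)$ is Lipschitz uniformly in $x$; there is $\bar C>0$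 with $\bar C^{-1}I_d\le D_{pp}H(x,p)\le\bar C I_d$ for all $(x,p)$; there are $\theta\in(0,1)$, $C>0$ with $|D_{xx}H(x,p)|\le C(1+|p|)^{1+\theta}$ and $|D_{xp}H(x,p)|\le C(1+|p|)^\theta$ for all $(x,p)$. (2) $\mathcal F:\mathcal P(\mathbb T^d)\to\mathbb R$ is $C^2$; its derivative $F(x,m)=\frac{\delta\mathcal F}{\delta m}(m,x)$ is twice differentiable in $x$ and $D^2_{xx}F$ is bounded. $H^*(x,q)=\sup_{p\in\mathbb R^d}\{p\cdot q-H(x,p)\}$. For $T>0$ and $m_0\in\mathcal P(\mathbb T^d)$, $$\mathcal U(T,m_0)=\inf_{(m,\alpha)}\int_0^T\Big(\int_{\mathbb T^d}H^*(x,\alpha(t,x))\,m(t,dx)+\mathcal F(m(t))\Big)dt,$$ over $m\in C^0([0,T],\mathcal P(\mathbb T^d))$ and $\alpha:[0,T]\times\mathbb T^d\to\mathbb R^d$ with $\int_0^T\int|\alpha|^2dm(t)\,dt<\infty$, such that $-\partial_tm+\Delta m+\mathrm{div}(m\alpha)=0$ in the sense of distributions with $m(0)=m_0$. For $\delta>0$, $$\mathcal V_\delta(m_0)=\inf_{(m,\alpha)}\int_0^\infty e^{-\delta t}\Big(\int_{\mathbb T^d}H^*(x,\alpha(t,x))\,m(t,dx)+\mathcal F(m(t))\Big)dt,$$ over $m\in C^0([0,\infty),\mathcal P(\mathbb T^d))$ and $\alpha$ with $\int_0^\infty e^{-\delta t}\int|\alpha|^2dm(t)\,dt<\infty$, satisfying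 the same equation on $[0,\infty)\times\mathbb T^d$ with $m(0)=m_0$. *)

theory Defs
  imports "HOL-Probability.Probability"
begin

definition int_lattice :: "(real^'n) set" where
  "int_lattice = {k. \<forall>i. k $ i \<in> \<int>}"

definition torus_rel :: "real^'n \<Rightarrow> real^'n \<Rightarrow> bool" where
  "torus_rel x y \<longleftrightarrow> x - y \<in> int_lattice"

lemma int_lattice_zero [simp]: "0 \<in> int_lattice"
  by (simp add: int_lattice_def)

lemma int_lattice_add: "k \<in> int_lattice \<Longrightarrow> l \<in> int_lattice \<Longrightarrow> k + l \<in> int_lattice"
  by (simp add: int_lattice_def)

lemma int_lattice_minus: "k \<in> int_lattice \<Longrightarrow> - k \<in> int_lattice"
  by (simp add: int_lattice_def)

lemma int_lattice_diff: "k \<in> int_lattice \<Longrightarrow> l \<in> int_lattice \<Longrightarrow> k - l \<in> int_lattice"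
  by (simp add: int_lattice_def)

lemma closed_int_lattice: "closed (int_lattice :: (real^'n) set)"
proof -
  have "closed ((\<lambda>k::real^'n. k $ i) -` \<int>)" for i :: 'n
    by (intro continuous_closed_vimage closed_Ints continuous_intros)
  then have "closed (\<Inter>i. (\<lambda>k::real^'n. k $ i) -` \<int>)"
    by blast
  also have "(\<Inter>i. (\<lambda>k::real^'n. k $ i) -` \<int>) = int_lattice"
    by (auto simp: int_lattice_def)
  finally show ?thesis .
qed

quotient_type 'n torus = "(real, 'n::finite) vec" / torus_rel
proof (rule equivpI)
  show "reflp torus_rel"
    by (simp add: reflp_def torus_rel_def)
  show "symp torus_rel"
    unfolding symp_def torus_rel_def using int_lattice_minus by fastforce
  show "transp torus_rel"
    unfolding transp_def torus_rel_def using int_lattice_add by fastforce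
qed

lemma infdist_int_lattice_attained:
  obtains k :: "real^'n" where "k \<in> int_lattice" "infdist x int_lattice = norm (x - k)"
  using infdist_attains_inf[OF closed_int_lattice, of x] int_lattice_zero
  by (metis dist_norm empty_iff)

lemma infdist_int_lattice_le: "k \<in> int_lattice \<Longrightarrow> infdist x int_lattice \<le> norm (x - k)"
  by (metis dist_norm infdist_le)

lemma infdist_int_lattice_shift:
  fixes x :: "real^'n"
  assumes "k \<in> int_lattice"
  shows "infdist (x + k) int_lattice = infdist x int_lattice"
proof -
  have *: "infdist (y + l) int_lattice \<le> infdist y int_lattice"
    if l: "l \<in> int_lattice" for y l :: "real^'n"
  proof -
    obtain j where j: "j \<in> int_lattice" "infdist y int_lattice = norm (y - j)"
      using infdist_int_lattice_attained by blast
    have "infdist (y + l) int_lattice \<le> norm ((y + l) - (j + l))"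
      using infdist_int_lattice_le int_lattice_add[OF j(1) l] by blast
    then show ?thesis using j by simp
  qed
  show ?thesis
    using *[OF assms, of x] *[OF int_lattice_minus[OF assms], of "x + k"] by simp
qed

instantiation torus :: (finite) metric_space
begin

lift_definition dist_torus :: "'a torus \<Rightarrow> 'a torus \<Rightarrow> real"
  is "\<lambda>x y. infdist (x - y) int_lattice"
proof -
  fix x x' y y' :: "real^'a"
  assume "torus_rel x x'" "torus_rel y y'"
  then have "(x - x') - (y - y') \<in> int_lattice"
    unfolding torus_rel_def by (rule int_lattice_diff)
  from infdist_int_lattice_shift[OF this, of "x' - y'"]
  show "infdist (x - y) int_lattice = infdist (x' - y') int_lattice"
    by (simp add: algebra_simps)
qed

definition uniformity_torus :: "('a torus \<times> 'a torus) filter" where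
  "uniformity_torus = (INF e\<in>{0<..}. principal {(x, y). dist x y < e})"

definition open_torus :: "'a torus set \<Rightarrow> bool" where
  "open_torus U \<longleftrightarrow> (\<forall>x\<in>U. \<forall>\<^sub>F (x', y) in uniformity. x' = x \<longrightarrow> y \<in> U)"

instance
proof
  fix x y z :: "'a torus"
  show "dist x y = 0 \<longleftrightarrow> x = y"
  proof transfer
    fix x y :: "real^'a"
    show "infdist (x - y) int_lattice = 0 \<longleftrightarrow> torus_rel x y"
      unfolding torus_rel_def
      using in_closed_iff_infdist_zero[OF closed_int_lattice] int_lattice_zero by blast
  qed
  show "dist x y \<le> dist x z + dist y z"
  proof transfer
    fix x y z :: "real^'a"
    obtain k where k: "k \<in> int_lattice" "infdist (x - z) int_lattice = norm (x - z - k)"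
      using infdist_int_lattice_attained by blast
    obtain l where l: "l \<in> int_lattice" "infdist (y - z) int_lattice = norm (y - z - l)"
      using infdist_int_lattice_attained by blast
    have "infdist (x - y) int_lattice \<le> norm ((x - y) - (k - l))"
      using infdist_int_lattice_le int_lattice_diff[OF k(1) l(1)] by blast
    also have "\<dots> = norm ((x - z - k) - (y - z - l))"
      by (simp add: algebra_simps)
    also have "\<dots> \<le> norm (x - z - k) + norm (y - z - l)"
      by (rule norm_triangle_ineq4)
    finally show "infdist (x - y) int_lattice
        \<le> infdist (x - z) int_lattice + infdist (y - z) int_lattice"
      using k l by simp
  qed
qed (simp_all add: uniformity_torus_def open_torus_def)

end

lemma dist_abs_torus_le: "dist (abs_torus x) (abs_torus y) \<le> dist x y"
  using infdist_int_lattice_le[OF int_lattice_zero, of "x - y"]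
  by (simp add: dist_torus.abs_eq dist_norm)

lemma continuous_on_abs_torus: "continuous_on A abs_torus"
  unfolding continuous_on_iff using dist_abs_torus_le le_less_trans by metis

lemma abs_torus_shift: "k \<in> int_lattice \<Longrightarrow> abs_torus (x + k) = abs_torus x"
  by (simp add: torus.abs_eq_iff torus_rel_def)

lemma compact_torus: "compact (UNIV :: 'n::finite torus set)"
proof -
  have "\<exists>y\<in>cbox 0 1. x = abs_torus y" for x :: "'n torus"
  proof -
    obtain z where z: "x = abs_torus z"
      by (metis Quotient_abs_rep Quotient_torus)
    define k :: "real^'n" where "k = (\<chi> i. - of_int \<lfloor>z $ i\<rfloor>)"
    have "k \<in> int_lattice"
      by (simp add: int_lattice_def k_def)
    moreover have "z + k \<in> cbox 0 1"
      by (simp add: mem_box_cart k_def) linarith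
    ultimately show ?thesis
      using abs_torus_shift z by metis
  qed
  then have "UNIV = abs_torus ` cbox (0::real^'n) 1"
    by blast
  then show ?thesis
    using compact_continuous_image[OF continuous_on_abs_torus compact_cbox] by metis
qed

text \<open>
  Over a finite-dimensional domain, continuity of all directional derivatives
  \<open>x \<mapsto> Df(x)v\<close> amounts to continuity of the Frechet derivative.
\<close>

primrec Ck :: "nat \<Rightarrow> ('a::real_normed_vector \<Rightarrow> 'b::real_normed_vector) \<Rightarrow> bool" where
  "Ck 0 f \<longleftrightarrow> continuous_on UNIV f"
| "Ck (Suc k) f \<longleftrightarrow> (\<forall>x. f differentiable (at x)) \<and>
     (\<forall>v. Ck k (\<lambda>x. frechet_derivative f (at x) v))"

definition smooth :: "('a::real_normed_vector \<Rightarrow> 'b::real_normed_vector) \<Rightarrow> bool" where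
  "smooth f \<longleftrightarrow> (\<forall>k. Ck k f)"

definition grad :: "(real^'n \<Rightarrow> real) \<Rightarrow> real^'n \<Rightarrow> real^'n" where
  "grad f x = (\<chi> i. frechet_derivative f (at x) (axis i 1))"

definition hessian :: "(real^'n \<Rightarrow> real) \<Rightarrow> real^'n \<Rightarrow> real^'n^'n" where
  "hessian f x = jacobian (grad f) (at x)"

definition twice_differentiable :: "(real^'n \<Rightarrow> real) \<Rightarrow> bool" where
  "twice_differentiable f \<longleftrightarrow>
     (\<forall>x. f differentiable (at x)) \<and> (\<forall>x. grad f differentiable (at x))"

text \<open>
  Functions on the torus are differentiated through their periodic lifts to \<open>\<real>\<^sup>n\<close>, so the
  choice of representative is immaterial (see the lemmas below).
\<close>

definition torus_grad :: "('n::finite torus \<Rightarrow> real) \<Rightarrow> 'n torus \<Rightarrow> real^'n" where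
  "torus_grad f x = grad (\<lambda>y. f (abs_torus y)) (rep_torus x)"

definition torus_hessian :: "('n::finite torus \<Rightarrow> real) \<Rightarrow> 'n torus \<Rightarrow> real^'n^'n" where
  "torus_hessian f x = hessian (\<lambda>y. f (abs_torus y)) (rep_torus x)"

definition torus_laplacian :: "('n::finite torus \<Rightarrow> real) \<Rightarrow> 'n torus \<Rightarrow> real" where
  "torus_laplacian f x = trace (torus_hessian f x)"

definition torus_jacobian :: "('n::finite torus \<Rightarrow> real^'m) \<Rightarrow> 'n torus \<Rightarrow> real^'n^'m" where
  "torus_jacobian g x = jacobian (\<lambda>y. g (abs_torus y)) (at (rep_torus x))"

lemma frechet_derivative_shift:
  fixes f :: "'a::real_normed_vector \<Rightarrow> 'b::real_normed_vector"
  assumes "\<And>x. f (x + k) = f x"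
  shows "frechet_derivative f (at (x + k)) = frechet_derivative f (at x)"
proof -
  have *: "(f has_derivative f') (at (y + l))"
    if f': "(f has_derivative f') (at y)" and l: "\<And>x. f (x + l) = f x" for f' y l
  proof -
    have s: "((\<lambda>z. z - l) has_derivative (\<lambda>h. h)) (at (y + l))"
      by (auto intro!: derivative_eq_intros)
    have "(f has_derivative f') (at ((y + l) - l))"
      using f' by simp
    from diff_chain_at[OF s this]
    have "((\<lambda>z. f (z - l)) has_derivative f') (at (y + l))"
      by (simp add: o_def)
    moreover have "(\<lambda>z. f (z - l)) = f"
    proof
      fix z show "f (z - l) = f z" using l[of "z - l"] by simp
    qed
    ultimately show ?thesis by simp
  qed
  have m: "f (z + (- k)) = f z" for z
    using assms[of "z - k"] by simp
  have "(f has_derivative f') (at (x + k)) \<longleftrightarrow> (f has_derivative f') (at x)" for f'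
  proof
    assume "(f has_derivative f') (at (x + k))"
    from *[OF this m] show "(f has_derivative f') (at x)" by simp
  qed (rule *[OF _ assms])
  then show ?thesis
    by (simp add: frechet_derivative_def)
qed

lemma rep_abs_torus: "\<exists>k\<in>int_lattice. rep_torus (abs_torus y) = y + k"
proof -
  have "torus_rel (rep_torus (abs_torus y)) y"
    by (metis Quotient_abs_rep Quotient_torus torus.abs_eq_iff)
  then show ?thesis
    by (intro bexI[of _ "rep_torus (abs_torus y) - y"]) (auto simp: torus_rel_def)
qed

lemma torus_grad_abs: "torus_grad f (abs_torus y) = grad (\<lambda>y. f (abs_torus y)) y"
proof -
  obtain k where k: "k \<in> int_lattice" "rep_torus (abs_torus y) = y + k"
    using rep_abs_torus by blast
  show ?thesis
    using frechet_derivative_shift[of "\<lambda>y. f (abs_torus y)" k y] abs_torus_shift[OF k(1)] k(2)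
    by (simp add: torus_grad_def grad_def)
qed

lemma torus_jacobian_abs: "torus_jacobian g (abs_torus y) = jacobian (\<lambda>y. g (abs_torus y)) (at y)"
proof -
  obtain k where k: "k \<in> int_lattice" "rep_torus (abs_torus y) = y + k"
    using rep_abs_torus by blast
  show ?thesis
    using frechet_derivative_shift[of "\<lambda>y. g (abs_torus y)" k y] abs_torus_shift[OF k(1)] k(2)
    by (simp add: torus_jacobian_def jacobian_def)
qed

lemma torus_hessian_eq: "torus_hessian f = torus_jacobian (torus_grad f)"
  by (simp add: fun_eq_iff torus_hessian_def hessian_def torus_jacobian_def torus_grad_abs)

lemma torus_hessian_abs: "torus_hessian f (abs_torus y) = hessian (\<lambda>y. f (abs_torus y)) y"
  by (simp add: torus_hessian_eq torus_jacobian_abs torus_grad_abs hessian_def)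

definition prob_torus :: "'n::finite torus measure set" where
  "prob_torus = {\<mu>. sets \<mu> = sets borel \<and> prob_space \<mu>}"

text \<open>
  The value \<open>0\<close> off \<open>prob_torus\<close> is a dummy: the locale \<open>Metric_space\<close> asks for
  nonnegativity and symmetry on the whole type.
\<close>

definition kr_dist :: "'n::finite torus measure \<Rightarrow> 'n torus measure \<Rightarrow> real" where
  "kr_dist \<mu> \<nu> =
     (if \<mu> \<in> prob_torus \<and> \<nu> \<in> prob_torus
      then SUP \<phi>\<in>{\<phi> :: 'n torus \<Rightarrow> real. 1-lipschitz_on UNIV \<phi>}.
             (\<integral>x. \<phi> x \<partial>\<mu>) - (\<integral>x. \<phi> x \<partial>\<nu>)
      else 0)"

definition prob_topology :: "'n::finite torus measure topology" where
  "prob_topology = Metric_space.mtopology prob_torus kr_dist"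

definition mix :: "real \<Rightarrow> 'a measure \<Rightarrow> 'a measure \<Rightarrow> 'a measure" where
  "mix t \<mu> \<nu> = measure_of (space \<mu>) (sets \<mu>)
     (\<lambda>A. ennreal (1 - t) * emeasure \<mu> A + ennreal t * emeasure \<nu> A)"

lemma prob_torusD:
  assumes "\<mu> \<in> prob_torus"
  shows "sets \<mu> = sets borel" "space \<mu> = UNIV" "prob_space \<mu>"
  using assms sets_eq_imp_space_eq[of \<mu> borel] by (auto simp: prob_torus_def)

lemma sets_mix [simp]: "sets (mix t \<mu> \<nu>) = sets \<mu>"
  by (simp add: mix_def)

lemma space_mix [simp]: "space (mix t \<mu> \<nu>) = space \<mu>"
  by (simp add: mix_def)

lemma emeasure_mix:
  assumes "sets \<nu> = sets \<mu>" "A \<in> sets \<mu>"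
  shows "emeasure (mix t \<mu> \<nu>) A = ennreal (1 - t) * emeasure \<mu> A + ennreal t * emeasure \<nu> A"
  unfolding mix_def
proof (rule emeasure_measure_of_sigma)
  show "sigma_algebra (space \<mu>) (sets \<mu>)" ..
  show "positive (sets \<mu>) (\<lambda>A. ennreal (1 - t) * emeasure \<mu> A + ennreal t * emeasure \<nu> A)"
    by (simp add: positive_def)
  show "countably_additive (sets \<mu>)
          (\<lambda>A. ennreal (1 - t) * emeasure \<mu> A + ennreal t * emeasure \<nu> A)"
  proof (rule countably_additiveI)
    fix A :: "nat \<Rightarrow> 'a set"
    assume A: "range A \<subseteq> sets \<mu>" "disjoint_family A"
    have "(\<Sum>i. ennreal (1 - t) * emeasure \<mu> (A i) + ennreal t * emeasure \<nu> (A i)) =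
        ennreal (1 - t) * (\<Sum>i. emeasure \<mu> (A i)) + ennreal t * (\<Sum>i. emeasure \<nu> (A i))"
      by (simp add: suminf_add[symmetric] ennreal_suminf_cmult)
    also have "(\<Sum>i. emeasure \<mu> (A i)) = emeasure \<mu> (\<Union>i. A i)"
      using A by (intro suminf_emeasure)
    also have "(\<Sum>i. emeasure \<nu> (A i)) = emeasure \<nu> (\<Union>i. A i)"
      using A assms(1) by (intro suminf_emeasure) simp_all
    finally show "(\<Sum>i. ennreal (1 - t) * emeasure \<mu> (A i) + ennreal t * emeasure \<nu> (A i)) =
        ennreal (1 - t) * emeasure \<mu> (\<Union>i. A i) + ennreal t * emeasure \<nu> (\<Union>i. A i)" .
  qed
qed (fact assms)

lemma mix_in_prob_torus:
  assumes "\<mu> \<in> prob_torus" "\<nu> \<in> prob_torus" "0 \<le> t" "t \<le> 1"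
  shows "mix t \<mu> \<nu> \<in> prob_torus"
proof -
  interpret \<mu>: prob_space \<mu> using prob_torusD[OF assms(1)] by blast
  interpret \<nu>: prob_space \<nu> using prob_torusD[OF assms(2)] by blast
  have s: "space \<mu> = UNIV" "space \<nu> = UNIV" "sets \<mu> = sets borel" "sets \<nu> = sets borel"
    using prob_torusD[OF assms(1)] prob_torusD[OF assms(2)] by auto
  have "emeasure (mix t \<mu> \<nu>) UNIV = ennreal (1 - t) + ennreal t"
    using \<mu>.emeasure_space_1 \<nu>.emeasure_space_1 s by (simp add: emeasure_mix)
  also have "\<dots> = 1"
    using assms(3,4) by (simp flip: ennreal_plus)
  finally have "prob_space (mix t \<mu> \<nu>)"
    by (intro prob_spaceI) (simp add: s)
  then show ?thesis
    by (simp add: prob_torus_def s)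
qed

lemma lipschitz_integrable:
  fixes \<phi> :: "'n::finite torus \<Rightarrow> real"
  assumes "\<mu> \<in> prob_torus" "C-lipschitz_on UNIV \<phi>"
  shows "integrable \<mu> \<phi>"
proof -
  interpret prob_space \<mu> using prob_torusD[OF assms(1)] by blast
  have c: "continuous_on UNIV \<phi>"
    using assms(2) by (rule lipschitz_on_continuous_on)
  then have "bounded (range \<phi>)"
    using compact_continuous_image[OF c compact_torus] compact_imp_bounded by blast
  then obtain B where "\<forall>x. norm (\<phi> x) \<le> B"
    by (auto simp: bounded_iff)
  moreover have "\<phi> \<in> borel_measurable \<mu>"
    using borel_measurable_continuous_onI[OF c] prob_torusD(1)[OF assms(1)]
    by (simp cong: measurable_cong_sets)
  ultimately show ?thesis
    by (intro integrable_const_bound[where B=B]) auto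
qed

lemma kr_dist_bdd:
  assumes "\<mu> \<in> prob_torus" "\<nu> \<in> (prob_torus :: 'n::finite torus measure set)"
  shows "bdd_above ((\<lambda>\<phi>. (\<integral>x. \<phi> x \<partial>\<mu>) - (\<integral>x. \<phi> x \<partial>\<nu>)) `
           {\<phi> :: 'n torus \<Rightarrow> real. 1-lipschitz_on UNIV \<phi>})"
proof -
  define D where "D = diameter (UNIV :: 'n torus set)"
  have *: "\<bar>(\<integral>x. \<phi> x \<partial>\<rho>) - \<phi> a\<bar> \<le> D"
    if "\<rho> \<in> prob_torus" "1-lipschitz_on UNIV \<phi>" for \<rho> and \<phi> :: "'n torus \<Rightarrow> real" and a
  proof -
    interpret prob_space \<rho> using prob_torusD[OF that(1)] by blast
    have i: "integrable \<rho> \<phi>" using that by (rule lipschitz_integrable)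
    have b: "\<bar>\<phi> x - \<phi> a\<bar> \<le> D" for x
    proof -
      have "dist (\<phi> x) (\<phi> a) \<le> 1 * dist x a"
        using lipschitz_onD[OF that(2), of x a] by simp
      also have "dist x a \<le> D"
        unfolding D_def
        by (intro diameter_bounded_bound compact_imp_bounded compact_torus) auto
      finally show ?thesis by (simp add: dist_real_def)
    qed
    have "(\<integral>x. \<phi> x \<partial>\<rho>) - \<phi> a = (\<integral>x. \<phi> x - \<phi> a \<partial>\<rho>)"
      using i by (simp add: prob_space)
    also have "\<bar>\<dots>\<bar> \<le> (\<integral>x. \<bar>\<phi> x - \<phi> a\<bar> \<partial>\<rho>)"
      by (rule integral_abs_bound)
    also have "\<dots> \<le> (\<integral>x. D \<partial>\<rho>)"
      using i b by (intro integral_mono) auto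
    finally show ?thesis by (simp add: prob_space)
  qed
  show ?thesis
  proof (rule bdd_aboveI2)
    fix \<phi> :: "'n torus \<Rightarrow> real" assume "\<phi> \<in> {\<phi>. 1-lipschitz_on UNIV \<phi>}"
    then show "(\<integral>x. \<phi> x \<partial>\<mu>) - (\<integral>x. \<phi> x \<partial>\<nu>) \<le> 2 * D"
      using *[OF assms(1), of \<phi> undefined] *[OF assms(2), of \<phi> undefined] by simp
  qed
qed

lemma kr_dist_upper:
  fixes \<phi> :: "'n::finite torus \<Rightarrow> real"
  assumes "\<mu> \<in> prob_torus" "\<nu> \<in> prob_torus" "1-lipschitz_on UNIV \<phi>"
  shows "(\<integral>x. \<phi> x \<partial>\<mu>) - (\<integral>x. \<phi> x \<partial>\<nu>) \<le> kr_dist \<mu> \<nu>"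
proof -
  have "(\<integral>x. \<phi> x \<partial>\<mu>) - (\<integral>x. \<phi> x \<partial>\<nu>)
      \<le> (SUP \<phi>\<in>{\<phi> :: 'n torus \<Rightarrow> real. 1-lipschitz_on UNIV \<phi>}.
           (\<integral>x. \<phi> x \<partial>\<mu>) - (\<integral>x. \<phi> x \<partial>\<nu>))"
    using kr_dist_bdd[OF assms(1,2)] assms(3) by (intro cSUP_upper) auto
  then show ?thesis using assms by (simp add: kr_dist_def)
qed

lemma kr_dist_least:
  fixes \<mu> \<nu> :: "'n::finite torus measure"
  assumes "\<mu> \<in> prob_torus" "\<nu> \<in> prob_torus"
    and "\<And>\<phi> :: 'n torus \<Rightarrow> real. 1-lipschitz_on UNIV \<phi> \<Longrightarrow>
    (\<integral>x. \<phi> x \<partial>\<mu>) - (\<integral>x. \<phi> x \<partial>\<nu>) \<le> c"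
  shows "kr_dist \<mu> \<nu> \<le> c"
proof -
  have "1-lipschitz_on UNIV (\<lambda>_ :: 'n torus. 0 :: real)"
    by (simp add: lipschitz_on_def)
  then have "(SUP \<phi>\<in>{\<phi> :: 'n torus \<Rightarrow> real. 1-lipschitz_on UNIV \<phi>}.
           (\<integral>x. \<phi> x \<partial>\<mu>) - (\<integral>x. \<phi> x \<partial>\<nu>)) \<le> c"
    using assms(3) by (intro cSUP_least) auto
  then show ?thesis using assms by (simp add: kr_dist_def)
qed

lemma kr_dist_zero_imp_eq:
  fixes \<mu> \<nu> :: "'n::finite torus measure"
  assumes \<mu>: "\<mu> \<in> prob_torus" and \<nu>: "\<nu> \<in> prob_torus"
    and zero: "kr_dist \<mu> \<nu> = 0"
  shows "\<mu> = \<nu>"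
proof -
  interpret \<mu>: prob_space \<mu> using prob_torusD[OF \<mu>] by blast
  interpret \<nu>: prob_space \<nu> using prob_torusD[OF \<nu>] by blast
  have le: "(\<integral>x. \<phi> x \<partial>\<mu>) \<le> (\<integral>x. \<phi> x \<partial>\<nu>)" if "1-lipschitz_on UNIV \<phi>"
    for \<phi> :: "'n torus \<Rightarrow> real"
    using kr_dist_upper[OF \<mu> \<nu> that] zero by simp
  have eq1: "(\<integral>x. \<phi> x \<partial>\<mu>) = (\<integral>x. \<phi> x \<partial>\<nu>)" if "1-lipschitz_on UNIV \<phi>"
    for \<phi> :: "'n torus \<Rightarrow> real"
    using le[OF that] le[of "\<lambda>x. - \<phi> x"] that by (simp add: lipschitz_on_def dist_minus)
  have eqn: "(\<integral>x. \<phi> x \<partial>\<mu>) = (\<integral>x. \<phi> x \<partial>\<nu>)" if "C-lipschitz_on UNIV \<phi>" "C > 0"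
    for \<phi> :: "'n torus \<Rightarrow> real" and C
  proof -
    have "1-lipschitz_on UNIV (\<lambda>x. \<phi> x / C)"
    proof (rule lipschitz_onI)
      fix x y
      have "dist (\<phi> x) (\<phi> y) \<le> C * dist x y"
        using that(1) by (auto dest: lipschitz_onD)
      then show "dist (\<phi> x / C) (\<phi> y / C) \<le> 1 * dist x y"
        using that(2) by (simp add: dist_real_def field_simps flip: diff_divide_distrib)
    qed simp
    from eq1[OF this] show ?thesis using that(2) by simp
  qed
  have closed_eq: "emeasure \<mu> K = emeasure \<nu> K" if K: "closed K" for K
  proof (cases "K = {}")
    case False
    define f :: "nat \<Rightarrow> 'n torus \<Rightarrow> real" where
      "f n x = max 0 (1 - real (Suc n) * infdist x K)" for n x
    have lip: "(real (Suc n))-lipschitz_on UNIV (f n)" for n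
    proof (rule lipschitz_onI)
      fix x y
      have "\<bar>f n x - f n y\<bar> \<le> \<bar>real (Suc n) * infdist x K - real (Suc n) * infdist y K\<bar>"
        unfolding f_def by linarith
      also have "\<dots> = real (Suc n) * \<bar>infdist x K - infdist y K\<bar>"
        by (simp add: abs_mult flip: right_diff_distrib)
      also have "\<dots> \<le> real (Suc n) * dist x y"
        by (intro mult_left_mono infdist_triangle_abs) simp
      finally show "dist (f n x) (f n y) \<le> real (Suc n) * dist x y"
        by (simp add: dist_real_def)
    qed simp
    have lim: "(\<lambda>n. f n x) \<longlonglongrightarrow> indicator K x" for x
    proof (cases "x \<in> K")
      case True
      then show ?thesis by (simp add: f_def)
    next
      case nK: False
      then have pos: "infdist x K > 0"
        using K False infdist_pos_not_in_closed by blast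
      obtain N :: nat where N: "1 / infdist x K < real N"
        using reals_Archimedean2 by blast
      have "f n x = 0" if "n \<ge> N" for n
      proof -
        have "1 / infdist x K < real (Suc n)" using N that by linarith
        then have "1 < real (Suc n) * infdist x K" using pos by (simp add: divide_less_eq)
        then show ?thesis by (simp add: f_def)
      qed
      then show ?thesis
        using nK by (intro tendsto_eventually) (auto simp: eventually_sequentially)
    qed
    have conv: "(\<lambda>n. \<integral>x. f n x \<partial>\<rho>) \<longlonglongrightarrow> measure \<rho> K" if \<rho>: "\<rho> \<in> prob_torus" for \<rho>
    proof -
      interpret \<rho>: prob_space \<rho> using prob_torusD[OF \<rho>] by blast
      have Kb: "K \<in> sets \<rho>" using K prob_torusD(1)[OF \<rho>] by simp
      have "(\<lambda>n. \<integral>x. f n x \<partial>\<rho>) \<longlonglongrightarrow> (\<integral>x. indicator K x \<partial>\<rho>)"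
      proof (rule integral_dominated_convergence[where w="\<lambda>_. 1"])
        show "f n \<in> borel_measurable \<rho>" for n
          using lipschitz_integrable[OF \<rho> lip] by blast
        show "AE x in \<rho>. norm (f n x) \<le> 1" for n
          by (intro AE_I2) (simp add: f_def infdist_nonneg)
      qed (use Kb lim in auto)
      then show ?thesis using Kb by simp
    qed
    have "(\<lambda>n. \<integral>x. f n x \<partial>\<mu>) = (\<lambda>n. \<integral>x. f n x \<partial>\<nu>)"
      using eqn[OF lip] by auto
    then have "measure \<mu> K = measure \<nu> K"
      using conv[OF \<mu>] conv[OF \<nu>] LIMSEQ_unique by metis
    then show ?thesis
      by (simp add: \<mu>.emeasure_eq_measure \<nu>.emeasure_eq_measure)
  qed simp
  show ?thesis
  proof (rule measure_eqI_generator_eq[where E="Collect closed" and \<Omega>=UNIV and A="\<lambda>_. UNIV"])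
    show "Int_stable (Collect closed :: 'n torus set set)"
      by (auto simp: Int_stable_def)
    show "sets \<mu> = sigma_sets UNIV (Collect closed)" "sets \<nu> = sigma_sets UNIV (Collect closed)"
      using prob_torusD(1)[OF \<mu>] prob_torusD(1)[OF \<nu>] by (simp_all add: borel_eq_closed)
    show "emeasure \<mu> UNIV \<noteq> \<infinity>"
      by simp
  qed (use closed_eq in auto)
qed

lemma Metric_space_prob_torus: "Metric_space (prob_torus :: 'n::finite torus measure set) kr_dist"
proof -
  have sym_le: "kr_dist \<mu> \<nu> \<le> kr_dist \<nu> \<mu>"
    if "\<mu> \<in> prob_torus" "\<nu> \<in> prob_torus" for \<mu> \<nu> :: "'n torus measure"
  proof (rule kr_dist_least[OF that])
    fix \<phi> :: "'n torus \<Rightarrow> real" assume "1-lipschitz_on UNIV \<phi>"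
    then have "1-lipschitz_on UNIV (\<lambda>x. - \<phi> x)"
      by (simp add: lipschitz_on_def dist_minus)
    from kr_dist_upper[OF that(2,1) this]
    show "(\<integral>x. \<phi> x \<partial>\<mu>) - (\<integral>x. \<phi> x \<partial>\<nu>) \<le> kr_dist \<nu> \<mu>" by simp
  qed
  have nonneg: "0 \<le> kr_dist \<mu> \<nu>"
    if "\<mu> \<in> prob_torus" "\<nu> \<in> prob_torus" for \<mu> \<nu> :: "'n torus measure"
    using kr_dist_upper[OF that, of "\<lambda>_. 0"] by (simp add: lipschitz_on_def)
  show ?thesis
  proof
    fix \<mu> \<nu> \<rho> :: "'n torus measure"
    show "0 \<le> kr_dist \<mu> \<nu>"
      using nonneg[of \<mu> \<nu>] by (cases "\<mu> \<in> prob_torus \<and> \<nu> \<in> prob_torus") (auto simp: kr_dist_def)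
    show "kr_dist \<mu> \<nu> = kr_dist \<nu> \<mu>"
      using sym_le[of \<mu> \<nu>] sym_le[of \<nu> \<mu>]
      by (cases "\<mu> \<in> prob_torus \<and> \<nu> \<in> prob_torus") (auto simp: kr_dist_def)
    assume P: "\<mu> \<in> prob_torus" "\<nu> \<in> prob_torus"
    have "kr_dist \<mu> \<mu> = 0"
      using nonneg[OF P(1) P(1)] kr_dist_least[OF P(1) P(1), of 0] by simp
    then show "kr_dist \<mu> \<nu> = 0 \<longleftrightarrow> \<mu> = \<nu>"
      using kr_dist_zero_imp_eq[OF P] by auto
    assume R: "\<rho> \<in> prob_torus"
    show "kr_dist \<mu> \<rho> \<le> kr_dist \<mu> \<nu> + kr_dist \<nu> \<rho>"
    proof (rule kr_dist_least[OF P(1) R])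
      fix \<phi> :: "'n torus \<Rightarrow> real" assume "1-lipschitz_on UNIV \<phi>"
      from kr_dist_upper[OF P this] kr_dist_upper[OF P(2) R this]
      show "(\<integral>x. \<phi> x \<partial>\<mu>) - (\<integral>x. \<phi> x \<partial>\<rho>) \<le> kr_dist \<mu> \<nu> + kr_dist \<nu> \<rho>" by simp
    qed
  qed
qed

text \<open>
  \<open>D m x = \<delta>\<Phi>/\<delta>m(m,x)\<close>; the last conjunct is the normalization that makes \<open>D\<close> unique on
  \<open>prob_torus\<close>.
\<close>

definition has_measure_deriv ::
  "('n::finite torus measure \<Rightarrow> real) \<Rightarrow> ('n torus measure \<Rightarrow> 'n torus \<Rightarrow> real) \<Rightarrow> bool" where
  "has_measure_deriv \<Phi> D \<longleftrightarrow>
     continuous_map (prod_topology prob_topology euclidean) euclideanreal (\<lambda>(m, x). D m x) \<and>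
     (\<forall>m1\<in>prob_torus. \<forall>m2\<in>prob_torus. \<Phi> m2 - \<Phi> m1 =
        (LINT t:{0..1}|lborel.
           (\<integral>x. D (mix t m1 m2) x \<partial>m2) - (\<integral>x. D (mix t m1 m2) x \<partial>m1))) \<and>
     (\<forall>m\<in>prob_torus. (\<integral>x. D m x \<partial>m) = 0)"

text \<open>
  \<open>D2 m x y = \<delta>\<^sup>2\<Phi>/\<delta>m\<^sup>2(m,x,y)\<close>, the derivative of \<open>m \<mapsto> D m x\<close> normalized in \<open>y\<close>, is required
  to be jointly continuous.
\<close>

definition measure_C2 :: "('n::finite torus measure \<Rightarrow> real) \<Rightarrow> bool" where
  "measure_C2 \<Phi> \<longleftrightarrow> (\<exists>D D2. has_measure_deriv \<Phi> D \<and>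
     (\<forall>x. has_measure_deriv (\<lambda>m. D m x) (\<lambda>m. D2 m x)) \<and>
     continuous_map (prod_topology prob_topology (prod_topology euclidean euclidean)) euclideanreal
       (\<lambda>(m, x, y). D2 m x y))"

definition legendre :: "('n::finite torus \<Rightarrow> real^'n \<Rightarrow> real) \<Rightarrow> 'n torus \<Rightarrow> real^'n \<Rightarrow> real" where
  "legendre H x q = (SUP p. p \<bullet> q - H x p)"

text \<open>
  \<open>- \<partial>\<^sub>t m + \<Delta> m + div (m \<alpha>) = 0\<close> in the sense of distributions on \<open>interior I \<times> \<T>\<^sup>d\<close>:
  the test functions are smooth with compact support in this open set.
\<close>

definition fokker_planck ::
  "real set \<Rightarrow> (real \<Rightarrow> 'n::finite torus measure) \<Rightarrow> (real \<Rightarrow> 'n torus \<Rightarrow> real^'n) \<Rightarrow> bool" where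
  "fokker_planck I m \<alpha> \<longleftrightarrow>
     (\<forall>\<phi> :: real \<Rightarrow> 'n torus \<Rightarrow> real.
        smooth (\<lambda>(t, y). \<phi> t (abs_torus y)) \<and>
        (\<exists>K. compact K \<and> K \<subseteq> interior I \<and> (\<forall>t x. t \<notin> K \<longrightarrow> \<phi> t x = 0)) \<longrightarrow>
        (LINT t:I|lborel. (\<integral>x. deriv (\<lambda>s. \<phi> s x) t + torus_laplacian (\<phi> t) x
                              - \<alpha> t x \<bullet> torus_grad (\<phi> t) x \<partial>m t)) = 0)"

text \<open>
  Competitors on the time interval \<open>I\<close>, with integrability weight \<open>w\<close>. The integrability
  condition uses the nonnegative integral, since the Bochner integral of a non-integrable
  function is \<open>0\<close>.
\<close>

definition admissible ::
  "real set \<Rightarrow> (real \<Rightarrow> real) \<Rightarrow> 'n::finite torus measure \<Rightarrow>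
     ((real \<Rightarrow> 'n torus measure) \<times> (real \<Rightarrow> 'n torus \<Rightarrow> real^'n)) set" where
  "admissible I w m0 = {(m, \<alpha>).
     continuous_map (top_of_set I) prob_topology m \<and>
     (\<lambda>(t, x). \<alpha> t x) \<in> borel_measurable (restrict_space borel I \<Otimes>\<^sub>M borel) \<and>
     (\<integral>\<^sup>+t\<in>I. ennreal (w t) * (\<integral>\<^sup>+x. ennreal ((norm (\<alpha> t x))\<^sup>2) \<partial>m t) \<partial>lborel) < \<infinity> \<and>
     fokker_planck I m \<alpha> \<and> m 0 = m0}"

definition finite_horizon_value ::
  "('n::finite torus \<Rightarrow> real^'n \<Rightarrow> real) \<Rightarrow> ('n torus measure \<Rightarrow> real) \<Rightarrow>
     real \<Rightarrow> 'n torus measure \<Rightarrow> real" where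
  "finite_horizon_value H \<F> T m0 =
     (INF (m, \<alpha>)\<in>admissible {0..T} (\<lambda>_. 1) m0.
        LINT t:{0..T}|lborel. ((\<integral>x. legendre H x (\<alpha> t x) \<partial>m t) + \<F> (m t)))"

definition discounted_value ::
  "('n::finite torus \<Rightarrow> real^'n \<Rightarrow> real) \<Rightarrow> ('n torus measure \<Rightarrow> real) \<Rightarrow>
     real \<Rightarrow> 'n torus measure \<Rightarrow> real" where
  "discounted_value H \<F> \<delta> m0 =
     (INF (m, \<alpha>)\<in>admissible {0..} (\<lambda>t. exp (- \<delta> * t)) m0.
        LINT t:{0..}|lborel. exp (- \<delta> * t) *
          ((\<integral>x. legendre H x (\<alpha> t x) \<partial>m t) + \<F> (m t)))"

end

theory Submission
  imports Defs "HOL-Real_Asymp.Real_Asymp"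
begin

text \<open>
  The proof works with trajectories only and never with the Hamilton-Jacobi equation on the space of measures. Of
  the data it uses that \<open>H\<^sup>*\<close> lies between two quadratics, is a countable supremum of affine functions of the
  control, and is Lipschitz in \<open>x\<close> with a constant of quadratic growth, and that \<open>\<F>\<close> is bounded and Lipschitz. The
  locale \<open>mf_cost\<close> collects these facts, and the last part of the theory derives them from the hypotheses. The
  constant is \<open>\<lambda> = - L\<close>, where \<open>L\<close> is obtained as follows.

  Let \<open>U T m\<close> be the value with horizon \<open>T\<close>, and let \<open>A N\<close> be the infimum of \<open>U N\<close> over all initial measures.
  Cutting a trajectory in two pieces shows that \<open>A\<close> is superadditive, so \<open>A N / N\<close> converges to its supremum \<open>L\<close>
  by Fekete's lemma. It remains to prove that \<open>U N\<close> exceeds \<open>A N\<close> by only \<open>o(N)\<close>, uniformly in the initial measure.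

  This is a Doeblin argument (\<open>U_oscillation\<close>). Given a nearly optimal trajectory from \<open>m1\<close>, one builds a
  trajectory from \<open>m0\<close> of comparable cost. First replace the given trajectory by an average of its small
  translates (\<open>mollify\<close>), at a cost of order \<open>\<epsilon> N\<close>. Then let the mass starting from \<open>m0\<close> follow the heat flow: after
  one unit of time it dominates a fixed fraction \<open>\<kappa>\<close> of every mollified measure (\<open>minorization\<close>), and this
  fraction joins the given trajectory. Repeating this with the remaining mass, whose weight decreases like
  \<open>(1 - \<kappa>)\<^sup>k\<close>, the total excess cost is bounded independently of \<open>N\<close> (\<open>coupling\<close>).

  Mixtures and averages of controlled trajectories carry randomized controls. Since the Fokker-Planck
  equation is affine in the control and the cost convex, the conditional expectation of the control given
  time and position is again admissible and does not cost more (\<open>relaxed_projection\<close>). Cutting and joining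
  trajectories of a distributional equation rests on the recovery of its boundary terms (\<open>fp_right_end\<close>,
  \<open>fp_left_end\<close>).

  For the discounted problem, dynamic programming over a window of fixed length \<open>N\<close>, on which the discount
  becomes negligible as \<open>\<delta> \<rightarrow> 0\<close>, bounds \<open>\<delta> V \<delta>\<close> above and below by values close to \<open>L\<close>.
\<close>

section \<open>Calculus of smooth functions\<close>

lemma frechet_derivative_eqI:
  "(f has_derivative f') (at x) \<Longrightarrow> frechet_derivative f (at x) = f'"
  using frechet_derivative_at by metis

lemma Ck_SucI:
  assumes "\<And>x. (f has_derivative f' x) (at x)" "\<And>v. Ck k (\<lambda>x. f' x v)"
  shows "Ck (Suc k) f"
proof -
  have "frechet_derivative f (at x) = f' x" for x
    using assms(1) by (rule frechet_derivative_eqI)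
  then show ?thesis
    using assms by (auto simp: differentiable_def)
qed

lemma Ck_SucD:
  assumes "Ck (Suc k) f"
  shows "(f has_derivative frechet_derivative f (at x)) (at x)"
    "Ck k (\<lambda>x. frechet_derivative f (at x) v)"
  using assms by (auto simp: frechet_derivative_works)

lemma Ck_Suc_imp_Ck: "Ck (Suc k) f \<Longrightarrow> Ck k f"
proof (induction k arbitrary: f)
  case 0
  then show ?case
    by (auto intro!: continuous_at_imp_continuous_on differentiable_imp_continuous_within)
next
  case (Suc k)
  show ?case
  proof (rule Ck_SucI[OF Ck_SucD(1)[OF Suc.prems]])
    fix v show "Ck k (\<lambda>x. frechet_derivative f (at x) v)"
      by (rule Suc.IH[OF Ck_SucD(2)[OF Suc.prems]])
  qed
qed

lemma Ck_const: "Ck k (\<lambda>x. c)"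
proof (induction k arbitrary: c)
  case (Suc k)
  show ?case
    by (rule Ck_SucI[where f'="\<lambda>x v. 0"]) (auto intro: Suc.IH)
qed auto

lemma Ck_add: "Ck k f \<Longrightarrow> Ck k g \<Longrightarrow> Ck k (\<lambda>x. f x + g x)"
proof (induction k arbitrary: f g)
  case (Suc k)
  show ?case
    by (rule Ck_SucI[OF has_derivative_add[OF Ck_SucD(1)[OF Suc.prems(1)] Ck_SucD(1)[OF Suc.prems(2)]]])
      (intro Suc.IH Ck_SucD(2) Suc.prems)
qed (auto intro: continuous_intros)

lemma Ck_mult:
  fixes f g :: "'a::real_normed_vector \<Rightarrow> real"
  shows "Ck k f \<Longrightarrow> Ck k g \<Longrightarrow> Ck k (\<lambda>x. f x * g x)"
proof (induction k arbitrary: f g)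
  case (Suc k)
  show ?case
    by (rule Ck_SucI[OF has_derivative_mult[OF Ck_SucD(1)[OF Suc.prems(1)] Ck_SucD(1)[OF Suc.prems(2)]]])
      (intro Ck_add Suc.IH Ck_SucD(2) Suc.prems Ck_Suc_imp_Ck[OF Suc.prems(1)] Ck_Suc_imp_Ck[OF Suc.prems(2)])
qed (auto intro: continuous_intros)

lemma Ck_compose_affine:
  assumes A: "bounded_linear A"
  shows "Ck k f \<Longrightarrow> Ck k (\<lambda>x. f (A x + a))"
proof (induction k arbitrary: f)
  case 0
  have "continuous_on UNIV (\<lambda>x. A x + a)"
    by (intro continuous_intros linear_continuous_on A)
  from continuous_on_compose2[OF _ this, of UNIV f] 0 show ?case by auto
next
  case (Suc k)
  show ?case
  proof (rule Ck_SucI)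
    fix x
    have "((\<lambda>x. A x + a) has_derivative A) (at x)"
      using bounded_linear_imp_has_derivative[OF A] by (auto intro!: derivative_eq_intros)
    from diff_chain_at[OF this Ck_SucD(1)[OF Suc.prems]]
    show "((\<lambda>x. f (A x + a)) has_derivative (\<lambda>v. frechet_derivative f (at (A x + a)) (A v))) (at x)"
      by (simp add: o_def)
  next
    fix v
    show "Ck k (\<lambda>x. frechet_derivative f (at (A x + a)) (A v))"
      by (rule Suc.IH[OF Ck_SucD(2)[OF Suc.prems]])
  qed
qed

lemma smooth_const: "smooth (\<lambda>x. c)"
  by (simp add: smooth_def Ck_const)

lemma smooth_add: "smooth f \<Longrightarrow> smooth g \<Longrightarrow> smooth (\<lambda>x. f x + g x)"
  by (simp add: smooth_def Ck_add)

lemma smooth_mult: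
  fixes f g :: "'a::real_normed_vector \<Rightarrow> real"
  shows "smooth f \<Longrightarrow> smooth g \<Longrightarrow> smooth (\<lambda>x. f x * g x)"
  by (simp add: smooth_def Ck_mult)

lemma smooth_compose_affine:
  assumes "bounded_linear A" "smooth f"
  shows "smooth (\<lambda>x. f (A x + a))"
proof -
  have "Ck k (\<lambda>x. f (A x + a))" for k
    by (rule Ck_compose_affine[OF assms(1)]) (use assms(2) in \<open>simp add: smooth_def\<close>)
  then show ?thesis by (simp add: smooth_def)
qed

lemma smooth_shift: "smooth f \<Longrightarrow> smooth (\<lambda>x. f (x + a))"
  by (rule smooth_compose_affine[OF bounded_linear_ident])

lemma Ck_antiderivative:
  fixes f g :: "real \<Rightarrow> real"
  assumes "\<And>x. (f has_real_derivative g x) (at x)" "Ck k g"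
  shows "Ck (Suc k) f"
  by (rule Ck_SucI[where f'="\<lambda>x v. g x * v"])
     (use assms in \<open>auto simp: has_field_derivative_def intro!: Ck_mult Ck_const\<close>)

lemma smooth_antiderivative:
  fixes f g :: "real \<Rightarrow> real"
  assumes "\<And>x. (f has_real_derivative g x) (at x)" "smooth g"
  shows "smooth f"
  using Ck_antiderivative[OF assms(1)] assms(2) Ck_Suc_imp_Ck unfolding smooth_def by blast

text \<open>
  The functions \<open>p(1/x) exp(-1/x)\<close>, extended by \<open>0\<close> to \<open>x \<le> 0\<close>. Carrying the polynomial \<open>p\<close> makes the
  family closed under differentiation, so that smoothness is an induction.
\<close>

definition flat_exp :: "real poly \<Rightarrow> real \<Rightarrow> real" where
  "flat_exp p x = (if x \<le> 0 then 0 else poly p (1 / x) * exp (- (1 / x)))"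

lemma tendsto_poly_times_exp_neg: "((\<lambda>s. poly p s * exp (- s)) \<longlongrightarrow> (0::real)) at_top"
proof -
  have "((\<lambda>s. \<Sum>i\<le>degree p. coeff p i * (s ^ i / exp s)) \<longlongrightarrow> (\<Sum>i\<le>degree p. coeff p i * 0)) at_top"
    by (intro tendsto_intros tendsto_power_div_exp_0)
  then show ?thesis
    by (simp add: poly_altdef sum_distrib_right exp_minus divide_inverse mult.assoc)
qed

lemma flat_exp_has_derivative:
  "(flat_exp p has_real_derivative flat_exp ([:0, 0, 1:] * (p - pderiv p)) x) (at x)"
proof (cases x "0 :: real" rule: linorder_cases)
  case less
  have "((\<lambda>_. 0) has_real_derivative 0) (at x)" by simp
  moreover have "eventually (\<lambda>y. (0::real) = flat_exp p y) (nhds x)"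
    using less eventually_nhds_in_open[of "{..<0}" x]
    by (auto elim!: eventually_mono simp: flat_exp_def)
  ultimately have "(flat_exp p has_real_derivative 0) (at x)"
    using DERIV_cong_ev[of x x "\<lambda>_. 0" "flat_exp p" 0 0] by simp
  then show ?thesis using less by (simp add: flat_exp_def)
next
  case equal
  have "((\<lambda>h. flat_exp p h / h) \<longlongrightarrow> 0) (at_left 0)"
    by (rule tendsto_eventually) (auto simp: flat_exp_def eventually_at_filter)
  moreover have "((\<lambda>h. flat_exp p h / h) \<longlongrightarrow> 0) (at_right 0)"
  proof -
    have "((\<lambda>h::real. poly (pCons 0 p) (inverse h) * exp (- (inverse h))) \<longlongrightarrow> 0) (at_right 0)"
      by (rule filterlim_compose[OF tendsto_poly_times_exp_neg filterlim_inverse_at_top_right])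
    then show ?thesis
      by (rule Lim_transform_eventually)
        (auto simp: flat_exp_def eventually_at_filter field_simps)
  qed
  ultimately have "((\<lambda>h. flat_exp p h / h) \<longlongrightarrow> 0) (at 0)"
    by (simp add: filterlim_split_at)
  then have "(flat_exp p has_real_derivative 0) (at 0)"
    by (simp add: DERIV_def flat_exp_def)
  then show ?thesis using equal by (simp add: flat_exp_def)
next
  case greater
  have "((\<lambda>x. poly p (1 / x) * exp (- (1 / x))) has_real_derivative
     poly (pderiv p) (1 / x) * (- 1 / x^2) * exp (- (1 / x)) + exp (- (1 / x)) * (1 / x^2) * poly p (1 / x)) (at x)"
    using greater
    by (auto intro!: derivative_eq_intros simp: power2_eq_square)
  moreover have "eventually (\<lambda>y. poly p (1 / y) * exp (- (1 / y)) = flat_exp p y) (nhds x)"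
    using greater eventually_nhds_in_open[of "{0<..}" x]
    by (auto elim!: eventually_mono simp: flat_exp_def)
  ultimately have "(flat_exp p has_real_derivative
      poly (pderiv p) (1 / x) * (- 1 / x^2) * exp (- (1 / x)) + exp (- (1 / x)) * (1 / x^2) * poly p (1 / x)) (at x)"
    using DERIV_cong_ev[of x x "\<lambda>x. poly p (1 / x) * exp (- (1 / x))" "flat_exp p"] by simp
  then show ?thesis
    using greater by (simp add: flat_exp_def power2_eq_square field_simps)
qed

lemma smooth_flat_exp: "smooth (flat_exp p)"
proof -
  have "Ck k (flat_exp p)" for k
  proof (induction k arbitrary: p)
    case 0
    show ?case
      using flat_exp_has_derivative
      by (auto intro!: continuous_at_imp_continuous_on DERIV_isCont)
  next
    case (Suc k)
    show ?case by (rule Ck_antiderivative[OF flat_exp_has_derivative Suc.IH])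
  qed
  then show ?thesis by (simp add: smooth_def)
qed

text \<open>
  The step is the antiderivative of the bump \<open>exp(-1/(t-p)) exp(-1/(q-t))\<close>, normalized to total mass one. Its
  derivative \<open>\<eta>\<close> is part of the conclusion because it will be used as an approximate Dirac mass in time.
\<close>

lemma smooth_step_exists:
  fixes p q :: real
  assumes "p < q"
  obtains \<theta> \<eta> :: "real \<Rightarrow> real" where
    "smooth \<theta>" "\<And>t. (\<theta> has_real_derivative \<eta> t) (at t)" "continuous_on UNIV \<eta>"
    "\<And>t. 0 \<le> \<eta> t" "\<And>t. t \<notin> {p..q} \<Longrightarrow> \<eta> t = 0"
    "\<And>t. t \<le> p \<Longrightarrow> \<theta> t = 0" "\<And>t. q \<le> t \<Longrightarrow> \<theta> t = 1" "\<And>t. 0 \<le> \<theta> t" "\<And>t. \<theta> t \<le> 1"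
proof -
  define b where "b t = flat_exp 1 (t + (-p)) * flat_exp 1 (- t + q)" for t
  have bs: "smooth b"
    unfolding b_def
    by (rule smooth_mult[OF smooth_shift[OF smooth_flat_exp]
        smooth_compose_affine[OF bounded_linear_minus[OF bounded_linear_ident] smooth_flat_exp]])
  have bc: "continuous_on UNIV b"
    using bs by (auto simp: smooth_def dest: spec[of _ 0])
  have b0: "b t \<ge> 0" for t by (simp add: b_def flat_exp_def)
  have bz: "b t = 0" if "t \<le> p \<or> q \<le> t" for t using that by (auto simp: b_def flat_exp_def)
  have bp: "b t > 0" if "p < t" "t < q" for t using that by (auto simp: b_def flat_exp_def)
  obtain F where F: "\<And>x. (F has_vector_derivative b x) (at x)"
    using einterval_antiderivative[of "-\<infinity>" \<infinity> b] bc by (auto simp: continuous_on_eq_continuous_at)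
  have F': "(F has_real_derivative b x) (at x)" for x
    using F by (simp add: has_real_derivative_iff_has_vector_derivative)
  have mono: "F x \<le> F y" if "x \<le> y" for x y
    using that F' b0 by (intro DERIV_nonneg_imp_nondecreasing[of x y F]) auto
  obtain z where z: "p < z" "z < q" "F q - F p = (q - p) * b z"
    using MVT2[of p q F b] F' assms by auto
  define Z where "Z = F q - F p"
  have Z: "Z > 0" using z bp[of z] by (simp add: Z_def)
  have low: "F t = F p" if "t \<le> p" for t
  proof (cases "t = p")
    case False
    then have "t < p" using that by simp
    then obtain z where "t < z" "z < p" "F p - F t = (p - t) * b z"
      using MVT2[OF \<open>t < p\<close> F'] by blast
    then show ?thesis using bz[of z] by simp
  qed simp
  have high: "F t = F q" if "q \<le> t" for t
  proof (cases "t = q")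
    case False
    then have "q < t" using that by simp
    then obtain z where "q < z" "z < t" "F t - F q = (t - q) * b z"
      using MVT2[OF \<open>q < t\<close> F'] by blast
    then show ?thesis using bz[of z] by simp
  qed simp
  show ?thesis
  proof (rule that[of "\<lambda>t. (F t - F p) / Z" "\<lambda>t. b t / Z"])
    show d: "((\<lambda>t. (F t - F p) / Z) has_real_derivative b t / Z) (at t)" for t
      using Z by (auto intro!: derivative_eq_intros F')
    have "smooth (\<lambda>t. b t / Z)"
      using smooth_mult[OF bs smooth_const[of "1 / Z"]] by simp
    from smooth_antiderivative[OF d this] show "smooth (\<lambda>t. (F t - F p) / Z)" .
    show "continuous_on UNIV (\<lambda>t. b t / Z)" using bc Z by (intro continuous_intros) auto
    show "0 \<le> b t / Z" for t using b0 Z by simp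
    show "b t / Z = 0" if "t \<notin> {p..q}" for t using that bz[of t] by auto
    show "(F t - F p) / Z = 0" if "t \<le> p" for t using low[OF that] by simp
    show "(F t - F p) / Z = 1" if "q \<le> t" for t using high[OF that] Z by (simp add: Z_def)
    fix t
    show "0 \<le> (F t - F p) / Z"
    proof (cases "t \<le> p")
      case True
      show ?thesis unfolding low[OF True] by simp
    next
      case False
      then have "F p \<le> F t" by (intro mono) simp
      then show ?thesis using Z by simp
    qed
    show "(F t - F p) / Z \<le> 1"
    proof (cases "q \<le> t")
      case True
      show ?thesis unfolding high[OF True] Z_def by simp
    next
      case False
      then have "F t \<le> F q" by (intro mono) simp
      then show ?thesis using Z by (simp add: Z_def)
    qed
  qed
qed

lemma smooth_step_sequence:
  fixes p q :: "nat \<Rightarrow> real"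
  assumes "\<And>k. p k < q k"
  obtains \<theta> \<eta> :: "nat \<Rightarrow> real \<Rightarrow> real" where "\<And>k. smooth (\<theta> k)" "\<And>k t. (\<theta> k has_real_derivative \<eta> k t) (at t)"
    "\<And>k. continuous_on UNIV (\<eta> k)" "\<And>k t. 0 \<le> \<eta> k t" "\<And>k t. t \<notin> {p k..q k} \<Longrightarrow> \<eta> k t = 0"
    "\<And>k t. t \<le> p k \<Longrightarrow> \<theta> k t = 0" "\<And>k t. t \<ge> q k \<Longrightarrow> \<theta> k t = 1" "\<And>k t. 0 \<le> \<theta> k t" "\<And>k t. \<theta> k t \<le> 1"
proof -
  let ?P = "\<lambda>k \<theta> \<eta>. smooth \<theta> \<and> (\<forall>t. (\<theta> has_real_derivative \<eta> t) (at t)) \<and> continuous_on UNIV \<eta> \<and>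
     (\<forall>t. 0 \<le> \<eta> t) \<and> (\<forall>t. t \<notin> {p k..q k} \<longrightarrow> \<eta> t = 0) \<and> (\<forall>t\<le>p k. \<theta> t = 0) \<and> (\<forall>t\<ge>q k. \<theta> t = 1) \<and> (\<forall>t. 0 \<le> \<theta> t \<and> \<theta> t \<le> (1::real))"
  have "\<exists>\<theta> \<eta>. ?P k \<theta> \<eta>" for k by (rule smooth_step_exists[OF assms[of k]]) blast
  then obtain \<theta> \<eta> where "\<And>k. ?P k (\<theta> k) (\<eta> k)" by metis
  then show ?thesis using that[of \<theta> \<eta>] by blast
qed

section \<open>Lipschitz bounds from second derivatives on the torus\<close>

lemma norm_le_one_plus_square: "norm q \<le> 1 + (norm q)\<^sup>2"
proof -
  have "0 \<le> (norm q - 1)\<^sup>2" by simp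
  then show ?thesis using norm_ge_zero[of q] unfolding power2_diff one_power2 mult_1_right by linarith
qed

lemma abs_le_of_bounded_derivs:
  fixes f :: "'a::euclidean_space \<Rightarrow> 'b::real_normed_vector"
  assumes "linear f" "\<And>b. b \<in> Basis \<Longrightarrow> norm (f b) \<le> M"
  shows "norm (f v) \<le> (real DIM('a) * M) * norm v"
proof -
  have "f v = (\<Sum>b\<in>Basis. (v \<bullet> b) *\<^sub>R f b)"
    by (subst euclidean_representation[of v, symmetric])
       (simp add: linear_sum[OF assms(1)] linear_scale[OF assms(1)])
  also have "norm \<dots> \<le> (\<Sum>b\<in>(Basis::'a set). norm v * M)"
    by (intro order.trans[OF norm_sum] sum_mono)
       (auto intro!: mult_mono assms(2) Basis_le_norm)
  finally show ?thesis by (simp add: algebra_simps)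
qed

lemma lipschitz_of_bounded_derivs:
  fixes f :: "'a::euclidean_space \<Rightarrow> 'b::real_normed_vector"
  assumes d: "\<And>x. f differentiable (at x)"
    and b: "\<And>x b. b \<in> Basis \<Longrightarrow> norm (frechet_derivative f (at x) b) \<le> M"
  shows "norm (f x - f y) \<le> (real DIM('a) * M) * norm (x - y)"
proof -
  obtain b :: 'a where "b \<in> Basis" using nonempty_Basis by blast
  from order.trans[OF norm_ge_zero b[OF this]] have M: "0 \<le> M" by blast
  show ?thesis
  proof (rule differentiable_bound[of UNIV f "\<lambda>x. frechet_derivative f (at x)"])
    fix x :: 'a
    show "(f has_derivative frechet_derivative f (at x)) (at x within UNIV)"
      using d by (simp add: frechet_derivative_works)
    show "onorm (frechet_derivative f (at x)) \<le> real DIM('a) * M"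
      using linear_frechet_derivative[OF d] b M
      by (intro onorm_bound abs_le_of_bounded_derivs) auto
  qed auto
qed

lemma axis_in_int_lattice [simp]: "axis i 1 \<in> int_lattice"
  by (auto simp: int_lattice_def axis_def)

lemma grad_nth: "grad f x $ i = frechet_derivative f (at x) (axis i 1)"
  by (simp add: grad_def)

lemma abs_hessian_entry_le: "\<bar>hessian f y $ i $ j\<bar> \<le> norm (hessian f y)"
  using component_le_norm_cart[of "hessian f y $ i" j] Finite_Cartesian_Product.norm_nth_le[of "hessian f y" i]
  by linarith

lemma hessian_nth:
  assumes "grad f differentiable (at x)"
  shows "hessian f x $ i $ j = frechet_derivative (\<lambda>y. grad f y $ i) (at x) (axis j 1)"
proof -
  have "(grad f has_derivative frechet_derivative (grad f) (at x)) (at x)"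
    using assms by (simp add: frechet_derivative_works)
  then have "((\<lambda>y. grad f y $ i) has_derivative (\<lambda>v. frechet_derivative (grad f) (at x) v $ i)) (at x)"
    by (rule bounded_linear.has_derivative[OF bounded_linear_vec_nth])
  from frechet_derivative_eqI[OF this] show ?thesis
    by (simp add: hessian_def jacobian_def matrix_def)
qed

text \<open>
  Along a coordinate direction \<open>f\<close> is periodic, so by Rolle its partial derivative vanishes somewhere
  within a period. The mean value theorem, started from that zero, turns the bound on the second derivative
  into one on the first.
\<close>

lemma periodic_grad_bound:
  fixes f :: "real^'n \<Rightarrow> real"
  assumes per: "\<And>x k. k \<in> int_lattice \<Longrightarrow> f (x + k) = f x"
    and d1: "\<And>x. f differentiable (at x)" and d2: "\<And>x. grad f differentiable (at x)"
    and B: "\<And>x i. \<bar>hessian f x $ i $ i\<bar> \<le> B"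
  shows "\<bar>grad f x $ i\<bar> \<le> B"
proof -
  define e :: "real^'n" where "e = axis i 1"
  define u where "u s = f (x + s *\<^sub>R e)" for s
  have aff: "((\<lambda>s. x + s *\<^sub>R e) has_derivative (\<lambda>h. h *\<^sub>R e)) (at s)" for s
    by (auto intro!: derivative_eq_intros)
  have lin: "frechet_derivative f (at y) (h *\<^sub>R e) = grad f y $ i * h" for y h
    using linear_scale[OF linear_frechet_derivative[OF d1[of y]], of h e]
    by (simp add: grad_nth e_def)
  have du: "(u has_real_derivative grad f (x + s *\<^sub>R e) $ i) (at s)" for s
  proof -
    have "(f has_derivative frechet_derivative f (at (x + s *\<^sub>R e))) (at (x + s *\<^sub>R e))"
      using d1 frechet_derivative_works by blast
    from diff_chain_at[OF aff this]
    show ?thesis unfolding has_field_derivative_def u_def o_def lin .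
  qed
  have d2': "(\<lambda>y. grad f y $ i) differentiable (at y)" for y
    using differentiable_compose[OF bounded_linear_imp_differentiable[OF bounded_linear_vec_nth[of i]] d2[of y]]
    by simp
  have lin2: "frechet_derivative (\<lambda>y. grad f y $ i) (at y) (h *\<^sub>R e) = hessian f y $ i $ i * h" for y h
    using linear_scale[OF linear_frechet_derivative[OF d2'[of y]], of h e]
    by (simp add: hessian_nth[OF d2] e_def)
  have ddu: "((\<lambda>s. grad f (x + s *\<^sub>R e) $ i) has_real_derivative hessian f (x + s *\<^sub>R e) $ i $ i) (at s)" for s
  proof -
    have "((\<lambda>y. grad f y $ i) has_derivative frechet_derivative (\<lambda>y. grad f y $ i) (at (x + s *\<^sub>R e))) (at (x + s *\<^sub>R e))"
      using d2' frechet_derivative_works by blast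
    from diff_chain_at[OF aff this]
    show ?thesis unfolding has_field_derivative_def o_def lin2 .
  qed
  have "u 1 = u 0" using per[of e x] by (simp add: u_def e_def)
  obtain z where z: "0 < z" "z < 1" "grad f (x + z *\<^sub>R e) $ i = 0"
    using MVT2[of 0 1 u "\<lambda>s. grad f (x + s *\<^sub>R e) $ i"] du \<open>u 1 = u 0\<close> by auto
  obtain w where w: "grad f (x + z *\<^sub>R e) $ i - grad f (x + 0 *\<^sub>R e) $ i = (z - 0) * hessian f (x + w *\<^sub>R e) $ i $ i"
    using MVT2[of 0 z "\<lambda>s. grad f (x + s *\<^sub>R e) $ i" "\<lambda>s. hessian f (x + s *\<^sub>R e) $ i $ i"] ddu z by auto
  have "grad f x $ i = - (z * hessian f (x + w *\<^sub>R e) $ i $ i)"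
    using w z(3) by simp
  then have "\<bar>grad f x $ i\<bar> = z * \<bar>hessian f (x + w *\<^sub>R e) $ i $ i\<bar>"
    using z(1) by (simp add: abs_mult)
  also have "\<dots> \<le> 1 * B" using z B by (intro mult_mono) auto
  finally show ?thesis by simp
qed

lemma abs_rep_torus [simp]: "abs_torus (rep_torus x) = x"
  by (metis Quotient_abs_rep Quotient_torus)

text \<open>
  Every point of the torus has a representative that realizes the distance to a given vector of \<open>\<real>\<^sup>n\<close>.
  This is how metric statements are transferred to the covering space.
\<close>

lemma torus_lift_near:
  obtains y' where "abs_torus y' = x'" "norm (y' - y) = dist x' (abs_torus y)"
proof -
  obtain k where k: "k \<in> int_lattice" "infdist (rep_torus x' - y) int_lattice = norm (rep_torus x' - y - k)"
    using infdist_int_lattice_attained by blast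
  have "abs_torus (rep_torus x' + (- k)) = x'"
    using abs_torus_shift[OF int_lattice_minus[OF k(1)]] by simp
  moreover have "norm (rep_torus x' + (- k) - y) = dist x' (abs_torus y)"
    using dist_torus.abs_eq[of "rep_torus x'" y] k(2) by (simp add: algebra_simps)
  ultimately show ?thesis using that by blast
qed

lemma torus_lipschitzI:
  fixes f :: "'n::finite torus \<Rightarrow> 'b::real_normed_vector"
  assumes "\<And>x y :: real^'n. norm (f (abs_torus x) - f (abs_torus y)) \<le> L * norm (x - y)"
  shows "norm (f x - f y) \<le> L * dist x y"
proof -
  obtain x' where x': "abs_torus x' = x" "norm (x' - rep_torus y) = dist x (abs_torus (rep_torus y))"
    using torus_lift_near by blast
  then show ?thesis using assms[of x' "rep_torus y"] by simp
qed

text \<open>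
  On a compact manifold without boundary, second-order bounds need no first-order companion. Both the
  running cost and the derivative of \<open>\<F>\<close> get their Lipschitz bounds from here.
\<close>

lemma torus_lipschitz_of_hessian_bound:
  fixes f :: "'n::finite torus \<Rightarrow> real"
  assumes d: "twice_differentiable (\<lambda>y. f (abs_torus y))"
    and B: "\<And>x. norm (torus_hessian f x) \<le> B"
  shows "\<bar>f x - f y\<bar> \<le> (real CARD('n) * B) * dist x y"
proof -
  let ?g = "\<lambda>y. f (abs_torus y)"
  have h: "\<bar>hessian ?g y $ i $ i\<bar> \<le> B" for y i
    using B[of "abs_torus y"] abs_hessian_entry_le[of ?g y i i] by (simp add: torus_hessian_abs)
  have g: "\<bar>grad ?g y $ i\<bar> \<le> B" for y i
  proof (rule periodic_grad_bound[of ?g])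
    show "?g (x + k) = ?g x" if "k \<in> int_lattice" for x k
      by (simp only: abs_torus_shift[OF that])
  qed (use d h in \<open>auto simp: twice_differentiable_def\<close>)
  have "norm (?g x - ?g y) \<le> (real DIM(real^'n) * B) * norm (x - y)" for x y
  proof (rule lipschitz_of_bounded_derivs)
    show "?g differentiable at x" for x using d by (simp add: twice_differentiable_def)
    fix x b assume "b \<in> (Basis :: (real^'n) set)"
    then obtain i where "b = axis i 1" by (auto simp: Basis_vec_def)
    then show "norm (frechet_derivative ?g (at x) b) \<le> B"
      using g[of x i] by (simp add: grad_nth)
  qed
  then show ?thesis using torus_lipschitzI[of f "real CARD('n) * B" x y] by simp
qed

section \<open>Topology of the torus and translations\<close>

instance torus :: (finite) second_countable_topology
proof
  obtain D0 :: "(real^'a) set" where D0: "countable D0" "\<And>X. open X \<Longrightarrow> X \<noteq> {} \<Longrightarrow> \<exists>d\<in>D0. d \<in> X"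
    using countable_dense_setE by blast
  define B where "B = (\<lambda>(d, n). ball (abs_torus d :: 'a torus) (1 / real (Suc n))) ` (D0 \<times> (UNIV :: nat set))"
  have "topological_basis B"
  proof (rule topological_basisI)
    show "open U" if "U \<in> B" for U using that by (auto simp: B_def)
    fix U :: "'a torus set" and x assume U: "open U" "x \<in> U"
    then obtain e where e: "e > 0" "ball x e \<subseteq> U" using open_contains_ball by blast
    obtain n where n: "1 / real (Suc n) < e / 2" using e nat_approx_posE[of "e/2"] by auto
    obtain d where d: "d \<in> D0" "d \<in> ball (rep_torus x) (1 / real (Suc n))"
      using D0(2)[of "ball (rep_torus x) (1 / real (Suc n))"] by auto
    have dx: "dist x (abs_torus d) < 1 / real (Suc n)"
      using dist_abs_torus_le[of "rep_torus x" d] d(2) by simp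
    have "x \<in> ball (abs_torus d) (1 / real (Suc n))" using dx by (simp add: dist_commute)
    moreover have "ball (abs_torus d) (1 / real (Suc n)) \<subseteq> U"
    proof
      fix y assume "y \<in> ball (abs_torus d) (1 / real (Suc n))"
      then have "dist x y < e"
        using dx n dist_triangle[of x y "abs_torus d"] by simp
      then show "y \<in> U" using e by auto
    qed
    ultimately show "\<exists>U'\<in>B. x \<in> U' \<and> U' \<subseteq> U" using d by (auto simp: B_def)
  qed
  moreover have "countable B" using D0 by (auto simp: B_def)
  ultimately show "\<exists>B::'a torus set set. countable B \<and> open = generate_topology B"
    using topological_basis_imp_subbasis by blast
qed

text \<open>
  Continuity is checked on periodic lifts; the parameter \<open>t\<close> allows joint continuity in time and space.
\<close>

lemma continuous_on_torus_lift:
  fixes f :: "'b::metric_space \<Rightarrow> 'n::finite torus \<Rightarrow> 'c::metric_space"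
  assumes "continuous_on UNIV (\<lambda>(t, y). f t (abs_torus y))"
  shows "continuous_on UNIV (\<lambda>(t, x). f t x)"
proof -
  have "\<exists>d>0. \<forall>q. dist q (t, x) < d \<longrightarrow> dist (case q of (t, x) \<Rightarrow> f t x) (f t x) < e" if e: "e > 0" for t x e
  proof -
    obtain d where d: "d > 0" "\<And>q. dist q (t, rep_torus x) < d \<Longrightarrow>
        dist (case q of (t, y) \<Rightarrow> f t (abs_torus y)) (f t x) < e"
      using assms e unfolding continuous_on_iff by (metis (no_types, lifting) UNIV_I abs_rep_torus case_prod_conv)
    show ?thesis
    proof (intro exI[of _ d] conjI allI impI d(1))
      fix q assume q: "dist q (t, x) < d"
      obtain t' x' where q': "q = (t', x')" by (cases q)
      obtain y' where y': "abs_torus y' = x'" "norm (y' - rep_torus x) = dist x' (abs_torus (rep_torus x))"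
        using torus_lift_near by blast
      have "dist (t', y') (t, rep_torus x) < d"
        using q y' by (simp add: q' dist_Pair_Pair dist_norm)
      from d(2)[OF this] show "dist (case q of (t, x) \<Rightarrow> f t x) (f t x) < e"
        by (simp add: q' y')
    qed
  qed
  then show ?thesis unfolding continuous_on_iff by fastforce
qed

definition tshift :: "'n::finite torus \<Rightarrow> real^'n \<Rightarrow> 'n torus" where
  "tshift x z = abs_torus (rep_torus x + z)"

lemma tshift_abs: "tshift (abs_torus y) z = abs_torus (y + z)"
proof -
  obtain k where k: "k \<in> int_lattice" "rep_torus (abs_torus y) = y + k"
    using rep_abs_torus by blast
  have "tshift (abs_torus y) z = abs_torus ((y + z) + k)"
    by (simp add: tshift_def k(2) algebra_simps)
  then show ?thesis by (simp only: abs_torus_shift[OF k(1)])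
qed

lemma dist_tshift: "dist (tshift x z) (tshift y w) \<le> dist x y + norm (z - w)"
proof -
  obtain y' where y': "abs_torus y' = y" "norm (y' - rep_torus x) = dist y x"
    using torus_lift_near[of y "rep_torus x"] by auto
  have "dist (tshift x z) (tshift y w) \<le> norm ((rep_torus x + z) - (y' + w))"
    using dist_abs_torus_le[of "rep_torus x + z" "y' + w"] tshift_abs[of y' w]
    by (simp add: tshift_def y'(1) dist_norm)
  also have "\<dots> = norm ((rep_torus x - y') + (z - w))" by (simp add: algebra_simps)
  also have "\<dots> \<le> norm (rep_torus x - y') + norm (z - w)" by (rule norm_triangle_ineq)
  finally show ?thesis using y'(2) by (simp add: norm_minus_commute dist_commute)
qed

lemma continuous_on_tshift: "continuous_on UNIV (\<lambda>(x, z). tshift x z)"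
proof -
  have "continuous_on UNIV (\<lambda>(z, x). tshift x z)"
  proof (rule continuous_on_torus_lift)
    show "continuous_on UNIV (\<lambda>(z, y). tshift (abs_torus y) z)"
      unfolding tshift_abs case_prod_beta
      by (intro continuous_on_compose2[OF continuous_on_abs_torus[of UNIV]] continuous_intros) auto
  qed
  from continuous_on_compose2[OF this continuous_on_swap[of UNIV]] show ?thesis
    by (simp add: case_prod_beta prod.swap_def)
qed

lemma measurable_tshift [measurable]: "(\<lambda>p. tshift (fst p) (snd p)) \<in> borel_measurable (borel \<Otimes>\<^sub>M borel)"
  unfolding borel_prod using borel_measurable_continuous_onI[OF continuous_on_tshift[where 'a='a]]
  by (simp add: case_prod_beta')

lemma measurable_tshift' [measurable (raw)]:
  "f \<in> borel_measurable M \<Longrightarrow> g \<in> borel_measurable M \<Longrightarrow> (\<lambda>w. tshift (f w) (g w)) \<in> borel_measurable M"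
  using measurable_compose[OF measurable_Pair[of f M borel g borel] measurable_tshift] by simp

section \<open>Probability measures on the torus and their mixtures\<close>

lemma kr_dist_integral:
  fixes \<phi> :: "'n::finite torus \<Rightarrow> real"
  assumes P: "\<mu> \<in> prob_torus" "\<nu> \<in> prob_torus" and L: "\<And>x y. \<bar>\<phi> x - \<phi> y\<bar> \<le> L * dist x y" and "0 \<le> L"
  shows "\<bar>(\<integral>x. \<phi> x \<partial>\<mu>) - (\<integral>x. \<phi> x \<partial>\<nu>)\<bar> \<le> L * kr_dist \<mu> \<nu>"
proof -
  interpret Metric_space "prob_torus :: 'n torus measure set" kr_dist by (rule Metric_space_prob_torus)
  have *: "(\<integral>x. \<phi> x \<partial>\<mu>) - (\<integral>x. \<phi> x \<partial>\<nu>) \<le> M * kr_dist \<mu> \<nu>"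
    if P: "\<mu> \<in> prob_torus" "\<nu> \<in> prob_torus" and "M > 0" "\<And>x y. \<bar>\<phi> x - \<phi> y\<bar> \<le> M * dist x y" for M \<mu> \<nu>
  proof -
    have "1-lipschitz_on UNIV (\<lambda>x. \<phi> x / M)"
      using that by (intro lipschitz_onI) (auto simp: dist_real_def field_simps simp flip: diff_divide_distrib)
    from kr_dist_upper[OF P this] show ?thesis using \<open>M > 0\<close> by (simp add: field_simps)
  qed
  \<comment> \<open>Normalizing \<open>\<phi>\<close> to be 1-Lipschitz requires a positive constant, hence the passage to the limit \<open>e \<rightarrow> 0\<close>.\<close>
  have **: "\<bar>(\<integral>x. \<phi> x \<partial>\<mu>) - (\<integral>x. \<phi> x \<partial>\<nu>)\<bar> \<le> (L + e) * kr_dist \<mu> \<nu>" if "e > 0" for e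
  proof -
    have "\<bar>\<phi> x - \<phi> y\<bar> \<le> (L + e) * dist x y" for x y
      using L[of x y] mult_right_mono[of L "L + e" "dist x y"] that by auto
    from *[OF P _ this] *[OF P(2,1) _ this] that \<open>0 \<le> L\<close> show ?thesis by (auto simp: commute abs_le_iff)
  qed
  show ?thesis
  proof (rule tendsto_lowerbound)
    show "((\<lambda>e. (L + e) * kr_dist \<mu> \<nu>) \<longlongrightarrow> L * kr_dist \<mu> \<nu>) (at_right 0)"
      by (auto intro!: tendsto_eq_intros)
    show "\<forall>\<^sub>F e in at_right 0. \<bar>(\<integral>x. \<phi> x \<partial>\<mu>) - (\<integral>x. \<phi> x \<partial>\<nu>)\<bar> \<le> (L + e) * kr_dist \<mu> \<nu>"
      using ** by (auto simp: eventually_at_filter)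
  qed simp
qed

lemma kr_dist_nonneg: "0 \<le> kr_dist \<mu> (\<nu> :: 'n::finite torus measure)"
  using Metric_space.nonneg[OF Metric_space_prob_torus] .

lemma integrable_torus_continuous:
  fixes f :: "'n::finite torus \<Rightarrow> real"
  assumes "\<mu> \<in> prob_torus" "continuous_on UNIV f"
  shows "integrable \<mu> f"
proof -
  interpret prob_space \<mu> using prob_torusD[OF assms(1)] by blast
  have "bounded (range f)"
    using compact_continuous_image[OF assms(2) compact_torus] compact_imp_bounded by blast
  then obtain B where "\<forall>x. norm (f x) \<le> B" by (auto simp: bounded_iff)
  moreover have "f \<in> borel_measurable \<mu>"
    using borel_measurable_continuous_onI[OF assms(2)] prob_torusD(1)[OF assms(1)]
    by (simp cong: measurable_cong_sets)
  ultimately show ?thesis by (intro integrable_const_bound[where B=B]) auto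
qed

lemma nn_integral_mix:
  assumes s: "sets \<nu> = sets \<mu>" and f: "f \<in> borel_measurable \<mu>"
  shows "(\<integral>\<^sup>+x. f x \<partial>mix t \<mu> \<nu>) = ennreal (1 - t) * (\<integral>\<^sup>+x. f x \<partial>\<mu>) + ennreal t * (\<integral>\<^sup>+x. f x \<partial>\<nu>)"
  using f
proof induction
  case (cong f g)
  have "space \<nu> = space \<mu>" using s by (rule sets_eq_imp_space_eq)
  then show ?case using cong(3,4)
    nn_integral_cong[of \<mu> f g] nn_integral_cong[of \<nu> f g] nn_integral_cong[of "mix t \<mu> \<nu>" f g] by simp
next
  case (set A)
  then show ?case using s by (simp add: emeasure_mix)
next
  case (mult u c)
  then have "u \<in> borel_measurable \<nu>" "u \<in> borel_measurable (mix t \<mu> \<nu>)"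
    using s by (simp_all cong: measurable_cong_sets)
  then show ?case using mult by (simp add: nn_integral_cmult algebra_simps)
next
  case (add u v)
  then have "u \<in> borel_measurable \<nu>" "u \<in> borel_measurable (mix t \<mu> \<nu>)" "v \<in> borel_measurable \<nu>" "v \<in> borel_measurable (mix t \<mu> \<nu>)"
    using s by (simp_all cong: measurable_cong_sets)
  then show ?case using add by (simp add: nn_integral_add algebra_simps)
next
  case (seq U)
  then have m: "\<And>i. U i \<in> borel_measurable \<nu>" "\<And>i. U i \<in> borel_measurable (mix t \<mu> \<nu>)"
    using s by (simp_all cong: measurable_cong_sets)
  have "(\<integral>\<^sup>+ x. (SUP i. U i) x \<partial>mix t \<mu> \<nu>) = (SUP i. \<integral>\<^sup>+ x. U i x \<partial>mix t \<mu> \<nu>)"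
    unfolding SUP_apply by (intro nn_integral_monotone_convergence_SUP seq m)
  also have "\<dots> = (SUP i. ennreal (1 - t) * (\<integral>\<^sup>+x. U i x \<partial>\<mu>) + ennreal t * (\<integral>\<^sup>+x. U i x \<partial>\<nu>))"
    using seq by simp
  also have "\<dots> = (SUP i. ennreal (1 - t) * (\<integral>\<^sup>+x. U i x \<partial>\<mu>)) + (SUP i. ennreal t * (\<integral>\<^sup>+x. U i x \<partial>\<nu>))"
    using seq(3) by (intro ennreal_SUP_add incseq_SucI mult_left_mono nn_integral_mono)
      (auto simp: incseq_Suc_iff le_fun_def)
  also have "\<dots> = ennreal (1 - t) * (SUP i. \<integral>\<^sup>+x. U i x \<partial>\<mu>) + ennreal t * (SUP i. \<integral>\<^sup>+x. U i x \<partial>\<nu>)"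
    by (simp add: SUP_mult_left_ennreal)
  also have "(SUP i. \<integral>\<^sup>+x. U i x \<partial>\<mu>) = (\<integral>\<^sup>+x. (SUP i. U i) x \<partial>\<mu>)"
    unfolding SUP_apply by (intro nn_integral_monotone_convergence_SUP[symmetric] seq)
  also have "(SUP i. \<integral>\<^sup>+x. U i x \<partial>\<nu>) = (\<integral>\<^sup>+x. (SUP i. U i) x \<partial>\<nu>)"
    unfolding SUP_apply by (intro nn_integral_monotone_convergence_SUP[symmetric] seq m)
  finally show ?case .
qed

lemma integrable_mix:
  fixes f :: "'a \<Rightarrow> real"
  assumes s: "sets \<nu> = sets \<mu>" and f: "integrable \<mu> f" "integrable \<nu> f"
  shows "integrable (mix t \<mu> \<nu>) f"
proof -
  have m: "f \<in> borel_measurable (mix t \<mu> \<nu>)"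
    using borel_measurable_integrable[OF f(1)] by (simp cong: measurable_cong_sets)
  have "(\<lambda>x. ennreal (norm (f x))) \<in> borel_measurable \<mu>" using f(1) by measurable
  from nn_integral_mix[OF s this, of t] show ?thesis
    using f m by (auto simp: integrable_iff_bounded ennreal_mult_less_top)
qed

lemma integral_mix:
  fixes f :: "'a \<Rightarrow> real"
  assumes s: "sets \<nu> = sets \<mu>" and f: "integrable \<mu> f" "integrable \<nu> f" and t: "0 \<le> t" "t \<le> 1"
  shows "(\<integral>x. f x \<partial>mix t \<mu> \<nu>) = (1 - t) * (\<integral>x. f x \<partial>\<mu>) + t * (\<integral>x. f x \<partial>\<nu>)"
proof -
  have m: "f \<in> borel_measurable \<mu>" using f by simp
  have fin: "(\<integral>\<^sup>+x. ennreal (f x) \<partial>\<mu>) < \<infinity>" "(\<integral>\<^sup>+x. ennreal (- f x) \<partial>\<mu>) < \<infinity>"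
    "(\<integral>\<^sup>+x. ennreal (f x) \<partial>\<nu>) < \<infinity>" "(\<integral>\<^sup>+x. ennreal (- f x) \<partial>\<nu>) < \<infinity>"
    using integrableD(2,3)[OF f(1)] integrableD(2,3)[OF f(2)] by (auto simp: less_top)
  have e: "enn2real (ennreal (1 - t) * a + ennreal t * b) = (1 - t) * enn2real a + t * enn2real b"
    if "a < \<infinity>" "b < \<infinity>" for a b
    using that t by (cases a; cases b) (auto simp flip: ennreal_mult ennreal_plus)
  have m': "(\<lambda>x. ennreal (f x)) \<in> borel_measurable \<mu>" "(\<lambda>x. ennreal (- f x)) \<in> borel_measurable \<mu>"
    using m by measurable
  show ?thesis
    unfolding real_lebesgue_integral_def[OF integrable_mix[OF s f]] real_lebesgue_integral_def[OF f(1)]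
      real_lebesgue_integral_def[OF f(2)] nn_integral_mix[OF s m'(1)] nn_integral_mix[OF s m'(2)]
      e[OF fin(1,3)] e[OF fin(2,4)]
    by (simp add: right_diff_distrib)
qed

lemma kr_dist_mix:
  assumes P: "\<mu> \<in> prob_torus" "\<nu> \<in> prob_torus" "\<mu>' \<in> prob_torus" "\<nu>' \<in> prob_torus"
    and t: "0 \<le> t" "t \<le> 1"
  shows "kr_dist (mix t \<mu> \<nu>) (mix t \<mu>' \<nu>') \<le> (1 - t) * kr_dist \<mu> \<mu>' + t * kr_dist \<nu> (\<nu>' :: 'n::finite torus measure)"
proof (rule kr_dist_least)
  fix \<phi> :: "'n torus \<Rightarrow> real" assume \<phi>: "1-lipschitz_on UNIV \<phi>"
  have "(\<integral>x. \<phi> x \<partial>mix t \<mu> \<nu>) - (\<integral>x. \<phi> x \<partial>mix t \<mu>' \<nu>')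
    = (1 - t) * ((\<integral>x. \<phi> x \<partial>\<mu>) - (\<integral>x. \<phi> x \<partial>\<mu>')) + t * ((\<integral>x. \<phi> x \<partial>\<nu>) - (\<integral>x. \<phi> x \<partial>\<nu>'))"
    using t by (simp add: integral_mix prob_torusD(1)[OF P(1)] prob_torusD(1)[OF P(2)] prob_torusD(1)[OF P(3)]
      prob_torusD(1)[OF P(4)] lipschitz_integrable[OF P(1) \<phi>] lipschitz_integrable[OF P(2) \<phi>]
      lipschitz_integrable[OF P(3) \<phi>] lipschitz_integrable[OF P(4) \<phi>] algebra_simps)
  also have "\<dots> \<le> (1 - t) * kr_dist \<mu> \<mu>' + t * kr_dist \<nu> \<nu>'"
    using t by (intro add_mono mult_left_mono kr_dist_upper P \<phi>) auto
  finally show "(\<integral>x. \<phi> x \<partial>mix t \<mu> \<nu>) - (\<integral>x. \<phi> x \<partial>mix t \<mu>' \<nu>') \<le> (1 - t) * kr_dist \<mu> \<mu>' + t * kr_dist \<nu> \<nu>'" .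
qed (use mix_in_prob_torus P t in auto)

section \<open>Continuous curves of measures\<close>

definition prob_curve :: "real set \<Rightarrow> (real \<Rightarrow> 'n::finite torus measure) \<Rightarrow> bool" where
  "prob_curve I m \<longleftrightarrow> continuous_map (top_of_set I) prob_topology m"

lemma prob_curve_iff:
  fixes m :: "real \<Rightarrow> 'n::finite torus measure"
  shows
  "prob_curve I m \<longleftrightarrow> (\<forall>t\<in>I. m t \<in> prob_torus) \<and>
     (\<forall>t\<in>I. \<forall>e>0. \<exists>d>0. \<forall>s\<in>I. dist s t < d \<longrightarrow> kr_dist (m t) (m s) < e)"
proof -
  interpret Metric_space "prob_torus :: 'n torus measure set" kr_dist by (rule Metric_space_prob_torus)
  have "prob_curve I m \<longleftrightarrow> (\<forall>x\<in>I. \<forall>\<epsilon>>0. \<exists>U. openin (top_of_set I) U \<and> x \<in> U \<and> (\<forall>y\<in>U. m y \<in> mball (m x) \<epsilon>))"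
    by (simp add: prob_curve_def prob_topology_def continuous_map_to_metric)
  also have "\<dots> \<longleftrightarrow> (\<forall>t\<in>I. m t \<in> prob_torus) \<and> (\<forall>t\<in>I. \<forall>e>0. \<exists>d>0. \<forall>s\<in>I. dist s t < d \<longrightarrow> kr_dist (m t) (m s) < e)"
    (is "?L \<longleftrightarrow> ?R")
  proof
    assume L: ?L
    have 1: "m t \<in> prob_torus" if "t \<in> I" for t
      using L that zero_less_one by (metis in_mball)
    have "\<exists>d>0. \<forall>s\<in>I. dist s t < d \<longrightarrow> kr_dist (m t) (m s) < e" if te: "t \<in> I" "e > 0" for t e
    proof -
      obtain U where U: "openin (top_of_set I) U" "t \<in> U" "\<forall>y\<in>U. m y \<in> mball (m t) e" using L te by blast
      then obtain d where "d > 0" "\<forall>s\<in>I. dist s t < d \<longrightarrow> s \<in> U"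
        unfolding openin_euclidean_subtopology_iff by blast
      then show ?thesis using U(3) by (auto intro!: exI[of _ d])
    qed
    with 1 show ?R by blast
  next
    assume R: ?R
    show ?L
    proof (intro ballI allI impI)
      fix t and e :: real assume te: "t \<in> I" "e > 0"
      then obtain d where d: "d > 0" "\<forall>s\<in>I. dist s t < d \<longrightarrow> kr_dist (m t) (m s) < e" using R by blast
      show "\<exists>U. openin (top_of_set I) U \<and> t \<in> U \<and> (\<forall>y\<in>U. m y \<in> mball (m t) e)"
        using d te R by (intro exI[of _ "I \<inter> ball t d"]) (auto simp: dist_commute openin_open_Int)
    qed
  qed
  finally show ?thesis .
qed

lemma prob_curveD: "prob_curve I m \<Longrightarrow> t \<in> I \<Longrightarrow> m t \<in> prob_torus"
  by (auto simp: prob_curve_iff)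

lemma prob_curve_integral_continuous:
  fixes \<phi> :: "'n::finite torus \<Rightarrow> real"
  assumes m: "prob_curve I m" and L: "\<And>x y. \<bar>\<phi> x - \<phi> y\<bar> \<le> L * dist x y" and "0 \<le> L"
  shows "continuous_on I (\<lambda>t. \<integral>x. \<phi> x \<partial>m t)"
  unfolding continuous_on_iff
proof (intro ballI allI impI)
  fix t and e :: real assume te: "t \<in> I" "e > 0"
  then obtain d where d: "d > 0" "\<And>s. s \<in> I \<Longrightarrow> dist s t < d \<Longrightarrow> kr_dist (m t) (m s) < e / (\<bar>L\<bar> + 1)"
    using m[unfolded prob_curve_iff] by (metis abs_ge_zero add_nonneg_pos divide_pos_pos zero_less_one)
  show "\<exists>d>0. \<forall>s\<in>I. dist s t < d \<longrightarrow> dist (\<integral>x. \<phi> x \<partial>m s) (\<integral>x. \<phi> x \<partial>m t) < e"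
  proof (intro exI[of _ d] conjI ballI impI d(1))
    fix s assume s: "s \<in> I" "dist s t < d"
    have "\<bar>(\<integral>x. \<phi> x \<partial>m t) - (\<integral>x. \<phi> x \<partial>m s)\<bar> \<le> L * kr_dist (m t) (m s)"
      by (intro kr_dist_integral prob_curveD[OF m] te s L \<open>0 \<le> L\<close>)
    also have "\<dots> \<le> (\<bar>L\<bar> + 1) * kr_dist (m t) (m s)"
      using kr_dist_nonneg by (intro mult_right_mono) auto
    also have "\<dots> < (\<bar>L\<bar> + 1) * (e / (\<bar>L\<bar> + 1))"
      by (intro mult_strict_left_mono d s) auto
    finally show "dist (\<integral>x. \<phi> x \<partial>m s) (\<integral>x. \<phi> x \<partial>m t) < e" by (simp add: dist_real_def abs_minus_commute)
  qed
qed

text \<open>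
  A continuous curve of measures is a Markov kernel from time to the torus. It suffices to test closed sets,
  whose indicators are limits of the Lipschitz functions \<open>max 0 (1 - n dist(x, K))\<close>.
\<close>

lemma prob_curve_kernel:
  fixes m :: "real \<Rightarrow> 'n::finite torus measure"
  assumes m: "prob_curve I m"
  shows "m \<in> restrict_space borel I \<rightarrow>\<^sub>M subprob_algebra borel"
proof (rule measurable_subprob_algebra_generated[where \<Omega>=UNIV and G="Collect closed"])
  show "sets borel = sigma_sets UNIV (Collect closed :: 'n torus set set)" by (simp add: borel_eq_closed)
  show "Int_stable (Collect closed :: 'n torus set set)" by (auto simp: Int_stable_def)
  fix t assume "t \<in> space (restrict_space borel I)"
  then have P: "m t \<in> prob_torus" using prob_curveD[OF m] by (simp add: space_restrict_space)
  then show "subprob_space (m t)" "sets (m t) = sets borel"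
    using prob_torusD[OF P] by (auto intro: prob_space_imp_subprob_space)
next
  have full: "(\<lambda>t. emeasure (m t) UNIV) \<in> borel_measurable (restrict_space borel I)"
  proof (subst measurable_cong)
    fix t assume "t \<in> space (restrict_space borel I)"
    then have "m t \<in> prob_torus" using prob_curveD[OF m] by (simp add: space_restrict_space)
    then show "emeasure (m t) UNIV = 1"
      using prob_torusD[of "m t"] prob_space.emeasure_space_1 by metis
  qed simp
  then show "(\<lambda>t. emeasure (m t) UNIV) \<in> borel_measurable (restrict_space borel I)" .
  fix K :: "'n torus set" assume "K \<in> Collect closed"
  then have K: "closed K" by simp
  show "(\<lambda>t. emeasure (m t) K) \<in> borel_measurable (restrict_space borel I)"
  proof (cases "K = {}")
    case False
    define f :: "nat \<Rightarrow> 'n torus \<Rightarrow> real" where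
      "f n x = max 0 (1 - real (Suc n) * infdist x K)" for n x
    have lip: "\<bar>f n x - f n y\<bar> \<le> real (Suc n) * dist x y" for n x y
    proof -
      have "\<bar>f n x - f n y\<bar> \<le> \<bar>real (Suc n) * infdist x K - real (Suc n) * infdist y K\<bar>"
        unfolding f_def by linarith
      also have "\<dots> = real (Suc n) * \<bar>infdist x K - infdist y K\<bar>"
        by (simp add: abs_mult flip: right_diff_distrib)
      also have "\<dots> \<le> real (Suc n) * dist x y"
        by (intro mult_left_mono infdist_triangle_abs) simp
      finally show ?thesis .
    qed
    have fc: "continuous_on UNIV (f n)" for n
      unfolding f_def by (intro continuous_intros)
    have lim: "(\<lambda>n. f n x) \<longlonglongrightarrow> indicator K x" for x
    proof (cases "x \<in> K")
      case True
      then show ?thesis by (simp add: f_def)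
    next
      case nK: False
      then have pos: "infdist x K > 0" using K False infdist_pos_not_in_closed by blast
      obtain N :: nat where N: "1 / infdist x K < real N" using reals_Archimedean2 by blast
      have "f n x = 0" if "n \<ge> N" for n
      proof -
        have "1 / infdist x K < real (Suc n)" using N that by linarith
        then have "1 < real (Suc n) * infdist x K" using pos by (simp add: divide_less_eq)
        then show ?thesis by (simp add: f_def)
      qed
      then show ?thesis using nK by (intro tendsto_eventually) (auto simp: eventually_sequentially)
    qed
    have conv: "(\<lambda>n. \<integral>x. f n x \<partial>m t) \<longlonglongrightarrow> measure (m t) K" if "t \<in> I" for t
    proof -
      have P: "m t \<in> prob_torus" using prob_curveD[OF m that] .
      interpret prob_space "m t" using prob_torusD[OF P] by blast
      have Kb: "K \<in> sets (m t)" using K prob_torusD(1)[OF P] by simp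
      have "(\<lambda>n. \<integral>x. f n x \<partial>m t) \<longlonglongrightarrow> (\<integral>x. indicator K x \<partial>m t)"
      proof (rule integral_dominated_convergence[where w="\<lambda>_. 1"])
        show "f n \<in> borel_measurable (m t)" for n
          using integrable_torus_continuous[OF P fc] by blast
        show "AE x in m t. norm (f n x) \<le> 1" for n
          by (intro AE_I2) (simp add: f_def infdist_nonneg)
      qed (use Kb lim in auto)
      then show ?thesis using Kb by simp
    qed
    have "(\<lambda>t. measure (m t) K) \<in> borel_measurable (restrict_space borel I)"
    proof (rule borel_measurable_LIMSEQ_real)
      show "(\<lambda>t. \<integral>x. f n x \<partial>m t) \<in> borel_measurable (restrict_space borel I)" for n
        by (intro borel_measurable_continuous_on_restrict prob_curve_integral_continuous[OF m lip]) simp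
    qed (use conv in \<open>auto simp: space_restrict_space\<close>)
    then have "(\<lambda>t. ennreal (measure (m t) K)) \<in> borel_measurable (restrict_space borel I)" by measurable
    then show ?thesis
    proof (rule subst[OF measurable_cong, rotated])
      fix t assume "t \<in> space (restrict_space borel I)"
      then have "m t \<in> prob_torus" using prob_curveD[OF m] by (simp add: space_restrict_space)
      then interpret prob_space "m t" using prob_torusD by blast
      show "ennreal (measure (m t) K) = emeasure (m t) K" by (simp add: emeasure_eq_measure)
    qed
  qed simp
qed auto

lemma prob_curve_mix:
  assumes "prob_curve I m" "prob_curve I m'" "0 \<le> t" "t \<le> 1"
  shows "prob_curve I (\<lambda>s. mix t (m s) (m' s))"
  unfolding prob_curve_iff
proof (intro conjI ballI allI impI)
  fix s and e :: real assume se: "s \<in> I" "e > 0"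
  obtain d where d: "d > 0" "\<forall>s'\<in>I. dist s' s < d \<longrightarrow> kr_dist (m s) (m s') < e"
    using assms(1) se unfolding prob_curve_iff by blast
  obtain d' where d': "d' > 0" "\<forall>s'\<in>I. dist s' s < d' \<longrightarrow> kr_dist (m' s) (m' s') < e"
    using assms(2) se unfolding prob_curve_iff by blast
  show "\<exists>d>0. \<forall>s'\<in>I. dist s' s < d \<longrightarrow> kr_dist (mix t (m s) (m' s)) (mix t (m s') (m' s')) < e"
  proof (intro exI[of _ "min d d'"] conjI ballI impI)
    fix s' assume s': "s' \<in> I" "dist s' s < min d d'"
    have "kr_dist (mix t (m s) (m' s)) (mix t (m s') (m' s')) \<le> (1 - t) * kr_dist (m s) (m s') + t * kr_dist (m' s) (m' s')"
      using prob_curveD[OF assms(1)] prob_curveD[OF assms(2)] s' se assms(3,4) by (intro kr_dist_mix) auto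
    also have "\<dots> < e"
      using d(2) d'(2) s' assms(3,4) by (intro convex_bound_lt) auto
    finally show "kr_dist (mix t (m s) (m' s)) (mix t (m s') (m' s')) < e" .
  qed (use d d' in auto)
qed (use assms prob_curveD mix_in_prob_torus in blast)

section \<open>Averages over random translations\<close>

text \<open>
  The law of \<open>X + s Z\<close> with \<open>X\<close> and \<open>Z\<close> independent of laws \<open>\<mu>\<close> and \<open>\<kappa>\<close>: convolution with the rescaled
  \<open>\<kappa>\<close>. The Gaussian yields the heat flow, the uniform law on a cube a mollifier.
\<close>

definition blur :: "(real^'n) measure \<Rightarrow> real \<Rightarrow> 'n::finite torus measure \<Rightarrow> 'n torus measure" where
  "blur \<kappa> s \<mu> = distr (\<mu> \<Otimes>\<^sub>M \<kappa>) borel (\<lambda>(x, z). tshift x (s *\<^sub>R z))"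

context
  fixes \<kappa> :: "(real^'n::finite) measure"
  assumes \<kappa>: "prob_space \<kappa>" "sets \<kappa> = sets borel"
begin

lemma blur_map_measurable:
  assumes "\<mu> \<in> prob_torus"
  shows "(\<lambda>(x, z). tshift x (s *\<^sub>R z)) \<in> \<mu> \<Otimes>\<^sub>M \<kappa> \<rightarrow>\<^sub>M borel"
proof -
  have "(\<lambda>(x, z). tshift x (s *\<^sub>R z)) \<in> borel \<Otimes>\<^sub>M borel \<rightarrow>\<^sub>M borel"
    by measurable
  then show ?thesis
    by (subst measurable_cong_sets[OF sets_pair_measure_cong[OF prob_torusD(1)[OF assms] \<kappa>(2)] refl])
qed

lemma blur_in_prob_torus:
  assumes "\<mu> \<in> prob_torus"
  shows "blur \<kappa> s \<mu> \<in> prob_torus"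
proof -
  interpret \<mu>: prob_space \<mu> using prob_torusD[OF assms] by blast
  interpret \<kappa>: prob_space \<kappa> by (rule \<kappa>)
  interpret P: pair_prob_space \<mu> \<kappa> ..
  show ?thesis
    unfolding prob_torus_def blur_def using P.prob_space_distr[OF blur_map_measurable[OF assms]] by simp
qed

lemma nn_integral_blur:
  assumes \<mu>: "\<mu> \<in> prob_torus" and f[measurable]: "f \<in> borel_measurable borel"
  shows "(\<integral>\<^sup>+x. f x \<partial>blur \<kappa> s \<mu>) = (\<integral>\<^sup>+x. \<integral>\<^sup>+z. f (tshift x (s *\<^sub>R z)) \<partial>\<kappa> \<partial>\<mu>)"
proof -
  interpret \<kappa>: prob_space \<kappa> by (rule \<kappa>)
  have m: "(\<lambda>p. f (case p of (x, z) \<Rightarrow> tshift x (s *\<^sub>R z))) \<in> borel_measurable (\<mu> \<Otimes>\<^sub>M \<kappa>)"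
    by (rule measurable_compose[OF blur_map_measurable[OF \<mu>] f])
  have "(\<integral>\<^sup>+x. f x \<partial>blur \<kappa> s \<mu>) = (\<integral>\<^sup>+p. f (case p of (x, z) \<Rightarrow> tshift x (s *\<^sub>R z)) \<partial>(\<mu> \<Otimes>\<^sub>M \<kappa>))"
    unfolding blur_def by (rule nn_integral_distr[OF blur_map_measurable[OF \<mu>]]) simp
  also have "\<dots> = (\<integral>\<^sup>+x. \<integral>\<^sup>+z. f (tshift x (s *\<^sub>R z)) \<partial>\<kappa> \<partial>\<mu>)"
    using \<kappa>.nn_integral_fst[OF m] by simp
  finally show ?thesis .
qed

lemma integral_blur:
  fixes f :: "'n torus \<Rightarrow> real"
  assumes \<mu>: "\<mu> \<in> prob_torus" and f[measurable]: "f \<in> borel_measurable borel" and B: "\<And>x. \<bar>f x\<bar> \<le> B"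
  shows "(\<integral>x. f x \<partial>blur \<kappa> s \<mu>) = (\<integral>x. \<integral>z. f (tshift x (s *\<^sub>R z)) \<partial>\<kappa> \<partial>\<mu>)"
proof -
  interpret \<mu>: prob_space \<mu> using prob_torusD[OF \<mu>] by blast
  interpret \<kappa>: prob_space \<kappa> by (rule \<kappa>)
  interpret P: pair_prob_space \<mu> \<kappa> ..
  have m: "(\<lambda>p. f (case p of (x, z) \<Rightarrow> tshift x (s *\<^sub>R z))) \<in> borel_measurable (\<mu> \<Otimes>\<^sub>M \<kappa>)"
    by (rule measurable_compose[OF blur_map_measurable[OF \<mu>] f])
  have i: "integrable (\<mu> \<Otimes>\<^sub>M \<kappa>) (\<lambda>p. f (case p of (x, z) \<Rightarrow> tshift x (s *\<^sub>R z)))"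
    by (rule P.integrable_const_bound[where B=B]) (use B m in auto)
  have "(\<integral>x. f x \<partial>blur \<kappa> s \<mu>) = (\<integral>p. f (case p of (x, z) \<Rightarrow> tshift x (s *\<^sub>R z)) \<partial>(\<mu> \<Otimes>\<^sub>M \<kappa>))"
    unfolding blur_def by (rule integral_distr[OF blur_map_measurable[OF \<mu>] f])
  also have "\<dots> = (\<integral>x. \<integral>z. f (tshift x (s *\<^sub>R z)) \<partial>\<kappa> \<partial>\<mu>)"
    using P.integral_fst'[OF i] by simp
  finally show ?thesis .
qed

text \<open>
  Testing a 1-Lipschitz \<open>\<phi>\<close> against the blurred measure is testing an average of translates of \<open>\<phi>\<close> against the
  original one; this average is 1-Lipschitz in space and Lipschitz in the scale \<open>s\<close>.
\<close>

lemma kr_dist_blur: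
  assumes P: "\<mu> \<in> prob_torus" "\<nu> \<in> prob_torus" and i: "integrable \<kappa> norm"
  shows "kr_dist (blur \<kappa> s \<mu>) (blur \<kappa> s' \<nu>) \<le> kr_dist \<mu> \<nu> + \<bar>s - s'\<bar> * (\<integral>z. norm z \<partial>\<kappa>)"
proof (rule kr_dist_least)
  interpret \<kappa>: prob_space \<kappa> by (rule \<kappa>)
  interpret \<nu>: prob_space \<nu> using prob_torusD[OF P(2)] by blast
  fix \<phi> :: "'n torus \<Rightarrow> real" assume \<phi>: "1-lipschitz_on UNIV \<phi>"
  have \<phi>l: "\<bar>\<phi> x - \<phi> y\<bar> \<le> dist x y" for x y
    using lipschitz_onD[OF \<phi>, of x y] by (simp add: dist_real_def)
  have \<phi>c: "continuous_on UNIV \<phi>" using \<phi> by (rule lipschitz_on_continuous_on)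
  have [measurable]: "\<phi> \<in> borel_measurable borel" by (rule borel_measurable_continuous_onI[OF \<phi>c])
  have "bounded (range \<phi>)"
    using compact_continuous_image[OF \<phi>c compact_torus] compact_imp_bounded by blast
  then obtain B where B: "\<And>x. \<bar>\<phi> x\<bar> \<le> B" by (auto simp: bounded_iff)
  have m: "(\<lambda>z. \<phi> (tshift x (r *\<^sub>R z))) \<in> borel_measurable \<kappa>" for x r
    by (subst measurable_cong_sets[OF \<kappa>(2) refl]) measurable
  have ii: "integrable \<kappa> (\<lambda>z. \<phi> (tshift x (r *\<^sub>R z)))" for x r
    by (rule \<kappa>.integrable_const_bound[where B=B]) (use B m in auto)
  have diff: "\<bar>(\<integral>z. \<phi> (tshift x (r *\<^sub>R z)) \<partial>\<kappa>) - (\<integral>z. \<phi> (tshift y (r' *\<^sub>R z)) \<partial>\<kappa>)\<bar> \<le> dist x y + \<bar>r - r'\<bar> * (\<integral>z. norm z \<partial>\<kappa>)" for x y r r'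
  proof -
    have "\<bar>(\<integral>z. \<phi> (tshift x (r *\<^sub>R z)) \<partial>\<kappa>) - (\<integral>z. \<phi> (tshift y (r' *\<^sub>R z)) \<partial>\<kappa>)\<bar>
       = \<bar>\<integral>z. \<phi> (tshift x (r *\<^sub>R z)) - \<phi> (tshift y (r' *\<^sub>R z)) \<partial>\<kappa>\<bar>"
      using ii by simp
    also have "\<dots> \<le> (\<integral>z. \<bar>\<phi> (tshift x (r *\<^sub>R z)) - \<phi> (tshift y (r' *\<^sub>R z))\<bar> \<partial>\<kappa>)"
      by (rule integral_abs_bound)
    also have "\<dots> \<le> (\<integral>z. dist x y + \<bar>r - r'\<bar> * norm z \<partial>\<kappa>)"
    proof (rule integral_mono)
      fix z
      have "\<bar>\<phi> (tshift x (r *\<^sub>R z)) - \<phi> (tshift y (r' *\<^sub>R z))\<bar> \<le> dist x y + norm (r *\<^sub>R z - r' *\<^sub>R z)"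
        using \<phi>l dist_tshift by (rule order.trans)
      then show "\<bar>\<phi> (tshift x (r *\<^sub>R z)) - \<phi> (tshift y (r' *\<^sub>R z))\<bar> \<le> dist x y + \<bar>r - r'\<bar> * norm z"
        by (simp flip: scaleR_diff_left)
    qed (use ii i in auto)
    finally show ?thesis using i by (simp add: \<kappa>.prob_space)
  qed
  define \<psi> where "\<psi> r x = (\<integral>z. \<phi> (tshift x (r *\<^sub>R z)) \<partial>\<kappa>)" for r x
  have \<psi>l: "1-lipschitz_on UNIV (\<psi> r)" for r
    using diff[of _ r _ r] by (intro lipschitz_onI) (auto simp: \<psi>_def dist_real_def)
  have "(\<integral>x. \<phi> x \<partial>blur \<kappa> s \<mu>) - (\<integral>x. \<phi> x \<partial>blur \<kappa> s' \<nu>) = (\<integral>x. \<psi> s x \<partial>\<mu>) - (\<integral>x. \<psi> s' x \<partial>\<nu>)"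
    unfolding \<psi>_def by (simp add: integral_blur[OF P(1) _ B] integral_blur[OF P(2) _ B])
  also have "\<dots> = ((\<integral>x. \<psi> s x \<partial>\<mu>) - (\<integral>x. \<psi> s x \<partial>\<nu>)) + (\<integral>x. \<psi> s x - \<psi> s' x \<partial>\<nu>)"
    using lipschitz_integrable[OF P(2) \<psi>l] by simp
  also have "\<dots> \<le> kr_dist \<mu> \<nu> + (\<integral>x. \<bar>s - s'\<bar> * (\<integral>z. norm z \<partial>\<kappa>) \<partial>\<nu>)"
  proof (intro add_mono kr_dist_upper[OF P \<psi>l] integral_mono)
    show "\<psi> s x - \<psi> s' x \<le> \<bar>s - s'\<bar> * (\<integral>z. norm z \<partial>\<kappa>)" for x
      using diff[of x s x s'] by (simp add: \<psi>_def)
  qed (use lipschitz_integrable[OF P(2) \<psi>l] in auto)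
  finally show "(\<integral>x. \<phi> x \<partial>blur \<kappa> s \<mu>) - (\<integral>x. \<phi> x \<partial>blur \<kappa> s' \<nu>) \<le> kr_dist \<mu> \<nu> + \<bar>s - s'\<bar> * (\<integral>z. norm z \<partial>\<kappa>)"
    by (simp add: \<nu>.prob_space)
qed (use blur_in_prob_torus P in auto)

end

section \<open>Test functions and the Fokker-Planck operator\<close>

text \<open>
  The part \<open>\<partial>\<^sub>t \<phi> + \<Delta>\<phi>\<close> of the dual Fokker-Planck operator that does not involve the control.
\<close>

definition fp_gen :: "(real \<Rightarrow> 'n::finite torus \<Rightarrow> real) \<Rightarrow> real \<Rightarrow> 'n torus \<Rightarrow> real" where
  "fp_gen \<phi> t x = deriv (\<lambda>s. \<phi> s x) t + torus_laplacian (\<phi> t) x"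

definition smooth_tx :: "(real \<Rightarrow> 'n::finite torus \<Rightarrow> real) \<Rightarrow> bool" where
  "smooth_tx \<phi> \<longleftrightarrow> smooth (\<lambda>(t, y). \<phi> t (abs_torus y))"

definition supported_in :: "(real \<Rightarrow> 'n::finite torus \<Rightarrow> real) \<Rightarrow> real set \<Rightarrow> bool" where
  "supported_in \<phi> K \<longleftrightarrow> (\<forall>t x. t \<notin> K \<longrightarrow> \<phi> t x = 0)"

lemma smoothD:
  assumes "smooth f"
  shows "(f has_derivative frechet_derivative f (at x)) (at x)"
    "smooth (\<lambda>x. frechet_derivative f (at x) v)" "continuous_on UNIV f"
proof -
  have "Ck (Suc k) f" for k using assms by (auto simp: smooth_def)
  from Ck_SucD[OF this] show "(f has_derivative frechet_derivative f (at x)) (at x)"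
    "smooth (\<lambda>x. frechet_derivative f (at x) v)" by (auto simp: smooth_def)
  show "continuous_on UNIV f" using assms by (auto simp: smooth_def dest: spec[of _ 0])
qed

lemma has_derivative_slice_snd:
  assumes "(g has_derivative g') (at (t, y))"
  shows "((\<lambda>y. g (t, y)) has_derivative (\<lambda>v. g' (0, v))) (at y)"
proof -
  have "((\<lambda>y. (t, y)) has_derivative (\<lambda>v. (0, v))) (at y)"
    by (auto intro!: derivative_eq_intros)
  from diff_chain_at[OF this assms] show ?thesis by (simp add: o_def)
qed

lemma has_derivative_slice_fst:
  assumes "(g has_derivative g') (at (t, y))"
  shows "((\<lambda>t. g (t, y)) has_derivative (\<lambda>h. g' (h, 0))) (at t)"
proof -
  have "((\<lambda>t. (t, y)) has_derivative (\<lambda>v. (v, 0))) (at t)"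
    by (auto intro!: derivative_eq_intros)
  from diff_chain_at[OF this assms] show ?thesis by (simp add: o_def)
qed

lemma differentiable_vec_components:
  fixes g :: "'a::real_normed_vector \<Rightarrow> real^'n"
  assumes "\<And>i. (\<lambda>y. g y $ i) differentiable (at x)"
  shows "g differentiable (at x)"
proof -
  have "((\<lambda>y. g y $ i) has_derivative frechet_derivative (\<lambda>y. g y $ i) (at x)) (at x)" for i
    using assms frechet_derivative_works by blast
  then have "(g has_derivative (\<lambda>v. \<chi> i. frechet_derivative (\<lambda>y. g y $ i) (at x) v)) (at x)"
    unfolding has_derivative_componentwise_within[of g _ x UNIV]
    by (auto simp: Basis_vec_def inner_axis)
  then show ?thesis by (auto simp: differentiable_def)
qed

text \<open>
  All derivatives of a test function are computed on its lift to the linear space \<open>\<real> \<times> \<real>\<^sup>n\<close>, where they are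
  directional derivatives \<open>pd\<close> of a single smooth function.
\<close>

definition lift_tx :: "(real \<Rightarrow> 'n::finite torus \<Rightarrow> real) \<Rightarrow> real \<times> (real^'n) \<Rightarrow> real" where
  "lift_tx \<phi> = (\<lambda>(t, y). \<phi> t (abs_torus y))"

abbreviation pd :: "('a::real_normed_vector \<Rightarrow> real) \<Rightarrow> 'a \<Rightarrow> 'a \<Rightarrow> real" where
  "pd g v p \<equiv> frechet_derivative g (at p) v"

context
  fixes \<phi> :: "real \<Rightarrow> 'n::finite torus \<Rightarrow> real"
  assumes sm: "smooth_tx \<phi>"
begin

lemma smooth_lift: "smooth (lift_tx \<phi>)"
  using sm by (simp add: smooth_tx_def lift_tx_def)

lemma time_deriv:
  "((\<lambda>s. \<phi> s (abs_torus y)) has_real_derivative pd (lift_tx \<phi>) (1, 0) (t, y)) (at t)"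
proof -
  have "((\<lambda>s. lift_tx \<phi> (s, y)) has_derivative (\<lambda>h. pd (lift_tx \<phi>) (h, 0) (t, y))) (at t)"
    by (rule has_derivative_slice_fst[OF smoothD(1)[OF smooth_lift]])
  moreover have "(\<lambda>h. pd (lift_tx \<phi>) (h, 0) (t, y)) = (\<lambda>h. pd (lift_tx \<phi>) (1, 0) (t, y) * h)"
  proof
    fix h show "pd (lift_tx \<phi>) (h, 0) (t, y) = pd (lift_tx \<phi>) (1, 0) (t, y) * h"
      using linear_scale[OF has_derivative_linear[OF smoothD(1)[OF smooth_lift]], of "(t, y)" h "(1, 0)"]
      by simp
  qed
  ultimately have "((\<lambda>s. lift_tx \<phi> (s, y)) has_derivative (\<lambda>h. pd (lift_tx \<phi>) (1, 0) (t, y) * h)) (at t)"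
    by simp
  then show ?thesis unfolding has_field_derivative_def by (simp only: lift_tx_def case_prod_conv)
qed

lemma torus_grad_lift: "torus_grad (\<phi> t) (abs_torus y) $ i = pd (lift_tx \<phi>) (0, axis i 1) (t, y)"
  using frechet_derivative_eqI[OF has_derivative_slice_snd[OF smoothD(1)[OF smooth_lift]], of t y]
  by (simp add: torus_grad_abs grad_nth lift_tx_def)

lemma torus_laplacian_lift:
  "torus_laplacian (\<phi> t) (abs_torus y) = (\<Sum>i\<in>UNIV. pd (pd (lift_tx \<phi>) (0, axis i 1)) (0, axis i 1) (t, y))"
proof -
  let ?f = "\<lambda>y. \<phi> t (abs_torus y)"
  have g: "grad ?f y $ i = pd (lift_tx \<phi>) (0, axis i 1) (t, y)" for y i
    using torus_grad_lift by (simp add: torus_grad_abs)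
  have d: "((\<lambda>y. grad ?f y $ i) has_derivative (\<lambda>v. pd (pd (lift_tx \<phi>) (0, axis i 1)) (0, v) (t, y))) (at y)" for y i
    unfolding g by (rule has_derivative_slice_snd[OF smoothD(1)[OF smoothD(2)[OF smooth_lift]]])
  have "grad ?f differentiable (at y)" for y
    by (rule differentiable_vec_components) (use d in \<open>auto simp: differentiable_def\<close>)
  then have "hessian ?f y $ i $ i = pd (pd (lift_tx \<phi>) (0, axis i 1)) (0, axis i 1) (t, y)" for i
    using frechet_derivative_eqI[OF d] by (simp add: hessian_nth)
  then show ?thesis by (simp add: torus_laplacian_def torus_hessian_abs trace_def)
qed

lemma fp_gen_lift: "fp_gen \<phi> t (abs_torus y) = pd (lift_tx \<phi>) (1, 0) (t, y) +
    (\<Sum>i\<in>UNIV. pd (pd (lift_tx \<phi>) (0, axis i 1)) (0, axis i 1) (t, y))"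
  using DERIV_imp_deriv[OF time_deriv] by (simp add: fp_gen_def torus_laplacian_lift)

lemma continuous_fp_gen: "continuous_on UNIV (\<lambda>(t, x). fp_gen \<phi> t x)"
proof (rule continuous_on_torus_lift)
  have "continuous_on UNIV (\<lambda>p. pd (lift_tx \<phi>) (1, 0) p + (\<Sum>i\<in>UNIV. pd (pd (lift_tx \<phi>) (0, axis i 1)) (0, axis i 1) p))"
    by (intro continuous_intros smoothD(3)[OF smoothD(2)[OF smooth_lift]]
        smoothD(3)[OF smoothD(2)[OF smoothD(2)[OF smooth_lift]]])
  then show "continuous_on UNIV (\<lambda>(t, y). fp_gen \<phi> t (abs_torus y))"
    by (simp add: fp_gen_lift case_prod_beta')
qed

lemma continuous_torus_grad: "continuous_on UNIV (\<lambda>(t, x). torus_grad (\<phi> t) x)"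
proof (rule continuous_on_torus_lift)
  have "continuous_on UNIV (\<lambda>p. \<chi> i. pd (lift_tx \<phi>) (0, axis i 1) p)"
    by (intro continuous_intros smoothD(3)[OF smoothD(2)[OF smooth_lift]])
  moreover have "torus_grad (\<phi> t) (abs_torus y) = (\<chi> i. pd (lift_tx \<phi>) (0, axis i 1) (t, y))" for t y
    by (simp add: vec_eq_iff torus_grad_lift)
  ultimately show "continuous_on UNIV (\<lambda>(t, y). torus_grad (\<phi> t) (abs_torus y))"
    by (simp add: case_prod_beta')
qed

lemma continuous_test: "continuous_on UNIV (\<lambda>(t, x). \<phi> t x)"
proof (rule continuous_on_torus_lift)
  show "continuous_on UNIV (\<lambda>(t, y). \<phi> t (abs_torus y))"
    using smoothD(3)[OF smooth_lift] by (simp add: lift_tx_def)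
qed

lemma continuous_time_deriv: "continuous_on UNIV (\<lambda>(t, x). deriv (\<lambda>s. \<phi> s x) t)"
proof (rule continuous_on_torus_lift)
  show "continuous_on UNIV (\<lambda>(t, y). deriv (\<lambda>s. \<phi> s (abs_torus y)) t)"
    using smoothD(3)[OF smoothD(2)[OF smooth_lift, of "(1, 0)"]]
    by (simp add: DERIV_imp_deriv[OF time_deriv] case_prod_beta')
qed

text \<open>
  Derivatives of a test function vanish off any closed set of times that supports it; these are the zero
  extensions on which compactness arguments in time rely.
\<close>

lemma fp_gen_eq_0:
  assumes "supported_in \<phi> K" "closed K" "t \<notin> K"
  shows "fp_gen \<phi> t x = 0" "torus_grad (\<phi> t) x = 0"
proof -
  have z: "\<phi> s x = 0" if "s \<notin> K" for s x using assms that by (simp add: supported_in_def)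
  have "eventually (\<lambda>s. s \<notin> K) (nhds t)"
    using assms eventually_nhds_in_open[of "- K" t] by auto
  then have "eventually (\<lambda>s. \<phi> s x = 0) (nhds t)" by (rule eventually_mono) (rule z)
  then have "deriv (\<lambda>s. \<phi> s x) t = deriv (\<lambda>s. 0) t" by (rule deriv_cong_ev) simp
  moreover have "\<phi> t = (\<lambda>x. 0)" using z[OF assms(3)] by auto
  moreover have "grad (\<lambda>y::real^'n. 0) = (\<lambda>y. 0)" by (auto simp: grad_def vec_eq_iff)
  moreover have "hessian (\<lambda>y::real^'n. 0) y = 0" for y
    using hessian_nth[of "\<lambda>y::real^'n. 0" y] \<open>grad (\<lambda>y::real^'n. 0) = (\<lambda>y. 0)\<close> by (simp add: vec_eq_iff)
  ultimately show "fp_gen \<phi> t x = 0" "torus_grad (\<phi> t) x = 0"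
    by (simp_all add: fp_gen_def torus_laplacian_def torus_hessian_def torus_grad_def trace_def)
qed

lemma time_supported_bound:
  fixes h :: "real \<Rightarrow> 'n torus \<Rightarrow> 'b::real_normed_vector"
  assumes K: "compact K" and h: "\<And>t x. t \<notin> K \<Longrightarrow> h t x = 0" and c: "continuous_on UNIV (\<lambda>(t, x). h t x)"
  shows "\<exists>B\<ge>0. \<forall>t x. norm (h t x) \<le> B"
proof -
  have "compact ((\<lambda>(t, x). h t x) ` (K \<times> UNIV))"
    by (intro compact_continuous_image continuous_on_subset[OF c] compact_Times K compact_torus) auto
  then obtain B where B: "\<And>t x. t \<in> K \<Longrightarrow> norm (h t x) \<le> B"
    using compact_imp_bounded[THEN bounded_iff[THEN iffD1]] by fastforce
  have "norm (h t x) \<le> max B 0" for t x using B[of t x] h[of t x] by (cases "t \<in> K") auto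
  then show ?thesis by (intro exI[of _ "max B 0"]) auto
qed

text \<open>
  Compact support in time and compactness of the torus make every quantity attached to a test function
  bounded; the Lipschitz bound is for the pair time-space.
\<close>

lemma test_bounded:
  assumes "supported_in \<phi> K" "compact K"
  obtains B where "0 \<le> B" "\<And>t x. \<bar>fp_gen \<phi> t x\<bar> \<le> B" "\<And>t x. norm (torus_grad (\<phi> t) x) \<le> B" "\<And>t x. \<bar>\<phi> t x\<bar> \<le> B"
    "\<And>t x. \<bar>deriv (\<lambda>s. \<phi> s x) t\<bar> \<le> B"
    "\<And>t s x y. \<bar>\<phi> t x - \<phi> s y\<bar> \<le> B * (\<bar>t - s\<bar> + dist x y)"
proof -
  note cl = compact_imp_closed[OF assms(2)]
  note bd = time_supported_bound[OF assms(2)]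
  obtain B1 where B1: "0 \<le> B1" "\<And>t x. norm (fp_gen \<phi> t x) \<le> B1"
    using bd[OF fp_gen_eq_0(1)[OF assms(1) cl] continuous_fp_gen] by blast
  obtain B2 where B2: "0 \<le> B2" "\<And>t x. norm (torus_grad (\<phi> t) x) \<le> B2"
    using bd[OF fp_gen_eq_0(2)[OF assms(1) cl] continuous_torus_grad] by blast
  obtain B3 where B3: "0 \<le> B3" "\<And>t x. norm (\<phi> t x) \<le> B3"
    using bd[OF _ continuous_test] assms(1) by (auto simp: supported_in_def)
  have d: "deriv (\<lambda>s. \<phi> s (abs_torus y)) t = pd (lift_tx \<phi>) (1, 0) (t, y)" for t y
    using DERIV_imp_deriv[OF time_deriv] .
  have dt0: "deriv (\<lambda>s. \<phi> s x) t = 0" if "t \<notin> K" for t x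
  proof -
    have "eventually (\<lambda>s. s \<notin> K) (nhds t)"
      using cl that eventually_nhds_in_open[of "- K" t] by auto
    then have "eventually (\<lambda>s. \<phi> s x = 0) (nhds t)"
      by (rule eventually_mono) (use assms(1) in \<open>auto simp: supported_in_def\<close>)
    then have "deriv (\<lambda>s. \<phi> s x) t = deriv (\<lambda>s. 0) t" by (rule deriv_cong_ev) simp
    then show ?thesis by simp
  qed
  obtain B4 where B4: "0 \<le> B4" "\<And>t x. norm (deriv (\<lambda>s. \<phi> s x) t) \<le> B4"
    using bd[OF dt0 continuous_time_deriv] by blast
  define M where "M = max B4 B2"
  have b: "norm (pd (lift_tx \<phi>) b p) \<le> M" if "b \<in> (Basis :: (real \<times> (real^'n)) set)" for p b
  proof -
    obtain t y where p: "p = (t, y)" by (cases p)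
    have "b = (1, 0) \<or> (\<exists>i. b = (0, axis i 1))"
      using that unfolding Basis_prod_def Basis_vec_def by auto
    then consider "b = (1, 0)" | i where "b = (0, axis i 1)" by blast
    then show ?thesis
    proof cases
      case 1
      show ?thesis using B4(2)[of "abs_torus y" t] by (simp add: p d 1 M_def)
    next
      case (2 i)
      have "\<bar>torus_grad (\<phi> t) (abs_torus y) $ i\<bar> \<le> B2"
        using component_le_norm_cart B2(2) by (rule order.trans)
      then show ?thesis by (simp add: p 2 M_def torus_grad_lift)
    qed
  qed
  define L where "L = real DIM(real \<times> (real^'n)) * M"
  have L0: "0 \<le> L" using B2(1) by (simp add: L_def M_def)
  have L: "norm (lift_tx \<phi> p - lift_tx \<phi> q) \<le> L * norm (p - q)" for p q
    unfolding L_def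
  proof (rule lipschitz_of_bounded_derivs[OF _ b])
    show "lift_tx \<phi> differentiable at p" for p
      unfolding differentiable_def using smoothD(1)[OF smooth_lift] by blast
  qed
  have lip: "\<bar>\<phi> t x - \<phi> s y\<bar> \<le> L * (\<bar>t - s\<bar> + dist x y)" for t s x y
  proof -
    obtain y' where y': "abs_torus y' = y" "norm (y' - rep_torus x) = dist y x"
      using torus_lift_near[of y "rep_torus x"] by auto
    have "\<bar>\<phi> t x - \<phi> s y\<bar> \<le> L * norm ((t, rep_torus x) - (s, y'))"
      using L[of "(t, rep_torus x)" "(s, y')"] by (simp add: lift_tx_def y'(1))
    also have "norm ((t, rep_torus x) - (s, y')) \<le> norm (t - s) + norm (rep_torus x - y')"
      using norm_Pair_le[of "t - s" "rep_torus x - y'"] by simp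
    also have "\<dots> = \<bar>t - s\<bar> + dist x y" using y'(2) by (simp add: norm_minus_commute dist_commute)
    finally show ?thesis using L0 by (simp add: mult_left_mono)
  qed
  let ?B = "max L (max (max B1 B2) (max B3 B4))"
  show ?thesis
  proof (rule that[of ?B])
    show "\<bar>deriv (\<lambda>s. \<phi> s x) t\<bar> \<le> ?B" for t x
      using B4(2)[of x t] by simp
    show "\<bar>\<phi> t x - \<phi> s y\<bar> \<le> ?B * (\<bar>t - s\<bar> + dist x y)" for t s x y
      by (rule order.trans[OF lip mult_right_mono]) auto
    show "norm (torus_grad (\<phi> t) x) \<le> ?B" for t x
      using B2(2)[of t x] by simp
    show "\<bar>fp_gen \<phi> t x\<bar> \<le> ?B" for t x
      using B1(2)[of t x] by simp
    show "\<bar>\<phi> t x\<bar> \<le> ?B" for t x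
      using B3(2)[of t x] by simp
  qed (use L0 in auto)
qed

lemma smooth_tx_time_shift: "smooth_tx (\<lambda>t. \<phi> (t + a))"
proof -
  have "smooth (\<lambda>p. lift_tx \<phi> (p + (a, 0)))" by (rule smooth_shift[OF smooth_lift])
  then show ?thesis by (simp add: smooth_tx_def lift_tx_def case_prod_beta')
qed

lemma fp_gen_time_shift: "fp_gen (\<lambda>t. \<phi> (t + a)) t x = fp_gen \<phi> (t + a) x"
proof -
  have "((\<lambda>s. \<phi> (s + a) x) has_real_derivative deriv (\<lambda>s. \<phi> s x) (t + a)) (at t)"
    using time_deriv[of "rep_torus x" "t + a"] DERIV_imp_deriv[OF time_deriv[of "rep_torus x" "t + a"]]
    DERIV_shift[of "\<lambda>s. \<phi> s x" _ t a] by simp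
  then show ?thesis by (simp add: fp_gen_def DERIV_imp_deriv)
qed

lemma smooth_tx_space_shift: "smooth_tx (\<lambda>t x. \<phi> t (tshift x u))"
proof -
  have "smooth (\<lambda>p. lift_tx \<phi> (p + (0, u)))" by (rule smooth_shift[OF smooth_lift])
  then show ?thesis by (simp add: smooth_tx_def lift_tx_def case_prod_beta' tshift_abs)
qed

end

lemma pd_shift:
  assumes "(g has_derivative g') (at (p + a))"
  shows "frechet_derivative (\<lambda>p. g (p + a)) (at p) = g'"
proof -
  have "((\<lambda>p. p + a) has_derivative (\<lambda>v. v)) (at p)" by (auto intro!: derivative_eq_intros)
  from diff_chain_at[OF this assms] show ?thesis
    by (intro frechet_derivative_eqI) (simp add: o_def)
qed

text \<open>
  Translation invariance of the equation, the reason why averages of translates of a solution are solutions.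
\<close>

lemma space_shift_ops:
  fixes \<phi> :: "real \<Rightarrow> 'n::finite torus \<Rightarrow> real"
  assumes sm: "smooth_tx \<phi>"
  shows "fp_gen (\<lambda>t x. \<phi> t (tshift x u)) t x = fp_gen \<phi> t (tshift x u)"
    "torus_grad (\<lambda>x. \<phi> t (tshift x u)) x = torus_grad (\<phi> t) (tshift x u)"
proof -
  let ?\<phi> = "\<lambda>t x. \<phi> t (tshift x u)"
  have l: "lift_tx ?\<phi> = (\<lambda>p. lift_tx \<phi> (p + (0, u)))"
    by (auto simp: lift_tx_def tshift_abs)
  have p1: "pd (lift_tx ?\<phi>) v p = pd (lift_tx \<phi>) v (p + (0, u))" for v p
    unfolding l by (subst pd_shift[OF smoothD(1)[OF smooth_lift[OF sm]]]) simp
  have p2: "pd (\<lambda>p. pd (lift_tx \<phi>) v (p + (0, u))) v p = pd (pd (lift_tx \<phi>) v) v (p + (0, u))" for v p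
    by (subst pd_shift[OF smoothD(1)[OF smoothD(2)[OF smooth_lift[OF sm]]]]) simp
  have t: "tshift x u = abs_torus (rep_torus x + u)" by (simp add: tshift_def)
  show "fp_gen (\<lambda>t x. \<phi> t (tshift x u)) t x = fp_gen \<phi> t (tshift x u)"
    using fp_gen_lift[OF smooth_tx_space_shift[OF sm, of u], of t "rep_torus x"]
    by (simp add: p1 p2 t fp_gen_lift[OF sm])
  show "torus_grad (\<lambda>x. \<phi> t (tshift x u)) x = torus_grad (\<phi> t) (tshift x u)"
    using torus_grad_lift[OF smooth_tx_space_shift[OF sm, of u], of t "rep_torus x"]
    by (simp add: p1 t vec_eq_iff torus_grad_lift[OF sm])
qed

lemma smooth_fst_compose:
  fixes \<theta> :: "real \<Rightarrow> real"
  assumes "smooth \<theta>" shows "smooth (\<lambda>p :: real \<times> 'a::real_normed_vector. \<theta> (fst p))"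
  using smooth_compose_affine[OF bounded_linear_fst assms, of 0] by simp

lemma smooth_tx_cutoff:
  fixes \<phi> :: "real \<Rightarrow> 'n::finite torus \<Rightarrow> real"
  assumes sm: "smooth_tx \<phi>" and \<theta>: "smooth \<theta>"
  shows "smooth_tx (\<lambda>t x. \<theta> t * \<phi> t x)"
  using smooth_mult[OF smooth_fst_compose[OF \<theta>] smooth_lift[OF sm]]
  by (simp add: smooth_tx_def lift_tx_def case_prod_beta')

text \<open>
  Multiplying a test function by a function of time alone only adds the zero-order term \<open>\<theta>' \<phi>\<close>, which
  becomes a boundary term when \<open>\<theta>\<close> approaches a step.
\<close>

lemma cutoff_ops:
  fixes \<phi> :: "real \<Rightarrow> 'n::finite torus \<Rightarrow> real"
  assumes sm: "smooth_tx \<phi>" and \<theta>: "smooth \<theta>" and d: "(\<theta> has_real_derivative \<eta>) (at t)"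
  shows "fp_gen (\<lambda>t x. \<theta> t * \<phi> t x) t x = \<theta> t * fp_gen \<phi> t x + \<eta> * \<phi> t x"
    "torus_grad (\<lambda>x. \<theta> t * \<phi> t x) x = \<theta> t *\<^sub>R torus_grad (\<phi> t) x"
proof -
  let ?\<phi> = "\<lambda>t x. \<theta> t * \<phi> t x"
  note sm' = smooth_tx_cutoff[OF sm \<theta>]
  define y where "y = rep_torus x"
  have x: "x = abs_torus y" by (simp add: y_def)
  have D: "deriv (\<lambda>s. \<theta> s * \<phi> s x) t = \<theta> t * deriv (\<lambda>s. \<phi> s x) t + \<eta> * \<phi> t x"
  proof (rule DERIV_imp_deriv)
    have "((\<lambda>s. \<phi> s x) has_real_derivative deriv (\<lambda>s. \<phi> s x) t) (at t)"
      using time_deriv[OF sm, of y t] DERIV_imp_deriv[OF time_deriv[OF sm, of y t]] by (simp add: x)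
    from DERIV_mult[OF d this]
    show "((\<lambda>s. \<theta> s * \<phi> s x) has_real_derivative \<theta> t * deriv (\<lambda>s. \<phi> s x) t + \<eta> * \<phi> t x) (at t)"
      by (simp add: algebra_simps)
  qed
  have g: "grad (\<lambda>y. \<theta> t * \<phi> t (abs_torus y)) y $ i = \<theta> t * grad (\<lambda>y. \<phi> t (abs_torus y)) y $ i" for y i
  proof -
    have "((\<lambda>y. \<phi> t (abs_torus y)) has_derivative (\<lambda>v. pd (lift_tx \<phi>) (0, v) (t, y))) (at y)"
      using has_derivative_slice_snd[OF smoothD(1)[OF smooth_lift[OF sm]], of t y] by (simp add: lift_tx_def)
    from frechet_derivative_eqI[OF has_derivative_mult_right[OF this, of "\<theta> t"]] frechet_derivative_eqI[OF this]
    show ?thesis by (simp add: grad_nth)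
  qed
  then have g': "torus_grad (\<lambda>x. \<theta> t * \<phi> t x) (abs_torus y) = \<theta> t *\<^sub>R torus_grad (\<phi> t) (abs_torus y)" for y
    by (simp add: torus_grad_abs vec_eq_iff)
  then show "torus_grad (\<lambda>x. \<theta> t * \<phi> t x) x = \<theta> t *\<^sub>R torus_grad (\<phi> t) x" by (simp add: x)
  have "pd (lift_tx ?\<phi>) (0, axis i 1) (t, y) = \<theta> t * pd (lift_tx \<phi>) (0, axis i 1) (t, y)" for y i
    using g'[of y] torus_grad_lift[OF sm', of t y i] torus_grad_lift[OF sm, of t y i]
    by (simp add: vec_eq_iff)
  then have 1: "(\<lambda>y. pd (lift_tx ?\<phi>) (0, axis i 1) (t, y)) = (\<lambda>y. \<theta> t * pd (lift_tx \<phi>) (0, axis i 1) (t, y))" for i by auto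
  have "pd (pd (lift_tx ?\<phi>) (0, axis i 1)) (0, axis i 1) (t, y) = \<theta> t * pd (pd (lift_tx \<phi>) (0, axis i 1)) (0, axis i 1) (t, y)" for i
  proof -
    have a: "((\<lambda>y. pd (lift_tx ?\<phi>) (0, axis i 1) (t, y)) has_derivative (\<lambda>v. pd (pd (lift_tx ?\<phi>) (0, axis i 1)) (0, v) (t, y))) (at y)"
      by (rule has_derivative_slice_snd[OF smoothD(1)[OF smoothD(2)[OF smooth_lift[OF sm']]]])
    have "((\<lambda>y. pd (lift_tx \<phi>) (0, axis i 1) (t, y)) has_derivative (\<lambda>v. pd (pd (lift_tx \<phi>) (0, axis i 1)) (0, v) (t, y))) (at y)"
      by (rule has_derivative_slice_snd[OF smoothD(1)[OF smoothD(2)[OF smooth_lift[OF sm]]]])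
    from fun_cong[OF has_derivative_unique[OF a[unfolded 1] has_derivative_mult_right[OF this, of "\<theta> t"]], of "axis i 1"]
    show ?thesis by simp
  qed
  then have "torus_laplacian (?\<phi> t) x = \<theta> t * torus_laplacian (\<phi> t) x"
    unfolding x torus_laplacian_lift[OF sm'] torus_laplacian_lift[OF sm] by (simp add: sum_distrib_left)
  then show "fp_gen (\<lambda>t x. \<theta> t * \<phi> t x) t x = \<theta> t * fp_gen \<phi> t x + \<eta> * \<phi> t x"
    using D by (simp add: fp_gen_def algebra_simps)
qed

definition test_fn :: "real set \<Rightarrow> (real \<Rightarrow> 'n::finite torus \<Rightarrow> real) \<Rightarrow> bool" where
  "test_fn I \<phi> \<longleftrightarrow> smooth_tx \<phi> \<and> (\<exists>K. compact K \<and> K \<subseteq> interior I \<and> supported_in \<phi> K)"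

lemma fokker_planck_iff:
  "fokker_planck I m \<alpha> \<longleftrightarrow> (\<forall>\<phi>. test_fn I \<phi> \<longrightarrow>
     (LINT t:I|lborel. (\<integral>x. fp_gen \<phi> t x - \<alpha> t x \<bullet> torus_grad (\<phi> t) x \<partial>m t)) = 0)"
  by (simp add: fokker_planck_def test_fn_def smooth_tx_def supported_in_def fp_gen_def)

section \<open>Space-time measures\<close>

abbreviation tx_space :: "real set \<Rightarrow> (real \<times> 'n::finite torus) measure" where
  "tx_space I \<equiv> restrict_space borel I \<Otimes>\<^sub>M borel"

abbreviation lb :: "real set \<Rightarrow> real measure" where
  "lb I \<equiv> restrict_space lborel I"

abbreviation speed2 :: "(real \<Rightarrow> 'n::finite torus \<Rightarrow> real^'n) \<Rightarrow> real \<times> 'n torus \<Rightarrow> real" where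
  "speed2 \<alpha> p \<equiv> (norm (\<alpha> (fst p) (snd p)))\<^sup>2"

abbreviation fp_along :: "(real \<Rightarrow> 'n::finite torus \<Rightarrow> real) \<Rightarrow> (real \<Rightarrow> 'n torus \<Rightarrow> real^'n) \<Rightarrow> real \<times> 'n torus \<Rightarrow> real" where
  "fp_along \<phi> \<alpha> p \<equiv> fp_gen \<phi> (fst p) (snd p) - \<alpha> (fst p) (snd p) \<bullet> torus_grad (\<phi> (fst p)) (snd p)"

text \<open>
  The measure \<open>m(t, dx) dt\<close> on \<open>I \<times> \<T>\<^sup>n\<close>. Integrating against it instead of iterating integrals makes
  measurability in time automatic and gives access to disintegration.
\<close>

definition curve :: "real set \<Rightarrow> (real \<Rightarrow> 'n::finite torus measure) \<Rightarrow> (real \<times> 'n torus) measure" where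
  "curve I m = lb I \<bind> (\<lambda>t. distr (m t) (tx_space I) (Pair t))"

lemma sets_lb: "sets (lb I) = sets (restrict_space borel I)"
  by (rule sets_restrict_space_cong) simp

lemma space_lb [simp]: "space (lb I) = I"
  by (simp add: space_restrict_space)

lemma lb_measurable: "f \<in> borel_measurable (restrict_space borel I) \<Longrightarrow> f \<in> borel_measurable (lb I)"
  by (simp cong: measurable_cong_sets add: sets_lb)

lemma space_tx_space [simp]: "space (tx_space I) = I \<times> UNIV"
  by (simp add: space_pair_measure space_restrict_space)

lemma measurable_tx_incl: "(\<lambda>p. p) \<in> tx_space I \<rightarrow>\<^sub>M borel \<Otimes>\<^sub>M borel"
proof -
  have "(\<lambda>p. fst p) \<in> tx_space I \<rightarrow>\<^sub>M borel"
    by (rule measurable_compose[OF measurable_fst measurable_restrict_space1]) simp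
  from measurable_Pair[OF this measurable_snd] show ?thesis by simp
qed

lemma measurable_tx_restrict: "f \<in> borel \<Otimes>\<^sub>M borel \<rightarrow>\<^sub>M M \<Longrightarrow> f \<in> tx_space I \<rightarrow>\<^sub>M M"
  using measurable_compose[OF measurable_tx_incl] by blast

lemma continuous_tx_measurable:
  fixes f :: "real \<Rightarrow> 'n::finite torus \<Rightarrow> 'b::topological_space"
  assumes "continuous_on UNIV (\<lambda>(t, x). f t x)"
  shows "(\<lambda>(t, x). f t x) \<in> borel_measurable (tx_space I)"
proof (rule measurable_tx_restrict)
  show "(\<lambda>(t, x). f t x) \<in> borel \<Otimes>\<^sub>M borel \<rightarrow>\<^sub>M borel"
    unfolding borel_prod by (rule borel_measurable_continuous_onI[OF assms])
qed

lemma LINT_lb: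
  fixes f :: "real \<Rightarrow> real"
  assumes "I \<in> sets borel"
  shows "(LINT t:I|lborel. f t) = (\<integral>t. f t \<partial>lb I)"
  using assms by (simp add: set_lebesgue_integral_def integral_restrict_space)

context
  fixes I :: "real set" and m :: "real \<Rightarrow> 'n::finite torus measure"
  assumes I: "I \<in> sets borel" "I \<noteq> {}" and m: "prob_curve I m"
begin

lemma kernel_lb: "m \<in> lb I \<rightarrow>\<^sub>M subprob_algebra borel"
  using prob_curve_kernel[OF m] by (simp cong: measurable_cong_sets add: sets_lb)

lemma sets_m: "t \<in> I \<Longrightarrow> sets (m t) = sets borel"
  using prob_curveD[OF m] prob_torusD by blast

lemma Pair_measurable_m: "t \<in> I \<Longrightarrow> Pair t \<in> m t \<rightarrow>\<^sub>M tx_space I"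
  using sets_m[of t] by (simp cong: measurable_cong_sets add: measurable_Pair1' space_restrict_space)

lemma slice_measurable: "f \<in> tx_space I \<rightarrow>\<^sub>M M \<Longrightarrow> t \<in> I \<Longrightarrow> (\<lambda>x. f (t, x)) \<in> m t \<rightarrow>\<^sub>M M"
  using measurable_compose[OF Pair_measurable_m] by blast

lemma kernel_tx: "(\<lambda>t. distr (m t) (tx_space I) (Pair t)) \<in> lb I \<rightarrow>\<^sub>M subprob_algebra (tx_space I)"
proof (rule measurable_distr2[OF _ kernel_lb])
  have "sets (lb I \<Otimes>\<^sub>M (borel :: 'n torus measure)) = sets (tx_space I)"
    by (rule sets_pair_measure_cong[OF sets_lb refl])
  then show "(\<lambda>(x, y). (x, y)) \<in> lb I \<Otimes>\<^sub>M borel \<rightarrow>\<^sub>M tx_space I"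
    by (simp cong: measurable_cong_sets)
qed

lemma sets_curve: "sets (curve I m) = sets (tx_space I)"
  unfolding curve_def by (rule sets_bind[OF sets_distr]) (use I in auto)

lemma curve_measurable: "f \<in> tx_space I \<rightarrow>\<^sub>M M \<Longrightarrow> f \<in> curve I m \<rightarrow>\<^sub>M M"
  by (simp cong: measurable_cong_sets add: sets_curve)

lemma nn_integral_curve:
  assumes f: "f \<in> borel_measurable (tx_space I)"
  shows "(\<integral>\<^sup>+p. f p \<partial>curve I m) = (\<integral>\<^sup>+t. \<integral>\<^sup>+x. f (t, x) \<partial>m t \<partial>lb I)"
proof -
  have "(\<integral>\<^sup>+p. f p \<partial>curve I m) = (\<integral>\<^sup>+t. \<integral>\<^sup>+p. f p \<partial>distr (m t) (tx_space I) (Pair t) \<partial>lb I)"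
    unfolding curve_def by (rule nn_integral_bind[OF f kernel_tx])
  also have "\<dots> = (\<integral>\<^sup>+t. \<integral>\<^sup>+x. f (t, x) \<partial>m t \<partial>lb I)"
    by (intro nn_integral_cong nn_integral_distr Pair_measurable_m) (use f in \<open>auto\<close>)
  finally show ?thesis .
qed

lemma inner_nn_measurable:
  assumes f: "f \<in> borel_measurable (tx_space I)"
  shows "(\<lambda>t. \<integral>\<^sup>+x. f (t, x) \<partial>m t) \<in> borel_measurable (lb I)"
proof (rule nn_integral_measurable_subprob_algebra2[OF _ kernel_lb])
  have "sets (lb I \<Otimes>\<^sub>M (borel :: 'n torus measure)) = sets (tx_space I)"
    by (rule sets_pair_measure_cong[OF sets_lb refl])
  then show "(\<lambda>(x, y). f (x, y)) \<in> borel_measurable (lb I \<Otimes>\<^sub>M borel)"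
    using f by (simp cong: measurable_cong_sets)
qed

lemma AE_curve_finite:
  assumes f: "f \<in> borel_measurable (tx_space I)" and fin: "(\<integral>\<^sup>+p. f p \<partial>curve I m) < \<infinity>"
  shows "AE t in lb I. (\<integral>\<^sup>+x. f (t, x) \<partial>m t) < \<infinity>"
  using nn_integral_PInf_AE[OF inner_nn_measurable[OF f]] fin
  by (simp add: nn_integral_curve[OF f] less_top)

text \<open>
  Fubini for a kernel that varies with time. Positive and negative parts are treated separately; the inner
  integral is \<open>0\<close> at the negligible times where the slice is not integrable.
\<close>

lemma integral_curve:
  fixes f :: "real \<times> 'n torus \<Rightarrow> real"
  assumes f: "integrable (curve I m) f"
  shows "integrable (lb I) (\<lambda>t. \<integral>x. f (t, x) \<partial>m t)"
    "(\<integral>p. f p \<partial>curve I m) = (\<integral>t. \<integral>x. f (t, x) \<partial>m t \<partial>lb I)"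
    "AE t in lb I. integrable (m t) (\<lambda>x. f (t, x))"
proof -
  have fm: "f \<in> borel_measurable (tx_space I)"
    using borel_measurable_integrable[OF f] by (simp cong: measurable_cong_sets add: sets_curve)
  define P where "P t = (\<integral>\<^sup>+x. ennreal (f (t, x)) \<partial>m t)" for t
  define Q where "Q t = (\<integral>\<^sup>+x. ennreal (- f (t, x)) \<partial>m t)" for t
  have pm: "(\<lambda>p. ennreal (f p)) \<in> borel_measurable (tx_space I)" "(\<lambda>p. ennreal (- f p)) \<in> borel_measurable (tx_space I)"
    using fm by measurable
  have [measurable]: "P \<in> borel_measurable (lb I)" "Q \<in> borel_measurable (lb I)"
    unfolding P_def Q_def by (rule inner_nn_measurable[OF pm(1)], rule inner_nn_measurable[OF pm(2)])
  have fin: "(\<integral>\<^sup>+p. ennreal (f p) \<partial>curve I m) < \<infinity>" "(\<integral>\<^sup>+p. ennreal (- f p) \<partial>curve I m) < \<infinity>"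
    using integrableD(2,3)[OF f] by (auto simp: less_top)
  have iP: "(\<integral>\<^sup>+t. P t \<partial>lb I) = (\<integral>\<^sup>+p. ennreal (f p) \<partial>curve I m)"
    and iQ: "(\<integral>\<^sup>+t. Q t \<partial>lb I) = (\<integral>\<^sup>+p. ennreal (- f p) \<partial>curve I m)"
    unfolding P_def Q_def by (simp_all add: nn_integral_curve[OF pm(1)] nn_integral_curve[OF pm(2)])
  have AEf: "AE t in lb I. P t < \<infinity>" "AE t in lb I. Q t < \<infinity>"
    unfolding P_def Q_def using AE_curve_finite[OF pm(1) fin(1)] AE_curve_finite[OF pm(2) fin(2)] by auto
  have i2: "integrable (m t) (\<lambda>x. f (t, x))" if "t \<in> I" "P t < \<infinity>" "Q t < \<infinity>" for t
    using that slice_measurable[OF fm that(1)] by (auto simp: real_integrable_def P_def Q_def)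
  show ae: "AE t in lb I. integrable (m t) (\<lambda>x. f (t, x))"
    using AEf AE_space by eventually_elim (use i2 in auto)
  have eq: "AE t in lb I. enn2real (P t) - enn2real (Q t) = (\<integral>x. f (t, x) \<partial>m t)"
    using AEf AE_space by eventually_elim (use i2 in \<open>auto simp: real_lebesgue_integral_def P_def Q_def\<close>)
  have eP: "(\<integral>\<^sup>+t. ennreal (enn2real (P t)) \<partial>lb I) = (\<integral>\<^sup>+t. P t \<partial>lb I)"
    by (rule nn_integral_cong_AE) (use AEf(1) in \<open>eventually_elim, simp add: less_top\<close>)
  have eQ: "(\<integral>\<^sup>+t. ennreal (enn2real (Q t)) \<partial>lb I) = (\<integral>\<^sup>+t. Q t \<partial>lb I)"
    by (rule nn_integral_cong_AE) (use AEf(2) in \<open>eventually_elim, simp add: less_top\<close>)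
  have intP: "integrable (lb I) (\<lambda>t. enn2real (P t))"
    by (rule integrableI_nonneg) (use eP iP fin in auto)
  have intQ: "integrable (lb I) (\<lambda>t. enn2real (Q t))"
    by (rule integrableI_nonneg) (use eQ iQ fin in auto)
  have meas: "(\<lambda>t. \<integral>x. f (t, x) \<partial>m t) \<in> borel_measurable (lb I)"
  proof (subst measurable_cong)
    fix t assume t: "t \<in> space (lb I)"
    have "integrable (m t) (\<lambda>x. f (t, x)) \<longleftrightarrow> P t < \<infinity> \<and> Q t < \<infinity>"
      using t slice_measurable[OF fm] by (auto simp: real_integrable_def P_def Q_def less_top)
    then show "(\<integral>x. f (t, x) \<partial>m t) = (if P t < \<infinity> \<and> Q t < \<infinity> then enn2real (P t) - enn2real (Q t) else 0)"
      by (auto simp: real_lebesgue_integral_def P_def Q_def not_integrable_integral_eq)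
  qed measurable
  show "integrable (lb I) (\<lambda>t. \<integral>x. f (t, x) \<partial>m t)"
    using integrable_cong_AE[OF _ meas eq] intP intQ by simp
  have "(\<integral>t. \<integral>x. f (t, x) \<partial>m t \<partial>lb I) = (\<integral>t. enn2real (P t) - enn2real (Q t) \<partial>lb I)"
    by (rule integral_cong_AE) (use meas eq in auto)
  also have "\<dots> = (\<integral>t. enn2real (P t) \<partial>lb I) - (\<integral>t. enn2real (Q t) \<partial>lb I)"
    using intP intQ by simp
  also have "(\<integral>t. enn2real (P t) \<partial>lb I) = enn2real (\<integral>\<^sup>+p. ennreal (f p) \<partial>curve I m)"
    by (subst integral_eq_nn_integral) (auto simp: eP iP)
  also have "(\<integral>t. enn2real (Q t) \<partial>lb I) = enn2real (\<integral>\<^sup>+p. ennreal (- f p) \<partial>curve I m)"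
    by (subst integral_eq_nn_integral) (auto simp: eQ iQ)
  finally show "(\<integral>p. f p \<partial>curve I m) = (\<integral>t. \<integral>x. f (t, x) \<partial>m t \<partial>lb I)"
    by (simp add: real_lebesgue_integral_def[OF f])
qed

lemma nn_integral_curve_time:
  assumes "f \<in> borel_measurable (lb I)"
  shows "(\<integral>\<^sup>+p. f (fst p) \<partial>curve I m) = (\<integral>\<^sup>+t. f t \<partial>lb I)"
proof -
  have "f \<in> borel_measurable (restrict_space borel I)"
    using assms by (simp cong: measurable_cong_sets add: sets_lb)
  then have "(\<lambda>p. f (fst p)) \<in> borel_measurable (tx_space I)" by measurable
  from nn_integral_curve[OF this] have "(\<integral>\<^sup>+p. f (fst p) \<partial>curve I m) = (\<integral>\<^sup>+t. \<integral>\<^sup>+x. f t \<partial>m t \<partial>lb I)" by simp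
  also have "\<dots> = (\<integral>\<^sup>+t. f t \<partial>lb I)"
  proof (rule nn_integral_cong)
    fix t assume "t \<in> space (lb I)"
    then have "m t \<in> prob_torus" using prob_curveD[OF m] by simp
    then interpret prob_space "m t" using prob_torusD by blast
    show "(\<integral>\<^sup>+x. f t \<partial>m t) = f t" by (simp add: emeasure_space_1)
  qed
  finally show ?thesis .
qed

lemma integrable_curve_time:
  fixes f :: "real \<Rightarrow> real"
  assumes "integrable (lb I) f"
  shows "integrable (curve I m) (\<lambda>p. f (fst p))" "(\<integral>p. f (fst p) \<partial>curve I m) = (\<integral>t. f t \<partial>lb I)"
proof -
  have fm: "f \<in> borel_measurable (lb I)" using assms by simp
  have "f \<in> borel_measurable (restrict_space borel I)"
    using fm by (simp cong: measurable_cong_sets add: sets_lb)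
  then have "(\<lambda>p. f (fst p)) \<in> borel_measurable (tx_space I)" by measurable
  then have "(\<lambda>p. f (fst p)) \<in> borel_measurable (curve I m)" by (rule curve_measurable)
  moreover have "(\<integral>\<^sup>+p. ennreal (norm (f (fst p))) \<partial>curve I m) < \<infinity>"
    using nn_integral_curve_time[of "\<lambda>t. ennreal (norm (f t))"] assms fm
    by (simp add: integrable_iff_bounded)
  ultimately show i: "integrable (curve I m) (\<lambda>p. f (fst p))" by (simp add: integrable_iff_bounded)
  have "(\<integral>p. f (fst p) \<partial>curve I m) = (\<integral>t. \<integral>x. f t \<partial>m t \<partial>lb I)"
    using integral_curve(2)[OF i] by simp
  also have "\<dots> = (\<integral>t. f t \<partial>lb I)"
  proof (rule Bochner_Integration.integral_cong[OF refl])
    fix t assume "t \<in> space (lb I)"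
    then have "m t \<in> prob_torus" using prob_curveD[OF m] by simp
    then interpret prob_space "m t" using prob_torusD by blast
    show "(\<integral>x. f t \<partial>m t) = f t" by (simp add: prob_space)
  qed
  finally show "(\<integral>p. f (fst p) \<partial>curve I m) = (\<integral>t. f t \<partial>lb I)" .
qed

end

text \<open>
  The weights \<open>1\<close> on \<open>[0, T]\<close> and \<open>exp(-\<delta>t)\<close> on \<open>[0, \<infinity>)\<close> are the ones of interest. Positivity on the whole line
  gives a positive lower bound on compact sets of times, so that weighted energy controls the energy there.
\<close>

definition weight :: "real set \<Rightarrow> (real \<Rightarrow> real) \<Rightarrow> bool" where
  "weight I w \<longleftrightarrow> I \<in> sets borel \<and> 0 \<in> I \<and> continuous_on UNIV w \<and> (\<forall>t. 0 < w t) \<and> integrable (lb I) w"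

lemma weightD:
  assumes "weight I w"
  shows "I \<in> sets borel" "I \<noteq> {}" "0 \<in> I" "continuous_on UNIV w" "\<And>t. 0 < w t" "\<And>t. 0 \<le> w t" "integrable (lb I) w"
    "w \<in> borel_measurable borel" "w \<in> borel_measurable (restrict_space borel I)"
proof -
  show "I \<in> sets borel" "I \<noteq> {}" "0 \<in> I" "continuous_on UNIV w" "\<And>t. 0 < w t" "integrable (lb I) w"
    using assms by (auto simp: weight_def)
  then show "\<And>t. 0 \<le> w t" using less_imp_le by blast
  show "w \<in> borel_measurable borel" by (rule borel_measurable_continuous_onI) fact
  then show "w \<in> borel_measurable (restrict_space borel I)" by (rule measurable_restrict_space1)
qed

lemma nn_lb: "I \<in> sets borel \<Longrightarrow> (\<integral>\<^sup>+t\<in>I. f t \<partial>lborel) = (\<integral>\<^sup>+t. f t \<partial>lb I)"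
  by (simp add: nn_integral_restrict_space)

lemma admissible_iff:
  assumes w: "weight I w"
  shows "(m, \<alpha>) \<in> admissible I w m0 \<longleftrightarrow> prob_curve I m \<and> (\<lambda>(t, x). \<alpha> t x) \<in> borel_measurable (tx_space I) \<and>
     (\<integral>\<^sup>+p. ennreal (w (fst p) * speed2 \<alpha> p) \<partial>curve I m) < \<infinity> \<and> fokker_planck I m \<alpha> \<and> m 0 = m0"
proof -
  note W = weightD[OF w]
  have "(\<integral>\<^sup>+t\<in>I. ennreal (w t) * (\<integral>\<^sup>+x. ennreal ((norm (\<alpha> t x))\<^sup>2) \<partial>m t) \<partial>lborel)
     = (\<integral>\<^sup>+p. ennreal (w (fst p) * speed2 \<alpha> p) \<partial>curve I m)"
    if m: "prob_curve I m" and \<alpha>: "(\<lambda>(t, x). \<alpha> t x) \<in> borel_measurable (tx_space I)"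
  proof -
    have [measurable]: "(\<lambda>p. \<alpha> (fst p) (snd p)) \<in> borel_measurable (tx_space I)"
      using \<alpha> by (simp add: case_prod_beta')
    note [measurable] = W(9)
    have me: "(\<lambda>p. ennreal (w (fst p) * speed2 \<alpha> p)) \<in> borel_measurable (tx_space I)"
      by measurable
    have "(\<lambda>p. ennreal (speed2 \<alpha> p)) \<in> borel_measurable (tx_space I)" by measurable
    note s = slice_measurable[OF W(1,2) m this]
    have "(\<integral>\<^sup>+t\<in>I. ennreal (w t) * (\<integral>\<^sup>+x. ennreal ((norm (\<alpha> t x))\<^sup>2) \<partial>m t) \<partial>lborel)
      = (\<integral>\<^sup>+t. ennreal (w t) * (\<integral>\<^sup>+x. ennreal ((norm (\<alpha> t x))\<^sup>2) \<partial>m t) \<partial>lb I)"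
      using W(1) by (rule nn_lb)
    also have "\<dots> = (\<integral>\<^sup>+t. \<integral>\<^sup>+x. ennreal (w t * (norm (\<alpha> t x))\<^sup>2) \<partial>m t \<partial>lb I)"
      using s W(6) by (intro nn_integral_cong) (simp add: nn_integral_cmult ennreal_mult)
    finally show ?thesis by (simp add: nn_integral_curve[OF W(1,2) m me])
  qed
  then show ?thesis unfolding admissible_def prob_curve_def[symmetric] by auto
qed

lemma fp_measurable:
  assumes \<phi>: "smooth_tx \<phi>"
    and \<alpha>: "(\<lambda>(t, x). \<alpha> t x) \<in> borel_measurable (tx_space I)"
  shows "(\<lambda>p. fp_gen \<phi> (fst p) (snd p)) \<in> borel_measurable (tx_space I)"
    "(\<lambda>p. torus_grad (\<phi> (fst p)) (snd p)) \<in> borel_measurable (tx_space I)"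
    "(\<lambda>p. fp_along \<phi> \<alpha> p) \<in> borel_measurable (tx_space I)"
proof -
  show [measurable]: "(\<lambda>p. fp_gen \<phi> (fst p) (snd p)) \<in> borel_measurable (tx_space I)"
    using continuous_tx_measurable[OF continuous_fp_gen[OF \<phi>]] by (simp add: case_prod_beta')
  show [measurable]: "(\<lambda>p. torus_grad (\<phi> (fst p)) (snd p)) \<in> borel_measurable (tx_space I)"
    using continuous_tx_measurable[OF continuous_torus_grad[OF \<phi>]] by (simp add: case_prod_beta')
  have [measurable]: "(\<lambda>p. \<alpha> (fst p) (snd p)) \<in> borel_measurable (tx_space I)"
    using \<alpha> by (simp add: case_prod_beta')
  show "(\<lambda>p. fp_along \<phi> \<alpha> p) \<in> borel_measurable (tx_space I)"
    by measurable
qed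

lemma fp_integrable_curve:
  fixes \<phi> :: "real \<Rightarrow> 'n::finite torus \<Rightarrow> real"
  assumes w: "weight I w" and m: "prob_curve I m"
    and \<alpha>: "(\<lambda>(t, x). \<alpha> t x) \<in> borel_measurable (tx_space I)"
    and e: "(\<integral>\<^sup>+p. ennreal (w (fst p) * speed2 \<alpha> p) \<partial>curve I m) < \<infinity>"
    and \<phi>: "smooth_tx \<phi>" "supported_in \<phi> K" "compact K"
  shows "integrable (curve I m) (\<lambda>p. fp_along \<phi> \<alpha> p)"
proof -
  note W = weightD[OF w]
  note cl = compact_imp_closed[OF \<phi>(3)]
  obtain B where B: "0 \<le> B" "\<And>t x. \<bar>fp_gen \<phi> t x\<bar> \<le> B" "\<And>t x. norm (torus_grad (\<phi> t) x) \<le> B"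
    by (rule test_bounded[OF \<phi>], rule that) auto
  \<comment> \<open>Only times in \<open>K\<close> matter, where the weight is bounded below.\<close>
  obtain c where c: "c > 0" "\<And>t. t \<in> K \<Longrightarrow> c \<le> w t"
  proof (cases "K = {}")
    case False
    obtain t0 where "t0 \<in> K" "\<And>t. t \<in> K \<Longrightarrow> w t0 \<le> w t"
      using continuous_attains_inf[OF \<phi>(3) False continuous_on_subset[OF W(4)]] by auto
    then show ?thesis using that[of "w t0"] W(5) by blast
  qed (use that[of 1] in auto)
  define g where "g p = (2 * B / c) * (w (fst p)) + (B / c) * (w (fst p) * speed2 \<alpha> p)" for p
  have am: "(\<lambda>p. \<alpha> (fst p) (snd p)) \<in> borel_measurable (curve I m)"
    using curve_measurable[OF W(1,2) m \<alpha>] by (simp add: case_prod_beta')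
  have wm: "(\<lambda>p. w (fst p)) \<in> borel_measurable (curve I m)"
    by (rule curve_measurable[OF W(1,2) m]) (use W(9) in measurable)
  have "integrable (curve I m) (\<lambda>p. w (fst p) * speed2 \<alpha> p)"
    using am wm e by (intro integrableI_nonneg) (auto simp: W(6))
  then have gi: "integrable (curve I m) g"
    unfolding g_def using integrable_curve_time(1)[OF W(1,2) m W(7)] by auto
  show ?thesis
  proof (rule Bochner_Integration.integrable_bound[OF gi])
    show "(\<lambda>p. fp_along \<phi> \<alpha> p) \<in> borel_measurable (curve I m)"
      by (rule curve_measurable[OF W(1,2) m fp_measurable(3)[OF \<phi>(1) \<alpha>]])
    have "norm (fp_gen \<phi> t x - \<alpha> t x \<bullet> torus_grad (\<phi> t) x) \<le> norm (g (t, x))" for t x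
    proof (cases "t \<in> K")
      case True
      have "norm (fp_gen \<phi> t x - \<alpha> t x \<bullet> torus_grad (\<phi> t) x) \<le> B + norm (\<alpha> t x) * B"
        using B(2)[of t x] Cauchy_Schwarz_ineq2[of "\<alpha> t x" "torus_grad (\<phi> t) x"]
          mult_left_mono[OF B(3)[of t x] norm_ge_zero[of "\<alpha> t x"]] by (simp add: abs_le_iff)
      also have "norm (\<alpha> t x) \<le> 1 + (norm (\<alpha> t x))\<^sup>2" by (rule norm_le_one_plus_square)
      then have "B + norm (\<alpha> t x) * B \<le> B + (1 + (norm (\<alpha> t x))\<^sup>2) * B"
        using B(1) by (intro add_left_mono mult_right_mono)
      also have "\<dots> = (2 * B / c) * c + (B / c) * (c * (norm (\<alpha> t x))\<^sup>2)"
        using c(1) by (simp add: algebra_simps)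
      also have "\<dots> \<le> g (t, x)"
        unfolding g_def using c(1) c(2)[OF True] B(1)
        by (intro add_mono mult_left_mono) (auto intro: mult_right_mono)
      finally show ?thesis by simp
    next
      case False
      then show ?thesis using fp_gen_eq_0[OF \<phi>(1,2) cl False] by simp
    qed
    then show "AE p in curve I m. norm (fp_along \<phi> \<alpha> p) \<le> norm (g p)"
      by (intro AE_I2) (metis prod.collapse)
  qed
qed

lemma fp_LINT_eq:
  fixes \<phi> :: "real \<Rightarrow> 'n::finite torus \<Rightarrow> real"
  assumes w: "weight I w" and m: "prob_curve I m"
    and \<alpha>: "(\<lambda>(t, x). \<alpha> t x) \<in> borel_measurable (tx_space I)"
    and e: "(\<integral>\<^sup>+p. ennreal (w (fst p) * speed2 \<alpha> p) \<partial>curve I m) < \<infinity>"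
    and \<phi>: "test_fn I \<phi>"
  shows "(LINT t:I|lborel. (\<integral>x. fp_gen \<phi> t x - \<alpha> t x \<bullet> torus_grad (\<phi> t) x \<partial>m t))
    = (\<integral>p. fp_along \<phi> \<alpha> p \<partial>curve I m)"
proof -
  note W = weightD[OF w]
  obtain K where K: "supported_in \<phi> K" "compact K" and sm: "smooth_tx \<phi>" using \<phi> by (auto simp: test_fn_def)
  show ?thesis
    using integral_curve(2)[OF W(1,2) m fp_integrable_curve[OF w m \<alpha> e sm K]] by (simp add: LINT_lb[OF W(1)])
qed

section \<open>The control problem for an abstract running cost\<close>

text \<open>
  What the argument needs from the data, with one constant \<open>c\<close> for all bounds; \<open>lag\<close> stands for \<open>H\<^sup>*\<close>.
  Convexity of \<open>lag x\<close> enters as \<open>l_affine\<close>: a supremum of countably many affine functions, with the same slopes at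
  all points \<open>x\<close>. In this form it gives joint measurability and a conditional Jensen inequality at once.
\<close>

locale mf_cost =
  fixes lag :: "'n::finite torus \<Rightarrow> real^'n \<Rightarrow> real" and \<F> :: "'n torus measure \<Rightarrow> real" and c :: real
  assumes c1: "1 \<le> c"
    and l_lower: "(norm q)\<^sup>2 / c - c \<le> lag x q"
    and l_upper: "lag x q \<le> c * (1 + (norm q)\<^sup>2)"
    and l_lip: "\<bar>lag x q - lag y q\<bar> \<le> c * dist x y * (1 + (norm q)\<^sup>2)"
    and l_affine: "\<exists>p b. (\<forall>j::nat. continuous_on UNIV (b j)) \<and>
       (\<forall>x q. (\<forall>j. p j \<bullet> q - b j x \<le> lag x q) \<and> (\<forall>e>0. \<exists>j. lag x q - e < p j \<bullet> q - b j x))"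
    and F_lip: "\<mu> \<in> prob_torus \<Longrightarrow> \<nu> \<in> prob_torus \<Longrightarrow> \<bar>\<F> \<mu> - \<F> \<nu>\<bar> \<le> c * kr_dist \<mu> \<nu>"
    and F_bound: "\<mu> \<in> prob_torus \<Longrightarrow> \<bar>\<F> \<mu>\<bar> \<le> c"
begin

definition run_cost :: "(real \<Rightarrow> 'n torus measure) \<Rightarrow> (real \<Rightarrow> 'n torus \<Rightarrow> real^'n) \<Rightarrow> real \<Rightarrow> real" where
  "run_cost m \<alpha> t = (\<integral>x. lag x (\<alpha> t x) \<partial>m t) + \<F> (m t)"

definition cost :: "real set \<Rightarrow> (real \<Rightarrow> real) \<Rightarrow> (real \<Rightarrow> 'n torus measure) \<Rightarrow> (real \<Rightarrow> 'n torus \<Rightarrow> real^'n) \<Rightarrow> real" where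
  "cost I w m \<alpha> = (LINT t:I|lborel. w t * run_cost m \<alpha> t)"

lemma c_pos: "0 < c" using c1 by simp

lemma l_measurable: "(\<lambda>p. lag (fst p) (snd p)) \<in> borel_measurable (borel \<Otimes>\<^sub>M borel)"
proof -
  obtain p b where b: "\<And>j::nat. continuous_on UNIV (b j)" and
    pb: "\<And>x q j. p j \<bullet> q - b j x \<le> lag x q" "\<And>x q e. e > 0 \<Longrightarrow> \<exists>j. lag x q - e < p j \<bullet> q - b j x"
    using l_affine by blast
  have [measurable]: "b j \<in> borel_measurable borel" for j
    by (rule borel_measurable_continuous_onI[OF b])
  have "lag x q = (SUP j. p j \<bullet> q - b j x)" for x q
  proof (rule antisym)
    have bdd: "bdd_above (range (\<lambda>j. p j \<bullet> q - b j x))" using pb(1)[of _ q x] by (auto intro!: bdd_aboveI)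
    show "lag x q \<le> (SUP j. p j \<bullet> q - b j x)"
    proof (rule field_le_epsilon)
      fix e :: real assume "e > 0"
      then obtain j where "lag x q - e < p j \<bullet> q - b j x" using pb(2) by blast
      also have "\<dots> \<le> (SUP j. p j \<bullet> q - b j x)" by (rule cSUP_upper[OF UNIV_I bdd])
      finally show "lag x q \<le> (SUP j. p j \<bullet> q - b j x) + e" by simp
    qed
    show "(SUP j. p j \<bullet> q - b j x) \<le> lag x q" by (rule cSUP_least) (use pb in auto)
  qed
  then have "(\<lambda>w. lag (fst w) (snd w)) = (\<lambda>w. SUP j\<in>UNIV. p j \<bullet> snd w - b j (fst w))" by auto
  also have "\<dots> \<in> borel_measurable (borel \<Otimes>\<^sub>M borel)"
    by (rule borel_measurable_cSUP) (use pb(1) in \<open>auto intro!: bdd_aboveI\<close>)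
  finally show ?thesis .
qed

lemma l_measurable' [measurable (raw)]:
  assumes "f \<in> borel_measurable M" "g \<in> borel_measurable M"
  shows "(\<lambda>w. lag (f w) (g w)) \<in> borel_measurable M"
  using measurable_compose[OF measurable_Pair[OF assms] l_measurable] by simp

lemma l_abs: "\<bar>lag x q\<bar> \<le> c * (1 + (norm q)\<^sup>2)"
proof -
  have "(norm q)\<^sup>2 / c \<ge> 0" "0 \<le> c * (norm q)\<^sup>2" using c1 by auto
  then show ?thesis using l_lower[of q x] l_upper[of x q] by (auto simp: abs_le_iff algebra_simps)
qed

lemma l_ge: "- c \<le> lag x q"
proof -
  have "(norm q)\<^sup>2 / c \<ge> 0" using c1 by auto
  then show ?thesis using l_lower[of q x] by linarith
qed

lemma F_continuous:
  assumes "prob_curve I m"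
  shows "continuous_on I (\<lambda>t. \<F> (m t))"
  unfolding continuous_on_iff
proof (intro ballI allI impI)
  fix t and e :: real assume te: "t \<in> I" "e > 0"
  have ec: "e / c > 0" using te c_pos by simp
  have "\<forall>t\<in>I. \<forall>e>0. \<exists>d>0. \<forall>s\<in>I. dist s t < d \<longrightarrow> kr_dist (m t) (m s) < e"
    using assms by (simp add: prob_curve_iff)
  with te(1) ec obtain d where d: "d > 0" "\<And>s. s \<in> I \<Longrightarrow> dist s t < d \<Longrightarrow> kr_dist (m t) (m s) < e / c"
    by blast
  show "\<exists>d>0. \<forall>s\<in>I. dist s t < d \<longrightarrow> dist (\<F> (m s)) (\<F> (m t)) < e"
  proof (intro exI[of _ d] conjI ballI impI d(1))
    fix s assume s: "s \<in> I" "dist s t < d"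
    have "\<bar>\<F> (m t) - \<F> (m s)\<bar> \<le> c * kr_dist (m t) (m s)"
      by (intro F_lip prob_curveD[OF assms] te s)
    also have "\<dots> < e" using d(2)[OF s] c_pos by (simp add: field_simps)
    finally show "dist (\<F> (m s)) (\<F> (m t)) < e" by (simp add: dist_real_def abs_minus_commute)
  qed
qed

lemma run_cost_ge:
  assumes "m t \<in> prob_torus"
  shows "- (2 * c) \<le> run_cost m \<alpha> t"
proof -
  interpret prob_space "m t" using prob_torusD[OF assms] by blast
  have "- c \<le> (\<integral>x. lag x (\<alpha> t x) \<partial>m t)"
  proof (cases "integrable (m t) (\<lambda>x. lag x (\<alpha> t x))")
    case True
    have "(\<integral>x. - c \<partial>m t) \<le> (\<integral>x. lag x (\<alpha> t x) \<partial>m t)"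
      by (rule integral_mono[OF _ True]) (auto simp: l_ge)
    then show ?thesis by (simp add: prob_space)
  qed (use c1 in \<open>simp add: not_integrable_integral_eq\<close>)
  then show ?thesis using F_bound[OF assms] by (simp add: run_cost_def abs_le_iff)
qed

text \<open>
  Quadratic growth makes cost and energy of an admissible pair comparable, so all integrals in the definition
  of the cost converge and can be taken over space-time. The last bound keeps values finite, the one before
  it bounds the energy of nearly optimal controls.
\<close>

lemma admissible_costs:
  assumes w: "weight I w" and a: "(m, \<alpha>) \<in> admissible I w m0"
  shows "integrable (curve I m) (\<lambda>p. w (fst p) * speed2 \<alpha> p)"
    "integrable (curve I m) (\<lambda>p. w (fst p) * lag (snd p) (\<alpha> (fst p) (snd p)))"
    "integrable (lb I) (\<lambda>t. w t * \<F> (m t))"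
    "integrable (lb I) (\<lambda>t. w t * run_cost m \<alpha> t)"
    "cost I w m \<alpha> = (\<integral>t. w t * run_cost m \<alpha> t \<partial>lb I)"
    "cost I w m \<alpha> = (\<integral>p. w (fst p) * lag (snd p) (\<alpha> (fst p) (snd p)) \<partial>curve I m) + (\<integral>t. w t * \<F> (m t) \<partial>lb I)"
    "(\<integral>p. w (fst p) * speed2 \<alpha> p \<partial>curve I m) \<le> c * cost I w m \<alpha> + 2 * c\<^sup>2 * (\<integral>t. w t \<partial>lb I)"
    "cost I w m \<alpha> \<ge> - (2 * c) * (\<integral>t. w t \<partial>lb I)"
proof -
  note W = weightD[OF w]
  have m: "prob_curve I m" and \<alpha>: "(\<lambda>(t, x). \<alpha> t x) \<in> borel_measurable (tx_space I)"
    and e: "(\<integral>\<^sup>+p. ennreal (w (fst p) * speed2 \<alpha> p) \<partial>curve I m) < \<infinity>"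
    using a by (auto simp: admissible_iff[OF w])
  have am: "(\<lambda>p. \<alpha> (fst p) (snd p)) \<in> borel_measurable (tx_space I)"
    using \<alpha> by (simp add: case_prod_beta')
  note cm = curve_measurable[OF W(1,2) m]
  note [measurable] = cm[OF am]
  have wm [measurable]: "(\<lambda>p. w (fst p)) \<in> borel_measurable (curve I m)"
    by (rule cm) (use W(9) in measurable)
  have [measurable]: "(\<lambda>p. snd p) \<in> borel_measurable (curve I m)" by (rule cm) measurable
  show E: "integrable (curve I m) (\<lambda>p. w (fst p) * speed2 \<alpha> p)"
    using e by (intro integrableI_nonneg) (auto simp: W(6))
  note wi = integrable_curve_time[OF W(1,2) m W(7)]
  show L: "integrable (curve I m) (\<lambda>p. w (fst p) * lag (snd p) (\<alpha> (fst p) (snd p)))"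
  proof (rule Bochner_Integration.integrable_bound)
    show "integrable (curve I m) (\<lambda>p. c * w (fst p) + c * (w (fst p) * speed2 \<alpha> p))"
      using E wi by simp
    show "AE p in curve I m. norm (w (fst p) * lag (snd p) (\<alpha> (fst p) (snd p))) \<le> norm (c * w (fst p) + c * (w (fst p) * speed2 \<alpha> p))"
    proof (rule AE_I2)
      fix p
      have "norm (w (fst p) * lag (snd p) (\<alpha> (fst p) (snd p))) \<le> w (fst p) * (c * (1 + speed2 \<alpha> p))"
        using W(6) l_abs by (simp add: abs_mult mult_left_mono)
      then show "norm (w (fst p) * lag (snd p) (\<alpha> (fst p) (snd p))) \<le> norm (c * w (fst p) + c * (w (fst p) * speed2 \<alpha> p))"
        by (simp add: algebra_simps)
    qed
  qed measurable
  have Fm: "(\<lambda>t. \<F> (m t)) \<in> borel_measurable (lb I)"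
    by (rule lb_measurable[OF borel_measurable_continuous_on_restrict[OF F_continuous[OF m]]])
  show F: "integrable (lb I) (\<lambda>t. w t * \<F> (m t))"
  proof (rule Bochner_Integration.integrable_bound)
    show "integrable (lb I) (\<lambda>t. c * w t)" using W(7) by simp
    show "(\<lambda>t. w t * \<F> (m t)) \<in> borel_measurable (lb I)" using Fm W(7) by measurable
    show "AE t in lb I. norm (w t * \<F> (m t)) \<le> norm (c * w t)"
    proof (rule AE_I2)
      fix t assume "t \<in> space (lb I)"
      then have "\<bar>\<F> (m t)\<bar> \<le> c" using F_bound[OF prob_curveD[OF m]] by simp
      then show "norm (w t * \<F> (m t)) \<le> norm (c * w t)"
        using W(6)[of t] c1 mult_left_mono[of "\<bar>\<F> (m t)\<bar>" c "w t"] by (simp add: abs_mult mult.commute)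
    qed
  qed
  note ic = integral_curve[OF W(1,2) m L]
  have eq: "(\<lambda>t. (\<integral>x. w t * lag x (\<alpha> t x) \<partial>m t) + w t * \<F> (m t)) = (\<lambda>t. w t * run_cost m \<alpha> t)"
    by (simp add: run_cost_def distrib_left)
  have i1: "integrable (lb I) (\<lambda>t. (\<integral>x. w t * lag x (\<alpha> t x) \<partial>m t) + w t * \<F> (m t))"
    by (rule Bochner_Integration.integrable_add[OF _ F]) (use ic(1) in simp)
  then show i2: "integrable (lb I) (\<lambda>t. w t * run_cost m \<alpha> t)" by (simp only: eq)
  show c1': "cost I w m \<alpha> = (\<integral>t. w t * run_cost m \<alpha> t \<partial>lb I)"
    by (simp add: cost_def LINT_lb[OF W(1)])
  have "(\<integral>t. w t * run_cost m \<alpha> t \<partial>lb I) = (\<integral>t. (\<integral>x. w t * lag x (\<alpha> t x) \<partial>m t) + w t * \<F> (m t) \<partial>lb I)"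
    by (simp only: eq)
  also have "\<dots> = (\<integral>t. (\<integral>x. w t * lag x (\<alpha> t x) \<partial>m t) \<partial>lb I) + (\<integral>t. w t * \<F> (m t) \<partial>lb I)"
    by (rule Bochner_Integration.integral_add[OF _ F]) (use ic(1) in simp)
  finally show c2: "cost I w m \<alpha> = (\<integral>p. w (fst p) * lag (snd p) (\<alpha> (fst p) (snd p)) \<partial>curve I m) + (\<integral>t. w t * \<F> (m t) \<partial>lb I)"
    using ic(2) c1' by simp
  have "(\<integral>p. (1/c) * (w (fst p) * speed2 \<alpha> p) - c * w (fst p) \<partial>curve I m) \<le> (\<integral>p. w (fst p) * lag (snd p) (\<alpha> (fst p) (snd p)) \<partial>curve I m)"
  proof (rule integral_mono)
    show "integrable (curve I m) (\<lambda>p. (1/c) * (w (fst p) * speed2 \<alpha> p) - c * w (fst p))"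
      using E wi by simp
    fix p
    show "(1/c) * (w (fst p) * speed2 \<alpha> p) - c * w (fst p) \<le> w (fst p) * lag (snd p) (\<alpha> (fst p) (snd p))"
      using mult_left_mono[OF l_lower[of "\<alpha> (fst p) (snd p)" "snd p"] W(6)[of "fst p"]] by (simp add: algebra_simps)
  qed (rule L)
  then have l1: "(1/c) * (\<integral>p. w (fst p) * speed2 \<alpha> p \<partial>curve I m) - c * (\<integral>t. w t \<partial>lb I) \<le> (\<integral>p. w (fst p) * lag (snd p) (\<alpha> (fst p) (snd p)) \<partial>curve I m)"
    using E wi by simp
  have "(\<integral>t. - c * w t \<partial>lb I) \<le> (\<integral>t. w t * \<F> (m t) \<partial>lb I)"
  proof (rule integral_mono[OF _ F])
    fix t assume "t \<in> space (lb I)"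
    then have "\<bar>\<F> (m t)\<bar> \<le> c" using F_bound[OF prob_curveD[OF m]] by simp
    then have "- c \<le> \<F> (m t)" by simp
    then show "- c * w t \<le> w t * \<F> (m t)" using mult_left_mono[OF _ W(6)[of t], of "-c" "\<F> (m t)"] by (simp add: mult.commute)
  qed (use W(7) in simp)
  then have l2: "- c * (\<integral>t. w t \<partial>lb I) \<le> (\<integral>t. w t * \<F> (m t) \<partial>lb I)" by simp
  have l3: "(1/c) * (\<integral>p. w (fst p) * speed2 \<alpha> p \<partial>curve I m) \<le> cost I w m \<alpha> + 2 * c * (\<integral>t. w t \<partial>lb I)"
    using l1 l2 c2 by linarith
  from mult_left_mono[OF this, of c] show "(\<integral>p. w (fst p) * speed2 \<alpha> p \<partial>curve I m) \<le> c * cost I w m \<alpha> + 2 * c\<^sup>2 * (\<integral>t. w t \<partial>lb I)"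
    using c_pos by (simp add: algebra_simps power2_eq_square)
  have "0 \<le> (1/c) * (\<integral>p. w (fst p) * speed2 \<alpha> p \<partial>curve I m)"
    using c_pos W(6) by (intro mult_nonneg_nonneg integral_nonneg) auto
  then show "cost I w m \<alpha> \<ge> - (2 * c) * (\<integral>t. w t \<partial>lb I)" using l3 by linarith
qed

end

section \<open>Boundary terms of the Fokker-Planck equation\<close>

definition fp_int :: "(real \<Rightarrow> 'n::finite torus \<Rightarrow> real) \<Rightarrow> (real \<Rightarrow> 'n torus measure) \<Rightarrow> (real \<Rightarrow> 'n torus \<Rightarrow> real^'n) \<Rightarrow> real \<Rightarrow> real" where
  "fp_int \<phi> m \<alpha> t = (\<integral>x. fp_gen \<phi> t x - \<alpha> t x \<bullet> torus_grad (\<phi> t) x \<partial>m t)"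

text \<open>
  Admissibility without the equation and the initial condition.
\<close>

definition controlled :: "real set \<Rightarrow> (real \<Rightarrow> real) \<Rightarrow> (real \<Rightarrow> 'n::finite torus measure) \<Rightarrow> (real \<Rightarrow> 'n torus \<Rightarrow> real^'n) \<Rightarrow> bool" where
  "controlled I w m \<alpha> \<longleftrightarrow> weight I w \<and> prob_curve I m \<and> (\<lambda>(t, x). \<alpha> t x) \<in> borel_measurable (tx_space I) \<and>
     (\<integral>\<^sup>+p. ennreal (w (fst p) * speed2 \<alpha> p) \<partial>curve I m) < \<infinity>"

lemma admissible_controlled:
  assumes "weight I w"
  shows "(m, \<alpha>) \<in> admissible I w m0 \<longleftrightarrow> controlled I w m \<alpha> \<and>
    (\<forall>\<phi>. test_fn I \<phi> \<longrightarrow> (\<integral>t. fp_int \<phi> m \<alpha> t \<partial>lb I) = 0) \<and> m 0 = m0"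
  using weightD(1)[OF assms] assms
  by (auto simp: admissible_iff controlled_def fokker_planck_iff fp_int_def LINT_lb)

context
  fixes I w and m :: "real \<Rightarrow> 'n::finite torus measure" and \<alpha> and \<phi> :: "real \<Rightarrow> 'n torus \<Rightarrow> real" and K
  assumes ctl: "controlled I w m \<alpha>" and sm: "smooth_tx \<phi>" and K: "supported_in \<phi> K" "compact K"
begin

lemma ctl_facts: "weight I w" "prob_curve I m" "(\<lambda>(t, x). \<alpha> t x) \<in> borel_measurable (tx_space I)"
     "(\<integral>\<^sup>+p. ennreal (w (fst p) * speed2 \<alpha> p) \<partial>curve I m) < \<infinity>"
  using ctl by (auto simp: controlled_def)

lemma fp_int_integrable: "integrable (lb I) (fp_int \<phi> m \<alpha>)"
  using integral_curve(1)[OF weightD(1,2)[OF ctl_facts(1)] ctl_facts(2) fp_integrable_curve[OF ctl_facts sm K]]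
  by (simp add: fp_int_def[abs_def])

lemma pairing_continuous: "continuous_on I (\<lambda>t. \<integral>x. \<phi> t x \<partial>m t)"
proof -
  obtain B where B: "0 \<le> B" "\<And>t s x y. \<bar>\<phi> t x - \<phi> s y\<bar> \<le> B * (\<bar>t - s\<bar> + dist x y)"
    by (rule test_bounded[OF sm K], rule that) auto
  have xl: "\<bar>\<phi> t x - \<phi> t y\<bar> \<le> B * dist x y" for t x y using B(2)[of t x t y] by simp
  have ii: "integrable (m s) (\<phi> t)" if "s \<in> I" for s t
  proof -
    have "\<bar>B\<bar>-lipschitz_on UNIV (\<phi> t)"
      using xl[of t] B(1) by (intro lipschitz_onI) (auto simp: dist_real_def)
    then show ?thesis using lipschitz_integrable[OF prob_curveD[OF ctl_facts(2) that]] by blast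
  qed
  show ?thesis
    unfolding continuous_on_iff
  proof (intro ballI allI impI)
    fix t and e :: real assume te: "t \<in> I" "e > 0"
    have c: "continuous_on I (\<lambda>s. \<integral>x. \<phi> t x \<partial>m s)"
      by (rule prob_curve_integral_continuous[OF ctl_facts(2) xl B(1)])
    have "e / 2 > 0" using te by simp
    then obtain d where d: "d > 0" "\<And>s. s \<in> I \<Longrightarrow> dist s t < d \<Longrightarrow> dist (\<integral>x. \<phi> t x \<partial>m s) (\<integral>x. \<phi> t x \<partial>m t) < e / 2"
      using c te(1) unfolding continuous_on_iff by blast
    define d' where "d' = min d (e / (2 * (B + 1)))"
    have "d' > 0" using d te B by (simp add: d'_def)
    moreover have "dist (\<integral>x. \<phi> s x \<partial>m s) (\<integral>x. \<phi> t x \<partial>m t) < e" if s: "s \<in> I" "dist s t < d'" for s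
    proof -
      interpret prob_space "m s" using prob_torusD[OF prob_curveD[OF ctl_facts(2) s(1)]] by blast
      have "\<bar>(\<integral>x. \<phi> s x \<partial>m s) - (\<integral>x. \<phi> t x \<partial>m s)\<bar> = \<bar>\<integral>x. \<phi> s x - \<phi> t x \<partial>m s\<bar>"
        using ii[OF s(1)] by simp
      also have "\<dots> \<le> (\<integral>x. \<bar>\<phi> s x - \<phi> t x\<bar> \<partial>m s)" by (rule integral_abs_bound)
      also have "\<dots> \<le> (\<integral>x. B * \<bar>s - t\<bar> \<partial>m s)"
        using ii[OF s(1)] B(2)[of s _ t] by (intro integral_mono) (auto, metis add.right_neutral dist_self)
      also have "\<dots> = B * \<bar>s - t\<bar>" by (simp add: prob_space)
      also have "\<dots> \<le> (B + 1) * \<bar>s - t\<bar>" by (intro mult_right_mono) auto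
      also have "\<dots> < (B + 1) * (e / (2 * (B + 1)))"
        using s(2) B(1) by (intro mult_strict_left_mono) (auto simp: d'_def dist_real_def)
      also have "\<dots> = e / 2" using B(1) by (simp add: field_simps)
      finally have 1: "\<bar>(\<integral>x. \<phi> s x \<partial>m s) - (\<integral>x. \<phi> t x \<partial>m s)\<bar> < e / 2" .
      have "\<bar>(\<integral>x. \<phi> t x \<partial>m s) - (\<integral>x. \<phi> t x \<partial>m t)\<bar> < e / 2"
        using d(2)[OF s(1)] s(2) by (simp add: dist_real_def d'_def)
      then show ?thesis using 1 unfolding dist_real_def by linarith
    qed
    ultimately show "\<exists>d>0. \<forall>s\<in>I. dist s t < d \<longrightarrow> dist (\<integral>x. \<phi> s x \<partial>m s) (\<integral>x. \<phi> t x \<partial>m t) < e" by blast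
  qed
qed

text \<open>
  A function \<open>\<phi>\<close> that does not vanish at the ends of \<open>I\<close> is not a test function, but \<open>\<theta> \<phi>\<close> is one when \<open>\<theta>\<close> cuts
  off near the ends. The two integrals are the interior part and the emerging boundary term.
\<close>

lemma cutoff_identity:
  assumes fp: "\<And>\<phi>. test_fn I \<phi> \<Longrightarrow> (\<integral>t. fp_int \<phi> m \<alpha> t \<partial>lb I) = 0"
    and \<theta>: "smooth \<theta>" "\<And>t. (\<theta> has_real_derivative \<eta> t) (at t)" "\<And>t. \<bar>\<theta> t\<bar> \<le> 1"
    and T: "test_fn I (\<lambda>t x. \<theta> t * \<phi> t x)"
  shows "integrable (lb I) (\<lambda>t. \<theta> t * fp_int \<phi> m \<alpha> t)" "integrable (lb I) (\<lambda>t. \<eta> t * (\<integral>x. \<phi> t x \<partial>m t))"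
    "(\<integral>t. \<theta> t * fp_int \<phi> m \<alpha> t \<partial>lb I) + (\<integral>t. \<eta> t * (\<integral>x. \<phi> t x \<partial>m t) \<partial>lb I) = 0"
proof -
  note W = weightD[OF ctl_facts(1)]
  let ?\<phi> = "\<lambda>t x. \<theta> t * \<phi> t x"
  let ?f = "\<lambda>p. fp_along \<phi> \<alpha> p"
  let ?g = "\<lambda>p. fp_gen ?\<phi> (fst p) (snd p) - \<alpha> (fst p) (snd p) \<bullet> torus_grad (?\<phi> (fst p)) (snd p)"
  have s': "supported_in ?\<phi> K" using K by (auto simp: supported_in_def)
  note sm' = smooth_tx_cutoff[OF sm \<theta>(1)]
  have f: "integrable (curve I m) ?f" by (rule fp_integrable_curve[OF ctl_facts sm K])
  have g: "integrable (curve I m) ?g" by (rule fp_integrable_curve[OF ctl_facts sm' s' K(2)])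
  have gf: "?g p = \<theta> (fst p) * ?f p + \<eta> (fst p) * \<phi> (fst p) (snd p)" for p
    unfolding cutoff_ops[OF sm \<theta>(1) \<theta>(2)] by (simp add: algebra_simps)
  have \<theta>m: "\<theta> \<in> borel_measurable borel" using smoothD(3)[OF \<theta>(1)] by (rule borel_measurable_continuous_onI)
  have [measurable]: "(\<lambda>p. \<theta> (fst p)) \<in> borel_measurable (curve I m)"
    by (rule curve_measurable[OF W(1,2) ctl_facts(2)]) (use measurable_restrict_space1[OF \<theta>m] in measurable)
  have \<theta>f: "integrable (curve I m) (\<lambda>p. \<theta> (fst p) * ?f p)"
  proof (rule Bochner_Integration.integrable_bound[OF f])
    show "(\<lambda>p. \<theta> (fst p) * ?f p) \<in> borel_measurable (curve I m)"
      using borel_measurable_integrable[OF f] by measurable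
    have "norm (\<theta> (fst p) * ?f p) \<le> norm (?f p)" for p
      unfolding norm_mult using \<theta>(3)[of "fst p"] mult_right_mono[of "\<bar>\<theta> (fst p)\<bar>" 1 "norm (?f p)"] by simp
    then show "AE p in curve I m. norm (\<theta> (fst p) * ?f p) \<le> norm (?f p)" by simp
  qed
  have \<eta>\<phi>: "integrable (curve I m) (\<lambda>p. \<eta> (fst p) * \<phi> (fst p) (snd p))"
  proof -
    have "integrable (curve I m) (\<lambda>p. ?g p - \<theta> (fst p) * ?f p)"
      by (rule Bochner_Integration.integrable_diff[OF g \<theta>f])
    then show ?thesis unfolding gf by simp
  qed
  note c1 = integral_curve[OF W(1,2) ctl_facts(2) \<theta>f] and c2 = integral_curve[OF W(1,2) ctl_facts(2) \<eta>\<phi>]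
    and c3 = integral_curve[OF W(1,2) ctl_facts(2) g]
  show "integrable (lb I) (\<lambda>t. \<theta> t * fp_int \<phi> m \<alpha> t)" using c1(1) by (simp add: fp_int_def)
  show "integrable (lb I) (\<lambda>t. \<eta> t * (\<integral>x. \<phi> t x \<partial>m t))" using c2(1) by simp
  have "0 = (\<integral>p. ?g p \<partial>curve I m)" using fp[OF T] c3(2) by (simp add: fp_int_def)
  also have "\<dots> = (\<integral>p. \<theta> (fst p) * ?f p \<partial>curve I m) + (\<integral>p. \<eta> (fst p) * \<phi> (fst p) (snd p) \<partial>curve I m)"
    unfolding gf by (rule Bochner_Integration.integral_add[OF \<theta>f \<eta>\<phi>])
  finally show "(\<integral>t. \<theta> t * fp_int \<phi> m \<alpha> t \<partial>lb I) + (\<integral>t. \<eta> t * (\<integral>x. \<phi> t x \<partial>m t) \<partial>lb I) = 0"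
    unfolding c1(2) c2(2) by (simp add: fp_int_def)
qed

text \<open>
  \<open>\<eta>\<close> is a probability density on \<open>[p, q]\<close>, so its average of \<open>f\<close> stays as close to \<open>v\<close> as \<open>f\<close> does.
\<close>

lemma bump_average:
  fixes f :: "real \<Rightarrow> real"
  assumes pq: "p \<le> q" "{p..q} \<subseteq> I" and W: "I \<in> sets borel" and z: "\<And>t. t \<notin> {p..q} \<Longrightarrow> \<eta> t = 0"
    and \<eta>: "\<And>t. (\<theta> has_real_derivative \<eta> t) (at t)" "continuous_on UNIV \<eta>" "\<And>t. 0 \<le> \<eta> t" "\<theta> q - \<theta> p = 1"
    and f: "\<And>t. t \<in> {p..q} \<Longrightarrow> \<bar>f t - v\<bar> \<le> e" and i: "integrable (lb I) (\<lambda>t. \<eta> t * f t)"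
  shows "\<bar>(\<integral>t. \<eta> t * f t \<partial>lb I) - v\<bar> \<le> e"
proof -
  have isc: "isCont \<eta> t" for t using \<eta>(2) by (simp add: continuous_on_eq_continuous_at)
  have "has_bochner_integral lborel (\<lambda>t. \<eta> t * indicator {p..q} t) (\<theta> q - \<theta> p)"
    by (rule has_bochner_integral_FTC_Icc_real[OF pq(1)]) (use \<eta> isc in auto)
  moreover have "(\<lambda>t. \<eta> t * indicator {p..q} t) = \<eta>"
  proof
    fix t show "\<eta> t * indicator {p..q} t = \<eta> t" using z[of t] by (cases "t \<in> {p..q}") auto
  qed
  ultimately have hb: "has_bochner_integral lborel \<eta> 1" using \<eta>(4) by simp
  have ind: "(\<lambda>t. indicator I t * \<eta> t) = \<eta>"
  proof
    fix t show "indicator I t * \<eta> t = \<eta> t"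
      using z[of t] pq(2) by (cases "t \<in> I") (auto simp: subset_iff)
  qed
  have i1: "integrable (lb I) \<eta>" and v1: "(\<integral>t. \<eta> t \<partial>lb I) = 1"
    using hb W by (simp_all add: integrable_restrict_space integral_restrict_space ind has_bochner_integral_iff)
  have i2: "integrable (lb I) (\<lambda>t. \<eta> t * (f t - v))"
    using i i1 by (simp add: algebra_simps)
  have "(\<integral>t. \<eta> t * f t \<partial>lb I) - v = (\<integral>t. \<eta> t * f t \<partial>lb I) - (\<integral>t. \<eta> t * v \<partial>lb I)" using v1 by simp
  also have "\<dots> = (\<integral>t. \<eta> t * (f t - v) \<partial>lb I)"
    using i i1 by (simp add: right_diff_distrib)
  also have "\<bar>\<dots>\<bar> \<le> (\<integral>t. \<bar>\<eta> t * (f t - v)\<bar> \<partial>lb I)" by (rule integral_abs_bound)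
  also have "\<dots> \<le> (\<integral>t. \<eta> t * e \<partial>lb I)"
  proof (rule integral_mono)
    show "\<bar>\<eta> t * (f t - v)\<bar> \<le> \<eta> t * e" for t
      using f[of t] z[of t] \<eta>(3)[of t] by (cases "t \<in> {p..q}") (auto simp: abs_mult intro!: mult_left_mono)
  qed (use i1 i2 in auto)
  finally show ?thesis using v1 by simp
qed

text \<open>
  Distributional solutions know nothing about the ends of the time interval. Cutting off on \<open>[p\<^sub>k, q\<^sub>k]\<close> with
  \<open>p\<^sub>k, q\<^sub>k \<rightarrow> a\<close> and using continuity of the curve recovers the boundary value.
\<close>

lemma fp_right_end:
  assumes fp: "\<And>\<phi>. test_fn I \<phi> \<Longrightarrow> (\<integral>t. fp_int \<phi> m \<alpha> t \<partial>lb I) = 0"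
    and I: "I = {0..a}" "0 < a" and K0: "K \<subseteq> {0<..}"
  shows "(\<integral>t. fp_int \<phi> m \<alpha> t \<partial>lb I) = (\<integral>x. \<phi> a x \<partial>m a)"
proof -
  note W = weightD[OF ctl_facts(1)]
  define c where "c t = (\<integral>x. \<phi> t x \<partial>m t)" for t
  let ?b = "fp_int \<phi> m \<alpha>"
  have cc: "continuous_on I c" unfolding c_def by (rule pairing_continuous)
  define p where "p k = a - a / (real k + 2)" for k :: nat
  define q where "q k = a - a / (real k + 3)" for k :: nat
  have pq: "0 < p k" "p k < q k" "q k < a" for k
    using I by (auto simp: p_def q_def field_simps intro!: add_pos_nonneg)
  have plim: "p \<longlonglongrightarrow> a"
    unfolding p_def by real_asymp
  obtain \<theta> \<eta> :: "nat \<Rightarrow> real \<Rightarrow> real" where \<theta>: "\<And>k. smooth (\<theta> k)" "\<And>k t. (\<theta> k has_real_derivative \<eta> k t) (at t)"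
    "\<And>k. continuous_on UNIV (\<eta> k)" "\<And>k t. 0 \<le> \<eta> k t" "\<And>k t. t \<notin> {p k..q k} \<Longrightarrow> \<eta> k t = 0"
    "\<And>k t. t \<le> p k \<Longrightarrow> \<theta> k t = 0" "\<And>k t. t \<ge> q k \<Longrightarrow> \<theta> k t = 1" "\<And>k t. 0 \<le> \<theta> k t" "\<And>k t. \<theta> k t \<le> 1"
    by (rule smooth_step_sequence[of p q, OF pq(2)]) (rule that)
  \<comment> \<open>The complement of a step, written so that it is visibly smooth.\<close>
  define \<theta>' where "\<theta>' k t = 1 + (-1) * \<theta> k t" for k t
  have T: "test_fn I (\<lambda>t x. \<theta>' k t * \<phi> t x)" for k
    unfolding test_fn_def
  proof (intro conjI exI[of _ "K \<inter> {..q k}"])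
    have "smooth (\<theta>' k)" unfolding \<theta>'_def by (intro smooth_add smooth_mult smooth_const \<theta>)
    then show "smooth_tx (\<lambda>t x. \<theta>' k t * \<phi> t x)" by (rule smooth_tx_cutoff[OF sm])
    show "compact (K \<inter> {..q k})" using K(2) by (simp add: compact_Int_closed)
    show "K \<inter> {..q k} \<subseteq> interior I" using K0 pq(3)[of k] by (auto simp: I)
    show "supported_in (\<lambda>t x. \<theta>' k t * \<phi> t x) (K \<inter> {..q k})"
      using K(1) \<theta>(7)[of k] unfolding supported_in_def \<theta>'_def by fastforce
  qed
  have sm': "smooth (\<theta>' k)" "(\<theta>' k has_real_derivative (- \<eta> k t)) (at t)" "\<bar>\<theta>' k t\<bar> \<le> 1" for k t
    unfolding \<theta>'_def using \<theta>(1,2,8,9)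
    by (intro smooth_add smooth_mult smooth_const, simp, auto intro!: derivative_eq_intros)
  note ci = cutoff_identity[OF fp sm' T]
  have ie: "integrable (lb I) (\<lambda>t. \<eta> k t * c t)" for k using ci(2)[of k] by (simp add: c_def)
  have eq: "(\<integral>t. \<theta>' k t * ?b t \<partial>lb I) = (\<integral>t. \<eta> k t * c t \<partial>lb I)" for k
    using ci(3)[of k] by (simp add: c_def)
  have "(\<lambda>k. \<integral>t. \<eta> k t * c t \<partial>lb I) \<longlonglongrightarrow> c a"
  proof (rule LIMSEQ_I)
    fix e :: real assume e: "e > 0"
    then obtain d where d: "d > 0" "\<And>t. t \<in> I \<Longrightarrow> dist t a < d \<Longrightarrow> dist (c t) (c a) < e / 2"
      using cc[unfolded continuous_on_iff, rule_format, of a "e / 2"] I by auto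
    obtain N where N: "\<And>k. k \<ge> N \<Longrightarrow> dist (p k) a < d"
      using plim d(1) unfolding lim_sequentially by blast
    have "norm ((\<integral>t. \<eta> k t * c t \<partial>lb I) - c a) < e" if "k \<ge> N" for k
    proof -
      have "\<bar>(\<integral>t. \<eta> k t * c t \<partial>lb I) - c a\<bar> \<le> e / 2"
      proof (rule bump_average[where p="p k" and q="q k" and \<theta>="\<theta> k"])
        show "\<bar>c t - c a\<bar> \<le> e / 2" if t: "t \<in> {p k..q k}" for t
        proof -
          have "dist t a < d" "t \<in> I" using t N[OF \<open>k \<ge> N\<close>] pq[of k] I by (auto simp: dist_real_def)
          then show ?thesis using d(2)[of t] by (simp add: dist_real_def)
        qed
      qed (use \<theta> pq[of k] W(1) ie I in auto)
      then show ?thesis using e by simp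
    qed
    then show "\<exists>N. \<forall>k\<ge>N. norm ((\<integral>t. \<eta> k t * c t \<partial>lb I) - c a) < e" by blast
  qed
  moreover have "(\<lambda>k. \<integral>t. \<theta>' k t * ?b t \<partial>lb I) \<longlonglongrightarrow> (\<integral>t. ?b t \<partial>lb I)"
  proof (rule integral_dominated_convergence[where w="\<lambda>t. norm (?b t)"])
    show "?b \<in> borel_measurable (lb I)" using fp_int_integrable by simp
    show "(\<lambda>t. \<theta>' k t * ?b t) \<in> borel_measurable (lb I)" for k using ci(1)[of k] by simp
    show "integrable (lb I) (\<lambda>t. norm (?b t))" using fp_int_integrable by simp
    have "AE t in lb I. t \<noteq> a"
      using AE_lborel_singleton[of a] W(1) by (subst AE_restrict_space_iff) auto
    then show "AE t in lb I. (\<lambda>k. \<theta>' k t * ?b t) \<longlonglongrightarrow> ?b t"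
      using AE_space
    proof eventually_elim
      case (elim t)
      then have "t < a" using I by simp
      then have "eventually (\<lambda>k. t < p k) sequentially" using plim by (rule order_tendstoD(1)[rotated])
      then have "eventually (\<lambda>k. \<theta>' k t * ?b t = ?b t) sequentially"
        by (rule eventually_mono) (simp add: \<theta>(6) \<theta>'_def)
      then show ?case by (rule tendsto_eventually)
    qed
    show "AE t in lb I. norm (\<theta>' k t * ?b t) \<le> norm (?b t)" for k
      using sm'(3)[of k] mult_right_mono[of "\<bar>\<theta>' k _\<bar>" 1] by (intro AE_I2) (simp add: abs_mult mult_left_le_one_le)
  qed
  ultimately show ?thesis using LIMSEQ_unique by (auto simp: eq c_def)
qed

text \<open>
  The interval may be unbounded on the right; \<open>K0\<close> says that \<open>\<phi>\<close> reaches the boundary of \<open>I\<close> only at time \<open>0\<close>.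
\<close>

lemma fp_left_end:
  assumes fp: "\<And>\<phi>. test_fn I \<phi> \<Longrightarrow> (\<integral>t. fp_int \<phi> m \<alpha> t \<partial>lb I) = 0"
    and I: "I \<subseteq> {0..}" "{0..s} \<subseteq> I" "0 < s" and K0: "K \<inter> {0<..} \<subseteq> interior I"
  shows "(\<integral>t. fp_int \<phi> m \<alpha> t \<partial>lb I) = - (\<integral>x. \<phi> 0 x \<partial>m 0)"
proof -
  note W = weightD[OF ctl_facts(1)]
  define c where "c t = (\<integral>x. \<phi> t x \<partial>m t)" for t
  let ?b = "fp_int \<phi> m \<alpha>"
  have cc: "continuous_on I c" unfolding c_def by (rule pairing_continuous)
  define p where "p k = s / (real k + 3)" for k :: nat
  define q where "q k = s / (real k + 2)" for k :: nat
  have pq: "0 < p k" "p k < q k" "q k < s" for k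
    using I by (auto simp: p_def q_def field_simps intro!: add_pos_nonneg)
  have qlim: "q \<longlonglongrightarrow> 0" unfolding q_def by real_asymp
  obtain \<theta> \<eta> :: "nat \<Rightarrow> real \<Rightarrow> real" where \<theta>: "\<And>k. smooth (\<theta> k)" "\<And>k t. (\<theta> k has_real_derivative \<eta> k t) (at t)"
    "\<And>k. continuous_on UNIV (\<eta> k)" "\<And>k t. 0 \<le> \<eta> k t" "\<And>k t. t \<notin> {p k..q k} \<Longrightarrow> \<eta> k t = 0"
    "\<And>k t. t \<le> p k \<Longrightarrow> \<theta> k t = 0" "\<And>k t. t \<ge> q k \<Longrightarrow> \<theta> k t = 1" "\<And>k t. 0 \<le> \<theta> k t" "\<And>k t. \<theta> k t \<le> 1"
    by (rule smooth_step_sequence[of p q, OF pq(2)]) (rule that)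
  have T: "test_fn I (\<lambda>t x. \<theta> k t * \<phi> t x)" for k
    unfolding test_fn_def
  proof (intro conjI exI[of _ "K \<inter> {p k..}"])
    show "smooth_tx (\<lambda>t x. \<theta> k t * \<phi> t x)" by (rule smooth_tx_cutoff[OF sm \<theta>(1)])
    show "compact (K \<inter> {p k..})" using K(2) by (simp add: compact_Int_closed)
    show "K \<inter> {p k..} \<subseteq> interior I" using K0 pq(1)[of k] by force
    show "supported_in (\<lambda>t x. \<theta> k t * \<phi> t x) (K \<inter> {p k..})"
      using K(1) \<theta>(6)[of _ k] unfolding supported_in_def by fastforce
  qed
  have ab: "\<bar>\<theta> k t\<bar> \<le> 1" for k t using \<theta>(8,9)[of k t] by simp
  note ci = cutoff_identity[OF fp \<theta>(1,2) ab T]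
  have ie: "integrable (lb I) (\<lambda>t. \<eta> k t * c t)" for k using ci(2)[of k] by (simp add: c_def)
  have eq: "(\<integral>t. \<theta> k t * ?b t \<partial>lb I) = - (\<integral>t. \<eta> k t * c t \<partial>lb I)" for k
    using ci(3)[of k] by (simp add: c_def)
  have "(\<lambda>k. \<integral>t. \<eta> k t * c t \<partial>lb I) \<longlonglongrightarrow> c 0"
  proof (rule LIMSEQ_I)
    fix e :: real assume e: "e > 0"
    then obtain d where d: "d > 0" "\<And>t. t \<in> I \<Longrightarrow> dist t 0 < d \<Longrightarrow> dist (c t) (c 0) < e / 2"
      using cc[unfolded continuous_on_iff, rule_format, of 0 "e / 2"] W(3) by auto
    obtain N where N: "\<And>k. k \<ge> N \<Longrightarrow> dist (q k) 0 < d"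
      using qlim d(1) unfolding lim_sequentially by blast
    have "norm ((\<integral>t. \<eta> k t * c t \<partial>lb I) - c 0) < e" if "k \<ge> N" for k
    proof -
      have "\<bar>(\<integral>t. \<eta> k t * c t \<partial>lb I) - c 0\<bar> \<le> e / 2"
      proof (rule bump_average[where p="p k" and q="q k" and \<theta>="\<theta> k"])
        show sub: "{p k..q k} \<subseteq> I" using pq[of k] I by auto
        show "\<bar>c t - c 0\<bar> \<le> e / 2" if t: "t \<in> {p k..q k}" for t
        proof -
          have "dist t 0 < d" "t \<in> I" using t N[OF \<open>k \<ge> N\<close>] pq[of k] sub by (auto simp: dist_real_def)
          then show ?thesis using d(2)[of t] by (simp add: dist_real_def)
        qed
      qed (use \<theta> pq[of k] W(1) ie in auto)
      then show ?thesis using e by simp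
    qed
    then show "\<exists>N. \<forall>k\<ge>N. norm ((\<integral>t. \<eta> k t * c t \<partial>lb I) - c 0) < e" by blast
  qed
  then have "(\<lambda>k. - (\<integral>t. \<eta> k t * c t \<partial>lb I)) \<longlonglongrightarrow> - c 0" by (rule tendsto_minus)
  moreover have "(\<lambda>k. \<integral>t. \<theta> k t * ?b t \<partial>lb I) \<longlonglongrightarrow> (\<integral>t. ?b t \<partial>lb I)"
  proof (rule integral_dominated_convergence[where w="\<lambda>t. norm (?b t)"])
    show "?b \<in> borel_measurable (lb I)" using fp_int_integrable by simp
    show "(\<lambda>t. \<theta> k t * ?b t) \<in> borel_measurable (lb I)" for k using ci(1)[of k] by simp
    show "integrable (lb I) (\<lambda>t. norm (?b t))" using fp_int_integrable by simp
    have "AE t in lb I. t \<noteq> 0"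
      using AE_lborel_singleton[of 0] W(1) by (subst AE_restrict_space_iff) auto
    then show "AE t in lb I. (\<lambda>k. \<theta> k t * ?b t) \<longlonglongrightarrow> ?b t"
      using AE_space
    proof eventually_elim
      case (elim t)
      then have "0 < t" using I by force
      then have "eventually (\<lambda>k. q k < t) sequentially" using qlim by (rule order_tendstoD(2)[rotated])
      then have "eventually (\<lambda>k. \<theta> k t * ?b t = ?b t) sequentially"
        by (rule eventually_mono) (simp add: \<theta>(7))
      then show ?case by (rule tendsto_eventually)
    qed
    show "AE t in lb I. norm (\<theta> k t * ?b t) \<le> norm (?b t)" for k
      using ab[of k] \<theta>(8) by (intro AE_I2) (simp add: abs_mult mult_left_le_one_le)
  qed
  ultimately show ?thesis using LIMSEQ_unique by (auto simp: eq c_def)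
qed

end

section \<open>Restriction to a later time window\<close>

lemma lb_ind_measurable:
  fixes f :: "real \<Rightarrow> ennreal"
  assumes "I \<in> sets borel" "f \<in> borel_measurable (lb I)"
  shows "(\<lambda>t. f t * indicator I t) \<in> borel_measurable borel"
proof -
  have "(\<lambda>t. f t * indicator I t) \<in> borel_measurable lborel"
    using assms by (subst borel_measurable_restrict_space_iff_ennreal[symmetric]) auto
  then show ?thesis by simp
qed

lemma nn_lb_shift:
  fixes f :: "real \<Rightarrow> ennreal"
  assumes I: "I \<in> sets borel" and f: "f \<in> borel_measurable (lb ((+) a ` I))"
    and aI: "(+) a ` I \<in> sets borel"
  shows "(\<integral>\<^sup>+t. f t \<partial>lb ((+) a ` I)) = (\<integral>\<^sup>+t. f (a + t) \<partial>lb I)"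
proof -
  have "(\<integral>\<^sup>+t. f t \<partial>lb ((+) a ` I)) = (\<integral>\<^sup>+t. f t * indicator ((+) a ` I) t \<partial>lborel)"
    using aI by (simp add: nn_integral_restrict_space)
  also have "\<dots> = (\<integral>\<^sup>+t. f (a + t) * indicator ((+) a ` I) (a + t) \<partial>lborel)"
    using nn_integral_real_affine[OF lb_ind_measurable[OF aI f], of 1 a] by simp
  also have "\<dots> = (\<integral>\<^sup>+t. f (a + t) * indicator I t \<partial>lborel)"
    by (intro nn_integral_cong) (auto simp: indicator_def)
  also have "\<dots> = (\<integral>\<^sup>+t. f (a + t) \<partial>lb I)"
    using I by (simp add: nn_integral_restrict_space)
  finally show ?thesis .
qed

lemma sets_borel_shift:
  fixes I :: "real set"
  assumes "I \<in> sets borel" shows "(+) a ` I \<in> sets borel"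
proof -
  have "(\<lambda>t. t - a) \<in> borel \<rightarrow>\<^sub>M borel" by measurable
  from measurable_sets[OF this assms] have "(\<lambda>t. t - a) -` I \<inter> space borel \<in> sets borel" .
  moreover have "(\<lambda>t. t - a) -` I \<inter> space borel = (+) a ` I"
    by (auto simp: image_iff intro!: bexI[of _ "_ - a"])
  ultimately show ?thesis by simp
qed

lemma integral_lb_shift:
  fixes f :: "real \<Rightarrow> real"
  assumes I: "I \<in> sets borel"
  shows "(\<integral>t. f t \<partial>lb ((+) a ` I)) = (\<integral>t. f (a + t) \<partial>lb I)"
proof -
  note aI = sets_borel_shift[OF I, of a]
  have "(\<integral>t. f t \<partial>lb ((+) a ` I)) = (\<integral>t. indicator ((+) a ` I) t * f t \<partial>lborel)"
    using aI by (simp add: integral_restrict_space)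
  also have "\<dots> = (\<integral>t. indicator ((+) a ` I) (a + t) * f (a + t) \<partial>lborel)"
    using lborel_integral_real_affine[of 1 "\<lambda>t. indicator ((+) a ` I) t * f t" a] by simp
  also have "\<dots> = (\<integral>t. indicator I t * f (a + t) \<partial>lborel)"
    by (intro Bochner_Integration.integral_cong) (auto simp: indicator_def)
  also have "\<dots> = (\<integral>t. f (a + t) \<partial>lb I)"
    using I by (simp add: integral_restrict_space)
  finally show ?thesis .
qed

lemma integrable_lb_shift:
  fixes f :: "real \<Rightarrow> real"
  assumes I: "I \<in> sets borel"
  shows "integrable (lb ((+) a ` I)) f \<longleftrightarrow> integrable (lb I) (\<lambda>t. f (a + t))"
proof -
  note aI = sets_borel_shift[OF I, of a]
  have "integrable (lb ((+) a ` I)) f \<longleftrightarrow> integrable lborel (\<lambda>t. indicator ((+) a ` I) t * f t)"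
    using aI by (simp add: integrable_restrict_space)
  also have "\<dots> \<longleftrightarrow> integrable lborel (\<lambda>t. indicator ((+) a ` I) (a + t) * f (a + t))"
    using lborel_integrable_real_affine_iff[of 1 "\<lambda>t. indicator ((+) a ` I) t * f t" a] by simp
  also have "(\<lambda>t. indicator ((+) a ` I) (a + t) * f (a + t)) = (\<lambda>t. indicator I t * f (a + t))"
  proof -
    have "a + t \<in> (+) a ` I \<longleftrightarrow> t \<in> I" for t by auto
    then show ?thesis by (simp add: indicator_def)
  qed
  finally show ?thesis using I by (simp add: integrable_restrict_space)
qed

lemma integral_lb_subset:
  fixes f :: "real \<Rightarrow> real"
  assumes "J \<subseteq> I" "J \<in> sets borel" "I \<in> sets borel" "\<And>t. t \<in> I - J \<Longrightarrow> f t = 0"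
  shows "(\<integral>t. f t \<partial>lb I) = (\<integral>t. f t \<partial>lb J)"
proof -
  have "(\<lambda>t. indicator I t * f t) = (\<lambda>t. indicator J t * f t)"
  proof
    fix t show "indicator I t * f t = indicator J t * f t"
      using assms(1) assms(4)[of t] by (cases "t \<in> J"; cases "t \<in> I") auto
  qed
  then show ?thesis using assms by (simp add: integral_restrict_space)
qed

lemma weight_Icc: "0 \<le> T \<Longrightarrow> continuous_on UNIV w \<Longrightarrow> (\<And>t. 0 < w t) \<Longrightarrow> weight {0..T} w"
  unfolding weight_def
  using borel_integrable_atLeastAtMost'[of 0 T w]
  by (auto simp: integrable_restrict_space set_integrable_def intro: continuous_on_subset)

lemma integral_exp_lb:
  assumes "0 < \<delta>"
  shows "integrable (lb {0..}) (\<lambda>t. exp (- \<delta> * t))" "(\<integral>t. exp (- \<delta> * t) \<partial>lb {0..}) = 1 / \<delta>"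
proof -
  have F: "((\<lambda>t. - exp (- \<delta> * t) / \<delta>) has_real_derivative exp (- \<delta> * t)) (at t)" for t
    using assms by (auto intro!: derivative_eq_intros)
  have lim: "((\<lambda>t. - exp (- \<delta> * t) / \<delta>) \<longlongrightarrow> 0) at_top"
    using assms by real_asymp
  have "(\<integral>\<^sup>+t. ennreal (exp (- \<delta> * t) * indicator {0..} t) \<partial>lborel) = (\<integral>\<^sup>+t. ennreal (exp (- \<delta> * t)) * indicator {0..} t \<partial>lborel)"
    by (intro nn_integral_cong) (auto simp: indicator_def)
  also have "\<dots> = ennreal (0 - (- exp (- \<delta> * 0) / \<delta>))"
    by (rule nn_integral_FTC_atLeast[OF _ F _ lim]) auto
  finally have "has_bochner_integral lborel (\<lambda>t. exp (- \<delta> * t) * indicator {0..} t) (0 - (- exp (- \<delta> * 0) / \<delta>))"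
    using assms by (intro has_bochner_integral_nn_integral) auto
  then show "integrable (lb {0..}) (\<lambda>t. exp (- \<delta> * t))" "(\<integral>t. exp (- \<delta> * t) \<partial>lb {0..}) = 1 / \<delta>"
    by (auto simp: integrable_restrict_space integral_restrict_space has_bochner_integral_iff mult.commute)
qed

lemma weight_exp: "0 < \<delta> \<Longrightarrow> weight {0..} (\<lambda>t. exp (- \<delta> * t))"
  using integral_exp_lb by (auto simp: weight_def intro!: continuous_intros)

lemma prob_curve_shift:
  assumes m: "prob_curve I m" and sub: "\<And>t. t \<in> J \<Longrightarrow> a + t \<in> I"
  shows "prob_curve J (\<lambda>t. m (a + t))"
  unfolding prob_curve_iff
proof (intro conjI ballI allI impI)
  fix t and e :: real assume te: "t \<in> J" "e > 0"
  have "\<forall>t\<in>I. \<forall>e>0. \<exists>d>0. \<forall>s\<in>I. dist s t < d \<longrightarrow> kr_dist (m t) (m s) < e"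
    using m by (simp add: prob_curve_iff)
  with sub[OF te(1)] te(2) obtain d where d: "d > 0" "\<forall>s\<in>I. dist s (a + t) < d \<longrightarrow> kr_dist (m (a + t)) (m s) < e"
    by blast
  then show "\<exists>d>0. \<forall>s\<in>J. dist s t < d \<longrightarrow> kr_dist (m (a + t)) (m (a + s)) < e"
    using sub by (intro exI[of _ d]) (auto simp: dist_real_def)
qed (use prob_curveD[OF m sub] in auto)

lemma measurable_time_shift:
  assumes \<alpha>: "(\<lambda>(t, x). \<alpha> t x) \<in> borel_measurable (tx_space I)" and J: "J \<in> sets borel"
    and sub: "\<And>t. t \<in> J \<Longrightarrow> a + t \<in> I"
  shows "(\<lambda>(t, x). \<alpha> (a + t) x) \<in> borel_measurable (tx_space J)"
proof -
  have "(\<lambda>t. a + t) \<in> restrict_space borel J \<rightarrow>\<^sub>M restrict_space borel I"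
    by (rule measurable_restrict_space3) (use sub in auto)
  then have "(\<lambda>p. (a + fst p, snd p)) \<in> tx_space J \<rightarrow>\<^sub>M tx_space I" by measurable
  from measurable_compose[OF this \<alpha>] show ?thesis by (simp add: case_prod_beta')
qed

lemma interior_shift_subset:
  fixes K :: "real set"
  assumes K: "K \<subseteq> interior J" and sub: "\<And>t. t \<in> J \<Longrightarrow> a + t \<in> I"
  shows "(+) a ` K \<subseteq> interior I"
proof -
  have "open ((+) a ` interior J)" by (simp add: open_translation)
  moreover have "(+) a ` interior J \<subseteq> I" using sub interior_subset by blast
  ultimately have "(+) a ` interior J \<subseteq> interior I" by (simp add: interior_maximal)
  then show ?thesis using K by blast
qed

text \<open>
  A tail of a trajectory is a trajectory: a test function on \<open>J\<close>, extended by zero and translated, is one on \<open>I\<close>.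
  The constant \<open>C\<close> allows the weight to change, which moves freely between constant and discounted weights.
\<close>

lemma admissible_shift:
  fixes m :: "real \<Rightarrow> 'n::finite torus measure"
  assumes w: "weight I w" and w': "weight J w'" and a: "(m, \<alpha>) \<in> admissible I w m0"
    and sub: "\<And>t. t \<in> J \<Longrightarrow> a + t \<in> I" and C: "\<And>t. t \<in> J \<Longrightarrow> w' t \<le> C * w (a + t)"
  shows "(\<lambda>t. m (a + t), \<lambda>t. \<alpha> (a + t)) \<in> admissible J w' (m a)"
proof -
  note W = weightD[OF w] and W' = weightD[OF w']
  have ctl: "controlled I w m \<alpha>" and fp: "\<And>\<phi>. test_fn I \<phi> \<Longrightarrow> (\<integral>t. fp_int \<phi> m \<alpha> t \<partial>lb I) = 0"
    using a by (auto simp: admissible_controlled[OF w])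
  have m: "prob_curve I m" and \<alpha>: "(\<lambda>(t, x). \<alpha> t x) \<in> borel_measurable (tx_space I)"
    and e: "(\<integral>\<^sup>+p. ennreal (w (fst p) * speed2 \<alpha> p) \<partial>curve I m) < \<infinity>"
    using ctl by (auto simp: controlled_def)
  let ?J = "(+) a ` J"
  note aJ = sets_borel_shift[OF W'(1), of a]
  have JI: "?J \<subseteq> I" using sub by auto
  note m' = prob_curve_shift[OF m sub]
  note \<alpha>' = measurable_time_shift[OF \<alpha> W'(1) sub]
  have [measurable]: "(\<lambda>p. \<alpha> (fst p) (snd p)) \<in> borel_measurable (tx_space I)" "(\<lambda>p. \<alpha> (a + fst p) (snd p)) \<in> borel_measurable (tx_space J)"
    using \<alpha> \<alpha>' by (auto simp: case_prod_beta')
  note [measurable] = W(9) W'(9)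
  have em: "(\<lambda>p. ennreal (w (fst p) * speed2 \<alpha> p)) \<in> borel_measurable (tx_space I)" by measurable
  have em': "(\<lambda>p. ennreal (w' (fst p) * (norm (\<alpha> (a + fst p) (snd p)))\<^sup>2)) \<in> borel_measurable (tx_space J)" by measurable
  have C0: "0 \<le> C"
  proof -
    have "0 < C * w (a + 0)" using C[OF W'(3)] W'(5)[of 0] by linarith
    then show ?thesis using W(5)[of "a + 0"] by (simp add: zero_less_mult_iff)
  qed
  define E where "E s = (\<integral>\<^sup>+x. ennreal (w s * (norm (\<alpha> s x))\<^sup>2) \<partial>m s)" for s
  have Em: "E \<in> borel_measurable (lb I)" using inner_nn_measurable[OF W(1,2) m em] by (simp add: E_def[abs_def])
  have Em': "E \<in> borel_measurable (lb ?J)"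
  proof -
    have "E \<in> borel_measurable (restrict_space (lb I) ?J)" by (rule measurable_restrict_space1[OF Em])
    then show ?thesis using JI by (simp add: restrict_restrict_space inf.absorb2 W(1) aJ)
  qed
  have "(\<integral>\<^sup>+p. ennreal (w' (fst p) * (norm (\<alpha> (a + fst p) (snd p)))\<^sup>2) \<partial>curve J (\<lambda>t. m (a + t)))
     = (\<integral>\<^sup>+t. \<integral>\<^sup>+x. ennreal (w' t * (norm (\<alpha> (a + t) x))\<^sup>2) \<partial>m (a + t) \<partial>lb J)"
    by (simp add: nn_integral_curve[OF W'(1,2) m' em'])
  also have "\<dots> \<le> (\<integral>\<^sup>+t. ennreal C * E (a + t) \<partial>lb J)"
  proof (rule nn_integral_mono)
    fix t assume t: "t \<in> space (lb J)"
    then have tI: "a + t \<in> I" using sub by simp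
    have [measurable]: "(\<lambda>x. \<alpha> (a + t) x) \<in> borel_measurable (m (a + t))"
      using slice_measurable[OF W(1,2) m \<alpha> tI] by simp
    have "(\<integral>\<^sup>+x. ennreal (w' t * (norm (\<alpha> (a + t) x))\<^sup>2) \<partial>m (a + t)) \<le> (\<integral>\<^sup>+x. ennreal C * ennreal (w (a + t) * (norm (\<alpha> (a + t) x))\<^sup>2) \<partial>m (a + t))"
    proof (rule nn_integral_mono)
      fix x
      have "w' t * (norm (\<alpha> (a + t) x))\<^sup>2 \<le> (C * w (a + t)) * (norm (\<alpha> (a + t) x))\<^sup>2"
        using C t by (intro mult_right_mono) auto
      then show "ennreal (w' t * (norm (\<alpha> (a + t) x))\<^sup>2) \<le> ennreal C * ennreal (w (a + t) * (norm (\<alpha> (a + t) x))\<^sup>2)"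
        using C0 by (simp flip: ennreal_mult' add: mult.assoc ennreal_leI)
    qed
    also have "\<dots> = ennreal C * E (a + t)"
      unfolding E_def by (rule nn_integral_cmult) measurable
    finally show "(\<integral>\<^sup>+x. ennreal (w' t * (norm (\<alpha> (a + t) x))\<^sup>2) \<partial>m (a + t)) \<le> ennreal C * E (a + t)" .
  qed
  also have "\<dots> = (\<integral>\<^sup>+s. ennreal C * E s \<partial>lb ?J)"
    using nn_lb_shift[OF W'(1) _ aJ, of "\<lambda>s. ennreal C * E s"] Em' by simp
  also have "\<dots> = ennreal C * (\<integral>\<^sup>+s. E s \<partial>lb ?J)" using Em' by (rule nn_integral_cmult)
  also have "\<dots> \<le> ennreal C * (\<integral>\<^sup>+s. E s \<partial>lb I)"
  proof (rule mult_left_mono)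
    have "E s * indicator ?J s \<le> E s * indicator I s" for s
      using JI by (intro mult_left_mono) (auto simp: indicator_def)
    then show "(\<integral>\<^sup>+s. E s \<partial>lb ?J) \<le> (\<integral>\<^sup>+s. E s \<partial>lb I)"
      using W(1) aJ by (simp add: nn_integral_restrict_space nn_integral_mono)
  qed simp
  also have "\<dots> < \<infinity>"
    using e C0 by (simp add: nn_integral_curve[OF W(1,2) m em] E_def ennreal_mult_less_top)
  finally have e': "(\<integral>\<^sup>+p. ennreal (w' (fst p) * (norm (\<alpha> (a + fst p) (snd p)))\<^sup>2) \<partial>curve J (\<lambda>t. m (a + t))) < \<infinity>" .
  have fp': "(\<integral>t. fp_int \<phi> (\<lambda>t. m (a + t)) (\<lambda>t. \<alpha> (a + t)) t \<partial>lb J) = 0" if \<phi>: "test_fn J \<phi>" for \<phi>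
  proof -
    obtain K where sm: "smooth_tx \<phi>" and K: "compact K" "K \<subseteq> interior J" "supported_in \<phi> K"
      using \<phi> by (auto simp: test_fn_def)
    let ?\<phi> = "\<lambda>t. \<phi> (t + (- a))"
    have sm': "smooth_tx ?\<phi>" by (rule smooth_tx_time_shift[OF sm])
    have supp: "supported_in ?\<phi> ((+) a ` K)"
      using K(3) unfolding supported_in_def by (force simp: image_iff)
    have cK: "compact ((+) a ` K)" using K(1) by (rule compact_translation)
    have T: "test_fn I ?\<phi>"
      unfolding test_fn_def using sm' supp cK interior_shift_subset[OF K(2) sub] by blast
    have KJ: "(+) a ` K \<subseteq> ?J" using K(2) interior_subset[of J] by blast
    have "0 = (\<integral>t. fp_int ?\<phi> m \<alpha> t \<partial>lb I)" using fp[OF T] by simp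
    also have "\<dots> = (\<integral>t. fp_int ?\<phi> m \<alpha> t \<partial>lb ?J)"
    proof (rule integral_lb_subset[OF JI aJ W(1)])
      fix t assume "t \<in> I - ?J"
      then have "t \<notin> (+) a ` K" using KJ by blast
      from fp_gen_eq_0[OF sm' supp compact_imp_closed[OF cK] this]
      show "fp_int ?\<phi> m \<alpha> t = 0" by (simp add: fp_int_def)
    qed
    also have "\<dots> = (\<integral>t. fp_int ?\<phi> m \<alpha> (a + t) \<partial>lb J)" by (rule integral_lb_shift[OF W'(1)])
    also have "\<dots> = (\<integral>t. fp_int \<phi> (\<lambda>t. m (a + t)) (\<lambda>t. \<alpha> (a + t)) t \<partial>lb J)"
      using fp_gen_time_shift[OF sm, of "- a"] by (simp add: fp_int_def)
    finally show ?thesis by simp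
  qed
  show ?thesis
    unfolding admissible_controlled[OF w'] controlled_def using w' m' \<alpha>' e' fp' by auto
qed

section \<open>Concatenation of trajectories\<close>

text \<open>
  \<open>f\<close> may differ from \<open>f2\<close> at the junction time, a null set; this frees \<open>glue\<close> from having to agree there.
\<close>

lemma lb_concat_integral:
  fixes f f1 f2 :: "real \<Rightarrow> real"
  assumes J: "J \<in> sets borel" "J \<subseteq> {0..}" and a: "0 \<le> a" and I: "I = {0..a} \<union> (+) a ` J"
    and i1: "integrable (lb {0..a}) f1" and i2: "integrable (lb J) f2"
    and f1: "\<And>t. 0 \<le> t \<Longrightarrow> t \<le> a \<Longrightarrow> f t = f1 t" and f2: "\<And>t. t \<in> J \<Longrightarrow> 0 < t \<Longrightarrow> f (a + t) = f2 t"
  shows "integrable (lb I) f" "(\<integral>t. f t \<partial>lb I) = (\<integral>t. f1 t \<partial>lb {0..a}) + (\<integral>t. f2 t \<partial>lb J)"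
proof -
  note aJ = sets_borel_shift[OF J(1), of a]
  have Ib: "I \<in> sets borel" using aJ I by simp
  define g1 where "g1 t = indicator {0..a} t * f1 t" for t
  define g2 where "g2 t = indicator ((+) a ` J) t * f2 (t - a)" for t
  have "integrable (lb ((+) a ` J)) (\<lambda>t. f2 (t - a))"
    using i2 by (simp add: integrable_lb_shift[OF J(1)])
  then have ig2: "integrable lborel g2" using aJ by (simp add: integrable_restrict_space g2_def[abs_def])
  have ig1: "integrable lborel g1" using i1 by (simp add: integrable_restrict_space g1_def[abs_def])
  have v1: "(\<integral>t. g1 t \<partial>lborel) = (\<integral>t. f1 t \<partial>lb {0..a})" by (simp add: integral_restrict_space g1_def)
  have v2: "(\<integral>t. g2 t \<partial>lborel) = (\<integral>t. f2 t \<partial>lb J)"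
    using integral_lb_shift[OF J(1), of a "\<lambda>t. f2 (t - a)"] aJ by (simp add: integral_restrict_space g2_def)
  have eq: "indicator I t * f t = g1 t + g2 t" if "t \<noteq> a" for t
  proof -
    have 1: "t \<notin> (+) a ` J" if "t < a" using that J(2) by force
    show ?thesis
    proof (cases "t < a")
      case True
      then show ?thesis using 1 f1[of t] by (auto simp: g1_def g2_def I indicator_def)
    next
      case False
      then have ta: "a < t" using \<open>t \<noteq> a\<close> by simp
      show ?thesis
      proof (cases "t \<in> (+) a ` J")
        case True
        then obtain s where s: "s \<in> J" "t = a + s" by auto
        then show ?thesis using f2[OF s(1)] ta by (auto simp: g1_def g2_def I indicator_def)
      next
        case False
        then show ?thesis using ta by (auto simp: g1_def g2_def I indicator_def)
      qed
    qed
  qed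
  have "AE t in lborel. g1 t + g2 t = indicator I t * f t"
    using AE_lborel_singleton[of a] by eventually_elim (simp add: eq)
  have m: "(\<lambda>t. indicator I t * f t) \<in> borel_measurable lborel"
  proof -
    have "(\<lambda>t. indicator I t * f t) = (\<lambda>t. if t = a then indicator I a * f a else g1 t + g2 t)" using eq by auto
    moreover have "(\<lambda>t. if t = a then indicator I a * f a else g1 t + g2 t) \<in> borel_measurable lborel"
      using ig1 ig2 by measurable
    ultimately show ?thesis by simp
  qed
  have "integrable lborel (\<lambda>t. indicator I t * f t)"
    by (rule integrable_cong_AE_imp[OF Bochner_Integration.integrable_add[OF ig1 ig2] m]) fact
  then show "integrable (lb I) f" using Ib by (simp add: integrable_restrict_space)
  have "(\<integral>t. f t \<partial>lb I) = (\<integral>t. indicator I t * f t \<partial>lborel)" using Ib by (simp add: integral_restrict_space)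
  also have "\<dots> = (\<integral>t. g1 t + g2 t \<partial>lborel)"
    by (rule integral_cong_AE) (use m ig1 ig2 \<open>AE t in lborel. g1 t + g2 t = indicator I t * f t\<close> in auto)
  also have "\<dots> = (\<integral>t. f1 t \<partial>lb {0..a}) + (\<integral>t. f2 t \<partial>lb J)"
    using ig1 ig2 v1 v2 by simp
  finally show "(\<integral>t. f t \<partial>lb I) = (\<integral>t. f1 t \<partial>lb {0..a}) + (\<integral>t. f2 t \<partial>lb J)" .
qed

definition glue :: "real \<Rightarrow> (real \<Rightarrow> 'b) \<Rightarrow> (real \<Rightarrow> 'b) \<Rightarrow> real \<Rightarrow> 'b" where
  "glue a f g t = (if t \<le> a then f t else g (t - a))"

lemma glue_measurable:
  assumes a: "0 \<le> a" and J: "J \<in> sets borel" "0 \<in> J" "J \<subseteq> {0..}" and I: "I = {0..a} \<union> (+) a ` J"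
    and f: "(\<lambda>(t, x). f t x) \<in> borel_measurable (tx_space {0..a})" and g: "(\<lambda>(t, x). g t x) \<in> borel_measurable (tx_space J)"
  shows "(\<lambda>(t, x). glue a f g t x) \<in> borel_measurable (tx_space I)"
proof -
  have ext: "(\<lambda>p. h (if fst p \<in> J then fst p else 0) (snd p)) \<in> borel \<Otimes>\<^sub>M borel \<rightarrow>\<^sub>M borel"
    if J: "J \<in> sets borel" "0 \<in> J" and h: "(\<lambda>(t, x). h t x) \<in> borel_measurable (tx_space J)" for J h
  proof -
    have "(\<lambda>t::real. if t \<in> J then t else 0) \<in> borel \<rightarrow>\<^sub>M restrict_space borel J"
      by (rule measurable_restrict_space2) (use J in auto)
    then have "(\<lambda>p. (if fst p \<in> J then fst p else 0, snd p)) \<in> borel \<Otimes>\<^sub>M borel \<rightarrow>\<^sub>M tx_space J" by measurable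
    from measurable_compose[OF this h] show ?thesis by simp
  qed
  have [measurable]: "(\<lambda>p. f (if fst p \<in> {0..a} then fst p else 0) (snd p)) \<in> borel \<Otimes>\<^sub>M borel \<rightarrow>\<^sub>M borel"
    by (rule ext[OF _ _ f]) (use a in auto)
  have [measurable]: "(\<lambda>p. g (if fst p \<in> J then fst p else 0) (snd p)) \<in> borel \<Otimes>\<^sub>M borel \<rightarrow>\<^sub>M borel"
    by (rule ext[OF J(1,2) g])
  have sh: "(\<lambda>p. g (if fst p - a \<in> J then fst p - a else 0) (snd p)) \<in> borel \<Otimes>\<^sub>M borel \<rightarrow>\<^sub>M borel"
  proof -
    have "(\<lambda>p. (fst p - a, snd p)) \<in> borel \<Otimes>\<^sub>M borel \<rightarrow>\<^sub>M borel \<Otimes>\<^sub>M borel" by measurable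
    from measurable_compose[OF this ext[OF J(1,2) g]] show ?thesis by (simp only: fst_conv snd_conv)
  qed
  note [measurable] = sh
  have "(\<lambda>p. if fst p \<le> a then f (if fst p \<in> {0..a} then fst p else 0) (snd p)
      else g (if fst p - a \<in> J then fst p - a else 0) (snd p)) \<in> borel \<Otimes>\<^sub>M borel \<rightarrow>\<^sub>M borel"
    by measurable
  then have "(\<lambda>p. if fst p \<le> a then f (if fst p \<in> {0..a} then fst p else 0) (snd p)
      else g (if fst p - a \<in> J then fst p - a else 0) (snd p)) \<in> borel_measurable (tx_space I)"
    by (rule measurable_tx_restrict)
  then show ?thesis
  proof (rule subst[OF measurable_cong, rotated])
    fix p assume "p \<in> space (tx_space I :: (real \<times> 'a torus) measure)"
    then have "fst p \<in> I" by auto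
    then show "(if fst p \<le> a then f (if fst p \<in> {0..a} then fst p else 0) (snd p)
      else g (if fst p - a \<in> J then fst p - a else 0) (snd p)) = (case p of (t, x) \<Rightarrow> glue a f g t x)"
      using J(3) a by (auto simp: I glue_def case_prod_beta')
  qed
qed

lemma prob_curve_glue:
  assumes a: "0 \<le> a" and J: "0 \<in> J" "J \<subseteq> {0..}" and I: "I = {0..a} \<union> (+) a ` J"
    and m1: "prob_curve {0..a} m1" and m2: "prob_curve J m2" and j: "m2 0 = m1 a"
  shows "prob_curve I (glue a m1 m2)"
  unfolding prob_curve_iff
proof (intro conjI ballI allI impI)
  fix t assume "t \<in> I"
  then show "glue a m1 m2 t \<in> prob_torus"
    using prob_curveD[OF m1, of t] prob_curveD[OF m2, of "t - a"] J(2) a by (auto simp: I glue_def)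
next
  fix t and e :: real assume t: "t \<in> I" and e: "e > 0"
  have P1: "\<exists>d>0. \<forall>s\<in>{0..a}. dist s t < d \<longrightarrow> kr_dist (m1 t) (m1 s) < e" if "t \<in> {0..a}"
    using m1 that e by (simp add: prob_curve_iff)
  have P2: "\<exists>d>0. \<forall>s\<in>J. dist s (t - a) < d \<longrightarrow> kr_dist (m2 (t - a)) (m2 s) < e" if "t - a \<in> J"
    using m2 that e by (simp add: prob_curve_iff)
  have sI: "0 \<le> s" "s \<le> a \<or> s - a \<in> J" if "s \<in> I" for s using that J(2) a by (auto simp: I)
  consider "t < a" | "t = a" | "a < t" by linarith
  then show "\<exists>d>0. \<forall>s\<in>I. dist s t < d \<longrightarrow> kr_dist (glue a m1 m2 t) (glue a m1 m2 s) < e"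
  proof cases
    case 1
    then obtain d where d: "d > 0" "\<forall>s\<in>{0..a}. dist s t < d \<longrightarrow> kr_dist (m1 t) (m1 s) < e"
      using P1 sI[OF t] by auto
    show ?thesis
    proof (intro exI[of _ "min d (a - t)"] conjI ballI impI)
      fix s assume s: "s \<in> I" "dist s t < min d (a - t)"
      then have "s \<le> a" "s \<in> {0..a}" using sI[OF s(1)] by (auto simp: dist_real_def)
      then show "kr_dist (glue a m1 m2 t) (glue a m1 m2 s) < e" using d(2) s 1 by (auto simp: glue_def)
    qed (use d 1 in auto)
  next
    case 2
    obtain d1 where d1: "d1 > 0" "\<forall>s\<in>{0..a}. dist s t < d1 \<longrightarrow> kr_dist (m1 t) (m1 s) < e"
      using P1 2 a by auto
    obtain d2 where d2: "d2 > 0" "\<forall>s\<in>J. dist s (t - a) < d2 \<longrightarrow> kr_dist (m2 (t - a)) (m2 s) < e"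
      using P2 2 J by auto
    show ?thesis
    proof (intro exI[of _ "min d1 d2"] conjI ballI impI)
      fix s assume s: "s \<in> I" "dist s t < min d1 d2"
      show "kr_dist (glue a m1 m2 t) (glue a m1 m2 s) < e"
      proof (cases "s \<le> a")
        case True
        then show ?thesis using d1(2) s sI[OF s(1)] 2 by (auto simp: glue_def)
      next
        case False
        then have "s - a \<in> J" "dist (s - a) 0 < d2" using sI[OF s(1)] s(2) 2 by (auto simp: dist_real_def)
        then show ?thesis using d2(2) False 2 j by (auto simp: glue_def)
      qed
    qed (use d1 d2 in auto)
  next
    case 3
    then obtain d where d: "d > 0" "\<forall>s\<in>J. dist s (t - a) < d \<longrightarrow> kr_dist (m2 (t - a)) (m2 s) < e"
      using P2 sI[OF t] by auto
    show ?thesis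
    proof (intro exI[of _ "min d (t - a)"] conjI ballI impI)
      fix s assume s: "s \<in> I" "dist s t < min d (t - a)"
      then have "\<not> s \<le> a" by (auto simp: dist_real_def)
      moreover have "s - a \<in> J" "dist (s - a) (t - a) < d" using sI[OF s(1)] s \<open>\<not> s \<le> a\<close> by (auto simp: dist_real_def)
      ultimately show "kr_dist (glue a m1 m2 t) (glue a m1 m2 s) < e" using d(2) 3 by (auto simp: glue_def)
    qed (use d 3 in auto)
  qed
qed

text \<open>
  For a test function on the whole interval, the first piece contributes its value at the junction with sign
  \<open>+\<close> (\<open>fp_right_end\<close>) and the second with sign \<open>-\<close> (\<open>fp_left_end\<close>); they cancel as the curves meet.
\<close>

lemma admissible_glue:
  fixes m1 m2 :: "real \<Rightarrow> 'n::finite torus measure"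
  assumes a: "0 < a" and J: "J \<subseteq> {0..}" "{0..s} \<subseteq> J" "0 < s" and I: "I = {0..a} \<union> (+) a ` J"
    and w: "weight {0..a} w" "weight J (\<lambda>t. w (a + t))"
    and a1: "(m1, \<alpha>1) \<in> admissible {0..a} w m0" and a2: "(m2, \<alpha>2) \<in> admissible J (\<lambda>t. w (a + t)) (m1 a)"
  shows "weight I w" "(glue a m1 m2, glue a \<alpha>1 \<alpha>2) \<in> admissible I w m0"
proof -
  let ?m = "glue a m1 m2" and ?\<alpha> = "glue a \<alpha>1 \<alpha>2"
  note W1 = weightD[OF w(1)] and W2 = weightD[OF w(2)]
  note aJ = sets_borel_shift[OF W2(1), of a]
  have Ib: "I \<in> sets borel" using aJ I by simp
  have "integrable (lb I) w"
    by (rule lb_concat_integral(1)[OF W2(1) J(1) _ I W1(7) W2(7)]) (use a in auto)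
  then show w': "weight I w" using a Ib W1 by (auto simp: weight_def I)
  note W = weightD[OF w']
  have c1: "controlled {0..a} w m1 \<alpha>1" and fp1: "\<And>\<phi>. test_fn {0..a} \<phi> \<Longrightarrow> (\<integral>t. fp_int \<phi> m1 \<alpha>1 t \<partial>lb {0..a}) = 0" and m10: "m1 0 = m0"
    using a1 by (auto simp: admissible_controlled[OF w(1)])
  have c2: "controlled J (\<lambda>t. w (a + t)) m2 \<alpha>2" and fp2: "\<And>\<phi>. test_fn J \<phi> \<Longrightarrow> (\<integral>t. fp_int \<phi> m2 \<alpha>2 t \<partial>lb J) = 0" and m20: "m2 0 = m1 a"
    using a2 by (auto simp: admissible_controlled[OF w(2)])
  have m1: "prob_curve {0..a} m1" and \<alpha>1: "(\<lambda>(t, x). \<alpha>1 t x) \<in> borel_measurable (tx_space {0..a})"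
    and e1: "(\<integral>\<^sup>+p. ennreal (w (fst p) * (norm (\<alpha>1 (fst p) (snd p)))\<^sup>2) \<partial>curve {0..a} m1) < \<infinity>"
    using c1 by (auto simp: controlled_def)
  have m2: "prob_curve J m2" and \<alpha>2: "(\<lambda>(t, x). \<alpha>2 t x) \<in> borel_measurable (tx_space J)"
    and e2: "(\<integral>\<^sup>+p. ennreal (w (a + fst p) * (norm (\<alpha>2 (fst p) (snd p)))\<^sup>2) \<partial>curve J m2) < \<infinity>"
    using c2 by (auto simp: controlled_def)
  have m: "prob_curve I ?m" by (rule prob_curve_glue[OF _ _ J(1) I m1 m2 m20]) (use a W2 in auto)
  have \<alpha>: "(\<lambda>(t, x). ?\<alpha> t x) \<in> borel_measurable (tx_space I)"
    by (rule glue_measurable[OF _ W2(1,3) J(1) I \<alpha>1 \<alpha>2]) (use a in auto)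
  have [measurable]: "(\<lambda>p. \<alpha>1 (fst p) (snd p)) \<in> borel_measurable (tx_space {0..a})"
    "(\<lambda>p. \<alpha>2 (fst p) (snd p)) \<in> borel_measurable (tx_space J)" "(\<lambda>p. ?\<alpha> (fst p) (snd p)) \<in> borel_measurable (tx_space I)"
    using \<alpha>1 \<alpha>2 \<alpha> by (auto simp: case_prod_beta')
  note [measurable] = W1(9) W2(9) W(9)
  have em1: "(\<lambda>p. ennreal (w (fst p) * (norm (\<alpha>1 (fst p) (snd p)))\<^sup>2)) \<in> borel_measurable (tx_space {0..a})" by measurable
  have em2: "(\<lambda>p. ennreal (w (a + fst p) * (norm (\<alpha>2 (fst p) (snd p)))\<^sup>2)) \<in> borel_measurable (tx_space J)" by measurable
  have em: "(\<lambda>p. ennreal (w (fst p) * (norm (?\<alpha> (fst p) (snd p)))\<^sup>2)) \<in> borel_measurable (tx_space I)" by measurable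
  define E where "E t = (\<integral>\<^sup>+x. ennreal (w t * (norm (?\<alpha> t x))\<^sup>2) \<partial>?m t)" for t
  have Em: "E \<in> borel_measurable (lb I)" using inner_nn_measurable[OF W(1,2) m em] by (simp add: E_def[abs_def])
  have EI: "(\<lambda>t. E t * indicator I t) \<in> borel_measurable borel" by (rule lb_ind_measurable[OF Ib Em])
  have "(\<integral>\<^sup>+p. ennreal (w (fst p) * (norm (?\<alpha> (fst p) (snd p)))\<^sup>2) \<partial>curve I ?m) = (\<integral>\<^sup>+t. E t * indicator I t \<partial>lborel)"
    using Ib by (simp add: nn_integral_curve[OF W(1,2) m em] E_def nn_integral_restrict_space)
  also have "\<dots> = (\<integral>\<^sup>+t. E t * indicator {0..a} t + (E t * indicator I t) * indicator {a<..} t \<partial>lborel)"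
    using J(1) a by (intro nn_integral_cong) (auto simp: I indicator_def)
  also have "\<dots> = (\<integral>\<^sup>+t. E t * indicator {0..a} t \<partial>lborel) + (\<integral>\<^sup>+t. (E t * indicator I t) * indicator {a<..} t \<partial>lborel)"
  proof (rule nn_integral_add)
    have "(\<lambda>t. E t * indicator {0..a} t) = (\<lambda>t. (E t * indicator I t) * indicator {0..a} t)"
      by (auto simp: I indicator_def)
    then show "(\<lambda>t. E t * indicator {0..a} t) \<in> borel_measurable lborel" using EI by simp
  qed (use EI in simp)
  also have "(\<integral>\<^sup>+t. E t * indicator {0..a} t \<partial>lborel) = (\<integral>\<^sup>+p. ennreal (w (fst p) * (norm (\<alpha>1 (fst p) (snd p)))\<^sup>2) \<partial>curve {0..a} m1)"
  proof -
    have "E t * indicator {0..a} t = (\<integral>\<^sup>+x. ennreal (w t * (norm (\<alpha>1 t x))\<^sup>2) \<partial>m1 t) * indicator {0..a} t" for t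
      by (auto simp: E_def glue_def indicator_def)
    then show ?thesis by (simp add: nn_integral_curve[OF W1(1,2) m1 em1] nn_integral_restrict_space)
  qed
  also have "(\<integral>\<^sup>+t. (E t * indicator I t) * indicator {a<..} t \<partial>lborel) \<le> (\<integral>\<^sup>+p. ennreal (w (a + fst p) * (norm (\<alpha>2 (fst p) (snd p)))\<^sup>2) \<partial>curve J m2)"
  proof -
    have "(\<integral>\<^sup>+t. (E t * indicator I t) * indicator {a<..} t \<partial>lborel) = (\<integral>\<^sup>+t. (E (a + t) * indicator I (a + t)) * indicator {a<..} (a + t) \<partial>lborel)"
      using nn_integral_real_affine[of "\<lambda>t. (E t * indicator I t) * indicator {a<..} t" 1 a] EI by simp
    also have "\<dots> \<le> (\<integral>\<^sup>+t. (\<integral>\<^sup>+x. ennreal (w (a + t) * (norm (\<alpha>2 t x))\<^sup>2) \<partial>m2 t) * indicator J t \<partial>lborel)"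
      by (intro nn_integral_mono) (auto simp: E_def glue_def indicator_def I)
    finally show ?thesis using W2(1) by (simp add: nn_integral_curve[OF W2(1,2) m2 em2] nn_integral_restrict_space)
  qed
  finally have e: "(\<integral>\<^sup>+p. ennreal (w (fst p) * (norm (?\<alpha> (fst p) (snd p)))\<^sup>2) \<partial>curve I ?m) < \<infinity>"
    using e1 e2 by (auto simp: add_left_mono intro: le_less_trans)
  have fp: "(\<integral>t. fp_int \<phi> ?m ?\<alpha> t \<partial>lb I) = 0" if \<phi>: "test_fn I \<phi>" for \<phi>
  proof -
    obtain K where sm: "smooth_tx \<phi>" and K: "compact K" "K \<subseteq> interior I" "supported_in \<phi> K"
      using \<phi> by (auto simp: test_fn_def)
    let ?\<phi> = "\<lambda>t. \<phi> (t + a)"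
    have sm': "smooth_tx ?\<phi>" by (rule smooth_tx_time_shift[OF sm])
    have supp: "supported_in ?\<phi> ((+) (- a) ` K)"
      using K(3) unfolding supported_in_def by (force simp: image_iff)
    have cK: "compact ((+) (- a) ` K)" using K(1) by (rule compact_translation)
    have K0: "K \<subseteq> {0<..}"
    proof -
      have "interior I \<subseteq> interior {0..}" using J(1) a by (intro interior_mono) (auto simp: I)
      then show ?thesis using K(2) by (simp add: interior_real_atLeast)
    qed
    have KJ: "(+) (- a) ` K \<inter> {0<..} \<subseteq> interior J"
    proof -
      have "open ((+) (- a) ` (interior I \<inter> {a<..}))" by (intro open_translation open_Int) auto
      moreover have "(+) (- a) ` (interior I \<inter> {a<..}) \<subseteq> J" using interior_subset[of I] by (auto simp: I)
      ultimately have "(+) (- a) ` (interior I \<inter> {a<..}) \<subseteq> interior J" by (simp add: interior_maximal)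
      then show ?thesis using K(2) by force
    qed
    have i1: "(\<integral>t. fp_int \<phi> m1 \<alpha>1 t \<partial>lb {0..a}) = (\<integral>x. \<phi> a x \<partial>m1 a)"
      by (rule fp_right_end[OF c1 sm K(3,1) fp1 refl a K0])
    have i2: "(\<integral>t. fp_int ?\<phi> m2 \<alpha>2 t \<partial>lb J) = - (\<integral>x. ?\<phi> 0 x \<partial>m2 0)"
      by (rule fp_left_end[OF c2 sm' supp cK fp2 J KJ])
    have "(\<integral>t. fp_int \<phi> ?m ?\<alpha> t \<partial>lb I) = (\<integral>t. fp_int \<phi> m1 \<alpha>1 t \<partial>lb {0..a}) + (\<integral>t. fp_int ?\<phi> m2 \<alpha>2 t \<partial>lb J)"
    proof (rule lb_concat_integral(2)[OF W2(1) J(1) less_imp_le[OF a] I])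
      show "integrable (lb {0..a}) (fp_int \<phi> m1 \<alpha>1)" by (rule fp_int_integrable[OF c1 sm K(3,1)])
      show "integrable (lb J) (fp_int ?\<phi> m2 \<alpha>2)" by (rule fp_int_integrable[OF c2 sm' supp cK])
      show "fp_int \<phi> ?m ?\<alpha> t = fp_int \<phi> m1 \<alpha>1 t" if "0 \<le> t" "t \<le> a" for t
        using that by (simp add: fp_int_def glue_def)
      show "fp_int \<phi> ?m ?\<alpha> (a + t) = fp_int ?\<phi> m2 \<alpha>2 t" if "t \<in> J" "0 < t" for t
        using that by (simp add: fp_int_def glue_def fp_gen_time_shift[OF sm] add.commute)
    qed
    then show ?thesis using i1 i2 m20 by simp
  qed
  show "(?m, ?\<alpha>) \<in> admissible I w m0"
    unfolding admissible_controlled[OF w'] controlled_def using w' m \<alpha> e fp a m10 by (auto simp: glue_def)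
qed

context mf_cost begin

lemma cost_shift:
  assumes "J \<in> sets borel"
  shows "cost J w' (\<lambda>t. m (a + t)) (\<lambda>t. \<alpha> (a + t)) = (\<integral>t. w' t * run_cost m \<alpha> (a + t) \<partial>lb J)"
  using assms by (simp add: cost_def LINT_lb run_cost_def)

lemma cost_glue:
  assumes a: "0 < a" and J: "J \<subseteq> {0..}" "{0..s} \<subseteq> J" "0 < s" and I: "I = {0..a} \<union> (+) a ` J"
    and w: "weight {0..a} w" "weight J (\<lambda>t. w (a + t))"
    and a1: "(m1, \<alpha>1) \<in> admissible {0..a} w m0" and a2: "(m2, \<alpha>2) \<in> admissible J (\<lambda>t. w (a + t)) (m1 a)"
  shows "cost I w (glue a m1 m2) (glue a \<alpha>1 \<alpha>2) = cost {0..a} w m1 \<alpha>1 + cost J (\<lambda>t. w (a + t)) m2 \<alpha>2"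
proof -
  note W2 = weightD[OF w(2)]
  note aJ = sets_borel_shift[OF W2(1), of a]
  have Ib: "I \<in> sets borel" using aJ I by simp
  have "(\<integral>t. w t * run_cost (glue a m1 m2) (glue a \<alpha>1 \<alpha>2) t \<partial>lb I) = (\<integral>t. w t * run_cost m1 \<alpha>1 t \<partial>lb {0..a}) + (\<integral>t. w (a + t) * run_cost m2 \<alpha>2 t \<partial>lb J)"
    by (rule lb_concat_integral(2)[OF W2(1) J(1) less_imp_le[OF a] I admissible_costs(4)[OF w(1) a1] admissible_costs(4)[OF w(2) a2]])
      (auto simp: run_cost_def glue_def)
  then show ?thesis using Ib W2(1) by (simp add: cost_def LINT_lb)
qed

lemma cost_split:
  assumes a: "0 \<le> a" and J: "J \<in> sets borel" "J \<subseteq> {0..}" and I: "I = {0..a} \<union> (+) a ` J"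
    and w: "weight I w" and ad: "(m, \<alpha>) \<in> admissible I w m0"
  shows "cost I w m \<alpha> = (\<integral>t. w t * run_cost m \<alpha> t \<partial>lb {0..a}) + (\<integral>t. w (a + t) * run_cost m \<alpha> (a + t) \<partial>lb J)"
    "integrable (lb {0..a}) (\<lambda>t. w t * run_cost m \<alpha> t)" "integrable (lb J) (\<lambda>t. w (a + t) * run_cost m \<alpha> (a + t))"
proof -
  note W = weightD[OF w]
  note i = admissible_costs(4)[OF w ad]
  have sub: "integrable (lb S) (\<lambda>t. w t * run_cost m \<alpha> t)" if "S \<subseteq> I" "S \<in> sets borel" for S
  proof -
    have "set_integrable lborel I (\<lambda>t. w t * run_cost m \<alpha> t)"
      using i W(1) by (simp add: integrable_restrict_space set_integrable_def)
    from set_integrable_subset[OF this _ that(1)] that(2)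
    show ?thesis by (simp add: integrable_restrict_space set_integrable_def)
  qed
  show i1: "integrable (lb {0..a}) (\<lambda>t. w t * run_cost m \<alpha> t)" by (rule sub) (auto simp: I)
  have "integrable (lb ((+) a ` J)) (\<lambda>t. w t * run_cost m \<alpha> t)"
    by (rule sub) (auto simp: I intro!: sets_borel_shift J)
  then show i2: "integrable (lb J) (\<lambda>t. w (a + t) * run_cost m \<alpha> (a + t))"
    by (simp add: integrable_lb_shift[OF J(1)])
  have "(\<integral>t. w t * run_cost m \<alpha> t \<partial>lb I) = (\<integral>t. w t * run_cost m \<alpha> t \<partial>lb {0..a}) + (\<integral>t. w (a + t) * run_cost m \<alpha> (a + t) \<partial>lb J)"
    by (rule lb_concat_integral(2)[OF J a I i1 i2]) auto
  then show "cost I w m \<alpha> = (\<integral>t. w t * run_cost m \<alpha> t \<partial>lb {0..a}) + (\<integral>t. w (a + t) * run_cost m \<alpha> (a + t) \<partial>lb J)"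
    using W(1) by (simp add: cost_def LINT_lb)
qed

end

section \<open>The Gaussian measure\<close>

lemma integrable_exp_square:
  assumes "0 < a"
  shows "integrable lborel (\<lambda>x::real. exp (- (a * x\<^sup>2)))"
proof -
  define \<sigma> where "\<sigma> = 1 / sqrt (2 * a)"
  have s: "2 * \<sigma>\<^sup>2 = 1 / a" and s0: "0 < \<sigma>" using assms by (simp_all add: \<sigma>_def power_divide)
  have "exp (- (a * x\<^sup>2)) = sqrt (2 * pi * \<sigma>\<^sup>2) * normal_density 0 \<sigma> x" for x
  proof -
    have "0 < sqrt (2 * pi * \<sigma>\<^sup>2)" "\<sigma> \<noteq> 0" using assms by (simp_all add: \<sigma>_def)
    then show ?thesis using s assms by (simp add: normal_density_def mult.commute)
  qed
  then show ?thesis using s0 by simp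
qed

lemma integrable_gaussian:
  assumes "0 < a"
  shows "integrable lborel (\<lambda>z::'a::euclidean_space. exp (- (a * (norm z)\<^sup>2)))"
proof (rule integrableI_nonneg)
  have eq: "exp (- (a * (norm z)\<^sup>2)) = (\<Prod>b\<in>Basis. exp (- (a * (z \<bullet> b)\<^sup>2)))" for z :: 'a
  proof -
    have "(norm z)\<^sup>2 = (\<Sum>b\<in>Basis. (z \<bullet> b)\<^sup>2)"
      unfolding power2_norm_eq_inner by (subst euclidean_inner) (simp add: power2_eq_square)
    then show ?thesis by (simp add: exp_sum[symmetric] sum_distrib_left sum_negf)
  qed
  have "(\<integral>\<^sup>+z. ennreal (exp (- (a * (norm (z::'a))\<^sup>2))) \<partial>lborel)
     = (\<integral>\<^sup>+z. (\<Prod>b\<in>(Basis::'a set). ennreal (exp (- (a * (z \<bullet> b)\<^sup>2)))) \<partial>lborel)"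
    by (simp add: eq prod_ennreal)
  also have "\<dots> = (\<Prod>b\<in>(Basis::'a set). (\<integral>\<^sup>+x. ennreal (exp (- (a * x\<^sup>2))) \<partial>lborel))"
    by (rule nn_integral_lborel_prod) auto
  also have "\<dots> < \<infinity>"
  proof -
    have "(\<integral>\<^sup>+x. ennreal (exp (- (a * x\<^sup>2))) \<partial>lborel) < \<infinity>"
      using integrableD(2)[OF integrable_exp_square[OF assms]] by (simp add: less_top)
    then show ?thesis by (simp add: power_less_top_ennreal)
  qed
  finally show "(\<integral>\<^sup>+z. ennreal (exp (- (a * (norm (z::'a))\<^sup>2))) \<partial>lborel) < \<infinity>" .
qed auto

definition gauss :: "'a::euclidean_space \<Rightarrow> real" where
  "gauss z = exp (- ((1/2) * (norm z)\<^sup>2)) / (\<integral>z. exp (- ((1/2) * (norm (z::'a))\<^sup>2)) \<partial>lborel)"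

lemma gauss_mass_pos: "0 < (\<integral>z. exp (- ((1/2) * (norm (z::'a::euclidean_space))\<^sup>2)) \<partial>lborel)"
proof -
  have i: "integrable lborel (\<lambda>z::'a. exp (- ((1/2) * (norm z)\<^sup>2)))" by (rule integrable_gaussian) simp
  have "(\<integral>z. exp (- ((1/2) * (norm (z::'a))\<^sup>2)) \<partial>lborel) \<noteq> 0"
  proof
    assume "(\<integral>z. exp (- ((1/2) * (norm (z::'a))\<^sup>2)) \<partial>lborel) = 0"
    then have "AE z::'a in lborel. exp (- ((1/2) * (norm z)\<^sup>2)) = 0"
      by (subst (asm) integral_nonneg_eq_0_iff_AE[OF i]) auto
    then have "AE z::'a in lborel. False" by simp
    then show False by (simp add: AE_iff_measurable[of UNIV] emeasure_lborel_UNIV)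
  qed
  moreover have "0 \<le> (\<integral>z. exp (- ((1/2) * (norm (z::'a))\<^sup>2)) \<partial>lborel)" by simp
  ultimately show ?thesis by linarith
qed

lemma gauss_pos: "0 < gauss (z :: 'a::euclidean_space)"
  using gauss_mass_pos[where 'a='a] by (simp add: gauss_def)

lemma gauss_continuous: "continuous_on UNIV (gauss :: 'a::euclidean_space \<Rightarrow> real)"
  unfolding gauss_def using gauss_mass_pos[where 'a='a] by (intro continuous_intros) auto

lemma gauss_measurable [measurable]: "gauss \<in> borel_measurable borel"
  by (rule borel_measurable_continuous_onI[OF gauss_continuous])

lemma integrable_gauss: "integrable lborel (gauss :: 'a::euclidean_space \<Rightarrow> real)"
  and integral_gauss: "(\<integral>z. gauss (z :: 'a) \<partial>lborel) = 1"
proof -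
  have i: "integrable lborel (\<lambda>z::'a. exp (- ((1/2) * (norm z)\<^sup>2)))" by (rule integrable_gaussian) simp
  show "integrable lborel (gauss :: 'a \<Rightarrow> real)" unfolding gauss_def using i by simp
  show "(\<integral>z. gauss (z::'a) \<partial>lborel) = 1"
    unfolding gauss_def using gauss_mass_pos[where 'a='a] by simp
qed

lemma integrable_norm_gauss: "integrable lborel (\<lambda>z :: 'a::euclidean_space. norm z * gauss z)"
proof -
  have i: "integrable lborel (\<lambda>z::'a. exp (- ((1/4) * (norm z)\<^sup>2)) / (\<integral>z. exp (- ((1/2) * (norm (z::'a))\<^sup>2)) \<partial>lborel))"
    using integrable_gaussian[of "1/4", where 'a='a] by simp
  show ?thesis
  proof (rule Bochner_Integration.integrable_bound[OF i])
    show "(\<lambda>z::'a. norm z * gauss z) \<in> borel_measurable lborel" by measurable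
    have "norm z * exp (- ((1/2) * (norm z)\<^sup>2)) \<le> exp (- ((1/4) * (norm z)\<^sup>2))" for z :: 'a
    proof -
      have "0 \<le> (norm z / 2 - 1)\<^sup>2" by simp
      then have "norm z \<le> 1 + (1/4) * (norm z)\<^sup>2"
        unfolding power2_diff by (simp add: power_divide)
      also have "\<dots> \<le> exp ((1/4) * (norm z)\<^sup>2)" by (rule exp_ge_add_one_self)
      finally have "norm z * exp (- ((1/2) * (norm z)\<^sup>2)) \<le> exp ((1/4) * (norm z)\<^sup>2) * exp (- ((1/2) * (norm z)\<^sup>2))"
        by (rule mult_right_mono) simp
      then show ?thesis by (simp flip: exp_add)
    qed
    then show "AE z::'a in lborel. norm (norm z * gauss z) \<le> norm (exp (- ((1/4) * (norm z)\<^sup>2)) / (\<integral>z. exp (- ((1/2) * (norm (z::'a))\<^sup>2)) \<partial>lborel))"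
      using gauss_mass_pos[where 'a='a] by (intro AE_I2) (simp add: gauss_def divide_right_mono)
  qed
qed

lemma gauss_line_derivative:
  fixes z b :: "'a::euclidean_space"
  shows "((\<lambda>s. gauss (z + s *\<^sub>R b)) has_real_derivative - ((z + s *\<^sub>R b) \<bullet> b) * gauss (z + s *\<^sub>R b)) (at s)"
proof -
  have n: "((\<lambda>s. (norm (z + s *\<^sub>R b))\<^sup>2) has_real_derivative 2 * ((z + s *\<^sub>R b) \<bullet> b)) (at s)"
  proof -
    have "(\<lambda>s. (norm (z + s *\<^sub>R b))\<^sup>2) = (\<lambda>s. z \<bullet> z + 2 * s * (z \<bullet> b) + s\<^sup>2 * (b \<bullet> b))"
      unfolding power2_norm_eq_inner
      by (simp add: inner_add_left inner_add_right inner_commute[of b z] power2_eq_square algebra_simps)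
    then show ?thesis
      by (auto intro!: derivative_eq_intros simp: inner_add_left algebra_simps)
  qed
  define N where "N s = (norm (z + s *\<^sub>R b))\<^sup>2" for s
  have N: "(N has_real_derivative 2 * ((z + s *\<^sub>R b) \<bullet> b)) (at s)" using n by (simp add: N_def[abs_def])
  define M where "M = (\<integral>z. exp (- ((1/2) * (norm (z :: 'a))\<^sup>2)) \<partial>lborel)"
  have "M \<noteq> 0" using gauss_mass_pos[where 'a='a] by (simp add: M_def)
  then have "((\<lambda>s. exp (- ((1/2) * N s)) / M) has_real_derivative - ((z + s *\<^sub>R b) \<bullet> b) * (exp (- ((1/2) * N s)) / M)) (at s)"
    by (auto intro!: derivative_eq_intros N)
  then show ?thesis unfolding gauss_def N_def M_def .
qed

definition gaussian :: "(real^'n::finite) measure" where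
  "gaussian = density lborel (\<lambda>z. ennreal (gauss z))"

lemma sets_gaussian [simp]: "sets gaussian = sets borel" and space_gaussian [simp]: "space gaussian = UNIV"
  by (auto simp: gaussian_def)

lemma prob_space_gaussian: "prob_space (gaussian :: (real^'a::finite) measure)"
proof (rule prob_spaceI)
  have "emeasure (gaussian :: (real^'a) measure) (space gaussian) = (\<integral>\<^sup>+z. ennreal (gauss (z :: real^'a)) \<partial>lborel)"
    by (simp add: gaussian_def emeasure_density)
  also have "\<dots> = ennreal (\<integral>z. gauss (z :: real^'a) \<partial>lborel)"
    by (rule nn_integral_eq_integral[OF integrable_gauss]) (use gauss_pos less_imp_le in auto)
  finally show "emeasure (gaussian :: (real^'a) measure) (space gaussian) = 1" by (simp add: integral_gauss)
qed

lemma integral_gaussian: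
  fixes f :: "real^'n::finite \<Rightarrow> real"
  assumes "f \<in> borel_measurable borel"
  shows "(\<integral>z. f z \<partial>gaussian) = (\<integral>z. gauss z * f z \<partial>lborel)" "integrable gaussian f \<longleftrightarrow> integrable lborel (\<lambda>z. gauss z * f z)"
proof -
  have f: "f \<in> borel_measurable lborel" and g: "(gauss :: real^'n \<Rightarrow> real) \<in> borel_measurable lborel"
    and p: "AE z::real^'n in lborel. 0 \<le> gauss z"
    using assms gauss_pos less_imp_le by auto
  show "(\<integral>z. f z \<partial>gaussian) = (\<integral>z. gauss z * f z \<partial>lborel)"
    unfolding gaussian_def using integral_density[OF f g p] by simp
  show "integrable gaussian f \<longleftrightarrow> integrable lborel (\<lambda>z. gauss z * f z)"
    unfolding gaussian_def using integrable_density[OF f g p] by simp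
qed

lemma integrable_norm_gaussian: "integrable gaussian (norm :: real^'n::finite \<Rightarrow> real)"
  using integral_gaussian(2)[of "norm :: real^'n \<Rightarrow> real"] integrable_norm_gauss[where 'a="real^'n"] by (simp add: mult.commute)

lemma integral_lborel_translate:
  fixes f :: "'a::euclidean_space \<Rightarrow> real"
  assumes [measurable]: "f \<in> borel_measurable borel"
  shows "(\<integral>z. f (c + z) \<partial>lborel) = (\<integral>z. f z \<partial>lborel)"
    "integrable lborel (\<lambda>z. f (c + z)) \<longleftrightarrow> integrable lborel f"
proof -
  have "(\<integral>z. f z \<partial>distr lborel borel ((+) c)) = (\<integral>z. f (c + z) \<partial>lborel)"
    by (rule integral_distr) auto
  then show "(\<integral>z. f (c + z) \<partial>lborel) = (\<integral>z. f z \<partial>lborel)" by (simp add: lborel_distr_plus)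
  have "integrable (distr lborel borel ((+) c)) f \<longleftrightarrow> integrable lborel (\<lambda>z. f (c + z))"
    by (rule integrable_distr_eq) auto
  then show "integrable lborel (\<lambda>z. f (c + z)) \<longleftrightarrow> integrable lborel f" by (simp add: lborel_distr_plus)
qed

text \<open>
  Integrate \<open>f(z + b) - f(z) = \<integral>\<^sub>0\<^sup>1 g(z + s b) ds\<close> over \<open>z\<close>: the left side vanishes by translation
  invariance, the right side is the integral of \<open>g\<close> by Fubini. No decay at infinity has to be discussed.
\<close>

lemma integral_directional_derivative_eq_0:
  fixes f g :: "'a::euclidean_space \<Rightarrow> real"
  assumes d: "\<And>z s. ((\<lambda>s. f (z + s *\<^sub>R b)) has_real_derivative g (z + s *\<^sub>R b)) (at s)"
    and c: "continuous_on UNIV f" "continuous_on UNIV g" and i: "integrable lborel f" "integrable lborel g"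
  shows "(\<integral>z. g z \<partial>lborel) = 0"
proof -
  have [measurable]: "f \<in> borel_measurable borel" "g \<in> borel_measurable borel"
    using c by (auto intro: borel_measurable_continuous_onI)
  let ?L = "restrict_space lborel {0..1::real}"
  interpret L: finite_measure ?L
    by (rule finite_measureI) (simp add: emeasure_restrict_space)
  interpret P: pair_sigma_finite ?L "lborel :: 'a measure" ..
  have [measurable_cong]: "sets ?L = sets (restrict_space borel {0..1})" by (rule sets_lb)
  have gm: "(\<lambda>(s, z). g (z + s *\<^sub>R b)) \<in> borel_measurable (?L \<Otimes>\<^sub>M lborel)"
  proof -
    have "(\<lambda>s::real. s) \<in> borel_measurable (restrict_space borel {0..1})" by (rule measurable_restrict_space1) simp
    note [measurable] = measurable_compose[OF measurable_fst this, of "borel :: 'a measure"]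
    show ?thesis by measurable
  qed
  have tr: "(\<integral>z. h (z + s *\<^sub>R b) \<partial>lborel) = (\<integral>z. h z \<partial>lborel)" "integrable lborel (\<lambda>z. h (z + s *\<^sub>R b)) \<longleftrightarrow> integrable lborel h"
    if [measurable]: "h \<in> borel_measurable borel" for h :: "'a \<Rightarrow> real" and s
    using integral_lborel_translate[OF that, of "s *\<^sub>R b"] by (simp_all add: add.commute)
  have int: "integrable (?L \<Otimes>\<^sub>M lborel) (\<lambda>(s, z). g (z + s *\<^sub>R b))"
  proof (rule P.Fubini_integrable[OF gm])
    have "(\<integral>z. norm (g (z + s *\<^sub>R b)) \<partial>lborel) = (\<integral>z. norm (g z) \<partial>lborel)" for s by (rule tr) measurable
    then show "integrable ?L (\<lambda>s. \<integral>z. norm (case (s, z) of (s, z) \<Rightarrow> g (z + s *\<^sub>R b)) \<partial>lborel)" by simp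
    show "AE s in ?L. integrable lborel (\<lambda>z. case (s, z) of (s, z) \<Rightarrow> g (z + s *\<^sub>R b))"
      using tr(2)[of g] i by simp
  qed
  have ftc: "(\<integral>s. g (z + s *\<^sub>R b) \<partial>?L) = f (z + b) - f z" for z
  proof -
    have cg: "isCont (\<lambda>s. g (z + s *\<^sub>R b)) s" for s
      using continuous_on_compose2[OF c(2), of UNIV "\<lambda>s. z + s *\<^sub>R b"]
      by (auto simp: continuous_on_eq_continuous_at intro!: continuous_intros)
    have "has_bochner_integral lborel (\<lambda>s. g (z + s *\<^sub>R b) * indicator {0..1} s) (f (z + 1 *\<^sub>R b) - f (z + 0 *\<^sub>R b))"
      using d cg by (intro has_bochner_integral_FTC_Icc_real) auto
    then show ?thesis by (simp add: integral_restrict_space has_bochner_integral_iff mult.commute)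
  qed
  have "(\<integral>z. g z \<partial>lborel) = (\<integral>s. (\<integral>z. g z \<partial>lborel) \<partial>?L)"
    by (simp add: measure_restrict_space)
  also have "\<dots> = (\<integral>s. (\<integral>z. g (z + s *\<^sub>R b) \<partial>lborel) \<partial>?L)" by (simp add: tr(1))
  also have "\<dots> = (\<integral>z. (\<integral>s. g (z + s *\<^sub>R b) \<partial>?L) \<partial>lborel)"
    using P.Fubini_integral[OF int] by simp
  also have "\<dots> = (\<integral>z. f (z + b) - f z \<partial>lborel)" by (simp add: ftc)
  also have "\<dots> = 0"
    using tr[of f 1] i by simp
  finally show ?thesis .
qed

text \<open>
  \<open>h gauss\<close> has derivative \<open>(k - h (z \<bullet> b)) gauss\<close> in direction \<open>b\<close>, whose integral is zero.
\<close>

lemma gaussian_integration_by_parts: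
  fixes h k :: "real^'n::finite \<Rightarrow> real"
  assumes d: "\<And>z s. ((\<lambda>s. h (z + s *\<^sub>R b)) has_real_derivative k (z + s *\<^sub>R b)) (at s)"
    and c: "continuous_on UNIV h" "continuous_on UNIV k" and B: "\<And>z. \<bar>h z\<bar> \<le> B" "\<And>z. \<bar>k z\<bar> \<le> B"
  shows "(\<integral>z. k z \<partial>gaussian) = (\<integral>z. h z * (z \<bullet> b) \<partial>gaussian)"
proof -
  have [measurable]: "h \<in> borel_measurable borel" "k \<in> borel_measurable borel"
    using c by (auto intro: borel_measurable_continuous_onI)
  have B0: "0 \<le> B" using order.trans[OF abs_ge_zero B(1)] .
  have i1: "integrable lborel (\<lambda>z. gauss z * h z)"
  proof (rule Bochner_Integration.integrable_bound)
    show "integrable lborel (\<lambda>z::real^'n. B * gauss z)" using integrable_gauss[where 'a="real^'n"] by simp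
    show "AE z in lborel. norm (gauss z * h z) \<le> norm (B * gauss z)"
      using mult_left_mono[OF B(1) less_imp_le[OF gauss_pos]] B0
      by (intro AE_I2) (simp add: abs_mult abs_of_pos[OF gauss_pos] mult.commute)
  qed measurable
  have i2: "integrable lborel (\<lambda>z. gauss z * k z)"
  proof (rule Bochner_Integration.integrable_bound)
    show "integrable lborel (\<lambda>z::real^'n. B * gauss z)" using integrable_gauss[where 'a="real^'n"] by simp
    show "AE z in lborel. norm (gauss z * k z) \<le> norm (B * gauss z)"
      using mult_left_mono[OF B(2) less_imp_le[OF gauss_pos]] B0
      by (intro AE_I2) (simp add: abs_mult abs_of_pos[OF gauss_pos] mult.commute)
  qed measurable
  have i3: "integrable lborel (\<lambda>z. gauss z * (h z * (z \<bullet> b)))"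
  proof (rule Bochner_Integration.integrable_bound)
    show "integrable lborel (\<lambda>z::real^'n. (B * norm b) * (norm z * gauss z))" using integrable_norm_gauss[where 'a="real^'n"] by simp
    show "AE z in lborel. norm (gauss z * (h z * (z \<bullet> b))) \<le> norm ((B * norm b) * (norm z * gauss z))"
    proof (rule AE_I2)
      fix z
      have "\<bar>h z\<bar> * \<bar>z \<bullet> b\<bar> \<le> B * (norm z * norm b)"
        using B(1)[of z] Cauchy_Schwarz_ineq2[of z b] B0 by (intro mult_mono) auto
      from mult_left_mono[OF this less_imp_le[OF gauss_pos[of z]]]
      show "norm (gauss z * (h z * (z \<bullet> b))) \<le> norm ((B * norm b) * (norm z * gauss z))"
        using gauss_pos[of z] B0 by (simp add: abs_mult algebra_simps)
    qed
  qed measurable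
  have "(\<integral>z. gauss z * k z - gauss z * (h z * (z \<bullet> b)) \<partial>lborel) = 0"
  proof (rule integral_directional_derivative_eq_0[where f="\<lambda>z. gauss z * h z" and b=b])
    show "((\<lambda>s. gauss (z + s *\<^sub>R b) * h (z + s *\<^sub>R b)) has_real_derivative
        gauss (z + s *\<^sub>R b) * k (z + s *\<^sub>R b) - gauss (z + s *\<^sub>R b) * (h (z + s *\<^sub>R b) * ((z + s *\<^sub>R b) \<bullet> b))) (at s)" for z s
      using DERIV_mult[OF gauss_line_derivative d] by (simp add: algebra_simps)
  qed (use c i1 i2 i3 gauss_continuous in \<open>auto intro!: continuous_intros\<close>)
  then have "(\<integral>z. gauss z * k z \<partial>lborel) = (\<integral>z. gauss z * (h z * (z \<bullet> b)) \<partial>lborel)" using i2 i3 by simp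
  then show ?thesis by (subst (1 2) integral_gaussian(1)) auto
qed

section \<open>The heat flow\<close>

text \<open>
  The law at time \<open>t\<close> of \<open>X + \<surd>2 W\<^sub>t\<close>: the generator is the full Laplacian, whence the factor \<open>2\<close>.
\<close>

definition heat :: "'n::finite torus measure \<Rightarrow> real \<Rightarrow> 'n torus measure" where
  "heat \<mu> t = blur gaussian (sqrt (2 * t)) \<mu>"

lemmas gaussian_blur = blur_in_prob_torus[OF prob_space_gaussian sets_gaussian]
  nn_integral_blur[OF prob_space_gaussian sets_gaussian] integral_blur[OF prob_space_gaussian sets_gaussian]
  kr_dist_blur[OF prob_space_gaussian sets_gaussian]

lemma tshift_0 [simp]: "tshift x 0 = x"
  by (simp add: tshift_def)

lemma nn_integral_const_prob: "prob_space M \<Longrightarrow> (\<integral>\<^sup>+x. c \<partial>M) = (c :: ennreal)"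
  by (simp add: prob_space.emeasure_space_1)

lemma blur_zero:
  fixes \<mu> :: "'n::finite torus measure" and \<kappa> :: "(real^'n) measure"
  assumes \<kappa>: "prob_space \<kappa>" "sets \<kappa> = sets borel" and \<mu>: "\<mu> \<in> prob_torus"
  shows "blur \<kappa> 0 \<mu> = \<mu>"
proof (rule measure_eqI)
  show s: "sets (blur \<kappa> 0 \<mu>) = sets \<mu>"
    using prob_torusD(1)[OF \<mu>] prob_torusD(1)[OF blur_in_prob_torus[OF \<kappa> \<mu>]] by simp
  fix A assume "A \<in> sets (blur \<kappa> 0 \<mu>)"
  then have A: "A \<in> sets borel" "A \<in> sets \<mu>" using s prob_torusD(1)[OF \<mu>] by auto
  have "emeasure (blur \<kappa> 0 \<mu>) A = (\<integral>\<^sup>+x. indicator A x \<partial>blur \<kappa> 0 \<mu>)" using A s by simp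
  also have "\<dots> = (\<integral>\<^sup>+x. \<integral>\<^sup>+z. indicator A x \<partial>\<kappa> \<partial>\<mu>)"
    using nn_integral_blur[OF \<kappa> \<mu>, of "indicator A" 0] A by simp
  also have "\<dots> = (\<integral>\<^sup>+x. indicator A x \<partial>\<mu>)"
    by (intro nn_integral_cong nn_integral_const_prob \<kappa>)
  finally show "emeasure (blur \<kappa> 0 \<mu>) A = emeasure \<mu> A" using A by simp
qed

lemma heat_0: "\<mu> \<in> prob_torus \<Longrightarrow> heat \<mu> 0 = (\<mu> :: 'n::finite torus measure)"
  unfolding heat_def using blur_zero[OF prob_space_gaussian sets_gaussian] by simp

lemma heat_in_prob_torus: "\<mu> \<in> prob_torus \<Longrightarrow> heat \<mu> t \<in> prob_torus"
  unfolding heat_def by (rule gaussian_blur(1))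

lemma prob_curve_heat:
  assumes \<mu>: "\<mu> \<in> prob_torus"
  shows "prob_curve I (heat \<mu>)"
  unfolding prob_curve_iff
proof (intro conjI ballI allI impI heat_in_prob_torus \<mu>)
  fix t and e :: real assume e: "e > 0"
  define E where "E = (\<integral>z. norm (z::real^'a) \<partial>gaussian)"
  have E0: "0 \<le> E" by (simp add: E_def)
  have "isCont (\<lambda>t::real. sqrt (2 * t)) t" by (intro continuous_intros)
  then obtain d where d: "d > 0" "\<And>s. dist s t < d \<Longrightarrow> dist (sqrt (2 * s)) (sqrt (2 * t)) < e / (E + 1)"
    unfolding continuous_at_eps_delta using e E0 by (metis add_nonneg_pos divide_pos_pos zero_less_one)
  show "\<exists>d>0. \<forall>s\<in>I. dist s t < d \<longrightarrow> kr_dist (heat \<mu> t) (heat \<mu> s) < e"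
  proof (intro exI[of _ d] conjI ballI impI d(1))
    fix s assume "dist s t < d"
    then have 1: "\<bar>sqrt (2 * t) - sqrt (2 * s)\<bar> < e / (E + 1)" using d(2) by (simp add: dist_real_def abs_minus_commute)
    have "kr_dist (heat \<mu> t) (heat \<mu> s) \<le> kr_dist \<mu> \<mu> + \<bar>sqrt (2 * t) - sqrt (2 * s)\<bar> * E"
      unfolding heat_def E_def by (rule gaussian_blur(4)[OF \<mu> \<mu> integrable_norm_gaussian])
    also have "kr_dist \<mu> \<mu> = 0" using Metric_space.mdist_zero[OF Metric_space_prob_torus \<mu>] .
    also have "0 + \<bar>sqrt (2 * t) - sqrt (2 * s)\<bar> * E \<le> \<bar>sqrt (2 * t) - sqrt (2 * s)\<bar> * (E + 1)"
      by (simp add: mult_left_mono)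
    also have "\<dots> < e / (E + 1) * (E + 1)" using 1 E0 by (intro mult_strict_right_mono) auto
    also have "\<dots> = e" using E0 by simp
    finally show "kr_dist (heat \<mu> t) (heat \<mu> s) < e" .
  qed
qed

lemma linear_split_pd:
  fixes D :: "real \<times> (real^'n::finite) \<Rightarrow> real"
  assumes "linear D"
  shows "D (h, v) = h * D (1, 0) + (\<Sum>i\<in>UNIV. D (0, axis i 1) * v $ i)"
proof -
  have "(h, v) = h *\<^sub>R (1, 0) + (\<Sum>i\<in>UNIV. v $ i *\<^sub>R (0, axis i 1))"
  proof -
    have "v = (\<Sum>i\<in>UNIV. v $ i *\<^sub>R axis i 1)"
      by (simp add: vec_eq_iff axis_def if_distrib[of "\<lambda>x. _ * x"] cong: if_cong)
    moreover have "(\<Sum>i\<in>UNIV. v $ i *\<^sub>R ((0::real), axis i 1)) = (0, \<Sum>i\<in>UNIV. v $ i *\<^sub>R axis i 1)"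
      by (simp add: prod_eq_iff fst_sum snd_sum)
    ultimately show ?thesis by (simp add: prod_eq_iff fst_sum snd_sum)
  qed
  then have "D (h, v) = D (h *\<^sub>R (1, 0) + (\<Sum>i\<in>UNIV. v $ i *\<^sub>R (0, axis i 1)))" by (rule arg_cong)
  also have "\<dots> = h *\<^sub>R D (1, 0) + (\<Sum>i\<in>UNIV. v $ i *\<^sub>R D (0, axis i 1))"
    by (simp only: linear_add[OF assms] linear_scale[OF assms] linear_sum[OF assms])
  finally show ?thesis by (simp add: mult.commute)
qed

context
  fixes \<phi> :: "real \<Rightarrow> 'n::finite torus \<Rightarrow> real"
  assumes sm: "smooth_tx \<phi>"
begin

text \<open>
  The time derivative of \<open>\<phi> t (x + \<surd>(2t) z)\<close> for frozen \<open>x\<close> and \<open>z\<close>.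
\<close>

definition flow_rate :: "real \<Rightarrow> 'n torus \<Rightarrow> real^'n \<Rightarrow> real" where
  "flow_rate t x z = deriv (\<lambda>s. \<phi> s (tshift x (sqrt (2 * t) *\<^sub>R z))) t
     + (torus_grad (\<phi> t) (tshift x (sqrt (2 * t) *\<^sub>R z)) \<bullet> z) / sqrt (2 * t)"

lemma flow_rate_derivative:
  assumes "0 < t"
  shows "((\<lambda>s. \<phi> s (tshift x (sqrt (2 * s) *\<^sub>R z))) has_real_derivative flow_rate t x z) (at t)"
proof -
  define y where "y = rep_torus x"
  define D where "D = frechet_derivative (lift_tx \<phi>) (at (t, y + sqrt (2 * t) *\<^sub>R z))"
  have D: "(lift_tx \<phi> has_derivative D) (at (t, y + sqrt (2 * t) *\<^sub>R z))"
    unfolding D_def by (rule smoothD(1)[OF smooth_lift[OF sm]])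
  have "((\<lambda>s. sqrt (2 * s)) has_real_derivative 1 / sqrt (2 * t)) (at t)"
    using assms by (auto intro!: derivative_eq_intros simp: field_simps)
  then have "((\<lambda>s. (s, y + sqrt (2 * s) *\<^sub>R z)) has_derivative (\<lambda>h. (h, (1 / sqrt (2 * t) * h) *\<^sub>R z))) (at t)"
    unfolding has_field_derivative_def
    by (rule has_derivative_Pair[OF has_derivative_ident has_derivative_eq_rhs[OF
      has_derivative_add[OF has_derivative_const has_derivative_scaleR_left] ]]) simp
  from diff_chain_at[OF this D]
  have "((\<lambda>s. \<phi> s (tshift x (sqrt (2 * s) *\<^sub>R z))) has_derivative (\<lambda>h. D (h, (1 / sqrt (2 * t) * h) *\<^sub>R z))) (at t)"
    by (simp add: o_def lift_tx_def tshift_def y_def)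
  moreover have "D (h, (1 / sqrt (2 * t) * h) *\<^sub>R z) = flow_rate t x z * h" for h
  proof -
    have "D (h, (1 / sqrt (2 * t) * h) *\<^sub>R z) = h * D (1, 0) + (\<Sum>i\<in>UNIV. D (0, axis i 1) * ((1 / sqrt (2 * t) * h) *\<^sub>R z) $ i)"
      by (rule linear_split_pd[OF has_derivative_linear[OF D]])
    moreover have "D (1, 0) = deriv (\<lambda>s. \<phi> s (tshift x (sqrt (2 * t) *\<^sub>R z))) t"
      unfolding D_def tshift_def y_def using DERIV_imp_deriv[OF time_deriv[OF sm]] by simp
    moreover have "D (0, axis i 1) = torus_grad (\<phi> t) (tshift x (sqrt (2 * t) *\<^sub>R z)) $ i" for i
      unfolding D_def tshift_def y_def by (simp add: torus_grad_lift[OF sm])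
    ultimately show ?thesis
      by (simp add: flow_rate_def inner_vec_def sum_divide_distrib sum_distrib_left algebra_simps)
  qed
  ultimately show ?thesis by (simp add: has_field_derivative_def)
qed

text \<open>
  The heat equation in weak form. Gaussian integration by parts trades the factor \<open>z / \<surd>(2t)\<close> in \<open>flow_rate\<close>
  for another space derivative, and the sum over directions is the Laplacian.
\<close>

lemma heat_generator:
  assumes t: "0 < t" and K: "supported_in \<phi> K" "compact K"
  shows "(\<integral>z. fp_gen \<phi> t (tshift x (sqrt (2 * t) *\<^sub>R z)) \<partial>gaussian) = (\<integral>z. flow_rate t x z \<partial>gaussian)"
proof -
  interpret prob_space "gaussian :: (real^'n) measure" by (rule prob_space_gaussian)
  define s where "s = sqrt (2 * t)"
  have s0: "0 < s" using t by (simp add: s_def)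
  define y where "y = rep_torus x"
  define P where "P i = pd (lift_tx \<phi>) (0, axis i 1)" for i
  define PP where "PP i = pd (P i) (0, axis i 1)" for i
  have smP: "smooth (P i)" for i unfolding P_def by (rule smoothD(2)[OF smooth_lift[OF sm]])
  have smPP: "smooth (PP i)" for i unfolding PP_def by (rule smoothD(2)[OF smP])
  have cP: "continuous_on UNIV (\<lambda>z. P i (t, y + s *\<^sub>R z))" for i
    by (rule continuous_on_compose2[OF smoothD(3)[OF smP]]) (auto intro!: continuous_intros)
  have cPP: "continuous_on UNIV (\<lambda>z. PP i (t, y + s *\<^sub>R z))" for i
    by (rule continuous_on_compose2[OF smoothD(3)[OF smPP]]) (auto intro!: continuous_intros)
  obtain B where B: "0 \<le> B" "\<And>t x. norm (torus_grad (\<phi> t) x) \<le> B"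
    by (rule test_bounded[OF sm K], rule that) auto
  have PB: "\<bar>P i (t, y + s *\<^sub>R z)\<bar> \<le> B" for i z
    using order.trans[OF component_le_norm_cart B(2)] torus_grad_lift[OF sm, of t "y + s *\<^sub>R z" i] unfolding P_def by metis
  \<comment> \<open>Second derivatives are periodic in space, hence bounded.\<close>
  have "\<exists>C. \<forall>z. \<bar>PP i (t, z)\<bar> \<le> C" for i
  proof -
    have per: "lift_tx \<phi> (p + (0, k)) = lift_tx \<phi> p" if "k \<in> int_lattice" for k p
      by (cases p) (simp add: lift_tx_def abs_torus_shift[OF that])
    have "P i (p + (0, k)) = P i p" if "k \<in> int_lattice" for k p
      unfolding P_def using frechet_derivative_shift[of "lift_tx \<phi>" "(0, k)" p] per[OF that] by simp
    then have perPP: "PP i (p + (0, k)) = PP i p" if "k \<in> int_lattice" for k p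
      unfolding PP_def using frechet_derivative_shift[of "P i" "(0, k)" p] that by simp
    have "compact ((\<lambda>z. PP i (t, z)) ` cbox 0 1)"
      by (rule compact_continuous_image[OF _ compact_cbox], rule continuous_on_compose2[OF smoothD(3)[OF smPP]])
        (auto intro!: continuous_intros)
    then obtain C where C: "\<And>z. z \<in> cbox 0 1 \<Longrightarrow> \<bar>PP i (t, z)\<bar> \<le> C"
      using compact_imp_bounded[THEN bounded_iff[THEN iffD1]] by fastforce
    have "\<bar>PP i (t, z)\<bar> \<le> C" for z
    proof -
      define k :: "real^'n" where "k = (\<chi> i. - of_int \<lfloor>z $ i\<rfloor>)"
      have "k \<in> int_lattice" by (simp add: int_lattice_def k_def)
      moreover have "z + k \<in> cbox 0 1" by (simp add: mem_box_cart k_def) linarith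
      ultimately show ?thesis using C perPP[of k "(t, z)"] by fastforce
    qed
    then show ?thesis by blast
  qed
  then obtain C where C: "\<And>i z. \<bar>PP i (t, z)\<bar> \<le> C i" by metis
  have ibp: "(\<integral>z. s * PP i (t, y + s *\<^sub>R z) \<partial>gaussian) = (\<integral>z. P i (t, y + s *\<^sub>R z) * (z \<bullet> axis i 1) \<partial>gaussian)" for i
  proof (rule gaussian_integration_by_parts)
    fix z :: "real^'n" and r
    have "(P i has_derivative frechet_derivative (P i) (at (t, y + s *\<^sub>R (z + r *\<^sub>R axis i 1)))) (at (t, y + s *\<^sub>R (z + r *\<^sub>R axis i 1)))"
      by (rule smoothD(1)[OF smP])
    moreover have "((\<lambda>r. (t, y + s *\<^sub>R (z + r *\<^sub>R axis i 1))) has_derivative (\<lambda>h. (0, (s * h) *\<^sub>R axis i 1))) (at r)"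
      by (auto intro!: derivative_eq_intros)
    ultimately have "((\<lambda>r. P i (t, y + s *\<^sub>R (z + r *\<^sub>R axis i 1))) has_derivative
        (\<lambda>h. frechet_derivative (P i) (at (t, y + s *\<^sub>R (z + r *\<^sub>R axis i 1))) (0, (s * h) *\<^sub>R axis i 1))) (at r)"
      using diff_chain_at by (fastforce simp: o_def)
    moreover have "frechet_derivative (P i) (at p) (0, (s * h) *\<^sub>R axis i 1) = s * PP i p * h" for p h
      using linear_scale[OF has_derivative_linear[OF smoothD(1)[OF smP]], of i p "s * h" "(0, axis i 1)"]
      by (simp add: PP_def)
    ultimately show "((\<lambda>r. P i (t, y + s *\<^sub>R (z + r *\<^sub>R axis i 1))) has_real_derivative s * PP i (t, y + s *\<^sub>R (z + r *\<^sub>R axis i 1))) (at r)"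
      by (simp add: has_field_derivative_def)
  next
    show "\<bar>P i (t, y + s *\<^sub>R z)\<bar> \<le> max B (s * C i)" for z using PB[of i z] by simp
    show "\<bar>s * PP i (t, y + s *\<^sub>R z)\<bar> \<le> max B (s * C i)" for z
      using mult_left_mono[OF C[of i "y + s *\<^sub>R z"] less_imp_le[OF s0]] s0 by (simp add: abs_mult le_max_iff_disj)
  qed (auto intro!: continuous_intros cP cPP)
  have bm: "continuous_on UNIV f \<Longrightarrow> f \<in> borel_measurable gaussian" for f :: "real^'n \<Rightarrow> real"
    using borel_measurable_continuous_onI[of f] by (simp cong: measurable_cong_sets)
  have iPP: "integrable gaussian (\<lambda>z. PP i (t, y + s *\<^sub>R z))" for i
    by (rule integrable_const_bound[where B="C i"]) (use C bm[OF cPP] in auto)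
  have iP: "integrable gaussian (\<lambda>z. P i (t, y + s *\<^sub>R z) * (z \<bullet> axis i 1))" for i
  proof (rule Bochner_Integration.integrable_bound)
    show "integrable gaussian (\<lambda>z::real^'n. B * norm z)" using integrable_norm_gaussian[where 'n='n] by simp
    show "(\<lambda>z. P i (t, y + s *\<^sub>R z) * (z \<bullet> axis i 1)) \<in> borel_measurable gaussian"
      by (intro bm continuous_intros cP)
    show "AE z in gaussian. norm (P i (t, y + s *\<^sub>R z) * (z \<bullet> axis i 1)) \<le> norm (B * norm z)"
    proof (rule AE_I2)
      fix z :: "real^'n"
      have "\<bar>P i (t, y + s *\<^sub>R z)\<bar> * \<bar>z $ i\<bar> \<le> B * norm z"
        using PB[of i z] component_le_norm_cart[of z i] B(1) by (intro mult_mono) auto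
      then show "norm (P i (t, y + s *\<^sub>R z) * (z \<bullet> axis i 1)) \<le> norm (B * norm z)"
        using B(1) by (simp add: abs_mult inner_axis)
    qed
  qed
  have dtc: "continuous_on UNIV (\<lambda>z. deriv (\<lambda>s. \<phi> s (tshift x (sqrt (2 * t) *\<^sub>R z))) t)"
  proof -
    have "continuous_on UNIV (\<lambda>z. (t, tshift x (sqrt (2 * t) *\<^sub>R z)))"
      unfolding tshift_def by (intro continuous_intros continuous_on_compose2[OF continuous_on_abs_torus[of UNIV]]) auto
    from continuous_on_compose2[OF continuous_time_deriv[OF sm] this] show ?thesis by simp
  qed
  obtain B' where "0 \<le> B'" and db: "\<And>t x. \<bar>deriv (\<lambda>s. \<phi> s x) t\<bar> \<le> B'"
    by (rule test_bounded[OF sm K], rule that) auto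
  have idt: "integrable gaussian (\<lambda>z. deriv (\<lambda>s. \<phi> s (tshift x (sqrt (2 * t) *\<^sub>R z))) t)"
    by (rule integrable_const_bound[where B=B']) (use db bm[OF dtc] in auto)
  have e1: "fp_gen \<phi> t (tshift x (sqrt (2 * t) *\<^sub>R z)) = deriv (\<lambda>s. \<phi> s (tshift x (sqrt (2 * t) *\<^sub>R z))) t + (\<Sum>i\<in>UNIV. PP i (t, y + s *\<^sub>R z))" for z
    unfolding fp_gen_def tshift_def by (simp add: torus_laplacian_lift[OF sm] y_def s_def PP_def P_def)
  have e2: "flow_rate t x z = deriv (\<lambda>s. \<phi> s (tshift x (sqrt (2 * t) *\<^sub>R z))) t + (\<Sum>i\<in>UNIV. P i (t, y + s *\<^sub>R z) * (z \<bullet> axis i 1)) / s" for z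
  proof -
    have iv: "a \<bullet> z = (\<Sum>i\<in>UNIV. a $ i * (z \<bullet> axis i 1))" for a :: "real^'n"
      by (simp add: inner_vec_def[of a z] inner_axis)
    show ?thesis
      unfolding flow_rate_def tshift_def iv by (simp add: torus_grad_lift[OF sm] y_def s_def P_def)
  qed
  have "(\<integral>z. (\<Sum>i\<in>UNIV. PP i (t, y + s *\<^sub>R z)) \<partial>gaussian) = (\<Sum>i\<in>UNIV. \<integral>z. PP i (t, y + s *\<^sub>R z) \<partial>gaussian)"
    using iPP by simp
  also have "\<dots> = (\<Sum>i\<in>UNIV. (\<integral>z. P i (t, y + s *\<^sub>R z) * (z \<bullet> axis i 1) \<partial>gaussian) / s)"
    using ibp s0 by (intro sum.cong refl) (simp add: field_simps)
  also have "\<dots> = (\<integral>z. (\<Sum>i\<in>UNIV. P i (t, y + s *\<^sub>R z) * (z \<bullet> axis i 1)) / s \<partial>gaussian)"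
    using iP by (simp add: sum_divide_distrib del: inner_axis)
  finally show ?thesis
    unfolding e1 e2 using idt iPP iP by (simp del: inner_axis)
qed

end

section \<open>The heat flow is an uncontrolled trajectory\<close>

lemma integrable_pair_snd:
  fixes g :: "'b \<Rightarrow> real"
  assumes "finite_measure M" "sigma_finite_measure N" and g: "integrable N g"
  shows "integrable (M \<Otimes>\<^sub>M N) (\<lambda>p. g (snd p))"
proof -
  interpret M: finite_measure M by fact
  interpret N: sigma_finite_measure N by fact
  interpret P: pair_sigma_finite M N ..
  have [measurable]: "g \<in> borel_measurable N" using g by simp
  have "integrable (M \<Otimes>\<^sub>M N) (\<lambda>(x, y). g y)"
    by (rule P.Fubini_integrable) (use g in auto)
  then show ?thesis by (simp add: case_prod_beta')
qed

text \<open>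
  By \<open>heat_generator\<close> the integrand is the average over \<open>(x, z)\<close> of the derivative in time of
  \<open>t \<mapsto> \<phi> t (x + \<surd>(2t) z)\<close>. Exchanging integrals, each such derivative integrates to zero because \<open>\<phi>\<close> vanishes
  at the ends of its support, which lies away from the singular time \<open>0\<close>.
\<close>

lemma heat_fp:
  fixes \<phi> :: "real \<Rightarrow> 'n::finite torus \<Rightarrow> real"
  assumes \<mu>: "\<mu> \<in> prob_torus" and I: "I \<in> sets borel" "I \<subseteq> {0..}" and \<phi>: "test_fn I \<phi>"
  shows "(\<integral>t. fp_int \<phi> (heat \<mu>) (\<lambda>_ _. 0) t \<partial>lb I) = 0"
proof -
  obtain K where sm: "smooth_tx \<phi>" and K: "compact K" "K \<subseteq> interior I" "supported_in \<phi> K"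
    using \<phi> by (auto simp: test_fn_def)
  note cl = compact_imp_closed[OF K(1)]
  have KI: "K \<subseteq> I" using K(2) interior_subset by blast
  have "interior I \<subseteq> interior {0..}" using I(2) by (rule interior_mono)
  then have K0: "K \<subseteq> {0<..}" using K(2) by (simp add: interior_real_atLeast)
  obtain p q where pq: "0 < p" "p < q" "K \<subseteq> {p<..<q}"
  proof (cases "K = {}")
    case False
    obtain a where a: "a \<in> K" "\<And>t. t \<in> K \<Longrightarrow> a \<le> t" using compact_attains_inf[OF K(1) False] by blast
    obtain b where b: "b \<in> K" "\<And>t. t \<in> K \<Longrightarrow> t \<le> b" using compact_attains_sup[OF K(1) False] by blast
    have "0 < a" using a K0 by auto
    moreover have "a \<le> b" using a b by auto
    ultimately show ?thesis using a b by (intro that[of "a / 2" "b + 1"]) force+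
  qed (use that[of 1 2] in auto)
  define m where "m = heat \<mu>"
  have m: "prob_curve J m" for J unfolding m_def by (rule prob_curve_heat[OF \<mu>])
  interpret \<mu>: prob_space \<mu> using prob_torusD[OF \<mu>] by blast
  interpret \<gamma>: prob_space "gaussian :: (real^'n) measure" by (rule prob_space_gaussian)
  interpret P: pair_prob_space \<mu> "gaussian :: (real^'n) measure" ..
  let ?P = "\<mu> \<Otimes>\<^sub>M (gaussian :: (real^'n) measure)"
  have sP: "sets ?P = sets (borel \<Otimes>\<^sub>M borel)"
    by (rule sets_pair_measure_cong[OF prob_torusD(1)[OF \<mu>] sets_gaussian])
  let ?L = "lb {p..q}"
  interpret L: finite_measure ?L by (rule finite_measureI) (use pq in \<open>simp add: emeasure_restrict_space\<close>)
  interpret LP: pair_sigma_finite ?L ?P ..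
  obtain B where B: "0 \<le> B" "\<And>t x. \<bar>fp_gen \<phi> t x\<bar> \<le> B" "\<And>t x. norm (torus_grad (\<phi> t) x) \<le> B"
    "\<And>t x. \<bar>deriv (\<lambda>s. \<phi> s x) t\<bar> \<le> B"
    by (rule test_bounded[OF sm K(3,1)], rule that) auto
  note db = B(4)
  define R where "R t w = flow_rate \<phi> t (fst w) (snd w)" for t w
  have Rb: "norm (R t w) \<le> B + (B / sqrt (2 * p)) * norm (snd w)" if t: "p \<le> t" for t w
  proof -
    have "\<bar>torus_grad (\<phi> t) x \<bullet> z\<bar> / sqrt (2 * t) \<le> (B * norm z) / sqrt (2 * p)" for x z
    proof (rule frac_le)
      show "\<bar>torus_grad (\<phi> t) x \<bullet> z\<bar> \<le> B * norm z"
        using Cauchy_Schwarz_ineq2[of "torus_grad (\<phi> t) x" z] mult_right_mono[OF B(3)[of t x] norm_ge_zero[of z]] by linarith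
    qed (use t pq B(1) in auto)
    note g = this
    let ?x = "tshift (fst w) (sqrt (2 * t) *\<^sub>R snd w)"
    have "\<bar>R t w\<bar> \<le> \<bar>deriv (\<lambda>s. \<phi> s ?x) t\<bar> + \<bar>(torus_grad (\<phi> t) ?x \<bullet> snd w) / sqrt (2 * t)\<bar>"
      unfolding R_def flow_rate_def[OF sm] by (rule abs_triangle_ineq)
    also have "\<bar>(torus_grad (\<phi> t) ?x \<bullet> snd w) / sqrt (2 * t)\<bar> = \<bar>torus_grad (\<phi> t) ?x \<bullet> snd w\<bar> / sqrt (2 * t)"
      using t pq by (simp add: abs_divide)
    also have "\<bar>deriv (\<lambda>s. \<phi> s ?x) t\<bar> + \<bar>torus_grad (\<phi> t) ?x \<bullet> snd w\<bar> / sqrt (2 * t) \<le> B + (B * norm (snd w)) / sqrt (2 * p)"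
      by (rule add_mono[OF db g])
    finally show ?thesis by simp
  qed
  have gi: "integrable ?P (\<lambda>w. B + (B / sqrt (2 * p)) * norm (snd w))"
  proof -
    have "integrable ?P (\<lambda>w. norm (snd w))"
      by (rule integrable_pair_snd[OF _ _ integrable_norm_gaussian]) unfold_locales
    then show ?thesis by simp
  qed
  have "(\<lambda>t. t) \<in> ?L \<rightarrow>\<^sub>M borel" by (rule measurable_restrict_space1) simp
  note idm[measurable] = this
  have mp: "(\<lambda>v. (fst v, tshift (fst (snd v)) (sqrt (2 * fst v) *\<^sub>R snd (snd v)))) \<in> ?L \<Otimes>\<^sub>M ?P \<rightarrow>\<^sub>M borel \<Otimes>\<^sub>M borel"
    and mz: "(\<lambda>v. snd (snd v)) \<in> ?L \<Otimes>\<^sub>M ?P \<rightarrow>\<^sub>M borel" and mt: "(\<lambda>v. fst v) \<in> ?L \<Otimes>\<^sub>M ?P \<rightarrow>\<^sub>M borel"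
  proof -
    have f: "(\<lambda>v. fst v) \<in> ?L \<Otimes>\<^sub>M ?P \<rightarrow>\<^sub>M borel" by (rule measurable_compose[OF measurable_fst idm])
    have x: "(\<lambda>v. fst (snd v)) \<in> ?L \<Otimes>\<^sub>M ?P \<rightarrow>\<^sub>M borel"
    proof -
      have "(\<lambda>v. fst (snd v)) \<in> ?L \<Otimes>\<^sub>M ?P \<rightarrow>\<^sub>M \<mu>" by measurable
      then show ?thesis by (simp cong: measurable_cong_sets add: prob_torusD(1)[OF \<mu>])
    qed
    have z: "(\<lambda>v. snd (snd v)) \<in> ?L \<Otimes>\<^sub>M ?P \<rightarrow>\<^sub>M borel"
    proof -
      have "(\<lambda>v. snd (snd v)) \<in> ?L \<Otimes>\<^sub>M ?P \<rightarrow>\<^sub>M (gaussian :: (real^'n) measure)" by measurable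
      then show ?thesis by (simp cong: measurable_cong_sets)
    qed
    note [measurable] = f x z
    show "(\<lambda>v. snd (snd v)) \<in> ?L \<Otimes>\<^sub>M ?P \<rightarrow>\<^sub>M borel" "(\<lambda>v. fst v) \<in> ?L \<Otimes>\<^sub>M ?P \<rightarrow>\<^sub>M borel" by fact+
    show "(\<lambda>v. (fst v, tshift (fst (snd v)) (sqrt (2 * fst v) *\<^sub>R snd (snd v)))) \<in> ?L \<Otimes>\<^sub>M ?P \<rightarrow>\<^sub>M borel \<Otimes>\<^sub>M borel"
      by measurable
  qed
  have dm: "(\<lambda>(t, x). deriv (\<lambda>s. \<phi> s x) t) \<in> borel \<Otimes>\<^sub>M borel \<rightarrow>\<^sub>M borel"
    unfolding borel_prod by (rule borel_measurable_continuous_onI[OF continuous_time_deriv[OF sm]])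
  have gm: "(\<lambda>(t, x). torus_grad (\<phi> t) x) \<in> borel \<Otimes>\<^sub>M borel \<rightarrow>\<^sub>M borel"
    unfolding borel_prod by (rule borel_measurable_continuous_onI[OF continuous_torus_grad[OF sm]])
  have Rm: "(\<lambda>(t, w). R t w) \<in> borel_measurable (?L \<Otimes>\<^sub>M ?P)"
  proof -
    note [measurable] = measurable_compose[OF mp dm, simplified] measurable_compose[OF mp gm, simplified] mz mt
    show ?thesis unfolding R_def flow_rate_def[OF sm] case_prod_beta' by measurable
  qed
  have RmP: "R t \<in> borel_measurable ?P" if "t \<in> {p..q}" for t
    using measurable_Pair2[OF Rm, of t] that by (simp add: space_restrict_space)
  have RiP: "integrable ?P (R t)" if "t \<in> {p..q}" for t
    by (rule Bochner_Integration.integrable_bound[OF gi RmP[OF that]])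
      (rule AE_I2, use Rb[of t] that in \<open>fastforce intro: order.trans[OF _ abs_ge_self]\<close>)
  have Ri: "integrable (?L \<Otimes>\<^sub>M ?P) (\<lambda>(t, w). R t w)"
  proof (rule Bochner_Integration.integrable_bound[OF _ Rm])
    show "integrable (?L \<Otimes>\<^sub>M ?P) (\<lambda>v. B + (B / sqrt (2 * p)) * norm (snd (snd v)))"
      by (rule integrable_pair_snd[OF _ _ gi]) unfold_locales
    show "AE v in ?L \<Otimes>\<^sub>M ?P. norm (case v of (t, w) \<Rightarrow> R t w) \<le> norm (B + (B / sqrt (2 * p)) * norm (snd (snd v)))"
    proof (rule AE_I2)
      fix v assume "v \<in> space (?L \<Otimes>\<^sub>M ?P)"
      then have "p \<le> fst v" by (auto simp: space_pair_measure)
      from Rb[OF this, of "snd v"] show "norm (case v of (t, w) \<Rightarrow> R t w) \<le> norm (B + (B / sqrt (2 * p)) * norm (snd (snd v)))"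
        by (simp add: case_prod_beta')
    qed
  qed
  have step: "fp_int \<phi> m (\<lambda>_ _. 0) t = (\<integral>w. R t w \<partial>?P)" if t: "t \<in> {p..q}" for t
  proof -
    have t0: "0 < t" using t pq by simp
    have fm: "fp_gen \<phi> t \<in> borel_measurable borel"
    proof (rule borel_measurable_continuous_onI)
      have "continuous_on UNIV (\<lambda>x::'n torus. (t, x))" by (intro continuous_intros)
      from continuous_on_compose2[OF continuous_fp_gen[OF sm] this] show "continuous_on UNIV (fp_gen \<phi> t)" by simp
    qed
    have "fp_int \<phi> m (\<lambda>_ _. 0) t = (\<integral>x. fp_gen \<phi> t x \<partial>m t)" by (simp add: fp_int_def)
    also have "\<dots> = (\<integral>x. \<integral>z. fp_gen \<phi> t (tshift x (sqrt (2 * t) *\<^sub>R z)) \<partial>gaussian \<partial>\<mu>)"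
      unfolding m_def heat_def by (rule gaussian_blur(3)[OF \<mu> fm B(2)])
    also have "\<dots> = (\<integral>x. \<integral>z. R t (x, z) \<partial>gaussian \<partial>\<mu>)"
      by (simp add: heat_generator[OF sm t0 K(3,1)] R_def)
    also have "\<dots> = (\<integral>w. R t w \<partial>?P)"
      by (rule P.integral_fst'[OF RiP[OF t]])
    finally show ?thesis .
  qed
  \<comment> \<open>Fundamental theorem of calculus along one random path.\<close>
  have ftc: "(\<integral>t. R t w \<partial>?L) = 0" for w
  proof -
    obtain x z where w: "w = (x, z)" by (cases w)
    have cc: "continuous_on {p..q} (\<lambda>t. (t, tshift x (sqrt (2 * t) *\<^sub>R z)))"
      unfolding tshift_def by (intro continuous_intros continuous_on_compose2[OF continuous_on_abs_torus[of UNIV]]) auto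
    have "continuous_on {p..q} (\<lambda>t. R t w)"
      unfolding R_def w fst_conv snd_conv flow_rate_def[OF sm]
      using pq(1) continuous_on_compose2[OF continuous_time_deriv[OF sm] cc] continuous_on_compose2[OF continuous_torus_grad[OF sm] cc]
      by (intro continuous_intros) auto
    then have "(\<integral>t. indicator {p..q} t *\<^sub>R R t w \<partial>lborel) = \<phi> q (tshift x (sqrt (2 * q) *\<^sub>R z)) - \<phi> p (tshift x (sqrt (2 * p) *\<^sub>R z))"
      using pq flow_rate_derivative[OF sm, of _ x z]
      by (intro integral_FTC_atLeastAtMost)
        (auto simp: R_def w has_real_derivative_iff_has_vector_derivative intro: has_vector_derivative_at_within)
    also have "\<dots> = 0"
    proof -
      have "p \<notin> K" "q \<notin> K" using pq by auto
      then show ?thesis using K(3) by (simp add: supported_in_def)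
    qed
    finally show ?thesis by (simp add: integral_restrict_space)
  qed
  have off: "fp_int \<phi> m (\<lambda>_ _. 0) t = 0" if "t \<notin> K" for t
    using fp_gen_eq_0[OF sm K(3) cl that] by (simp add: fp_int_def)
  have "(\<integral>t. fp_int \<phi> m (\<lambda>_ _. 0) t \<partial>lb I) = (\<integral>t. fp_int \<phi> m (\<lambda>_ _. 0) t \<partial>lb K)"
    by (rule integral_lb_subset[OF KI]) (use cl I off in auto)
  also have "\<dots> = (\<integral>t. fp_int \<phi> m (\<lambda>_ _. 0) t \<partial>?L)"
    by (rule integral_lb_subset[symmetric]) (use cl pq off in auto)
  also have "\<dots> = (\<integral>t. \<integral>w. R t w \<partial>?P \<partial>?L)"
    by (rule Bochner_Integration.integral_cong) (use step in auto)
  also have "\<dots> = (\<integral>w. \<integral>t. R t w \<partial>?L \<partial>?P)"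
    using LP.Fubini_integral[OF Ri] by simp
  also have "\<dots> = 0" by (simp add: ftc)
  finally show ?thesis by (simp add: m_def)
qed

lemma heat_admissible:
  fixes \<mu> :: "'n::finite torus measure"
  assumes \<mu>: "\<mu> \<in> prob_torus" and w: "weight I w" and I: "I \<subseteq> {0..}"
  shows "(heat \<mu>, \<lambda>_ _. 0) \<in> admissible I w \<mu>"
  unfolding admissible_controlled[OF w] controlled_def
  using w prob_curve_heat[OF \<mu>] heat_fp[OF \<mu> weightD(1)[OF w] I] heat_0[OF \<mu>] by auto

section \<open>Mollification and the minorization by the heat flow\<close>

definition cube_unif :: "(real^'n::finite) measure" where
  "cube_unif = density lborel (indicator (cbox 0 One))"

lemma sets_cube_unif [simp]: "sets cube_unif = sets borel" and space_cube_unif [simp]: "space cube_unif = UNIV"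
  by (auto simp: cube_unif_def)

lemma prob_space_cube_unif: "prob_space (cube_unif :: (real^'n::finite) measure)"
proof (rule prob_spaceI)
  have "emeasure (cube_unif :: (real^'n) measure) (space cube_unif) = emeasure lborel (cbox (0::real^'n) One)"
    by (simp add: cube_unif_def emeasure_density)
  also have "\<dots> = 1" by (subst emeasure_lborel_cbox) auto
  finally show "emeasure (cube_unif :: (real^'n) measure) (space cube_unif) = 1" .
qed

lemma norm_cube:
  fixes u :: "real^'n::finite"
  assumes "u \<in> cbox 0 One" shows "norm u \<le> real CARD('n)"
proof -
  have "norm u \<le> (\<Sum>b\<in>Basis. \<bar>u \<bullet> b\<bar>)" by (rule norm_le_l1)
  also have "\<dots> \<le> (\<Sum>b\<in>(Basis :: (real^'n) set). 1)"
    using assms by (intro sum_mono) (auto simp: mem_box)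
  finally show ?thesis by simp
qed

lemma AE_cube_unif: "AE u in (cube_unif :: (real^'n::finite) measure). u \<in> cbox 0 One"
  unfolding cube_unif_def by (subst AE_density) (auto simp: indicator_def)

lemma integrable_norm_cube_unif: "integrable cube_unif (norm :: real^'n::finite \<Rightarrow> real)"
  and integral_norm_cube_unif: "(\<integral>u. norm (u :: real^'n) \<partial>cube_unif) \<le> real CARD('n)"
proof -
  interpret prob_space "cube_unif :: (real^'n) measure" by (rule prob_space_cube_unif)
  have ae: "AE u in (cube_unif :: (real^'n) measure). norm u \<le> real CARD('n)"
    using AE_cube_unif by eventually_elim (rule norm_cube)
  have nm: "(norm :: real^'n \<Rightarrow> real) \<in> borel_measurable cube_unif"
    by (subst measurable_cong_sets[OF sets_cube_unif refl]) simp
  show i: "integrable cube_unif (norm :: real^'n \<Rightarrow> real)"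
    by (rule integrable_const_bound[where B="real CARD('n)"]) (use ae nm in auto)
  have "(\<integral>u. norm (u :: real^'n) \<partial>cube_unif) \<le> (\<integral>u. real CARD('n) \<partial>(cube_unif :: (real^'n) measure))"
    by (rule integral_mono_AE[OF i _ ae]) simp
  then show "(\<integral>u. norm (u :: real^'n) \<partial>cube_unif) \<le> real CARD('n)" using prob_space by simp
qed

definition moll :: "real \<Rightarrow> 'n::finite torus measure \<Rightarrow> 'n torus measure" where
  "moll \<epsilon> \<mu> = blur cube_unif \<epsilon> \<mu>"

lemmas cube_blur = blur_in_prob_torus[OF prob_space_cube_unif sets_cube_unif]
  nn_integral_blur[OF prob_space_cube_unif sets_cube_unif] integral_blur[OF prob_space_cube_unif sets_cube_unif]
  kr_dist_blur[OF prob_space_cube_unif sets_cube_unif]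

lemma moll_in_prob_torus: "\<mu> \<in> prob_torus \<Longrightarrow> moll \<epsilon> \<mu> \<in> prob_torus"
  unfolding moll_def by (rule cube_blur(1))

lemma torus_dist_bounded: "\<exists>D. \<forall>x y :: 'n::finite torus. dist x y \<le> D"
  using diameter_bounded_bound[OF compact_imp_bounded[OF compact_torus]] by blast

text \<open>
  A Doeblin condition. After unit time the heat flow has a density bounded below, whatever the initial law;
  mollified measures have a density bounded above. Concretely, for points \<open>x\<close>, \<open>y\<close> of the torus with
  representatives at distance at most the diameter, the affine substitution \<open>z = t + (\<epsilon> / \<surd>2) u\<close> turns
  \<open>x + \<surd>2 z\<close> into \<open>y + \<epsilon> u\<close> and keeps \<open>z\<close> in a fixed ball, on which the Gaussian density is at least \<open>gauss z0\<close>.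
  The minimum with \<open>1/2\<close> only serves to have \<open>\<kappa> < 1\<close>.
\<close>

lemma minorization:
  assumes \<epsilon>: "0 < \<epsilon>" "\<epsilon> \<le> 1"
  obtains \<kappa> where "0 < \<kappa>" "\<kappa> < 1"
    "\<And>\<rho> \<nu> A. \<rho> \<in> prob_torus \<Longrightarrow> \<nu> \<in> (prob_torus :: 'n::finite torus measure set) \<Longrightarrow> A \<in> sets borel \<Longrightarrow>
       ennreal \<kappa> * emeasure (moll \<epsilon> \<nu>) A \<le> emeasure (heat \<rho> 1) A"
proof -
  obtain D where D: "\<And>x y :: 'n torus. dist x y \<le> D" using torus_dist_bounded by blast
  have D0: "0 \<le> D" using order.trans[OF zero_le_dist D] .
  define R where "R = D + real CARD('n)"
  have "compact (cball (0::real^'n) R)" "cball (0::real^'n) R \<noteq> {}" using D0 by (auto simp: R_def)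
  then have "\<exists>z0\<in>cball (0::real^'n) R. \<forall>z\<in>cball (0::real^'n) R. gauss z0 \<le> gauss z"
    by (rule continuous_attains_inf) (rule continuous_on_subset[OF gauss_continuous subset_UNIV])
  then obtain z0 :: "real^'n" where z0: "\<And>z::real^'n. z \<in> cball 0 R \<Longrightarrow> gauss z0 \<le> gauss z" by blast
  define c where "c = \<epsilon> / sqrt 2"
  have c: "0 < c" "c \<le> 1" using \<epsilon> by (auto simp: c_def field_simps intro: order.trans[of _ 1])
  define \<kappa> where "\<kappa> = min (1/2) (c ^ CARD('n) * gauss z0)"
  have \<kappa>: "0 < \<kappa>" "\<kappa> < 1" using c gauss_pos[of z0] by (auto simp: \<kappa>_def)
  have key: "ennreal \<kappa> * (\<integral>\<^sup>+u. indicator A (tshift y (\<epsilon> *\<^sub>R u)) \<partial>cube_unif) \<le> (\<integral>\<^sup>+z. indicator A (tshift x (sqrt 2 *\<^sub>R z)) \<partial>gaussian)"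
    if A[measurable]: "A \<in> sets borel" for A and x y :: "'n torus"
  proof -
    obtain y' where y': "abs_torus y' = y" "norm (y' - rep_torus x) = dist y x"
      using torus_lift_near[of y "rep_torus x"] by auto
    define t where "t = (1 / sqrt 2) *\<^sub>R (y' - rep_torus x)"
    have eq: "tshift x (sqrt 2 *\<^sub>R (t + c *\<^sub>R u)) = tshift y (\<epsilon> *\<^sub>R u)" for u
    proof -
      have "rep_torus x + sqrt 2 *\<^sub>R (t + c *\<^sub>R u) = y' + \<epsilon> *\<^sub>R u"
        by (simp add: t_def c_def scaleR_add_right)
      then show ?thesis using tshift_abs[of y' "\<epsilon> *\<^sub>R u"] by (simp add: tshift_def y'(1))
    qed
    have gb: "gauss z0 \<le> gauss (t + c *\<^sub>R u)" if "u \<in> cbox 0 One" for u :: "real^'n"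
    proof (rule z0)
      have "norm (t + c *\<^sub>R u) \<le> norm t + norm (c *\<^sub>R u)" by (rule norm_triangle_ineq)
      also have "norm t \<le> D"
      proof -
        have "norm t = (1 / sqrt 2) * dist y x" by (simp add: t_def y'(2))
        also have "\<dots> \<le> 1 * dist y x" by (intro mult_right_mono) (auto simp: divide_le_eq_1 intro: order.trans[of _ 1])
        finally show ?thesis using D[of y x] by simp
      qed
      also have "norm (c *\<^sub>R u) \<le> 1 * real CARD('n)"
        using c norm_cube[OF that] mult_mono[of c 1 "norm u" "real CARD('n)"] by simp
      finally show "t + c *\<^sub>R u \<in> cball 0 R" by (simp add: R_def)
    qed
    have m1: "(\<lambda>z. ennreal (gauss z) * indicator A (tshift x (sqrt 2 *\<^sub>R z))) \<in> borel_measurable borel" by measurable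
    have "(\<integral>\<^sup>+z. indicator A (tshift x (sqrt 2 *\<^sub>R z)) \<partial>gaussian) = (\<integral>\<^sup>+z. ennreal (gauss z) * indicator A (tshift x (sqrt 2 *\<^sub>R z)) \<partial>lborel)"
      unfolding gaussian_def by (subst nn_integral_density) auto
    also have "\<dots> = (\<integral>\<^sup>+z. ennreal (gauss z) * indicator A (tshift x (sqrt 2 *\<^sub>R z)) \<partial>density (distr lborel borel (\<lambda>u. t + c *\<^sub>R u)) (\<lambda>_. ennreal (\<bar>c\<bar> ^ DIM(real^'n))))"
      using lborel_affine[of c t] c by simp
    also have "\<dots> = (\<integral>\<^sup>+u. ennreal (c ^ CARD('n)) * (ennreal (gauss (t + c *\<^sub>R u)) * indicator A (tshift y (\<epsilon> *\<^sub>R u))) \<partial>lborel)"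
      using c m1 by (subst nn_integral_density; simp add: nn_integral_distr eq)
    also have "\<dots> \<ge> (\<integral>\<^sup>+u. ennreal \<kappa> * (indicator (cbox 0 One) u * indicator A (tshift y (\<epsilon> *\<^sub>R u))) \<partial>lborel)"
    proof (rule nn_integral_mono)
      fix u :: "real^'n"
      show "ennreal \<kappa> * (indicator (cbox 0 One) u * indicator A (tshift y (\<epsilon> *\<^sub>R u))) \<le> ennreal (c ^ CARD('n)) * (ennreal (gauss (t + c *\<^sub>R u)) * indicator A (tshift y (\<epsilon> *\<^sub>R u)))"
      proof (cases "u \<in> cbox 0 One")
        case True
        have "\<kappa> \<le> c ^ CARD('n) * gauss z0" by (simp add: \<kappa>_def)
        also have "\<dots> \<le> c ^ CARD('n) * gauss (t + c *\<^sub>R u)" using gb[OF True] c by (intro mult_left_mono) auto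
        finally have "ennreal \<kappa> \<le> ennreal (c ^ CARD('n)) * ennreal (gauss (t + c *\<^sub>R u))"
          using c by (simp add: ennreal_leI flip: ennreal_mult')
        then show ?thesis using True by (auto simp: indicator_def)
      qed simp
    qed
    finally have 1: "(\<integral>\<^sup>+u. ennreal \<kappa> * (indicator (cbox 0 One) u * indicator A (tshift y (\<epsilon> *\<^sub>R u))) \<partial>lborel) \<le> (\<integral>\<^sup>+z. indicator A (tshift x (sqrt 2 *\<^sub>R z)) \<partial>gaussian)" .
    have "(\<integral>\<^sup>+u. indicator A (tshift y (\<epsilon> *\<^sub>R u)) \<partial>cube_unif) = (\<integral>\<^sup>+u. indicator (cbox 0 One) u * indicator A (tshift y (\<epsilon> *\<^sub>R u)) \<partial>lborel)"
      unfolding cube_unif_def by (subst nn_integral_density) auto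
    then show ?thesis using 1 by (subst (asm) nn_integral_cmult) auto
  qed
  show ?thesis
  proof (rule that[OF \<kappa>])
    fix \<rho> \<nu> :: "'n torus measure" and A :: "'n torus set"
    assume P: "\<rho> \<in> prob_torus" "\<nu> \<in> prob_torus" and A[measurable]: "A \<in> sets borel"
    have [measurable_cong]: "sets \<rho> = sets borel" "sets \<nu> = sets borel" using prob_torusD(1) P by auto
    define g where "g y = (\<integral>\<^sup>+u. indicator A (tshift y (\<epsilon> *\<^sub>R u)) \<partial>(cube_unif :: (real^'n) measure))" for y
    define h where "h x = (\<integral>\<^sup>+z. indicator A (tshift x (sqrt 2 *\<^sub>R z)) \<partial>(gaussian :: (real^'n) measure))" for x
    have e1: "emeasure (moll \<epsilon> \<nu>) A = (\<integral>\<^sup>+y. g y \<partial>\<nu>)"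
    proof -
      have "emeasure (moll \<epsilon> \<nu>) A = (\<integral>\<^sup>+x. indicator A x \<partial>moll \<epsilon> \<nu>)"
        using prob_torusD(1)[OF moll_in_prob_torus[OF P(2)]] by simp
      then show ?thesis unfolding moll_def g_def by (subst (asm) cube_blur(2)[OF P(2)]) auto
    qed
    have e2: "emeasure (heat \<rho> 1) A = (\<integral>\<^sup>+x. h x \<partial>\<rho>)"
    proof -
      have "emeasure (heat \<rho> 1) A = (\<integral>\<^sup>+x. indicator A x \<partial>heat \<rho> 1)"
        using prob_torusD(1)[OF heat_in_prob_torus[OF P(1)]] by simp
      then show ?thesis unfolding heat_def h_def by (subst (asm) gaussian_blur(2)[OF P(1)]) auto
    qed
    have le: "ennreal \<kappa> * g y \<le> (\<integral>\<^sup>+x. h x \<partial>\<rho>)" for y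
    proof -
      have "ennreal \<kappa> * g y = (\<integral>\<^sup>+x. ennreal \<kappa> * g y \<partial>\<rho>)" by (rule nn_integral_const_prob[OF prob_torusD(3)[OF P(1)], symmetric])
      also have "\<dots> \<le> (\<integral>\<^sup>+x. h x \<partial>\<rho>)" unfolding g_def h_def by (intro nn_integral_mono key A)
      finally show ?thesis .
    qed
    have gm: "g \<in> borel_measurable \<nu>"
    proof -
      interpret prob_space "cube_unif :: (real^'n) measure" by (rule prob_space_cube_unif)
      have [measurable_cong]: "sets (cube_unif :: (real^'n) measure) = sets borel" by simp
      show ?thesis unfolding g_def by measurable
    qed
    have "ennreal \<kappa> * (\<integral>\<^sup>+y. g y \<partial>\<nu>) = (\<integral>\<^sup>+y. ennreal \<kappa> * g y \<partial>\<nu>)" using gm by (simp add: nn_integral_cmult)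
    also have "\<dots> \<le> (\<integral>\<^sup>+y. (\<integral>\<^sup>+x. h x \<partial>\<rho>) \<partial>\<nu>)" by (intro nn_integral_mono le)
    also have "\<dots> = (\<integral>\<^sup>+x. h x \<partial>\<rho>)" by (rule nn_integral_const_prob[OF prob_torusD(3)[OF P(2)]])
    finally show "ennreal \<kappa> * emeasure (moll \<epsilon> \<nu>) A \<le> emeasure (heat \<rho> 1) A" by (simp add: e1 e2)
  qed
qed

section \<open>Relaxed controls\<close>

abbreviation txq_space :: "real set \<Rightarrow> ((real \<times> 'n::finite torus) \<times> (real^'n)) measure" where
  "txq_space I \<equiv> tx_space I \<Otimes>\<^sub>M borel"

abbreviation fp_relaxed :: "(real \<Rightarrow> 'n::finite torus \<Rightarrow> real) \<Rightarrow> (real \<times> 'n torus) \<times> (real^'n) \<Rightarrow> real" where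
  "fp_relaxed \<phi> w \<equiv> fp_gen \<phi> (fst (fst w)) (snd (fst w)) - snd w \<bullet> torus_grad (\<phi> (fst (fst w))) (snd (fst w))"

lemma borel_measurable_vec_lambda:
  fixes f :: "'n::finite \<Rightarrow> 'a \<Rightarrow> real"
  assumes "\<And>i. f i \<in> borel_measurable M"
  shows "(\<lambda>x. \<chi> i. f i x) \<in> borel_measurable M"
  by (subst borel_measurable_euclidean_space) (auto simp: Basis_vec_def inner_axis assms)

text \<open>
  Doob-Dynkin for a projection: a function measurable with respect to the first coordinate does not depend
  on the second, so any value \<open>e\<close> may be inserted there.
\<close>

lemma measurable_wrt_fst_factor:
  fixes f :: "'a \<times> 'b \<Rightarrow> real"
  assumes f: "f \<in> borel_measurable (vimage_algebra (space (N \<Otimes>\<^sub>M S)) fst N)" and e: "e \<in> space S"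
  shows "(\<lambda>y. f (y, e)) \<in> borel_measurable N" "\<And>y s. y \<in> space N \<Longrightarrow> s \<in> space S \<Longrightarrow> f (y, s) = f (y, e)"
proof -
  let ?F = "vimage_algebra (space (N \<Otimes>\<^sub>M S)) fst N"
  have "(\<lambda>y. (y, e)) \<in> N \<rightarrow>\<^sub>M ?F"
    by (rule measurable_vimage_algebra2) (use e in \<open>auto simp: space_pair_measure\<close>)
  from measurable_compose[OF this f] show "(\<lambda>y. f (y, e)) \<in> borel_measurable N" .
  fix y s assume ys: "y \<in> space N" "s \<in> space S"
  have "f -` {f (y, e)} \<inter> space ?F \<in> sets ?F" using f by (rule measurable_sets) simp
  moreover have "fst \<in> space (N \<Otimes>\<^sub>M S) \<rightarrow> space N" by (auto simp: space_pair_measure)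
  ultimately have "f -` {f (y, e)} \<inter> space ?F \<in> {fst -` A \<inter> space (N \<Otimes>\<^sub>M S) |A. A \<in> sets N}"
    by (simp only: sets_vimage_algebra2)
  then obtain A where A: "A \<in> sets N" "f -` {f (y, e)} \<inter> space ?F = fst -` A \<inter> space (N \<Otimes>\<^sub>M S)"
    by blast
  have "(y, e) \<in> f -` {f (y, e)} \<inter> space ?F" using ys e by (simp add: space_pair_measure)
  then have "(y, e) \<in> fst -` A \<inter> space (N \<Otimes>\<^sub>M S)" unfolding A(2) .
  then have "y \<in> A" by simp
  then have "(y, s) \<in> fst -` A \<inter> space (N \<Otimes>\<^sub>M S)" using ys by (simp add: space_pair_measure)
  then have "(y, s) \<in> f -` {f (y, e)} \<inter> space ?F" unfolding A(2) .
  then have "(y, s) \<in> f -` {f (y, e)}" by blast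
  then show "f (y, s) = f (y, e)" by simp
qed

lemma finite_measure_curve:
  assumes T: "0 \<le> T" and m: "prob_curve {0..T} (m :: real \<Rightarrow> 'n::finite torus measure)"
  shows "finite_measure (curve {0..T} m)" "measure (curve {0..T} m) (space (curve {0..T} m)) = T"
proof -
  have I: "{0..T} \<in> sets borel" "{0..T} \<noteq> {}" using T by auto
  have "emeasure (curve {0..T} m) (space (curve {0..T} m)) = (\<integral>\<^sup>+p. 1 \<partial>curve {0..T} m)" by simp
  also have "\<dots> = (\<integral>\<^sup>+t. 1 \<partial>lb {0..T})"
    using nn_integral_curve_time[OF I m, of "\<lambda>_. 1"] by simp
  also have "\<dots> = ennreal T" using T by (simp add: emeasure_restrict_space)
  finally have e: "emeasure (curve {0..T} m) (space (curve {0..T} m)) = ennreal T" .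
  show "finite_measure (curve {0..T} m)" by (rule finite_measureI) (simp add: e)
  show "measure (curve {0..T} m) (space (curve {0..T} m)) = T" using e T by (simp add: measure_def)
qed

text \<open>
  A control that is randomized: \<open>Q\<close> is a law of (time, position, control) whose first marginal is the curve.
  This set is convex and stable under averaging, unlike that of the controls given by functions.
\<close>

definition relaxed :: "real \<Rightarrow> (real \<Rightarrow> 'n::finite torus measure) \<Rightarrow> ((real \<times> 'n torus) \<times> (real^'n)) measure \<Rightarrow> bool" where
  "relaxed T m Q \<longleftrightarrow> 0 < T \<and> prob_curve {0..T} m \<and> sets Q = sets (txq_space {0..T}) \<and>
     distr Q (tx_space {0..T}) fst = curve {0..T} m \<and> integrable Q (\<lambda>w. (norm (snd w))\<^sup>2) \<and>
     (\<forall>\<phi>. test_fn {0..T} \<phi> \<longrightarrow>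
       (\<integral>w. fp_relaxed \<phi> w \<partial>Q) = 0)"

lemma weight_one: "0 \<le> T \<Longrightarrow> weight {0..T} (\<lambda>_. 1)"
  by (rule weight_Icc) auto

lemma relaxed_finite:
  fixes Q :: "((real \<times> 'n::finite torus) \<times> (real^'n)) measure"
  assumes R: "relaxed T m Q"
  shows "finite_measure Q"
proof (rule finite_measureI)
  let ?N = "tx_space {0..T} :: (real \<times> 'n torus) measure"
  have T: "0 < T" and m: "prob_curve {0..T} m" and sQ: "sets Q = sets (txq_space {0..T})"
    and dQ: "distr Q ?N fst = curve {0..T} m" using R by (auto simp: relaxed_def)
  interpret C: finite_measure "curve {0..T} m" by (rule finite_measure_curve) (use T m in auto)
  have fstm: "fst \<in> Q \<rightarrow>\<^sub>M ?N" using sQ by (simp cong: measurable_cong_sets)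
  have "emeasure Q (space Q) = emeasure (distr Q ?N fst) (space ?N)"
    using emeasure_distr[OF fstm sets.top] measurable_space[OF fstm]
    by (auto intro!: arg_cong[where f="emeasure Q"])
  then show "emeasure Q (space Q) \<noteq> \<infinity>" using C.emeasure_finite by (simp add: dQ)
qed

lemma relaxed_fp_integrable:
  fixes Q :: "((real \<times> 'n::finite torus) \<times> (real^'n)) measure"
  assumes R: "relaxed T m Q" and sm: "smooth_tx \<phi>" and K: "supported_in \<phi> K" "compact K"
  shows "integrable Q (\<lambda>w. fp_relaxed \<phi> w)"
proof -
  have sQ: "sets Q = sets (txq_space {0..T})" and sq: "integrable Q (\<lambda>w. (norm (snd w))\<^sup>2)"
    using R by (auto simp: relaxed_def)
  note [measurable_cong] = sQ
  interpret Q: finite_measure Q by (rule relaxed_finite[OF R])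
  obtain B where B: "0 \<le> B" "\<And>t x. \<bar>fp_gen \<phi> t x\<bar> \<le> B" "\<And>t x. norm (torus_grad (\<phi> t) x) \<le> B"
    by (rule test_bounded[OF sm K], rule that) auto
  have z: "(\<lambda>(t, x). 0) \<in> borel_measurable (tx_space {0..T} :: (real \<times> 'n torus) measure)" by measurable
  note fm = fp_measurable(1,2)[OF sm z]
  have fstm: "fst \<in> Q \<rightarrow>\<^sub>M tx_space {0..T}" by measurable
  note [measurable] = measurable_compose[OF fstm fm(1)] measurable_compose[OF fstm fm(2)]
  show ?thesis
  proof (rule Bochner_Integration.integrable_bound)
    show "integrable Q (\<lambda>w. 2 * B + B * (norm (snd w))\<^sup>2)" using sq by simp
    show "AE w in Q. norm (fp_relaxed \<phi> w) \<le> norm (2 * B + B * (norm (snd w))\<^sup>2)"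
    proof (rule AE_I2)
      fix w :: "(real \<times> 'n torus) \<times> (real^'n)"
      obtain t x q where w: "w = ((t, x), q)" by (metis prod.collapse)
      have "norm q \<le> 1 + (norm q)\<^sup>2" by (rule norm_le_one_plus_square)
      then have "norm q * B \<le> (1 + (norm q)\<^sup>2) * B" using B(1) by (rule mult_right_mono)
      moreover have "\<bar>q \<bullet> torus_grad (\<phi> t) x\<bar> \<le> norm q * B"
        using Cauchy_Schwarz_ineq2[of q "torus_grad (\<phi> t) x"] mult_left_mono[OF B(3)[of t x] norm_ge_zero[of q]] by linarith
      ultimately have "\<bar>fp_gen \<phi> t x - q \<bullet> torus_grad (\<phi> t) x\<bar> \<le> B + (1 + (norm q)\<^sup>2) * B"
        using B(2)[of t x] by linarith
      then show "norm (fp_relaxed \<phi> w) \<le> norm (2 * B + B * (norm (snd w))\<^sup>2)"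
        using abs_ge_self[of "2 * B + B * (norm q)\<^sup>2"] by (simp add: w algebra_simps)
    qed
  qed measurable
qed

context mf_cost begin

text \<open>
  A relaxed control can be replaced by the function \<open>\<alpha>(t, x)\<close> that averages the control given \<open>(t, x)\<close>. The
  equation is affine in the control, so it persists; the running cost is convex in the control, so by Jensen
  it does not increase. The averaged control is a conditional expectation with respect to the projection of
  \<open>Q\<close> onto time and position.
\<close>

lemma relaxed_projection:
  assumes R: "relaxed T m Q"
  obtains \<alpha> where "(m, \<alpha>) \<in> admissible {0..T} (\<lambda>_. 1) (m 0)"
    "cost {0..T} (\<lambda>_. 1) m \<alpha> \<le> (\<integral>w. lag (snd (fst w)) (snd w) \<partial>Q) + (\<integral>t. \<F> (m t) \<partial>lb {0..T})"
proof -
  let ?I = "{0..T}"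
  let ?N = "tx_space ?I :: (real \<times> 'n torus) measure"
  have T: "0 < T" and m: "prob_curve ?I m" and sQ: "sets Q = sets (txq_space ?I)"
    and dQ: "distr Q ?N fst = curve ?I m" and sq: "integrable Q (\<lambda>w. (norm (snd w))\<^sup>2)"
    and fpQ: "\<And>\<phi>. test_fn {0..T} \<phi> \<Longrightarrow>
       (\<integral>w. fp_relaxed \<phi> w \<partial>Q) = 0"
    using R by (auto simp: relaxed_def)
  have w1: "weight ?I (\<lambda>_. 1)" using T by (intro weight_one) simp
  note W = weightD[OF w1]
  note [measurable_cong] = sQ
  have spQ: "space Q = space (txq_space ?I)" using sQ by (rule sets_eq_imp_space_eq)
  have fstm [measurable]: "fst \<in> Q \<rightarrow>\<^sub>M ?N" by measurable
  have sndm [measurable]: "snd \<in> Q \<rightarrow>\<^sub>M borel" by measurable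
  interpret C: finite_measure "curve ?I m" by (rule finite_measure_curve) (use T m in auto)
  interpret Q: finite_measure Q by (rule relaxed_finite[OF R])
  define G where "G = vimage_algebra (space Q) fst ?N"
  have Gf: "fst \<in> G \<rightarrow>\<^sub>M ?N"
    unfolding G_def by (rule measurable_vimage_algebra1) (use measurable_space[OF fstm] in auto)
  have sub: "subalgebra Q G"
    unfolding subalgebra_def G_def using measurable_sets[OF fstm] measurable_space[OF fstm]
    by (auto simp: sets_vimage_algebra2)
  interpret G: finite_measure_subalgebra Q G by unfold_locales (rule sub)
  have iq: "integrable Q (\<lambda>w. norm (snd w))"
  proof (rule Bochner_Integration.integrable_bound)
    show "integrable Q (\<lambda>w. 1 + (norm (snd w))\<^sup>2)" using sq by simp
    have "norm q \<le> 1 + (norm q)\<^sup>2" for q :: "real^'n" by (rule norm_le_one_plus_square)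
    then show "AE w in Q. norm (norm (snd w)) \<le> norm (1 + (norm (snd w))\<^sup>2)" by (simp add: AE_I2)
  qed measurable
  have [measurable]: "(\<lambda>w. snd w $ i) \<in> borel_measurable Q" for i
    by (rule measurable_compose[OF sndm]) (intro borel_measurable_continuous_onI continuous_intros)
  have iqi: "integrable Q (\<lambda>w. snd w $ i)" for i
    by (rule Bochner_Integration.integrable_bound[OF iq]) (auto simp: component_le_norm_cart)
  define E where "E i = real_cond_exp Q G (\<lambda>w. snd w $ i)" for i
  \<comment> \<open>The conditional expectation is a function of \<open>(t, x)\<close>; the control slot is filled with \<open>0\<close>.\<close>
  define \<beta> where "\<beta> y = (\<chi> i. E i (y, 0))" for y
  have GG: "G = vimage_algebra (space (?N \<Otimes>\<^sub>M (borel :: (real^'n) measure))) fst ?N" by (simp add: G_def spQ)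
  have Em: "E i \<in> borel_measurable G" for i unfolding E_def by simp
  have fac1: "(\<lambda>y. E i (y, 0)) \<in> borel_measurable ?N" for i
    by (rule measurable_wrt_fst_factor(1)[OF Em[unfolded GG]]) simp
  have fac2: "E i (y, q) = E i (y, 0)" if "y \<in> space ?N" for i y q
    by (rule measurable_wrt_fst_factor(2)[OF Em[unfolded GG] _ that]) auto
  have \<beta>m [measurable]: "\<beta> \<in> borel_measurable ?N"
    unfolding \<beta>_def by (intro borel_measurable_vec_lambda fac1)
  have E\<beta>: "E i w = \<beta> (fst w) $ i" if "w \<in> space Q" for i w
  proof -
    have "fst w \<in> space ?N" by (rule measurable_space[OF fstm that])
    from fac2[OF this, of i "snd w"] show ?thesis by (simp add: \<beta>_def)
  qed
  have Ei: "integrable Q (E i)" for i unfolding E_def using iqi by (rule G.real_cond_exp_int(1))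
  have \<beta>i: "integrable Q (\<lambda>w. \<beta> (fst w) $ i)" for i
    using Ei[of i] by (rule Bochner_Integration.integrable_cong[THEN iffD1, rotated -1]) (auto simp: E\<beta>)
  have lq: "integrable Q (\<lambda>w. lag (snd (fst w)) (snd w))"
  proof (rule Bochner_Integration.integrable_bound)
    show "integrable Q (\<lambda>w. c * (1 + (norm (snd w))\<^sup>2))" using sq by simp
    show "(\<lambda>w. lag (snd (fst w)) (snd w)) \<in> borel_measurable Q"
    proof -
      have "(\<lambda>w. snd (fst w)) \<in> borel_measurable Q" by measurable
      then show ?thesis by measurable
    qed
    show "AE w in Q. norm (lag (snd (fst w)) (snd w)) \<le> norm (c * (1 + (norm (snd w))\<^sup>2))"
      by (intro AE_I2) (simp only: real_norm_def order.trans[OF l_abs abs_ge_self])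
  qed
  define H where "H = real_cond_exp Q G (\<lambda>w. lag (snd (fst w)) (snd w))"
  have Hi: "integrable Q H" and Hv: "(\<integral>w. H w \<partial>Q) = (\<integral>w. lag (snd (fst w)) (snd w) \<partial>Q)"
    unfolding H_def using G.real_cond_exp_int[OF lq] by auto
  \<comment> \<open>Conditional Jensen, through the countable family of affine minorants of \<open>lag\<close>: the slopes are constants, and the offsets depend on \<open>x\<close> only.\<close>
  obtain pp b where b: "\<And>j::nat. continuous_on UNIV (b j)" and
    pb: "\<And>x q j. pp j \<bullet> q - b j x \<le> lag x q" "\<And>x q e. e > 0 \<Longrightarrow> \<exists>j. lag x q - e < pp j \<bullet> q - b j x"
    using l_affine by blast
  have aff: "AE w in Q. pp j \<bullet> \<beta> (fst w) - b j (snd (fst w)) \<le> H w" for j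
  proof -
    have bjm: "b j \<in> borel_measurable borel" by (rule borel_measurable_continuous_onI[OF b])
    have bG: "(\<lambda>w. b j (snd (fst w))) \<in> borel_measurable G"
      by (rule measurable_compose[OF measurable_compose[OF Gf measurable_snd] bjm])
    have bQ: "(\<lambda>w. b j (snd (fst w))) \<in> borel_measurable Q"
      by (rule measurable_compose[OF measurable_compose[OF fstm measurable_snd] bjm])
    have "bounded (range (b j))"
      using compact_continuous_image[OF b compact_torus] compact_imp_bounded by blast
    then obtain Bj where Bj: "\<And>x. \<bar>b j x\<bar> \<le> Bj" by (auto simp: bounded_iff)
    have ib: "integrable Q (\<lambda>w. b j (snd (fst w)))"
      by (rule Q.integrable_const_bound[where B=Bj]) (use Bj bQ in auto)
    have iv: "pp j \<bullet> q = (\<Sum>i\<in>UNIV. pp j $ i * q $ i)" for q by (simp add: inner_vec_def)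
    have ip: "integrable Q (\<lambda>w. pp j \<bullet> snd w)" unfolding iv using iqi by simp
    have "AE w in Q. real_cond_exp Q G (\<lambda>w. pp j \<bullet> snd w - b j (snd (fst w))) w \<le> H w"
      unfolding H_def by (rule G.real_cond_exp_mono) (use ip ib lq pb(1) in auto)
    moreover have "AE w in Q. real_cond_exp Q G (\<lambda>w. pp j \<bullet> snd w - b j (snd (fst w))) w
        = real_cond_exp Q G (\<lambda>w. pp j \<bullet> snd w) w - real_cond_exp Q G (\<lambda>w. b j (snd (fst w))) w"
      by (rule G.real_cond_exp_diff[OF ip ib])
    moreover have "AE w in Q. real_cond_exp Q G (\<lambda>w. b j (snd (fst w))) w = b j (snd (fst w))"
      by (rule G.real_cond_exp_F_meas[OF ib bG])
    moreover have "AE w in Q. real_cond_exp Q G (\<lambda>w. \<Sum>i\<in>UNIV. pp j $ i * snd w $ i) w = (\<Sum>i\<in>UNIV. real_cond_exp Q G (\<lambda>w. pp j $ i * snd w $ i) w)"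
      by (rule G.real_cond_exp_sum) (use iqi in auto)
    moreover have "AE w in Q. \<forall>i. real_cond_exp Q G (\<lambda>w. pp j $ i * snd w $ i) w = pp j $ i * real_cond_exp Q G (\<lambda>w. snd w $ i) w"
      unfolding AE_finite_all[OF finite, symmetric]
      by (subst AE_finite_allI[of UNIV, simplified]) (use iqi in auto)
    ultimately show ?thesis using AE_space
    proof eventually_elim
      case (elim w)
      then show ?case using E\<beta>[OF elim(6)] by (simp add: iv E_def)
    qed
  qed
  have jensen: "AE w in Q. lag (snd (fst w)) (\<beta> (fst w)) \<le> H w"
  proof -
    have "AE w in Q. \<forall>j. pp j \<bullet> \<beta> (fst w) - b j (snd (fst w)) \<le> H w"
      using aff by (simp add: AE_all_countable)
    then show ?thesis
    proof eventually_elim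
      case (elim w)
      show ?case
      proof (rule field_le_epsilon)
        fix e :: real assume "e > 0"
        then obtain j where "lag (snd (fst w)) (\<beta> (fst w)) - e < pp j \<bullet> \<beta> (fst w) - b j (snd (fst w))" using pb(2) by blast
        then show "lag (snd (fst w)) (\<beta> (fst w)) \<le> H w + e" using elim[rule_format, of j] by linarith
      qed
    qed
  qed
  have \<beta>Q [measurable]: "(\<lambda>w. \<beta> (fst w)) \<in> borel_measurable Q" by (rule measurable_compose[OF fstm \<beta>m])
  have xQ: "(\<lambda>w. snd (fst w)) \<in> borel_measurable Q" by (rule measurable_compose[OF fstm measurable_snd])
  have l\<beta>: "integrable Q (\<lambda>w. lag (snd (fst w)) (\<beta> (fst w)))"
  proof (rule Bochner_Integration.integrable_bound)
    show "integrable Q (\<lambda>w. \<bar>H w\<bar> + c)" using Hi by simp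
    show "(\<lambda>w. lag (snd (fst w)) (\<beta> (fst w))) \<in> borel_measurable Q" using xQ by measurable
    show "AE w in Q. norm (lag (snd (fst w)) (\<beta> (fst w))) \<le> norm (\<bar>H w\<bar> + c)"
      using jensen
    proof eventually_elim
      case (elim w)
      then show ?case using l_ge[of "snd (fst w)" "\<beta> (fst w)"] c1 by (auto simp: abs_le_iff)
    qed
  qed
  \<comment> \<open>Coercivity of \<open>lag\<close> returns an energy bound for the averaged control.\<close>
  have ien: "integrable Q (\<lambda>w. (norm (\<beta> (fst w)))\<^sup>2)"
  proof (rule Bochner_Integration.integrable_bound)
    show "integrable Q (\<lambda>w. c * (lag (snd (fst w)) (\<beta> (fst w)) + c))" using l\<beta> by simp
    have "(norm q)\<^sup>2 \<le> c * (lag x q + c)" for x q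
      using l_lower[of q x] c_pos by (simp add: field_simps)
    then show "AE w in Q. norm ((norm (\<beta> (fst w)))\<^sup>2) \<le> norm (c * (lag (snd (fst w)) (\<beta> (fst w)) + c))"
      by (intro AE_I2) (auto intro: order.trans[OF _ abs_ge_self])
  qed measurable
  define \<alpha> where "\<alpha> t x = \<beta> (t, x)" for t x
  have \<alpha>m: "(\<lambda>(t, x). \<alpha> t x) \<in> borel_measurable ?N" using \<beta>m by (simp add: \<alpha>_def)
  have tr: "(\<integral>y. f y \<partial>curve ?I m) = (\<integral>w. f (fst w) \<partial>Q)" "integrable (curve ?I m) f \<longleftrightarrow> integrable Q (\<lambda>w. f (fst w))"
    if "f \<in> borel_measurable ?N" for f :: "real \<times> 'n torus \<Rightarrow> real"
    unfolding dQ[symmetric] by (rule integral_distr[OF fstm that], rule integrable_distr_eq[OF fstm that])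
  have en: "(\<integral>\<^sup>+p. ennreal (1 * speed2 \<alpha> p) \<partial>curve ?I m) < \<infinity>"
  proof -
    have "(\<lambda>y. (norm (\<beta> y))\<^sup>2) \<in> borel_measurable ?N" by measurable
    from tr(2)[OF this] ien have "integrable (curve ?I m) (\<lambda>y. (norm (\<beta> y))\<^sup>2)" by simp
    from integrableD(2)[OF this] show ?thesis by (simp add: \<alpha>_def less_top)
  qed
  have ctl: "controlled ?I (\<lambda>_. 1) m \<alpha>" unfolding controlled_def using w1 m \<alpha>m en by blast
  have fp: "(\<integral>t. fp_int \<phi> m \<alpha> t \<partial>lb ?I) = 0" if \<phi>: "test_fn ?I \<phi>" for \<phi>
  proof -
    obtain K where K: "supported_in \<phi> K" "compact K" and sm: "smooth_tx \<phi>" using \<phi> by (auto simp: test_fn_def)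
    obtain B where B: "0 \<le> B" "\<And>t x. \<bar>fp_gen \<phi> t x\<bar> \<le> B" "\<And>t x. norm (torus_grad (\<phi> t) x) \<le> B"
      by (rule test_bounded[OF sm K], rule that) auto
    note fm = fp_measurable[OF sm \<alpha>m]
    have gim: "(\<lambda>y. torus_grad (\<phi> (fst y)) (snd y) $ i) \<in> borel_measurable ?N" for i
      by (rule measurable_compose[OF fm(2)]) (intro borel_measurable_continuous_onI continuous_intros)
    have gG: "(\<lambda>w. torus_grad (\<phi> (fst (fst w))) (snd (fst w)) $ i) \<in> borel_measurable G" for i
      by (rule measurable_compose[OF Gf gim])
    have gQ [measurable]: "(\<lambda>w. torus_grad (\<phi> (fst (fst w))) (snd (fst w)) $ i) \<in> borel_measurable Q" for i
      by (rule measurable_compose[OF fstm gim])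
    have gb: "\<bar>torus_grad (\<phi> t) x $ i\<bar> \<le> B" for t x i
      using component_le_norm_cart B(3) by (rule order.trans)
    have igq: "integrable Q (\<lambda>w. torus_grad (\<phi> (fst (fst w))) (snd (fst w)) $ i * snd w $ i)" for i
    proof (rule Bochner_Integration.integrable_bound)
      show "integrable Q (\<lambda>w. B * \<bar>snd w $ i\<bar>)" using iqi by simp
      show "AE w in Q. norm (torus_grad (\<phi> (fst (fst w))) (snd (fst w)) $ i * snd w $ i) \<le> norm (B * \<bar>snd w $ i\<bar>)"
        using gb B(1) by (intro AE_I2) (simp add: abs_mult mult_right_mono)
    qed measurable
    have qE: "(\<integral>w. torus_grad (\<phi> (fst (fst w))) (snd (fst w)) $ i * snd w $ i \<partial>Q)
        = (\<integral>w. torus_grad (\<phi> (fst (fst w))) (snd (fst w)) $ i * \<beta> (fst w) $ i \<partial>Q)"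
      and ig\<beta>: "integrable Q (\<lambda>w. torus_grad (\<phi> (fst (fst w))) (snd (fst w)) $ i * \<beta> (fst w) $ i)" for i
    proof -
      note ci = G.real_cond_exp_intg[OF igq gG, of i]
      have cong: "\<And>w. w \<in> space Q \<Longrightarrow> torus_grad (\<phi> (fst (fst w))) (snd (fst w)) $ i * real_cond_exp Q G (\<lambda>w. snd w $ i) w
         = torus_grad (\<phi> (fst (fst w))) (snd (fst w)) $ i * \<beta> (fst w) $ i"
        using E\<beta> by (simp add: E_def)
      have "(\<lambda>w. snd w $ i) \<in> borel_measurable Q" by measurable
      note ci = ci[OF this]
      show "integrable Q (\<lambda>w. torus_grad (\<phi> (fst (fst w))) (snd (fst w)) $ i * \<beta> (fst w) $ i)"
        using ci(1) by (rule iffD1[OF Bochner_Integration.integrable_cong[OF refl cong], rotated])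
      show "(\<integral>w. torus_grad (\<phi> (fst (fst w))) (snd (fst w)) $ i * snd w $ i \<partial>Q)
        = (\<integral>w. torus_grad (\<phi> (fst (fst w))) (snd (fst w)) $ i * \<beta> (fst w) $ i \<partial>Q)"
      proof -
        have "(\<integral>w. torus_grad (\<phi> (fst (fst w))) (snd (fst w)) $ i * real_cond_exp Q G (\<lambda>w. snd w $ i) w \<partial>Q)
          = (\<integral>w. torus_grad (\<phi> (fst (fst w))) (snd (fst w)) $ i * \<beta> (fst w) $ i \<partial>Q)"
          by (rule Bochner_Integration.integral_cong[OF refl cong])
        then show ?thesis using ci(2) by simp
      qed
    qed
    have fgQ: "(\<lambda>w. fp_gen \<phi> (fst (fst w)) (snd (fst w))) \<in> borel_measurable Q"
      by (rule measurable_compose[OF fstm fm(1)])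
    have ifg: "integrable Q (\<lambda>w. fp_gen \<phi> (fst (fst w)) (snd (fst w)))"
      by (rule Q.integrable_const_bound[where B=B]) (use B fgQ in auto)
    have iv: "q \<bullet> g = (\<Sum>i\<in>UNIV. g $ i * q $ i)" for q g :: "real^'n" by (simp add: inner_vec_def mult.commute)
    have "(\<integral>t. fp_int \<phi> m \<alpha> t \<partial>lb ?I) = (\<integral>p. fp_along \<phi> \<alpha> p \<partial>curve ?I m)"
      using fp_LINT_eq[OF w1 m \<alpha>m en \<phi>] by (simp add: fp_int_def LINT_lb)
    also have "\<dots> = (\<integral>w. fp_gen \<phi> (fst (fst w)) (snd (fst w)) - \<beta> (fst w) \<bullet> torus_grad (\<phi> (fst (fst w))) (snd (fst w)) \<partial>Q)"
      using tr(1)[OF fm(3)] by (simp add: \<alpha>_def)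
    also have "\<dots> = (\<integral>w. fp_gen \<phi> (fst (fst w)) (snd (fst w)) \<partial>Q) - (\<Sum>i\<in>UNIV. \<integral>w. torus_grad (\<phi> (fst (fst w))) (snd (fst w)) $ i * \<beta> (fst w) $ i \<partial>Q)"
      unfolding iv using ifg ig\<beta> by simp
    also have "\<dots> = (\<integral>w. fp_relaxed \<phi> w \<partial>Q)"
      unfolding iv using ifg igq by (simp add: qE)
    also have "\<dots> = 0" by (rule fpQ[OF \<phi>])
    finally show ?thesis .
  qed
  have ad: "(m, \<alpha>) \<in> admissible ?I (\<lambda>_. 1) (m 0)"
    unfolding admissible_controlled[OF w1] using ctl fp by auto
  have lm: "(\<lambda>y. lag (snd y) (\<beta> y)) \<in> borel_measurable ?N" by measurable
  have "(\<integral>p. lag (snd p) (\<alpha> (fst p) (snd p)) \<partial>curve ?I m) = (\<integral>w. lag (snd (fst w)) (\<beta> (fst w)) \<partial>Q)"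
    using tr(1)[OF lm] by (simp add: \<alpha>_def)
  also have "\<dots> \<le> (\<integral>w. H w \<partial>Q)" by (rule integral_mono_AE[OF l\<beta> Hi jensen])
  finally have "cost ?I (\<lambda>_. 1) m \<alpha> \<le> (\<integral>w. lag (snd (fst w)) (snd w) \<partial>Q) + (\<integral>t. \<F> (m t) \<partial>lb {0..T})"
    using admissible_costs(6)[OF w1 ad] Hv by simp
  with ad show ?thesis by (rule that)
qed

end

section \<open>Mixing and mollifying controlled trajectories\<close>

lemma measure_eqI_nn_integral:
  assumes "sets M = sets N" "\<And>g. g \<in> borel_measurable N \<Longrightarrow> (\<integral>\<^sup>+x. g x \<partial>M) = (\<integral>\<^sup>+x. g x \<partial>N)"
  shows "M = N"
proof (rule measure_eqI)
  fix A assume "A \<in> sets M"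
  then show "emeasure M A = emeasure N A"
    using assms(1) assms(2)[of "indicator A"] by simp
qed fact

lemma integrable_pair_fst:
  fixes g :: "'a \<Rightarrow> real"
  assumes "finite_measure M" "prob_space N" and g: "integrable M g"
  shows "integrable (M \<Otimes>\<^sub>M N) (\<lambda>p. g (fst p))" "(\<integral>p. g (fst p) \<partial>(M \<Otimes>\<^sub>M N)) = (\<integral>x. g x \<partial>M)"
proof -
  interpret M: finite_measure M by fact
  interpret N: prob_space N by fact
  interpret P: pair_sigma_finite M N ..
  have [measurable]: "g \<in> borel_measurable M" using g by simp
  have "integrable (M \<Otimes>\<^sub>M N) (\<lambda>(x, y). g x)"
    by (rule P.Fubini_integrable) (use g in \<open>auto simp: N.prob_space\<close>)
  then show i: "integrable (M \<Otimes>\<^sub>M N) (\<lambda>p. g (fst p))" by (simp add: case_prod_beta')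
  show "(\<integral>p. g (fst p) \<partial>(M \<Otimes>\<^sub>M N)) = (\<integral>x. g x \<partial>M)"
    using P.integral_fst'[OF i] by (simp add: N.prob_space)
qed

lemma integrable_pair_prod:
  fixes g :: "'a \<Rightarrow> real" and h :: "'b \<Rightarrow> real"
  assumes "finite_measure M" "prob_space N" and g: "integrable M g" and h: "integrable N h"
  shows "integrable (M \<Otimes>\<^sub>M N) (\<lambda>p. g (fst p) * h (snd p))" "(\<integral>p. g (fst p) * h (snd p) \<partial>(M \<Otimes>\<^sub>M N)) = (\<integral>x. g x \<partial>M) * (\<integral>y. h y \<partial>N)"
proof -
  interpret M: finite_measure M by fact
  interpret N: prob_space N by fact
  interpret P: pair_sigma_finite M N ..
  have [measurable]: "g \<in> borel_measurable M" "h \<in> borel_measurable N" using g h by auto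
  have "integrable (M \<Otimes>\<^sub>M N) (\<lambda>(x, y). g x * h y)"
    by (rule P.Fubini_integrable) (use g h in \<open>auto simp: abs_mult\<close>)
  then show i: "integrable (M \<Otimes>\<^sub>M N) (\<lambda>p. g (fst p) * h (snd p))" by (simp add: case_prod_beta')
  show "(\<integral>p. g (fst p) * h (snd p) \<partial>(M \<Otimes>\<^sub>M N)) = (\<integral>x. g x \<partial>M) * (\<integral>y. h y \<partial>N)"
    using P.integral_fst'[OF i] by simp
qed

lemma kr_dist_bounded: "\<exists>D\<ge>0. \<forall>\<mu>\<in>prob_torus. \<forall>\<nu>\<in>prob_torus. kr_dist \<mu> (\<nu> :: 'n::finite torus measure) \<le> D"
proof -
  obtain D where D: "\<And>x y :: 'n torus. dist x y \<le> D" using torus_dist_bounded by blast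
  have D0: "0 \<le> D" using order.trans[OF zero_le_dist D] .
  have *: "\<bar>(\<integral>x. \<phi> x \<partial>\<mu>) - \<phi> a\<bar> \<le> D" if "\<mu> \<in> prob_torus" "1-lipschitz_on UNIV \<phi>" for \<mu> and \<phi> :: "'n torus \<Rightarrow> real" and a
  proof -
    interpret prob_space \<mu> using prob_torusD[OF that(1)] by blast
    note i = lipschitz_integrable[OF that]
    have "(\<integral>x. \<phi> x \<partial>\<mu>) - \<phi> a = (\<integral>x. \<phi> x - \<phi> a \<partial>\<mu>)" using i by (simp add: prob_space)
    also have "\<bar>\<dots>\<bar> \<le> (\<integral>x. \<bar>\<phi> x - \<phi> a\<bar> \<partial>\<mu>)" by (rule integral_abs_bound)
    also have "\<dots> \<le> (\<integral>x. D \<partial>\<mu>)"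
    proof (rule integral_mono)
      show "\<bar>\<phi> x - \<phi> a\<bar> \<le> D" for x
        using lipschitz_onD[OF that(2), of x a] D[of x a] by (simp add: dist_real_def)
    qed (use i in auto)
    finally show ?thesis by (simp add: prob_space)
  qed
  have "kr_dist \<mu> \<nu> \<le> 2 * D" if "\<mu> \<in> prob_torus" "\<nu> \<in> prob_torus" for \<mu> \<nu> :: "'n torus measure"
  proof (rule kr_dist_least[OF that])
    fix \<phi> :: "'n torus \<Rightarrow> real" assume "1-lipschitz_on UNIV \<phi>"
    from *[OF that(1) this, of undefined] *[OF that(2) this, of undefined]
    show "(\<integral>x. \<phi> x \<partial>\<mu>) - (\<integral>x. \<phi> x \<partial>\<nu>) \<le> 2 * D" by linarith
  qed
  then show ?thesis using D0 by (intro exI[of _ "2 * D"]) auto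
qed

lemma kr_dist_mix_left:
  assumes P: "\<mu> \<in> prob_torus" "\<nu> \<in> prob_torus" and r: "0 \<le> r" "r \<le> 1"
  shows "kr_dist (mix r \<mu> \<nu>) \<mu> \<le> r * kr_dist \<nu> (\<mu> :: 'n::finite torus measure)"
proof (rule kr_dist_least)
  fix \<phi> :: "'n torus \<Rightarrow> real" assume \<phi>: "1-lipschitz_on UNIV \<phi>"
  have "(\<integral>x. \<phi> x \<partial>mix r \<mu> \<nu>) - (\<integral>x. \<phi> x \<partial>\<mu>) = r * ((\<integral>x. \<phi> x \<partial>\<nu>) - (\<integral>x. \<phi> x \<partial>\<mu>))"
    using r by (simp add: integral_mix prob_torusD(1)[OF P(1)] prob_torusD(1)[OF P(2)]
      lipschitz_integrable[OF P(1) \<phi>] lipschitz_integrable[OF P(2) \<phi>] algebra_simps)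
  also have "\<dots> \<le> r * kr_dist \<nu> \<mu>" by (intro mult_left_mono kr_dist_upper P \<phi> r)
  finally show "(\<integral>x. \<phi> x \<partial>mix r \<mu> \<nu>) - (\<integral>x. \<phi> x \<partial>\<mu>) \<le> r * kr_dist \<nu> \<mu>" .
qed (use mix_in_prob_torus P r in auto)

lemma prob_curve_moll:
  assumes m: "prob_curve I m"
  shows "prob_curve I (\<lambda>t. moll \<epsilon> (m t))"
  unfolding prob_curve_iff
proof (intro conjI ballI allI impI moll_in_prob_torus prob_curveD[OF m])
  fix t and e :: real assume te: "t \<in> I" "e > 0"
  have "\<forall>t\<in>I. \<forall>e>0. \<exists>d>0. \<forall>s\<in>I. dist s t < d \<longrightarrow> kr_dist (m t) (m s) < e"
    using m by (simp add: prob_curve_iff)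
  with te obtain d where d: "d > 0" "\<forall>s\<in>I. dist s t < d \<longrightarrow> kr_dist (m t) (m s) < e" by blast
  show "\<exists>d>0. \<forall>s\<in>I. dist s t < d \<longrightarrow> kr_dist (moll \<epsilon> (m t)) (moll \<epsilon> (m s)) < e"
  proof (intro exI[of _ d] conjI ballI impI d(1))
    fix s assume s: "s \<in> I" "dist s t < d"
    have "kr_dist (moll \<epsilon> (m t)) (moll \<epsilon> (m s)) \<le> kr_dist (m t) (m s)"
      unfolding moll_def
      using cube_blur(4)[OF prob_curveD[OF m te(1)] prob_curveD[OF m s(1)] integrable_norm_cube_unif, of \<epsilon> \<epsilon>] by simp
    then show "kr_dist (moll \<epsilon> (m t)) (moll \<epsilon> (m s)) < e" using d(2) s by fastforce
  qed
qed

lemma kr_dist_moll: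
  assumes \<mu>: "\<mu> \<in> prob_torus" and \<epsilon>: "0 \<le> \<epsilon>"
  shows "kr_dist (moll \<epsilon> \<mu>) (\<mu> :: 'n::finite torus measure) \<le> \<epsilon> * real CARD('n)"
proof -
  have "kr_dist (moll \<epsilon> \<mu>) \<mu> = kr_dist (blur cube_unif \<epsilon> \<mu>) (blur cube_unif 0 \<mu>)"
    by (simp add: moll_def blur_zero[OF prob_space_cube_unif _ \<mu>])
  also have "\<dots> \<le> kr_dist \<mu> \<mu> + \<bar>\<epsilon> - 0\<bar> * (\<integral>z. norm (z :: real^'n) \<partial>cube_unif)"
    by (rule cube_blur(4)[OF \<mu> \<mu> integrable_norm_cube_unif])
  also have "kr_dist \<mu> \<mu> = 0" using Metric_space.mdist_zero[OF Metric_space_prob_torus \<mu>] .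
  also have "0 + \<bar>\<epsilon> - 0\<bar> * (\<integral>z. norm (z :: real^'n) \<partial>cube_unif) \<le> \<epsilon> * real CARD('n)"
    using \<epsilon> integral_norm_cube_unif[where 'n='n] by (simp add: mult_left_mono)
  finally show ?thesis .
qed

lemma relaxed_mix:
  assumes R1: "relaxed T m1 Q1" and R2: "relaxed T m2 Q2" and r: "0 \<le> r" "r \<le> 1"
  shows "relaxed T (\<lambda>t. mix r (m1 t) (m2 t)) (mix r Q1 Q2)"
proof -
  let ?I = "{0..T}"
  let ?N = "tx_space ?I :: (real \<times> 'a torus) measure"
  have T: "0 < T" and m1: "prob_curve ?I m1" and m2: "prob_curve ?I m2"
    and s1: "sets Q1 = sets (txq_space ?I)" and s2: "sets Q2 = sets (txq_space ?I)"
    and d1: "distr Q1 ?N fst = curve ?I m1" and d2: "distr Q2 ?N fst = curve ?I m2"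
    and i1: "integrable Q1 (\<lambda>w. (norm (snd w))\<^sup>2)" and i2: "integrable Q2 (\<lambda>w. (norm (snd w))\<^sup>2)"
    using R1 R2 by (auto simp: relaxed_def)
  note f1 = R1[unfolded relaxed_def, THEN conjunct2, THEN conjunct2, THEN conjunct2, THEN conjunct2, THEN conjunct2]
  note f2 = R2[unfolded relaxed_def, THEN conjunct2, THEN conjunct2, THEN conjunct2, THEN conjunct2, THEN conjunct2]
  have I: "?I \<in> sets borel" "?I \<noteq> {}" using T by auto
  have s12: "sets Q2 = sets Q1" using s1 s2 by simp
  have m: "prob_curve ?I (\<lambda>t. mix r (m1 t) (m2 t))" by (rule prob_curve_mix[OF m1 m2 r])
  have fst1: "fst \<in> Q1 \<rightarrow>\<^sub>M ?N" "fst \<in> Q2 \<rightarrow>\<^sub>M ?N" "fst \<in> mix r Q1 Q2 \<rightarrow>\<^sub>M ?N"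
    using s1 s2 by (simp_all cong: measurable_cong_sets)
  have d: "distr (mix r Q1 Q2) ?N fst = curve ?I (\<lambda>t. mix r (m1 t) (m2 t))"
  proof (rule measure_eqI_nn_integral)
    show "sets (distr (mix r Q1 Q2) ?N fst) = sets (curve ?I (\<lambda>t. mix r (m1 t) (m2 t)))"
      by (simp add: sets_curve[OF I m])
    fix g :: "real \<times> 'a torus \<Rightarrow> ennreal" assume "g \<in> borel_measurable (curve ?I (\<lambda>t. mix r (m1 t) (m2 t)))"
    then have g: "g \<in> borel_measurable ?N" by (simp cong: measurable_cong_sets add: sets_curve[OF I m])
    have gf: "(\<lambda>w. g (fst w)) \<in> borel_measurable Q1" by (rule measurable_compose[OF fst1(1) g])
    have "(\<integral>\<^sup>+p. g p \<partial>distr (mix r Q1 Q2) ?N fst) = ennreal (1 - r) * (\<integral>\<^sup>+w. g (fst w) \<partial>Q1) + ennreal r * (\<integral>\<^sup>+w. g (fst w) \<partial>Q2)"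
      by (simp add: nn_integral_distr[OF fst1(3)] g nn_integral_mix[OF s12 gf])
    also have "(\<integral>\<^sup>+w. g (fst w) \<partial>Q1) = (\<integral>\<^sup>+p. g p \<partial>curve ?I m1)"
      unfolding d1[symmetric] by (simp add: nn_integral_distr[OF fst1(1)] g)
    also have "(\<integral>\<^sup>+w. g (fst w) \<partial>Q2) = (\<integral>\<^sup>+p. g p \<partial>curve ?I m2)"
      unfolding d2[symmetric] by (simp add: nn_integral_distr[OF fst1(2)] g)
    also have "ennreal (1 - r) * (\<integral>\<^sup>+p. g p \<partial>curve ?I m1) + ennreal r * (\<integral>\<^sup>+p. g p \<partial>curve ?I m2)
      = (\<integral>\<^sup>+t. ennreal (1 - r) * (\<integral>\<^sup>+x. g (t, x) \<partial>m1 t) + ennreal r * (\<integral>\<^sup>+x. g (t, x) \<partial>m2 t) \<partial>lb ?I)"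
      using inner_nn_measurable[OF I m1 g] inner_nn_measurable[OF I m2 g]
      by (simp add: nn_integral_curve[OF I m1 g] nn_integral_curve[OF I m2 g] nn_integral_add nn_integral_cmult)
    also have "\<dots> = (\<integral>\<^sup>+t. \<integral>\<^sup>+x. g (t, x) \<partial>mix r (m1 t) (m2 t) \<partial>lb ?I)"
    proof (rule nn_integral_cong)
      fix t assume "t \<in> space (lb ?I)"
      then have t: "t \<in> ?I" by simp
      have "sets (m2 t) = sets (m1 t)" using sets_m[OF I m1 t] sets_m[OF I m2 t] by simp
      from nn_integral_mix[OF this slice_measurable[OF I m1 g t], of r]
      show "ennreal (1 - r) * (\<integral>\<^sup>+x. g (t, x) \<partial>m1 t) + ennreal r * (\<integral>\<^sup>+x. g (t, x) \<partial>m2 t) = (\<integral>\<^sup>+x. g (t, x) \<partial>mix r (m1 t) (m2 t))" by simp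
    qed
    finally show "(\<integral>\<^sup>+p. g p \<partial>distr (mix r Q1 Q2) ?N fst) = (\<integral>\<^sup>+p. g p \<partial>curve ?I (\<lambda>t. mix r (m1 t) (m2 t)))"
      by (simp add: nn_integral_curve[OF I m g])
  qed
  have fp: "(\<integral>w. fp_relaxed \<phi> w \<partial>mix r Q1 Q2) = 0"
    if \<phi>: "test_fn ?I \<phi>" for \<phi>
  proof -
    obtain K where K: "supported_in \<phi> K" "compact K" and sm: "smooth_tx \<phi>" using \<phi> by (auto simp: test_fn_def)
    have int: "integrable Q (\<lambda>w. fp_relaxed \<phi> w)"
      if R: "relaxed T m Q" for m Q
      by (rule relaxed_fp_integrable[OF R sm K])
    show ?thesis
      using f1 f2 \<phi> by (simp add: integral_mix[OF s12 int[OF R1] int[OF R2] r])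
  qed
  show ?thesis
    unfolding relaxed_def using T m d fp s1 integrable_mix[OF s12 i1 i2] by simp
qed

context mf_cost begin

lemma F_integrable:
  assumes "0 \<le> T" "prob_curve {0..T} m"
  shows "integrable (lb {0..T}) (\<lambda>t. \<F> (m t))"
proof -
  interpret finite_measure "lb {0..T}" by (rule finite_measureI) (use assms in \<open>simp add: emeasure_restrict_space\<close>)
  have "(\<lambda>t. \<F> (m t)) \<in> borel_measurable (lb {0..T})"
    by (rule lb_measurable[OF borel_measurable_continuous_on_restrict[OF F_continuous[OF assms(2)]]])
  then show ?thesis
    by (intro integrable_const_bound[where B=c]) (auto intro!: AE_I2 F_bound prob_curveD[OF assms(2)])
qed

lemma integral_lb_const: "0 \<le> T \<Longrightarrow> (\<integral>t. k \<partial>lb {0..T}) = T * (k :: real)"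
  "0 \<le> T \<Longrightarrow> integrable (lb {0..T}) (\<lambda>t. k :: real)"
  by (simp_all add: measure_restrict_space integrable_restrict_space)

text \<open>
  An ordinary control as a relaxed one, concentrated on its graph.
\<close>

lemma strict_relaxed:
  assumes T: "0 < T" and ad: "(m, \<alpha>) \<in> admissible {0..T} (\<lambda>_. 1) m0"
  shows "relaxed T m (distr (curve {0..T} m) (txq_space {0..T}) (\<lambda>p. (p, \<alpha> (fst p) (snd p))))"
    "(\<integral>w. lag (snd (fst w)) (snd w) \<partial>distr (curve {0..T} m) (txq_space {0..T}) (\<lambda>p. (p, \<alpha> (fst p) (snd p)))) = (\<integral>p. lag (snd p) (\<alpha> (fst p) (snd p)) \<partial>curve {0..T} m)"
    "integrable (distr (curve {0..T} m) (txq_space {0..T}) (\<lambda>p. (p, \<alpha> (fst p) (snd p)))) (\<lambda>w. lag (snd (fst w)) (snd w))"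
proof -
  let ?I = "{0..T}"
  have w1: "weight ?I (\<lambda>_. 1)" using T by (intro weight_one) simp
  note W = weightD[OF w1]
  have ctl: "controlled ?I (\<lambda>_. 1) m \<alpha>" and fp: "\<And>\<phi>. test_fn ?I \<phi> \<Longrightarrow> (\<integral>t. fp_int \<phi> m \<alpha> t \<partial>lb ?I) = 0"
    using ad by (auto simp: admissible_controlled[OF w1])
  have m: "prob_curve ?I m" and \<alpha>: "(\<lambda>(t, x). \<alpha> t x) \<in> borel_measurable (tx_space ?I)"
    and e: "(\<integral>\<^sup>+p. ennreal (1 * speed2 \<alpha> p) \<partial>curve ?I m) < \<infinity>"
    using ctl by (auto simp: controlled_def)
  let ?f = "\<lambda>p. (p, \<alpha> (fst p) (snd p))"
  let ?Q = "distr (curve ?I m) (txq_space ?I) ?f"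
  have fm: "?f \<in> curve ?I m \<rightarrow>\<^sub>M txq_space ?I"
  proof (rule curve_measurable[OF W(1,2) m])
    have [measurable]: "(\<lambda>p. \<alpha> (fst p) (snd p)) \<in> borel_measurable (tx_space ?I)" using \<alpha> by (simp add: case_prod_beta')
    show "?f \<in> tx_space ?I \<rightarrow>\<^sub>M txq_space ?I" by measurable
  qed
  have dist: "distr ?Q (tx_space ?I) fst = curve ?I m"
  proof -
    have "distr ?Q (tx_space ?I) fst = distr (curve ?I m) (tx_space ?I) (fst \<circ> ?f)"
      by (rule distr_distr[OF measurable_fst fm])
    also have "\<dots> = distr (curve ?I m) (curve ?I m) (\<lambda>p. p)"
      by (rule distr_cong) (auto simp: sets_curve[OF W(1,2) m])
    finally show ?thesis by simp
  qed
  have ien: "integrable ?Q (\<lambda>w. (norm (snd w))\<^sup>2)"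
    using admissible_costs(1)[OF w1 ad] by (subst integrable_distr_eq[OF fm]) auto
  have fpQ: "(\<integral>w. fp_relaxed \<phi> w \<partial>?Q) = 0"
    if \<phi>: "test_fn ?I \<phi>" for \<phi>
  proof -
    have sm: "smooth_tx \<phi>" using \<phi> by (auto simp: test_fn_def)
    note fm' = fp_measurable[OF sm \<alpha>]
    have [measurable]: "(\<lambda>w. fp_gen \<phi> (fst (fst w)) (snd (fst w))) \<in> borel_measurable (txq_space ?I)"
      "(\<lambda>w. torus_grad (\<phi> (fst (fst w))) (snd (fst w))) \<in> borel_measurable (txq_space ?I)"
      using measurable_compose[OF measurable_fst fm'(1)] measurable_compose[OF measurable_fst fm'(2)] by auto
    have "(\<integral>w. fp_relaxed \<phi> w \<partial>?Q)
      = (\<integral>p. fp_along \<phi> \<alpha> p \<partial>curve ?I m)"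
      by (subst integral_distr[OF fm]) auto
    also have "\<dots> = 0"
      using fp_LINT_eq[OF w1 m \<alpha> e \<phi>] fp[OF \<phi>] by (simp add: fp_int_def[abs_def] LINT_lb)
    finally show ?thesis .
  qed
  show "relaxed T m ?Q" unfolding relaxed_def using T m dist ien fpQ by simp
  have lm: "(\<lambda>w. lag (snd (fst w)) (snd w)) \<in> borel_measurable (txq_space ?I)"
  proof -
    have "(\<lambda>w. snd (fst w)) \<in> borel_measurable (txq_space ?I)" by measurable
    then show ?thesis by measurable
  qed
  show "(\<integral>w. lag (snd (fst w)) (snd w) \<partial>?Q) = (\<integral>p. lag (snd p) (\<alpha> (fst p) (snd p)) \<partial>curve ?I m)"
    using lm by (subst integral_distr[OF fm]) auto
  show "integrable ?Q (\<lambda>w. lag (snd (fst w)) (snd w))"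
    using lm admissible_costs(2)[OF w1 ad] by (subst integrable_distr_eq[OF fm]) auto
qed

text \<open>
  The mixture of the two relaxed controls, projected. While a fraction \<open>r\<close> of the mass follows the heat flow, the
  excess cost per unit of time is at most \<open>r (2 c + c D)\<close>: the first term compares the Lagrangians, the second
  the interaction, using that the two curves are within \<open>r D\<close> of each other.
\<close>

lemma mix_with_heat:
  assumes T: "0 < T" and ad: "(m, \<alpha>) \<in> admissible {0..T} (\<lambda>_. 1) m0" and \<rho>: "\<rho> \<in> prob_torus"
    and r: "0 \<le> r" "r \<le> 1"
    and D: "\<And>\<mu> \<nu>. \<mu> \<in> prob_torus \<Longrightarrow> \<nu> \<in> (prob_torus :: 'n torus measure set) \<Longrightarrow> kr_dist \<mu> \<nu> \<le> D"
  obtains \<beta> where "(\<lambda>t. mix r (m t) (heat \<rho> t), \<beta>) \<in> admissible {0..T} (\<lambda>_. 1) (mix r m0 \<rho>)"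
    "cost {0..T} (\<lambda>_. 1) (\<lambda>t. mix r (m t) (heat \<rho> t)) \<beta> \<le> cost {0..T} (\<lambda>_. 1) m \<alpha> + r * (T * (2 * c + c * D))"
proof -
  let ?I = "{0..T}"
  have w1: "weight ?I (\<lambda>_. 1)" using T by (intro weight_one) simp
  note W = weightD[OF w1]
  have m: "prob_curve ?I m" and m0: "m 0 = m0" using ad by (auto simp: admissible_iff[OF w1])
  have ad2: "(heat \<rho>, \<lambda>_ _. 0) \<in> admissible ?I (\<lambda>_. 1) \<rho>" by (rule heat_admissible[OF \<rho> w1]) auto
  have h: "prob_curve ?I (heat \<rho>)" by (rule prob_curve_heat[OF \<rho>])
  let ?Q1 = "distr (curve ?I m) (txq_space ?I) (\<lambda>p. (p, \<alpha> (fst p) (snd p)))"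
  let ?Q2 = "distr (curve ?I (heat \<rho>)) (txq_space ?I) (\<lambda>p. (p, 0))"
  note s1 = strict_relaxed[OF T ad] and s2 = strict_relaxed[OF T ad2]
  have sQ: "sets ?Q2 = sets ?Q1" by simp
  let ?m = "\<lambda>t. mix r (m t) (heat \<rho> t)"
  have mm: "prob_curve ?I ?m" by (rule prob_curve_mix[OF m h r])
  obtain \<beta> where \<beta>: "(?m, \<beta>) \<in> admissible ?I (\<lambda>_. 1) (?m 0)"
    "cost ?I (\<lambda>_. 1) ?m \<beta> \<le> (\<integral>w. lag (snd (fst w)) (snd w) \<partial>mix r ?Q1 ?Q2) + (\<integral>t. \<F> (?m t) \<partial>lb ?I)"
    by (rule relaxed_projection[OF relaxed_mix[OF s1(1) s2(1) r]])
  define L where "L = (\<integral>p. lag (snd p) (\<alpha> (fst p) (snd p)) \<partial>curve ?I m)"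
  define L0 where "L0 = (\<integral>p. lag (snd p) 0 \<partial>curve ?I (heat \<rho>))"
  have "(\<integral>w. lag (snd (fst w)) (snd w) \<partial>mix r ?Q1 ?Q2) = (1 - r) * L + r * L0"
    unfolding L_def L0_def by (simp add: integral_mix[OF sQ s1(3) s2(3) r] s1(2) s2(2))
  moreover have "- (T * c) \<le> L"
  proof -
    interpret finite_measure "curve ?I m" by (rule finite_measure_curve) (use T m in auto)
    have "(\<integral>p. - c \<partial>curve ?I m) \<le> L"
      unfolding L_def using admissible_costs(2)[OF w1 ad] l_ge by (intro integral_mono) auto
    then show ?thesis using finite_measure_curve(2)[OF _ m] T by simp
  qed
  moreover have "L0 \<le> T * c"
  proof -
    interpret finite_measure "curve ?I (heat \<rho>)" by (rule finite_measure_curve) (use T h in auto)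
    have "L0 \<le> (\<integral>p. c \<partial>curve ?I (heat \<rho>))"
      unfolding L0_def using admissible_costs(2)[OF w1 ad2] l_upper[of _ 0] by (intro integral_mono) auto
    then show ?thesis using finite_measure_curve(2)[OF _ h] T by simp
  qed
  ultimately have "(\<integral>w. lag (snd (fst w)) (snd w) \<partial>mix r ?Q1 ?Q2) \<le> L + r * (T * (2 * c))"
    using mult_left_mono[of "- L" "T * c" r] mult_left_mono[of L0 "T * c" r] r by (simp add: algebra_simps)
  moreover have "(\<integral>t. \<F> (?m t) \<partial>lb ?I) \<le> (\<integral>t. \<F> (m t) \<partial>lb ?I) + r * (T * (c * D))"
  proof -
    have "(\<integral>t. \<F> (?m t) \<partial>lb ?I) \<le> (\<integral>t. \<F> (m t) + c * (r * D) \<partial>lb ?I)"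
    proof (rule integral_mono)
      show "integrable (lb ?I) (\<lambda>t. \<F> (m t) + c * (r * D))"
        by (intro Bochner_Integration.integrable_add F_integrable[OF _ m] integral_lb_const) (use T in auto)
      fix t assume "t \<in> space (lb ?I)"
      then have P: "m t \<in> prob_torus" "heat \<rho> t \<in> prob_torus" "?m t \<in> prob_torus"
        using prob_curveD[OF m] prob_curveD[OF h] prob_curveD[OF mm] by auto
      have "\<F> (?m t) - \<F> (m t) \<le> c * kr_dist (?m t) (m t)" using F_lip[OF P(3,1)] by simp
      also have "\<dots> \<le> c * (r * D)"
        using kr_dist_mix_left[OF P(1,2) r] D[OF P(2,1)] r c_pos
        by (intro mult_left_mono) (auto intro: order.trans mult_left_mono)
      finally show "\<F> (?m t) \<le> \<F> (m t) + c * (r * D)" by simp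
    qed (use F_integrable[OF _ mm] T in auto)
    also have "\<dots> = (\<integral>t. \<F> (m t) \<partial>lb ?I) + T * (c * (r * D))"
      using F_integrable[OF _ m] T integral_lb_const[of T "c * (r * D)"] by simp
    finally show ?thesis by (simp add: algebra_simps)
  qed
  ultimately have "cost ?I (\<lambda>_. 1) ?m \<beta> \<le> cost ?I (\<lambda>_. 1) m \<alpha> + r * (T * (2 * c + c * D))"
    using \<beta>(2) admissible_costs(6)[OF w1 ad] by (simp add: L_def algebra_simps)
  moreover have "?m 0 = mix r m0 \<rho>" by (simp add: m0 heat_0[OF \<rho>])
  ultimately show ?thesis using \<beta>(1) by (intro that) auto
qed

text \<open>
  Average over translations by \<open>\<epsilon> u\<close> with \<open>u\<close> uniform in a cube, each translate keeping the original control.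
  Every translate solves the equation, and its Lagrangian cost changes by at most \<open>\<epsilon> |u|\<close> times the Lipschitz
  constant \<open>c (1 + |\<alpha>|\<^sup>2)\<close>; hence the energy in the error term.
\<close>

lemma mollify:
  assumes T: "0 < T" and ad: "(m, \<alpha>) \<in> admissible {0..T} (\<lambda>_. 1) m0" and \<epsilon>: "0 \<le> \<epsilon>"
  obtains \<beta> where "(\<lambda>t. moll \<epsilon> (m t), \<beta>) \<in> admissible {0..T} (\<lambda>_. 1) (moll \<epsilon> m0)"
    "cost {0..T} (\<lambda>_. 1) (\<lambda>t. moll \<epsilon> (m t)) \<beta> \<le> cost {0..T} (\<lambda>_. 1) m \<alpha>
      + c * (\<epsilon> * real CARD('n)) * (2 * T + (\<integral>p. speed2 \<alpha> p \<partial>curve {0..T} m))"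
proof -
  let ?I = "{0..T}"
  let ?N = "tx_space ?I :: (real \<times> 'n torus) measure"
  let ?U = "cube_unif :: (real^'n) measure"
  define n where "n = real CARD('n)"
  have n0: "0 \<le> n" by (simp add: n_def)
  have w1: "weight ?I (\<lambda>_. 1)" using T by (intro weight_one) simp
  note W = weightD[OF w1]
  have ctl: "controlled ?I (\<lambda>_. 1) m \<alpha>" and fp: "\<And>\<phi>. test_fn ?I \<phi> \<Longrightarrow> (\<integral>t. fp_int \<phi> m \<alpha> t \<partial>lb ?I) = 0" and m0: "m 0 = m0"
    using ad by (auto simp: admissible_controlled[OF w1])
  have m: "prob_curve ?I m" and \<alpha>: "(\<lambda>(t, x). \<alpha> t x) \<in> borel_measurable (tx_space ?I)"
    and e: "(\<integral>\<^sup>+p. ennreal (1 * speed2 \<alpha> p) \<partial>curve ?I m) < \<infinity>"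
    using ctl by (auto simp: controlled_def)
  let ?M = "curve ?I m"
  let ?m = "\<lambda>t. moll \<epsilon> (m t)"
  have mm: "prob_curve ?I ?m" by (rule prob_curve_moll[OF m])
  have fM: "finite_measure ?M" and mass: "measure ?M (space ?M) = T" using finite_measure_curve[OF _ m] T by auto
  interpret M: finite_measure ?M by (rule fM)
  interpret U: prob_space ?U by (rule prob_space_cube_unif)
  interpret P: pair_sigma_finite ?M ?U ..
  note [measurable_cong] = sets_curve[OF W(1,2) m]
  have su [measurable_cong]: "sets ?U = sets borel" by simp
  let ?MU = "?M \<Otimes>\<^sub>M ?U"
  have am: "(\<lambda>p. \<alpha> (fst p) (snd p)) \<in> borel_measurable ?N" using \<alpha> by (simp add: case_prod_beta')
  have pf: "fst \<in> ?MU \<rightarrow>\<^sub>M ?N" by measurable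
  have amU [measurable]: "(\<lambda>v. \<alpha> (fst (fst v)) (snd (fst v))) \<in> borel_measurable ?MU" by (rule measurable_compose[OF pf am])
  let ?g = "\<lambda>v. (fst (fst v), tshift (snd (fst v)) (\<epsilon> *\<^sub>R snd v))"
  have gm [measurable]: "?g \<in> ?MU \<rightarrow>\<^sub>M ?N"
  proof -
    have "(\<lambda>v. fst (fst v)) \<in> ?MU \<rightarrow>\<^sub>M restrict_space borel ?I" by measurable
    moreover have x: "(\<lambda>v. snd (fst v)) \<in> ?MU \<rightarrow>\<^sub>M borel" by (rule measurable_compose[OF pf measurable_snd])
    moreover have u: "(\<lambda>v. snd v) \<in> ?MU \<rightarrow>\<^sub>M borel" by measurable
    ultimately show ?thesis by measurable
  qed
  let ?f = "\<lambda>v. (?g v, \<alpha> (fst (fst v)) (snd (fst v)))"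
  have fm: "?f \<in> ?MU \<rightarrow>\<^sub>M txq_space ?I" by measurable
  let ?Q = "distr ?MU (txq_space ?I) ?f"
  have d: "distr ?Q ?N fst = curve ?I ?m"
  proof (rule measure_eqI_nn_integral)
    show "sets (distr ?Q ?N fst) = sets (curve ?I ?m)" by (simp add: sets_curve[OF W(1,2) mm])
    fix h :: "real \<times> 'n torus \<Rightarrow> ennreal" assume "h \<in> borel_measurable (curve ?I ?m)"
    then have h: "h \<in> borel_measurable ?N" by (simp cong: measurable_cong_sets add: sets_curve[OF W(1,2) mm])
    have hg: "(\<lambda>v. h (?g v)) \<in> borel_measurable ?MU" by (rule measurable_compose[OF gm h])
    have hg': "(\<lambda>v. h (?g v)) \<in> borel_measurable (?N \<Otimes>\<^sub>M ?U)" using hg by (simp cong: measurable_cong_sets)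
    have "(\<integral>\<^sup>+p. h p \<partial>distr ?Q ?N fst) = (\<integral>\<^sup>+v. h (?g v) \<partial>?MU)"
      using h by (simp add: nn_integral_distr distr_distr[OF measurable_fst fm] o_def)
    also have "\<dots> = (\<integral>\<^sup>+p. \<integral>\<^sup>+u. h (?g (p, u)) \<partial>?U \<partial>?M)"
      by (rule U.nn_integral_fst[OF hg, symmetric])
    also have "\<dots> = (\<integral>\<^sup>+t. \<integral>\<^sup>+x. \<integral>\<^sup>+u. h (?g ((t, x), u)) \<partial>?U \<partial>m t \<partial>lb ?I)"
      by (rule nn_integral_curve[OF W(1,2) m]) (rule U.borel_measurable_nn_integral_fst[OF hg'])
    also have "\<dots> = (\<integral>\<^sup>+t. \<integral>\<^sup>+x. h (t, x) \<partial>moll \<epsilon> (m t) \<partial>lb ?I)"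
    proof (rule nn_integral_cong)
      fix t assume "t \<in> space (lb ?I)"
      then have t: "t \<in> ?I" by simp
      have hm: "(\<lambda>x. h (t, x)) \<in> borel_measurable borel"
        by (rule measurable_compose[OF measurable_Pair1' h]) (use t in \<open>simp add: space_restrict_space\<close>)
      show "(\<integral>\<^sup>+x. \<integral>\<^sup>+u. h (?g ((t, x), u)) \<partial>?U \<partial>m t) = (\<integral>\<^sup>+x. h (t, x) \<partial>moll \<epsilon> (m t))"
        unfolding moll_def using cube_blur(2)[OF prob_curveD[OF m t] hm, of \<epsilon>] by simp
    qed
    also have "\<dots> = (\<integral>\<^sup>+p. h p \<partial>curve ?I ?m)" by (rule nn_integral_curve[OF W(1,2) mm h, symmetric])
    finally show "(\<integral>\<^sup>+p. h p \<partial>distr ?Q ?N fst) = (\<integral>\<^sup>+p. h p \<partial>curve ?I ?m)" .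
  qed
  have ienM: "integrable ?M (\<lambda>p. speed2 \<alpha> p)" using admissible_costs(1)[OF w1 ad] by simp
  have ien: "integrable ?MU (\<lambda>v. (norm (\<alpha> (fst (fst v)) (snd (fst v))))\<^sup>2)"
    using integrable_pair_fst(1)[OF fM prob_space_cube_unif ienM] by simp
  have ienQ: "integrable ?Q (\<lambda>w. (norm (snd w))\<^sup>2)"
    using ien by (subst integrable_distr_eq[OF fm]) auto
  have fpQ: "(\<integral>w. fp_relaxed \<phi> w \<partial>?Q) = 0"
    if \<phi>: "test_fn ?I \<phi>" for \<phi>
  proof -
    obtain K where K: "supported_in \<phi> K" "compact K" "K \<subseteq> interior ?I" and sm: "smooth_tx \<phi>" using \<phi> by (auto simp: test_fn_def)
    obtain B where B: "0 \<le> B" "\<And>t x. \<bar>fp_gen \<phi> t x\<bar> \<le> B" "\<And>t x. norm (torus_grad (\<phi> t) x) \<le> B"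
      by (rule test_bounded[OF sm K(1,2)], rule that) auto
    note fm' = fp_measurable(1,2)[OF sm \<alpha>]
    have mQ [measurable]: "(\<lambda>w. fp_gen \<phi> (fst (fst w)) (snd (fst w))) \<in> borel_measurable (txq_space ?I)"
      "(\<lambda>w. torus_grad (\<phi> (fst (fst w))) (snd (fst w))) \<in> borel_measurable (txq_space ?I)"
      using measurable_compose[OF measurable_fst fm'(1)] measurable_compose[OF measurable_fst fm'(2)] by auto
    let ?h = "\<lambda>v. fp_gen \<phi> (fst (fst v)) (tshift (snd (fst v)) (\<epsilon> *\<^sub>R snd v)) - \<alpha> (fst (fst v)) (snd (fst v)) \<bullet> torus_grad (\<phi> (fst (fst v))) (tshift (snd (fst v)) (\<epsilon> *\<^sub>R snd v))"
    have hm: "?h \<in> borel_measurable ?MU"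
      using measurable_compose[OF gm fm'(1)] measurable_compose[OF gm fm'(2)] by simp
    have hi: "integrable ?MU ?h"
    proof (rule Bochner_Integration.integrable_bound[OF _ hm])
      have "integrable ?MU (\<lambda>v. 2 * B)"
        using integrable_pair_fst(1)[OF fM prob_space_cube_unif, of "\<lambda>_. 2 * B"] by simp
      then show "integrable ?MU (\<lambda>v. 2 * B + B * (norm (\<alpha> (fst (fst v)) (snd (fst v))))\<^sup>2)" using ien by simp
      have "norm (fp_gen \<phi> t x' - q \<bullet> torus_grad (\<phi> t) x') \<le> norm (2 * B + B * (norm q)\<^sup>2)" for t x' q
      proof -
        have "norm q \<le> 1 + (norm q)\<^sup>2" by (rule norm_le_one_plus_square)
        then have "norm q * B \<le> (1 + (norm q)\<^sup>2) * B" using B(1) by (rule mult_right_mono)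
        moreover have "\<bar>q \<bullet> torus_grad (\<phi> t) x'\<bar> \<le> norm q * B"
          using Cauchy_Schwarz_ineq2[of q "torus_grad (\<phi> t) x'"] mult_left_mono[OF B(3)[of t x'] norm_ge_zero[of q]] by linarith
        ultimately have "\<bar>fp_gen \<phi> t x' - q \<bullet> torus_grad (\<phi> t) x'\<bar> \<le> B + (1 + (norm q)\<^sup>2) * B"
          using B(2)[of t x'] by linarith
        then show ?thesis using abs_ge_self[of "2 * B + B * (norm q)\<^sup>2"] by (simp add: algebra_simps)
      qed
      then show "AE v in ?MU. norm (?h v) \<le> norm (2 * B + B * (norm (\<alpha> (fst (fst v)) (snd (fst v))))\<^sup>2)" by (intro AE_I2)
    qed
    \<comment> \<open>For fixed \<open>u\<close>, the translated test function is tested against the original trajectory.\<close>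
    have slice: "(\<integral>p. ?h (p, u) \<partial>?M) = 0" for u
    proof -
      let ?\<phi> = "\<lambda>t x. \<phi> t (tshift x (\<epsilon> *\<^sub>R u))"
      have sm': "smooth_tx ?\<phi>" by (rule smooth_tx_space_shift[OF sm])
      have T': "test_fn ?I ?\<phi>"
        unfolding test_fn_def using sm' K by (auto simp: supported_in_def)
      have "(\<integral>p. ?h (p, u) \<partial>?M) = (\<integral>p. fp_gen ?\<phi> (fst p) (snd p) - \<alpha> (fst p) (snd p) \<bullet> torus_grad (?\<phi> (fst p)) (snd p) \<partial>?M)"
        by (simp add: space_shift_ops[OF sm])
      also have "\<dots> = 0"
        using fp_LINT_eq[OF w1 m \<alpha> e T'] fp[OF T'] by (simp add: fp_int_def[abs_def] LINT_lb)
      finally show ?thesis .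
    qed
    have "(\<integral>w. fp_relaxed \<phi> w \<partial>?Q) = (\<integral>v. ?h v \<partial>?MU)"
      by (subst integral_distr[OF fm]) auto
    also have "\<dots> = (\<integral>u. \<integral>p. ?h (p, u) \<partial>?M \<partial>?U)"
      using P.integral_snd[of "\<lambda>p u. ?h (p, u)"] hi by (simp add: case_prod_beta')
    also have "\<dots> = 0" by (simp only: slice Bochner_Integration.integral_zero)
    finally show ?thesis .
  qed
  have R: "relaxed T ?m ?Q" unfolding relaxed_def using T mm d ienQ fpQ by simp
  obtain \<beta> where \<beta>: "(?m, \<beta>) \<in> admissible ?I (\<lambda>_. 1) (?m 0)"
    "cost ?I (\<lambda>_. 1) ?m \<beta> \<le> (\<integral>w. lag (snd (fst w)) (snd w) \<partial>?Q) + (\<integral>t. \<F> (?m t) \<partial>lb ?I)"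
    by (rule relaxed_projection[OF R])
  define L where "L = (\<integral>p. lag (snd p) (\<alpha> (fst p) (snd p)) \<partial>?M)"
  define E where "E = (\<integral>p. speed2 \<alpha> p \<partial>?M)"
  have lM: "integrable ?M (\<lambda>p. lag (snd p) (\<alpha> (fst p) (snd p)))" using admissible_costs(2)[OF w1 ad] by simp
  have "(\<integral>w. lag (snd (fst w)) (snd w) \<partial>?Q) \<le> L + (c * \<epsilon>) * (n * (T + E))"
  proof -
    have lm: "(\<lambda>w. lag (snd (fst w)) (snd w)) \<in> borel_measurable (txq_space ?I)"
    proof -
      have "(\<lambda>w. snd (fst w)) \<in> borel_measurable (txq_space ?I)" by measurable
      then show ?thesis by measurable
    qed
    have lU: "integrable ?MU (\<lambda>v. lag (snd (fst v)) (\<alpha> (fst (fst v)) (snd (fst v))))"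
      "(\<integral>v. lag (snd (fst v)) (\<alpha> (fst (fst v)) (snd (fst v))) \<partial>?MU) = L"
      using integrable_pair_fst[OF fM prob_space_cube_unif lM] by (simp_all add: L_def)
    have i1: "integrable ?M (\<lambda>p. 1 + speed2 \<alpha> p)" using ienM by simp
    note pp = integrable_pair_prod[OF fM prob_space_cube_unif i1 integrable_norm_cube_unif[where 'n='n]]
    have v1: "(\<integral>p. 1 + speed2 \<alpha> p \<partial>?M) = T + E" using ienM by (simp add: mass E_def)
    let ?b = "\<lambda>v. lag (snd (fst v)) (\<alpha> (fst (fst v)) (snd (fst v))) + (c * \<epsilon>) * ((1 + (norm (\<alpha> (fst (fst v)) (snd (fst v))))\<^sup>2) * norm (snd v))"
    have bi: "integrable ?MU ?b"
      by (intro Bochner_Integration.integrable_add integrable_mult_right lU(1) pp(1))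
    have ptw: "\<bar>lag (tshift x (\<epsilon> *\<^sub>R u)) q - lag x q\<bar> \<le> (c * \<epsilon>) * ((1 + (norm q)\<^sup>2) * norm u)" for x u q
    proof -
      have "\<bar>lag (tshift x (\<epsilon> *\<^sub>R u)) q - lag x q\<bar> \<le> c * dist (tshift x (\<epsilon> *\<^sub>R u)) x * (1 + (norm q)\<^sup>2)" by (rule l_lip)
      also have "\<dots> \<le> c * (\<epsilon> * norm u) * (1 + (norm q)\<^sup>2)"
        using dist_tshift[of x "\<epsilon> *\<^sub>R u" x 0] \<epsilon> c_pos by (intro mult_right_mono mult_left_mono) auto
      finally show ?thesis by (simp add: algebra_simps)
    qed
    have shi: "integrable ?MU (\<lambda>v. lag (tshift (snd (fst v)) (\<epsilon> *\<^sub>R snd v)) (\<alpha> (fst (fst v)) (snd (fst v))))"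
    proof -
      have "(\<lambda>v. lag (snd (fst (?f v))) (snd (?f v))) \<in> borel_measurable ?MU" by (rule measurable_compose[OF fm lm])
      then have sm: "(\<lambda>v. lag (tshift (snd (fst v)) (\<epsilon> *\<^sub>R snd v)) (\<alpha> (fst (fst v)) (snd (fst v)))) \<in> borel_measurable ?MU" by simp
      have "integrable ?MU (\<lambda>v. lag (tshift (snd (fst v)) (\<epsilon> *\<^sub>R snd v)) (\<alpha> (fst (fst v)) (snd (fst v))) - lag (snd (fst v)) (\<alpha> (fst (fst v)) (snd (fst v))))"
      proof (rule Bochner_Integration.integrable_bound)
        show "integrable ?MU (\<lambda>v. (c * \<epsilon>) * ((1 + (norm (\<alpha> (fst (fst v)) (snd (fst v))))\<^sup>2) * norm (snd v)))" using pp(1) by simp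
        show "AE v in ?MU. norm (lag (tshift (snd (fst v)) (\<epsilon> *\<^sub>R snd v)) (\<alpha> (fst (fst v)) (snd (fst v))) - lag (snd (fst v)) (\<alpha> (fst (fst v)) (snd (fst v))))
           \<le> norm ((c * \<epsilon>) * ((1 + (norm (\<alpha> (fst (fst v)) (snd (fst v))))\<^sup>2) * norm (snd v)))"
          unfolding real_norm_def by (intro AE_I2 order.trans[OF ptw abs_ge_self])
      qed (use sm lU(1) in auto)
      from Bochner_Integration.integrable_add[OF this lU(1)] show ?thesis by simp
    qed
    have "(\<integral>w. lag (snd (fst w)) (snd w) \<partial>?Q) = (\<integral>v. lag (tshift (snd (fst v)) (\<epsilon> *\<^sub>R snd v)) (\<alpha> (fst (fst v)) (snd (fst v))) \<partial>?MU)"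
      using lm by (subst integral_distr[OF fm]) auto
    also have "\<dots> \<le> (\<integral>v. ?b v \<partial>?MU)"
    proof (rule integral_mono[OF shi bi])
      fix v show "lag (tshift (snd (fst v)) (\<epsilon> *\<^sub>R snd v)) (\<alpha> (fst (fst v)) (snd (fst v))) \<le> ?b v"
        using ptw[of "snd (fst v)" "snd v" "\<alpha> (fst (fst v)) (snd (fst v))"] by linarith
    qed
    also have "\<dots> = L + (c * \<epsilon>) * ((T + E) * (\<integral>u. norm u \<partial>?U))"
      by (subst Bochner_Integration.integral_add[OF lU(1) integrable_mult_right[OF pp(1)]])
        (simp only: lU(2) integral_mult_right_zero pp(2) v1)
    also have "\<dots> \<le> L + (c * \<epsilon>) * ((T + E) * n)"
      using integral_norm_cube_unif[where 'n='n] c_pos \<epsilon> T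
      by (intro add_left_mono mult_left_mono) (auto simp: n_def E_def)
    finally show ?thesis by (simp add: mult.commute)
  qed
  moreover have "(\<integral>t. \<F> (?m t) \<partial>lb ?I) \<le> (\<integral>t. \<F> (m t) \<partial>lb ?I) + T * (c * (\<epsilon> * n))"
  proof -
    have "(\<integral>t. \<F> (?m t) \<partial>lb ?I) \<le> (\<integral>t. \<F> (m t) + c * (\<epsilon> * n) \<partial>lb ?I)"
    proof (rule integral_mono)
      show "integrable (lb ?I) (\<lambda>t. \<F> (m t) + c * (\<epsilon> * n))"
        by (intro Bochner_Integration.integrable_add F_integrable[OF _ m] integral_lb_const) (use T in auto)
      fix t assume "t \<in> space (lb ?I)"
      then have P: "m t \<in> prob_torus" "?m t \<in> prob_torus" using prob_curveD[OF m] prob_curveD[OF mm] by auto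
      have "\<F> (?m t) - \<F> (m t) \<le> c * kr_dist (?m t) (m t)" using F_lip[OF P(2,1)] by simp
      also have "\<dots> \<le> c * (\<epsilon> * n)"
        using kr_dist_moll[OF P(1) \<epsilon>] c_pos by (intro mult_left_mono) (auto simp: n_def)
      finally show "\<F> (?m t) \<le> \<F> (m t) + c * (\<epsilon> * n)" by simp
    qed (use F_integrable[OF _ mm] T in auto)
    also have "\<dots> = (\<integral>t. \<F> (m t) \<partial>lb ?I) + T * (c * (\<epsilon> * n))"
      using F_integrable[OF _ m] T integral_lb_const[of T "c * (\<epsilon> * n)"] by simp
    finally show ?thesis .
  qed
  ultimately have "cost ?I (\<lambda>_. 1) ?m \<beta> \<le> cost ?I (\<lambda>_. 1) m \<alpha> + c * (\<epsilon> * n) * (2 * T + E)"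
    using \<beta>(2) admissible_costs(6)[OF w1 ad] by (simp add: L_def algebra_simps)
  then show ?thesis using \<beta>(1) m0 by (intro that) (auto simp: n_def E_def)
qed

end

section \<open>Coupling two initial measures\<close>

lemma mix_mix:
  assumes s: "sets \<nu> = sets \<mu>" and r: "0 \<le> r" "r \<le> 1" and q: "0 \<le> q" "q \<le> 1"
  shows "mix r \<mu> (mix q \<mu> \<nu>) = mix (r * q) \<mu> \<nu>"
proof (rule measure_eqI)
  fix A assume "A \<in> sets (mix r \<mu> (mix q \<mu> \<nu>))"
  then have A: "A \<in> sets \<mu>" by simp
  have "ennreal (1 - r) * a + ennreal r * (ennreal (1 - q) * a + ennreal q * b) = ennreal (1 - r * q) * a + ennreal (r * q) * b" for a b
  proof -
    have "ennreal (1 - r * q) = ennreal ((1 - r) + r * (1 - q))" by (simp add: algebra_simps)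
    also have "\<dots> = ennreal (1 - r) + ennreal r * ennreal (1 - q)"
      using r q by (simp add: ennreal_plus ennreal_mult)
    finally have "ennreal (1 - r * q) = ennreal (1 - r) + ennreal r * ennreal (1 - q)" .
    moreover have "ennreal (r * q) = ennreal r * ennreal q" using r q by (simp add: ennreal_mult)
    ultimately show ?thesis by (simp add: algebra_simps)
  qed
  then show "emeasure (mix r \<mu> (mix q \<mu> \<nu>)) A = emeasure (mix (r * q) \<mu> \<nu>) A"
    using A s by (simp add: emeasure_mix)
qed simp

lemma mix_one:
  assumes "sets \<nu> = sets \<mu>"
  shows "mix 1 \<mu> \<nu> = \<nu>"
  by (rule measure_eqI) (use assms in \<open>auto simp: emeasure_mix\<close>)

text \<open>
  The remainder of \<open>\<mu>\<close> after removing \<open>\<kappa> \<nu>\<close>, renormalized.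
\<close>

lemma mix_complement:
  fixes \<mu> \<nu> :: "'n::finite torus measure"
  assumes P: "\<mu> \<in> prob_torus" "\<nu> \<in> prob_torus" and \<kappa>: "0 < \<kappa>" "\<kappa> < 1"
    and le: "\<And>A. A \<in> sets borel \<Longrightarrow> ennreal \<kappa> * emeasure \<nu> A \<le> emeasure \<mu> A"
  shows "\<exists>\<rho>\<in>prob_torus. \<mu> = mix (1 - \<kappa>) \<nu> \<rho>"
proof -
  have s: "sets \<mu> = sets borel" "sets \<nu> = sets borel" "space \<mu> = UNIV" "space \<nu> = UNIV" using prob_torusD P by auto
  interpret \<mu>: prob_space \<mu> by (rule prob_torusD(3)[OF P(1)])
  interpret \<nu>: prob_space \<nu> by (rule prob_torusD(3)[OF P(2)])
  define \<rho> where "\<rho> = scale_measure (ennreal (1 / (1 - \<kappa>))) (diff_measure \<mu> (scale_measure (ennreal \<kappa>) \<nu>))"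
  have fin: "finite_measure (scale_measure (ennreal \<kappa>) \<nu>)"
    by (rule finite_measureI) (simp add: s ennreal_mult_eq_top_iff)
  have d: "emeasure (diff_measure \<mu> (scale_measure (ennreal \<kappa>) \<nu>)) A = emeasure \<mu> A - ennreal \<kappa> * emeasure \<nu> A" if "A \<in> sets borel" for A
    using that le s by (subst emeasure_diff_measure) (auto intro: fin \<mu>.finite_measure_axioms)
  have e: "emeasure \<rho> A = ennreal (1 / (1 - \<kappa>)) * (emeasure \<mu> A - ennreal \<kappa> * emeasure \<nu> A)" if "A \<in> sets borel" for A
    using d[OF that] by (simp add: \<rho>_def)
  have s\<rho>: "sets \<rho> = sets borel" using s by (simp add: \<rho>_def)
  have "emeasure \<rho> UNIV = ennreal (1 / (1 - \<kappa>)) * (1 - ennreal \<kappa>)"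
    using e[of UNIV] \<mu>.emeasure_space_1 \<nu>.emeasure_space_1 s by simp
  also have "\<dots> = 1"
  proof -
    have "(1 - ennreal \<kappa>) = ennreal (1 - \<kappa>)" using \<kappa> by (simp flip: ennreal_1 add: ennreal_minus)
    then show ?thesis using \<kappa> by (simp flip: ennreal_mult')
  qed
  finally have "prob_space \<rho>"
    by (intro prob_spaceI) (use s\<rho> sets_eq_imp_space_eq[OF s\<rho>] in simp)
  then have \<rho>: "\<rho> \<in> prob_torus" using s\<rho> by (simp add: prob_torus_def)
  have "\<mu> = mix (1 - \<kappa>) \<nu> \<rho>"
  proof (rule measure_eqI)
    show "sets \<mu> = sets (mix (1 - \<kappa>) \<nu> \<rho>)" using s by simp
    fix A assume "A \<in> sets \<mu>"
    then have A: "A \<in> sets borel" using s by simp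
    have "emeasure (mix (1 - \<kappa>) \<nu> \<rho>) A = ennreal \<kappa> * emeasure \<nu> A + ennreal (1 - \<kappa>) * (ennreal (1 / (1 - \<kappa>)) * (emeasure \<mu> A - ennreal \<kappa> * emeasure \<nu> A))"
      using A s s\<rho> e[OF A] by (subst emeasure_mix) auto
    also have "ennreal (1 - \<kappa>) * (ennreal (1 / (1 - \<kappa>)) * (emeasure \<mu> A - ennreal \<kappa> * emeasure \<nu> A)) = emeasure \<mu> A - ennreal \<kappa> * emeasure \<nu> A"
      using \<kappa> by (simp flip: mult.assoc ennreal_mult')
    also have "ennreal \<kappa> * emeasure \<nu> A + (emeasure \<mu> A - ennreal \<kappa> * emeasure \<nu> A) = emeasure \<mu> A"
      using le[OF A] by (rule add_diff_inverse_ennreal)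
    finally show "emeasure \<mu> A = emeasure (mix (1 - \<kappa>) \<nu> \<rho>) A" by simp
  qed
  with \<rho> show ?thesis by blast
qed

lemma Icc_concat: "0 \<le> a \<Longrightarrow> 0 \<le> b \<Longrightarrow> {0..a + b} = {0..a} \<union> (+) a ` {0..b::real}"
  by auto

lemma Ici_concat: "0 \<le> (a::real) \<Longrightarrow> {0..} = {0..a} \<union> (+) a ` {0..}"
  by auto

lemma prob_torus_nonempty: "(prob_torus :: 'n::finite torus measure set) \<noteq> {}"
proof -
  have "return borel (undefined :: 'n torus) \<in> prob_torus"
    by (auto simp: prob_torus_def intro!: prob_space_return)
  then show ?thesis by blast
qed

context mf_cost begin

lemma admissible_restrict:
  assumes ad: "(m, \<alpha>) \<in> admissible {0..T} (\<lambda>_. 1) m0" and S: "0 \<le> a" "0 \<le> b" "a + b \<le> T"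
  shows "(\<lambda>t. m (a + t), \<lambda>t. \<alpha> (a + t)) \<in> admissible {0..b} (\<lambda>_. 1) (m a)"
  by (rule admissible_shift[OF _ _ ad, of _ _ _ 1]) (use S in \<open>auto intro!: weight_one\<close>)

lemma cost_two:
  assumes ad: "(m, \<alpha>) \<in> admissible {0..a + b} (\<lambda>_. 1) m0" and S: "0 \<le> a" "0 \<le> b"
  shows "cost {0..a + b} (\<lambda>_. 1) m \<alpha> = cost {0..a} (\<lambda>_. 1) m \<alpha> + cost {0..b} (\<lambda>_. 1) (\<lambda>t. m (a + t)) (\<lambda>t. \<alpha> (a + t))"
  using cost_split(1)[OF S(1) _ _ Icc_concat[OF S] weight_one ad] S
  by (simp add: cost_shift) (simp add: cost_def LINT_lb)

text \<open>
  Start from the mixture of \<open>m0\<close> and an arbitrary \<open>\<rho>\<close> with weight \<open>r\<close> on \<open>\<rho>\<close>. For one unit of time let the \<open>\<rho>\<close> part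
  follow the heat flow, at excess cost of order \<open>r\<close>. Then a fraction \<open>\<kappa>\<close> of it can be reassigned to the reference
  trajectory, which is made of mollified measures; the weight drops to \<open>r (1 - \<kappa>)\<close> and one repeats. The geometric
  series bounds the total excess by a multiple of \<open>r / \<kappa>\<close> that is independent of the horizon.
\<close>

lemma coupling:
  assumes \<kappa>: "0 < \<kappa>" "\<kappa> < 1"
    and split: "\<And>\<rho> \<nu>. \<rho> \<in> prob_torus \<Longrightarrow> \<nu> \<in> (prob_torus :: 'n torus measure set) \<Longrightarrow> \<exists>\<rho>'\<in>prob_torus. heat \<rho> 1 = mix (1 - \<kappa>) (moll \<epsilon> \<nu>) \<rho>'"
    and D: "\<And>\<mu> \<nu>. \<mu> \<in> prob_torus \<Longrightarrow> \<nu> \<in> (prob_torus :: 'n torus measure set) \<Longrightarrow> kr_dist \<mu> \<nu> \<le> D" "0 \<le> D"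
  shows "(m, \<alpha>) \<in> admissible {0..real (Suc N)} (\<lambda>_. 1) m0 \<Longrightarrow> (\<And>t. t \<in> {0..real (Suc N)} \<Longrightarrow> \<exists>\<nu>\<in>prob_torus. m t = moll \<epsilon> \<nu>) \<Longrightarrow>
     0 \<le> r \<Longrightarrow> r \<le> 1 \<Longrightarrow> \<rho> \<in> prob_torus \<Longrightarrow>
     \<exists>m' \<alpha>'. (m', \<alpha>') \<in> admissible {0..real (Suc N)} (\<lambda>_. 1) (mix r m0 \<rho>) \<and>
       cost {0..real (Suc N)} (\<lambda>_. 1) m' \<alpha>' \<le> cost {0..real (Suc N)} (\<lambda>_. 1) m \<alpha> + r * ((2 * c + c * D) / \<kappa>)"
proof (induction N arbitrary: m \<alpha> m0 r \<rho>)
  case 0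
  define C where "C = 2 * c + c * D"
  have C0: "0 \<le> C" using c_pos D by (simp add: C_def)
  have ad: "(m, \<alpha>) \<in> admissible {0..1} (\<lambda>_. 1) m0" using 0(1) by simp
  obtain \<beta> where \<beta>: "(\<lambda>t. mix r (m t) (heat \<rho> t), \<beta>) \<in> admissible {0..1} (\<lambda>_. 1) (mix r m0 \<rho>)"
    "cost {0..1} (\<lambda>_. 1) (\<lambda>t. mix r (m t) (heat \<rho> t)) \<beta> \<le> cost {0..1} (\<lambda>_. 1) m \<alpha> + r * (1 * C)"
    unfolding C_def by (rule mix_with_heat[OF _ ad 0(5,3,4) D(1)]) auto
  have "C \<le> C / \<kappa>" using \<kappa> C0 by (simp add: le_divide_eq mult_left_le)
  then have "r * C \<le> r * (C / \<kappa>)" using 0(3) by (rule mult_left_mono)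
  then have "cost {0..1} (\<lambda>_. 1) (\<lambda>t. mix r (m t) (heat \<rho> t)) \<beta> \<le> cost {0..1} (\<lambda>_. 1) m \<alpha> + r * (C / \<kappa>)"
    using \<beta>(2) by simp
  with \<beta>(1) show ?case unfolding C_def by (intro exI[of _ "\<lambda>t. mix r (m t) (heat \<rho> t)"] exI[of _ \<beta>]) simp
next
  case (Suc N)
  define C where "C = 2 * c + c * D"
  let ?b = "real (Suc N)"
  have T: "real (Suc (Suc N)) = 1 + ?b" by simp
  have ad: "(m, \<alpha>) \<in> admissible {0..1 + ?b} (\<lambda>_. 1) m0" using Suc.prems(1) by (simp only: T)
  have m00: "m 0 = m0" using ad by (simp add: admissible_def)
  have ad1: "(m, \<alpha>) \<in> admissible {0..1} (\<lambda>_. 1) m0"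
    using admissible_restrict[OF ad, of 0 1] by (simp add: m00)
  have ad2: "(\<lambda>t. m (1 + t), \<lambda>t. \<alpha> (1 + t)) \<in> admissible {0..?b} (\<lambda>_. 1) (m 1)"
    by (rule admissible_restrict[OF ad]) auto
  obtain \<beta> where \<beta>: "(\<lambda>t. mix r (m t) (heat \<rho> t), \<beta>) \<in> admissible {0..1} (\<lambda>_. 1) (mix r m0 \<rho>)"
    "cost {0..1} (\<lambda>_. 1) (\<lambda>t. mix r (m t) (heat \<rho> t)) \<beta> \<le> cost {0..1} (\<lambda>_. 1) m \<alpha> + r * (1 * C)"
    unfolding C_def by (rule mix_with_heat[OF _ ad1 Suc.prems(5,3,4) D(1)]) auto
  obtain \<nu> where \<nu>: "\<nu> \<in> prob_torus" "m 1 = moll \<epsilon> \<nu>" using Suc.prems(2)[of 1] by auto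
  obtain \<rho>' where \<rho>': "\<rho>' \<in> prob_torus" "heat \<rho> 1 = mix (1 - \<kappa>) (m 1) \<rho>'"
    using split[OF Suc.prems(5) \<nu>(1)] \<nu>(2) by auto
  have s: "sets \<rho>' = sets (m 1)" using prob_torusD(1)[OF \<rho>'(1)] prob_torusD(1)[OF moll_in_prob_torus[OF \<nu>(1)]] \<nu>(2) by simp
  have end1: "mix r (m 1) (heat \<rho> 1) = mix (r * (1 - \<kappa>)) (m 1) \<rho>'"
    unfolding \<rho>'(2) using \<kappa> Suc.prems(3,4) by (intro mix_mix s) auto
  have r': "0 \<le> r * (1 - \<kappa>)" "r * (1 - \<kappa>) \<le> 1"
    using \<kappa> Suc.prems(3,4) mult_le_one[of r "1 - \<kappa>"] by auto
  have "\<exists>m' \<alpha>'. (m', \<alpha>') \<in> admissible {0..?b} (\<lambda>_. 1) (mix (r * (1 - \<kappa>)) (m 1) \<rho>') \<and>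
       cost {0..?b} (\<lambda>_. 1) m' \<alpha>' \<le> cost {0..?b} (\<lambda>_. 1) (\<lambda>t. m (1 + t)) (\<lambda>t. \<alpha> (1 + t)) + (r * (1 - \<kappa>)) * ((2 * c + c * D) / \<kappa>)"
  proof (rule Suc.IH[OF ad2 _ r' \<rho>'(1)])
    show "\<exists>\<nu>\<in>prob_torus. m (1 + t) = moll \<epsilon> \<nu>" if "t \<in> {0..?b}" for t
      using Suc.prems(2)[of "1 + t"] that by simp
  qed
  then obtain m' \<alpha>' where m': "(m', \<alpha>') \<in> admissible {0..?b} (\<lambda>_. 1) (mix r (m 1) (heat \<rho> 1))"
    "cost {0..?b} (\<lambda>_. 1) m' \<alpha>' \<le> cost {0..?b} (\<lambda>_. 1) (\<lambda>t. m (1 + t)) (\<lambda>t. \<alpha> (1 + t)) + (r * (1 - \<kappa>)) * (C / \<kappa>)"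
    unfolding end1 C_def by blast
  have I: "{0..1 + ?b} = {0..1} \<union> (+) 1 ` {0..?b}" by (rule Icc_concat) auto
  note g = admissible_glue[of 1 "{0..?b}" ?b _ "\<lambda>_. 1", OF _ _ _ _ I _ _ \<beta>(1) m'(1)]
  note gc = cost_glue[of 1 "{0..?b}" ?b _ "\<lambda>_. 1", OF _ _ _ _ I _ _ \<beta>(1) m'(1)]
  let ?m = "glue 1 (\<lambda>t. mix r (m t) (heat \<rho> t)) m'" and ?\<alpha> = "glue 1 \<beta> \<alpha>'"
  have adg: "(?m, ?\<alpha>) \<in> admissible {0..1 + ?b} (\<lambda>_. 1) (mix r m0 \<rho>)" by (rule g(2)) (auto intro!: weight_one)
  have "cost {0..1 + ?b} (\<lambda>_. 1) ?m ?\<alpha> = cost {0..1} (\<lambda>_. 1) (\<lambda>t. mix r (m t) (heat \<rho> t)) \<beta> + cost {0..?b} (\<lambda>_. 1) m' \<alpha>'"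
    by (rule gc) (auto intro!: weight_one)
  also have "\<dots> \<le> (cost {0..1} (\<lambda>_. 1) m \<alpha> + r * C) + (cost {0..?b} (\<lambda>_. 1) (\<lambda>t. m (1 + t)) (\<lambda>t. \<alpha> (1 + t)) + (r * (1 - \<kappa>)) * (C / \<kappa>))"
    using \<beta>(2) m'(2) by simp
  also have "\<dots> = cost {0..1 + ?b} (\<lambda>_. 1) m \<alpha> + r * (C / \<kappa>)"
    unfolding cost_two[OF ad zero_le_one of_nat_0_le_iff] using \<kappa> by (simp add: field_simps)
  finally show ?case using adg unfolding T C_def by blast
qed

section \<open>Value functions\<close>

definition val :: "real set \<Rightarrow> (real \<Rightarrow> real) \<Rightarrow> 'n torus measure \<Rightarrow> real" where
  "val I w m0 = (INF (m, \<alpha>)\<in>admissible I w m0. cost I w m \<alpha>)"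

context
  fixes I w and m0 :: "'n torus measure"
  assumes w: "weight I w" and I: "I \<subseteq> {0..}" and m0: "m0 \<in> prob_torus"
begin

lemma val_bdd: "bdd_below ((\<lambda>(m, \<alpha>). cost I w m \<alpha>) ` admissible I w m0)"
  using admissible_costs(8)[OF w] by (intro bdd_belowI2[where m="- (2 * c) * (\<integral>t. w t \<partial>lb I)"]) auto

lemma val_le: "(m, \<alpha>) \<in> admissible I w m0 \<Longrightarrow> val I w m0 \<le> cost I w m \<alpha>"
  unfolding val_def using cINF_lower[OF val_bdd, of "(m, \<alpha>)"] by simp

lemma val_ge: "(\<And>m \<alpha>. (m, \<alpha>) \<in> admissible I w m0 \<Longrightarrow> x \<le> cost I w m \<alpha>) \<Longrightarrow> x \<le> val I w m0"
  unfolding val_def using heat_admissible[OF m0 w I] by (intro cINF_greatest) auto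

lemma val_lower: "- (2 * c) * (\<integral>t. w t \<partial>lb I) \<le> val I w m0"
  using admissible_costs(8)[OF w] by (intro val_ge)

lemma val_near: "e > 0 \<Longrightarrow> \<exists>m \<alpha>. (m, \<alpha>) \<in> admissible I w m0 \<and> cost I w m \<alpha> < val I w m0 + e"
proof (rule ccontr)
  assume e: "e > 0" and n: "\<not> ?thesis"
  have "val I w m0 + e \<le> val I w m0" by (rule val_ge) (use n in force)
  with e show False by simp
qed

lemma val_upper: "val I w m0 \<le> 2 * c * (\<integral>t. w t \<partial>lb I)"
proof -
  note ad = heat_admissible[OF m0 w I]
  note W = weightD[OF w]
  have "val I w m0 \<le> cost I w (heat m0) (\<lambda>_ _. 0)" by (rule val_le[OF ad])
  also have "\<dots> = (\<integral>t. w t * run_cost (heat m0) (\<lambda>_ _. 0) t \<partial>lb I)" by (rule admissible_costs(5)[OF w ad])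
  also have "\<dots> \<le> (\<integral>t. w t * (2 * c) \<partial>lb I)"
  proof (rule integral_mono[OF admissible_costs(4)[OF w ad]])
    fix t
    have P: "heat m0 t \<in> prob_torus" by (rule heat_in_prob_torus[OF m0])
    interpret prob_space "heat m0 t" using prob_torusD[OF P] by blast
    have "(\<integral>x. lag x 0 \<partial>heat m0 t) \<le> c"
    proof (cases "integrable (heat m0 t) (\<lambda>x. lag x 0)")
      case True
      have "(\<integral>x. lag x 0 \<partial>heat m0 t) \<le> (\<integral>x. c \<partial>heat m0 t)"
        by (rule integral_mono[OF True]) (use l_upper[of _ 0] in auto)
      then show ?thesis by (simp add: prob_space)
    qed (use c1 in \<open>simp add: not_integrable_integral_eq\<close>)
    then have "run_cost (heat m0) (\<lambda>_ _. 0) t \<le> 2 * c"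
      using F_bound[OF P] by (simp add: run_cost_def abs_le_iff)
    then show "w t * run_cost (heat m0) (\<lambda>_ _. 0) t \<le> w t * (2 * c)" by (intro mult_left_mono W)
  qed (use W(7) in simp)
  finally show ?thesis by (simp add: mult.commute)
qed

end

abbreviation U :: "real \<Rightarrow> 'n torus measure \<Rightarrow> real" where
  "U T \<equiv> val {0..T} (\<lambda>_. 1)"

lemma U_bounds:
  assumes "0 \<le> T" "m0 \<in> prob_torus"
  shows "- (2 * c * T) \<le> U T m0" "U T m0 \<le> 2 * c * T"
  using val_lower[OF weight_one[OF assms(1)] _ assms(2)] val_upper[OF weight_one[OF assms(1)] _ assms(2)]
    integral_lb_const(1)[OF assms(1), of 1] by (auto simp: mult.assoc)

section \<open>The value function depends little on the initial measure\<close>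

text \<open>
  Take a nearly optimal trajectory from \<open>m1\<close>, mollify it, and couple to it starting from \<open>m0\<close> with weight
  \<open>r = 1\<close>. The coupling costs a constant \<open>K\<close>, large for small \<open>\<epsilon>\<close>; the mollification costs a multiple of \<open>\<epsilon>\<close> times
  the horizon plus the energy, and the energy is at most of order \<open>N\<close> by near optimality.
\<close>

lemma U_oscillation:
  assumes "0 < \<epsilon>" "\<epsilon> \<le> 1"
  shows "\<exists>K\<ge>0. \<forall>N\<ge>1. \<forall>m0\<in>prob_torus. \<forall>m1\<in>prob_torus.
     U (real N) m0 \<le> U (real N) m1 + K + c * (\<epsilon> * real CARD('n)) * (8 * c\<^sup>2) * real N"
proof -
  obtain \<kappa> where \<kappa>: "0 < \<kappa>" "\<kappa> < 1"
    "\<And>\<rho> \<nu> A. \<rho> \<in> prob_torus \<Longrightarrow> \<nu> \<in> (prob_torus :: 'n torus measure set) \<Longrightarrow> A \<in> sets borel \<Longrightarrow>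
       ennreal \<kappa> * emeasure (moll \<epsilon> \<nu>) A \<le> emeasure (heat \<rho> 1) A"
    by (rule minorization[OF assms]) (rule that)
  have split: "\<exists>\<rho>'\<in>prob_torus. heat \<rho> 1 = mix (1 - \<kappa>) (moll \<epsilon> \<nu>) \<rho>'"
    if "\<rho> \<in> prob_torus" "\<nu> \<in> prob_torus" for \<rho> \<nu> :: "'n torus measure"
    by (rule mix_complement[OF heat_in_prob_torus moll_in_prob_torus \<kappa>(1,2) \<kappa>(3)]) (use that in auto)
  obtain D where D: "0 \<le> D" "\<And>\<mu> \<nu>. \<mu> \<in> prob_torus \<Longrightarrow> \<nu> \<in> (prob_torus :: 'n torus measure set) \<Longrightarrow> kr_dist \<mu> \<nu> \<le> D"
    using kr_dist_bounded by blast
  define K where "K = 1 + (2 * c + c * D) / \<kappa>"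
  have K0: "0 \<le> K" using \<kappa> D c_pos by (simp add: K_def)
  have "U (real N) m0 \<le> U (real N) m1 + K + c * (\<epsilon> * real CARD('n)) * (8 * c\<^sup>2) * real N"
    if N: "N \<ge> 1" and P: "m0 \<in> prob_torus" "m1 \<in> prob_torus" for N m0 m1
  proof -
    obtain k where k: "N = Suc k" using N by (cases N) auto
    let ?I = "{0..real N}"
    have N0: "0 < real N" using N by simp
    have w: "weight ?I (\<lambda>_. 1)" by (rule weight_one) simp
    obtain m \<alpha> where ad: "(m, \<alpha>) \<in> admissible ?I (\<lambda>_. 1) m1" "cost ?I (\<lambda>_. 1) m \<alpha> < U (real N) m1 + 1"
      using val_near[OF w _ P(2), of 1] by auto
    define E where "E = (\<integral>p. speed2 \<alpha> p \<partial>curve ?I m)"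
    obtain \<beta> where \<beta>: "(\<lambda>t. moll \<epsilon> (m t), \<beta>) \<in> admissible ?I (\<lambda>_. 1) (moll \<epsilon> m1)"
      "cost ?I (\<lambda>_. 1) (\<lambda>t. moll \<epsilon> (m t)) \<beta> \<le> cost ?I (\<lambda>_. 1) m \<alpha> + c * (\<epsilon> * real CARD('n)) * (2 * real N + E)"
      by (rule mollify[OF N0 ad(1) less_imp_le[OF assms(1)]], rule that) (simp_all add: E_def)
    have mp: "prob_curve ?I m" using ad(1) by (simp add: admissible_iff[OF w])
    have "\<exists>m' \<alpha>'. (m', \<alpha>') \<in> admissible {0..real (Suc k)} (\<lambda>_. 1) (mix 1 (moll \<epsilon> m1) m0) \<and>
       cost {0..real (Suc k)} (\<lambda>_. 1) m' \<alpha>' \<le> cost {0..real (Suc k)} (\<lambda>_. 1) (\<lambda>t. moll \<epsilon> (m t)) \<beta> + 1 * ((2 * c + c * D) / \<kappa>)"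
      by (rule coupling[OF \<kappa>(1,2) split D(2,1)]) (use \<beta>(1) prob_curveD[OF mp] P k in auto)
    moreover have "mix 1 (moll \<epsilon> m1) m0 = m0"
      by (rule mix_one) (use prob_torusD(1)[OF P(1)] prob_torusD(1)[OF moll_in_prob_torus[OF P(2)]] in simp)
    ultimately obtain m' \<alpha>' where m': "(m', \<alpha>') \<in> admissible ?I (\<lambda>_. 1) m0"
      "cost ?I (\<lambda>_. 1) m' \<alpha>' \<le> cost ?I (\<lambda>_. 1) (\<lambda>t. moll \<epsilon> (m t)) \<beta> + (2 * c + c * D) / \<kappa>"
      unfolding k by auto
    have "E \<le> c * cost ?I (\<lambda>_. 1) m \<alpha> + 2 * c\<^sup>2 * real N"
      using admissible_costs(7)[OF w ad(1)] integral_lb_const(1)[of "real N" 1] by (simp add: E_def)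
    also have "\<dots> \<le> c * (2 * c * real N + 1) + 2 * c\<^sup>2 * real N"
      using ad(2) U_bounds(2)[of "real N" m1] P c_pos by (intro add_right_mono mult_left_mono) auto
    also have "\<dots> \<le> 5 * c\<^sup>2 * real N"
    proof -
      have "c * 1 \<le> c * (c * real N)" using c1 N mult_mono[of 1 c 1 "real N"] by (intro mult_left_mono) auto
      then show ?thesis by (simp add: power2_eq_square algebra_simps)
    qed
    finally have E: "E \<le> 5 * c\<^sup>2 * real N" .
    have "2 * real N \<le> 2 * c\<^sup>2 * real N" using c1 by (intro mult_right_mono) (auto simp: one_le_power)
    then have E': "2 * real N + E \<le> (8 * c\<^sup>2) * real N"
      using E mult_nonneg_nonneg[of "c\<^sup>2" "real N"] by (simp add: algebra_simps)
    have "U (real N) m0 \<le> cost ?I (\<lambda>_. 1) m' \<alpha>'" by (rule val_le[OF w _ P(1) m'(1)]) auto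
    also have "\<dots> \<le> U (real N) m1 + K + c * (\<epsilon> * real CARD('n)) * (2 * real N + E)"
      using m'(2) \<beta>(2) ad(2) by (simp add: K_def)
    also have "\<dots> \<le> U (real N) m1 + K + c * (\<epsilon> * real CARD('n)) * ((8 * c\<^sup>2) * real N)"
      using E' assms c_pos by (intro add_left_mono mult_left_mono) auto
    finally show ?thesis by (simp add: mult.assoc)
  qed
  then show ?thesis using K0 by blast
qed

lemma U_mono_time:
  assumes "0 \<le> S" "S \<le> T" "m0 \<in> prob_torus"
  shows "U S m0 - 2 * c * (T - S) \<le> U T m0"
proof (rule val_ge[OF weight_one _ assms(3)])
  fix m \<alpha> assume ad: "(m, \<alpha>) \<in> admissible {0..T} (\<lambda>_. 1) m0"
  have T: "T = S + (T - S)" by simp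
  have ad': "(m, \<alpha>) \<in> admissible {0..S + (T - S)} (\<lambda>_. 1) m0" using ad by simp
  have m00: "m 0 = m0" using ad by (simp add: admissible_def)
  have a1: "(m, \<alpha>) \<in> admissible {0..S} (\<lambda>_. 1) m0"
    using admissible_restrict[OF ad, of 0 S] assms by (simp add: m00)
  have a2: "(\<lambda>t. m (S + t), \<lambda>t. \<alpha> (S + t)) \<in> admissible {0..T - S} (\<lambda>_. 1) (m S)"
    by (rule admissible_restrict[OF ad]) (use assms in auto)
  have "U S m0 \<le> cost {0..S} (\<lambda>_. 1) m \<alpha>" by (rule val_le[OF weight_one _ assms(3) a1]) (use assms in auto)
  moreover have "- (2 * c) * (T - S) \<le> cost {0..T - S} (\<lambda>_. 1) (\<lambda>t. m (S + t)) (\<lambda>t. \<alpha> (S + t))"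
    using admissible_costs(8)[OF weight_one a2] integral_lb_const(1)[of "T - S" 1] assms by simp
  ultimately show "U S m0 - 2 * c * (T - S) \<le> cost {0..T} (\<lambda>_. 1) m \<alpha>"
    using cost_two[OF ad'] assms by simp
qed (use assms in auto)

lemma measure_lb_Icc: "0 \<le> T \<Longrightarrow> measure (lb {0..T}) {0..T} = T"
  using integral_lb_const(1)[of T 1] by simp

section \<open>Long horizons\<close>

definition A :: "nat \<Rightarrow> real" where "A N = (INF m0\<in>prob_torus. U (real N) m0)"

lemma A_le: "m0 \<in> prob_torus \<Longrightarrow> A N \<le> U (real N) m0"
  unfolding A_def using U_bounds(1)[of "real N"] by (intro cINF_lower bdd_belowI2[where m="- (2 * c * real N)"]) auto

lemma A_ge: "(\<And>m0. m0 \<in> prob_torus \<Longrightarrow> x \<le> U (real N) m0) \<Longrightarrow> x \<le> A N"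
  unfolding A_def using prob_torus_nonempty by (intro cINF_greatest)

lemma A_bounds: "- (2 * c * real N) \<le> A N" "A N \<le> 2 * c * real N"
proof -
  show "- (2 * c * real N) \<le> A N" using U_bounds(1)[of "real N"] by (intro A_ge) auto
  obtain m0 :: "'n torus measure" where "m0 \<in> prob_torus" using prob_torus_nonempty by blast
  then show "A N \<le> 2 * c * real N" using A_le[of m0 N] U_bounds(2)[of "real N" m0] by simp
qed

text \<open>
  Cutting a trajectory at time \<open>N\<close> costs nothing, and both pieces compete for the minimum over all initial
  measures.
\<close>

lemma A_superadditive: "A N + A M \<le> A (N + M)"
proof (intro A_ge val_ge[OF weight_one])
  fix m0 :: "'n torus measure" and m \<alpha> assume P: "m0 \<in> prob_torus" and "(m, \<alpha>) \<in> admissible {0..real (N + M)} (\<lambda>_. 1) m0"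
  then have ad: "(m, \<alpha>) \<in> admissible {0..real N + real M} (\<lambda>_. 1) m0" by simp
  have m00: "m 0 = m0" using ad by (simp add: admissible_def)
  have a1: "(m, \<alpha>) \<in> admissible {0..real N} (\<lambda>_. 1) m0"
    using admissible_restrict[OF ad, of 0 "real N"] by (simp add: m00)
  have a2: "(\<lambda>t. m (real N + t), \<lambda>t. \<alpha> (real N + t)) \<in> admissible {0..real M} (\<lambda>_. 1) (m (real N))"
    by (rule admissible_restrict[OF ad]) auto
  have P': "m (real N) \<in> prob_torus"
    using ad weight_one[of "real N + real M"] by (auto simp: admissible_iff intro!: prob_curveD)
  have "A N \<le> cost {0..real N} (\<lambda>_. 1) m \<alpha>"
    using order.trans[OF A_le[OF P] val_le[OF weight_one _ P a1]] by simp
  moreover have "A M \<le> cost {0..real M} (\<lambda>_. 1) (\<lambda>t. m (real N + t)) (\<lambda>t. \<alpha> (real N + t))"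
    using order.trans[OF A_le[OF P'] val_le[OF weight_one _ P' a2]] by simp
  ultimately show "A N + A M \<le> cost {0..real (N + M)} (\<lambda>_. 1) m \<alpha>"
    using cost_two[OF ad] by simp
qed auto

definition L where "L = (SUP N\<in>{1..}. A N / real N)"

lemma A_bdd: "bdd_above ((\<lambda>N. A N / real N) ` {1..})"
  using A_bounds(2) by (intro bdd_aboveI2[where M="2 * c"]) (auto simp: divide_le_eq)

lemma A_le_L: "A N \<le> L * real N"
proof (cases "N = 0")
  case True
  then show ?thesis using A_bounds(2)[of 0] by simp
next
  case False
  then have "A N / real N \<le> L" unfolding L_def by (intro cSUP_upper A_bdd) auto
  then show ?thesis using False by (simp add: divide_le_eq)
qed

lemma A_multiple: "real k * A n \<le> A (k * n)"
proof (induction k)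
  case 0
  then show ?case using A_bounds(1)[of 0] by simp
next
  case (Suc k)
  then show ?case using A_superadditive[of n "k * n"] by (simp add: algebra_simps)
qed

text \<open>
  Fekete's lemma: write \<open>N = k n + r\<close> with \<open>n\<close> a nearly optimal length in the supremum defining \<open>L\<close>.
\<close>

lemma A_asymptotic:
  assumes e: "e > 0"
  shows "\<forall>\<^sub>F N in sequentially. (L - e) * real N \<le> A N"
proof -
  have "\<exists>n\<in>{1..}. L - e / 2 < A n / real n"
    unfolding L_def using e less_cSUP_iff[OF _ A_bdd, of "L - e / 2"] by (auto simp: L_def)
  then obtain n where n: "n \<ge> 1" "L - e / 2 < A n / real n" by auto
  have *: "(L - e / 2) * real N - 4 * c * real n \<le> A N" for N
  proof -
    define k where "k = N div n"
    define r where "r = N mod n"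
    have N: "N = k * n + r" by (simp add: k_def r_def)
    have r: "r < n" using n by (simp add: r_def)
    have "real k * A n \<le> A (k * n)" by (rule A_multiple)
    moreover have "A (k * n) + A r \<le> A N" unfolding N by (rule A_superadditive)
    moreover have "- (2 * c * real r) \<le> A r" by (rule A_bounds)
    moreover have "2 * c * real r \<le> 2 * c * real n" using r c_pos by simp
    moreover have "real k * ((L - e / 2) * real n) \<le> real k * A n"
      using n by (intro mult_left_mono) (auto simp: less_divide_eq)
    moreover have "(L - e / 2) * real r \<le> 2 * c * real n"
    proof -
      have "A n / real n \<le> 2 * c" using n A_bounds(2)[of n] by (simp add: divide_le_eq)
      then have "L - e / 2 < 2 * c" using n by linarith
      then have "(L - e / 2) * real r \<le> 2 * c * real r" by (intro mult_right_mono) auto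
      then show ?thesis using \<open>2 * c * real r \<le> 2 * c * real n\<close> by simp
    qed
    moreover have "(L - e / 2) * real N = real k * ((L - e / 2) * real n) + (L - e / 2) * real r"
      by (simp add: N algebra_simps)
    ultimately show ?thesis by linarith
  qed
  obtain N0 :: nat where N0: "4 * c * real n / (e / 2) < real N0" using reals_Archimedean2 by blast
  show ?thesis
    unfolding eventually_sequentially
  proof (intro exI[of _ N0] allI impI)
    fix N assume "N0 \<le> N"
    then have "(e / 2) * real N0 \<le> (e / 2) * real N" using e by (intro mult_left_mono) auto
    moreover have "4 * c * real n < real N0 * (e / 2)" using N0 e by (simp only: pos_divide_less_eq half_gt_zero)
    ultimately have "4 * c * real n \<le> (e / 2) * real N" by (simp only: mult.commute[of "real N0"])
    then show "(L - e) * real N \<le> A N" using *[of N] by (simp add: algebra_simps)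
  qed
qed

text \<open>
  First choose \<open>\<epsilon>\<close> so that the linear part of the oscillation bound is below \<open>e / 2\<close>, then \<open>N\<close> so large that the
  constant part is.
\<close>

lemma U_nat_limit:
  assumes e: "e > 0"
  shows "\<forall>\<^sub>F N in sequentially. \<forall>m0\<in>prob_torus. (L - e) * real N \<le> U (real N) m0 \<and> U (real N) m0 \<le> (L + e) * real N"
proof -
  define n where "n = real CARD('n)"
  define \<epsilon> where "\<epsilon> = min 1 (e / 2 / (c * n * (8 * c\<^sup>2)))"
  have n0: "0 < n" by (simp add: n_def)
  have cn: "0 < c * n * (8 * c\<^sup>2)" using n0 c_pos by simp
  have \<epsilon>: "0 < \<epsilon>" "\<epsilon> \<le> 1" using e cn by (auto simp: \<epsilon>_def)
  have \<epsilon>e: "c * (\<epsilon> * n) * (8 * c\<^sup>2) \<le> e / 2"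
  proof -
    have "\<epsilon> \<le> e / 2 / (c * n * (8 * c\<^sup>2))" by (simp add: \<epsilon>_def)
    then have "\<epsilon> * (c * n * (8 * c\<^sup>2)) \<le> e / 2" using cn by (simp only: pos_le_divide_eq)
    then show ?thesis by (simp add: algebra_simps)
  qed
  obtain K where K: "0 \<le> K" "\<And>N m0 m1. N \<ge> 1 \<Longrightarrow> m0 \<in> prob_torus \<Longrightarrow> m1 \<in> prob_torus \<Longrightarrow>
     U (real N) m0 \<le> U (real N) m1 + K + c * (\<epsilon> * n) * (8 * c\<^sup>2) * real N"
    using U_oscillation[OF \<epsilon>] unfolding n_def by blast
  obtain N0 :: nat where N0: "K / (e / 2) < real N0" using reals_Archimedean2 by blast
  have "\<forall>\<^sub>F N in sequentially. N \<ge> max 1 N0" by (rule eventually_ge_at_top)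
  with A_asymptotic[OF e] show ?thesis
  proof eventually_elim
    case (elim N)
    show ?case
    proof
      fix m0 :: "'n torus measure" assume P: "m0 \<in> prob_torus"
      have "U (real N) m0 - K - c * (\<epsilon> * n) * (8 * c\<^sup>2) * real N \<le> A N"
      proof (rule A_ge)
        fix m1 :: "'n torus measure" assume "m1 \<in> prob_torus"
        then show "U (real N) m0 - K - c * (\<epsilon> * n) * (8 * c\<^sup>2) * real N \<le> U (real N) m1"
          using K(2)[of N m0 m1] elim P by auto
      qed
      moreover have "c * (\<epsilon> * n) * (8 * c\<^sup>2) * real N \<le> (e / 2) * real N" using \<epsilon>e by (rule mult_right_mono) simp
      moreover have "K \<le> (e / 2) * real N"
      proof -
        have "K < real N0 * (e / 2)" using N0 e by (simp add: divide_less_eq)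
        also have "\<dots> \<le> real N * (e / 2)" using elim e by (intro mult_right_mono) auto
        finally show ?thesis by (simp add: mult.commute)
      qed
      ultimately have "U (real N) m0 \<le> (L + e) * real N" using A_le_L[of N] by (simp add: algebra_simps)
      then show "(L - e) * real N \<le> U (real N) m0 \<and> U (real N) m0 \<le> (L + e) * real N"
        using elim A_le[OF P, of N] by simp
    qed
  qed
qed

theorem U_limit:
  assumes e: "e > 0"
  shows "\<forall>\<^sub>F T in at_top. \<forall>m0\<in>prob_torus. \<bar>U T m0 / T - L\<bar> \<le> e"
proof -
  have "e / 2 > 0" using e by simp
  from U_nat_limit[OF this] obtain N0 where N0: "\<And>N m0. N \<ge> N0 \<Longrightarrow> m0 \<in> prob_torus \<Longrightarrow>
    (L - e / 2) * real N \<le> U (real N) m0 \<and> U (real N) m0 \<le> (L + e / 2) * real N"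
    unfolding eventually_sequentially by blast
  define C where "C = \<bar>L\<bar> + e + 2 * c"
  have "\<forall>\<^sub>F T in at_top. T \<ge> max (real N0 + 1) (C / (e / 2))" by (rule eventually_ge_at_top)
  then show ?thesis
  proof eventually_elim
    case (elim T)
    have T1: "real N0 + 1 \<le> T" and TC: "C \<le> (e / 2) * T" and T0: "0 < T"
      using elim e by (auto simp: divide_le_eq mult.commute)
    define N where "N = nat \<lfloor>T\<rfloor>"
    have N: "real N \<le> T" "T \<le> real (Suc N)" "N0 \<le> N" using T1 T0 unfolding N_def by linarith+
    show ?case
    proof
      fix m0 :: "'n torus measure" assume P: "m0 \<in> prob_torus"
      have b1: "(L - e / 2) * real N \<le> U (real N) m0" using N0[OF N(3) P] by simp
      have b2: "U (real (Suc N)) m0 \<le> (L + e / 2) * real (Suc N)" using N0[of "Suc N" m0] N(3) P by simp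
      have d1: "T - real N \<le> 1" "0 \<le> T - real N" "real (Suc N) - T \<le> 1" "0 \<le> real (Suc N) - T" using N by auto
      have "2 * c * (T - real N) \<le> 2 * c" "2 * c * (real (Suc N) - T) \<le> 2 * c"
        using d1 c_pos by (auto simp: mult_left_le)
      then have u1: "U (real N) m0 - 2 * c \<le> U T m0" and u2: "U T m0 \<le> U (real (Suc N)) m0 + 2 * c"
        using U_mono_time[OF _ N(1) P] U_mono_time[OF _ N(2) P] T0 by fastforce+
      have l1: "L * (T - real N) \<le> \<bar>L\<bar>"
        using d1 mult_mono[of L "\<bar>L\<bar>" "T - real N" 1] by simp
      have l2: "L * (real (Suc N) - T) \<le> \<bar>L\<bar>"
        using d1 mult_mono[of L "\<bar>L\<bar>" "real (Suc N) - T" 1] by simp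
      have e1: "e / 2 * real N \<le> e / 2 * T" using N(1) e by (intro mult_left_mono) auto
      have "e / 2 * real (Suc N) = e / 2 * real N + e / 2" by (simp add: algebra_simps)
      then have e2: "e / 2 * real (Suc N) \<le> e / 2 * T + e" using e1 e by linarith
      have x: "L * T = L * (T - real N) + L * real N" "L * T = L * real (Suc N) - L * (real (Suc N) - T)"
        "(L - e / 2) * real N = L * real N - e / 2 * real N" "(L + e / 2) * real (Suc N) = L * real (Suc N) + e / 2 * real (Suc N)"
        "e * T = e / 2 * T + e / 2 * T"
        by (simp_all only: left_diff_distrib right_diff_distrib distrib_right)
      have "L * T - e * T \<le> U T m0" "U T m0 \<le> L * T + e * T"
        using e1 e2 u1 u2 b1 b2 l1 l2 TC x c_pos e unfolding C_def by linarith+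
      then have "\<bar>U T m0 - L * T\<bar> \<le> e * T" by (simp add: abs_le_iff)
      moreover have "U T m0 / T - L = (U T m0 - L * T) / T" using T0 by (simp add: diff_divide_distrib)
      then have "\<bar>U T m0 / T - L\<bar> = \<bar>U T m0 - L * T\<bar> / T" using T0 by (simp only: abs_divide abs_of_pos)
      ultimately show "\<bar>U T m0 / T - L\<bar> \<le> e" using T0 by (simp add: divide_le_eq)
    qed
  qed
qed

section \<open>Small discount\<close>

abbreviation V :: "real \<Rightarrow> 'n torus measure \<Rightarrow> real" where
  "V \<delta> \<equiv> val {0..} (\<lambda>t. exp (- \<delta> * t))"

lemma V_bounds:
  assumes "0 < \<delta>" "m0 \<in> prob_torus"
  shows "- (2 * c / \<delta>) \<le> V \<delta> m0" "V \<delta> m0 \<le> 2 * c / \<delta>"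
  using val_lower[OF weight_exp[OF assms(1)] _ assms(2)] val_upper[OF weight_exp[OF assms(1)] _ assms(2)]
    integral_exp_lb(2)[OF assms(1)] by auto

text \<open>
  Dynamic programming on \<open>[0, N]\<close>, with \<open>q\<close> the discount factor over the window. There the weight lies
  between \<open>q\<close> and \<open>1\<close>; adding \<open>2 c\<close> makes the running cost nonnegative, so that the weight may be replaced by \<open>q\<close>.
\<close>

lemma V_lower:
  assumes \<delta>: "0 < \<delta>" and q: "q = exp (- \<delta> * real N)" and a: "\<And>m0. m0 \<in> prob_torus \<Longrightarrow> a \<le> V \<delta> m0" and P: "m0 \<in> prob_torus"
  shows "q * (A N + 2 * c * real N) - 2 * c * real N + q * a \<le> V \<delta> m0"
proof (rule val_ge[OF weight_exp[OF \<delta>] _ P])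
  let ?w = "\<lambda>t. exp (- \<delta> * t)"
  fix m \<alpha> assume ad: "(m, \<alpha>) \<in> admissible {0..} ?w m0"
  have w: "weight {0..} ?w" by (rule weight_exp[OF \<delta>])
  have wN: "weight {0..real N} (\<lambda>_. 1)" by (rule weight_one) simp
  have m: "prob_curve {0..} m" and m00: "m 0 = m0" using ad unfolding admissible_iff[OF w] by blast+
  have q0: "0 < q" by (simp add: q)
  have I: "{0..} = {0..real N} \<union> (+) (real N) ` {0..}" by (rule Ici_concat) simp
  have a1: "(\<lambda>t. m (0 + t), \<lambda>t. \<alpha> (0 + t)) \<in> admissible {0..real N} (\<lambda>_. 1) (m 0)"
  proof (rule admissible_shift[OF w wN ad])
    fix t assume t: "t \<in> {0..real N}"
    have "1 = exp (\<delta> * t) * ?w t" by (simp flip: exp_add)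
    also have "\<dots> \<le> exp (\<delta> * real N) * ?w t" using t \<delta> by (intro mult_right_mono) auto
    finally show "1 \<le> exp (\<delta> * real N) * ?w (0 + t)" by simp
  qed auto
  then have a1: "(m, \<alpha>) \<in> admissible {0..real N} (\<lambda>_. 1) m0" by (simp add: m00)
  have a2: "(\<lambda>t. m (real N + t), \<lambda>t. \<alpha> (real N + t)) \<in> admissible {0..} ?w (m (real N))"
  proof (rule admissible_shift[OF w w ad])
    show "?w t \<le> exp (\<delta> * real N) * ?w (real N + t)" for t
      by (simp add: algebra_simps flip: exp_add)
  qed auto
  have P': "m (real N) \<in> prob_torus" by (rule prob_curveD[OF m]) simp
  note cs = cost_split[OF _ _ _ I w ad, simplified]
  have "(\<integral>t. ?w (real N + t) * run_cost m \<alpha> (real N + t) \<partial>lb {0..}) = q * cost {0..} ?w (\<lambda>t. m (real N + t)) (\<lambda>t. \<alpha> (real N + t))"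
  proof -
    have "?w (real N + t) = q * ?w t" for t by (simp add: q algebra_simps flip: exp_add)
    then show ?thesis unfolding mult.assoc by (simp only: cost_shift weightD(1)[OF w] mult.assoc integral_mult_right_zero)
  qed
  moreover have "q * a \<le> q * cost {0..} ?w (\<lambda>t. m (real N + t)) (\<lambda>t. \<alpha> (real N + t))"
    using a[OF P'] val_le[OF w _ P' a2] q0 by (intro mult_left_mono) auto
  moreover have "q * (A N + 2 * c * real N) - 2 * c * real N \<le> (\<integral>t. ?w t * run_cost m \<alpha> t \<partial>lb {0..real N})"
  proof -
    have ir: "integrable (lb {0..real N}) (\<lambda>t. run_cost m \<alpha> t)" using admissible_costs(4)[OF wN a1] by simp
    have ie: "integrable (lb {0..real N}) (\<lambda>t. ?w t * run_cost m \<alpha> t)" using cs(2) by simp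
    have "(\<integral>t. q * (run_cost m \<alpha> t + 2 * c) - 2 * c \<partial>lb {0..real N}) \<le> (\<integral>t. ?w t * run_cost m \<alpha> t \<partial>lb {0..real N})"
    proof (rule integral_mono[OF _ ie])
      show "integrable (lb {0..real N}) (\<lambda>t. q * (run_cost m \<alpha> t + 2 * c) - 2 * c)"
        by (intro Bochner_Integration.integrable_diff integrable_mult_right Bochner_Integration.integrable_add ir integral_lb_const) auto
      fix t assume "t \<in> space (lb {0..real N})"
      then have t: "0 \<le> t" "t \<le> real N" by auto
      have "- (2 * c) \<le> run_cost m \<alpha> t" by (rule run_cost_ge) (use prob_curveD[OF m] t in auto)
      moreover have "q \<le> ?w t" using t \<delta> by (simp add: q)
      ultimately have "q * (run_cost m \<alpha> t + 2 * c) \<le> ?w t * (run_cost m \<alpha> t + 2 * c)" by (intro mult_right_mono) auto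
      moreover have "?w t * (2 * c) \<le> 1 * (2 * c)" using t \<delta> c_pos by (intro mult_right_mono) auto
      ultimately show "q * (run_cost m \<alpha> t + 2 * c) - 2 * c \<le> ?w t * run_cost m \<alpha> t" by (simp add: algebra_simps)
    qed
    also have "(\<integral>t. q * (run_cost m \<alpha> t + 2 * c) - 2 * c \<partial>lb {0..real N}) = q * (cost {0..real N} (\<lambda>_. 1) m \<alpha> + 2 * c * real N) - 2 * c * real N"
    proof -
      have i2: "integrable (lb {0..real N}) (\<lambda>t. run_cost m \<alpha> t + 2 * c)"
        by (intro Bochner_Integration.integrable_add ir integral_lb_const) auto
      have "(\<integral>t. q * (run_cost m \<alpha> t + 2 * c) - 2 * c \<partial>lb {0..real N}) = q * (\<integral>t. run_cost m \<alpha> t + 2 * c \<partial>lb {0..real N}) - real N * (2 * c)"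
        by (subst Bochner_Integration.integral_diff[OF integrable_mult_right[OF i2] integral_lb_const(2)]) (simp_all add: measure_lb_Icc)
      also have "(\<integral>t. run_cost m \<alpha> t + 2 * c \<partial>lb {0..real N}) = cost {0..real N} (\<lambda>_. 1) m \<alpha> + real N * (2 * c)"
        using Bochner_Integration.integral_add[OF ir integral_lb_const(2)[of "real N" "2 * c"]] admissible_costs(5)[OF wN a1]
        by (simp add: measure_lb_Icc)
      finally show ?thesis by (simp add: mult.commute)
    qed
    finally have "q * (cost {0..real N} (\<lambda>_. 1) m \<alpha> + 2 * c * real N) - 2 * c * real N \<le> (\<integral>t. ?w t * run_cost m \<alpha> t \<partial>lb {0..real N})" .
    moreover have "A N \<le> cost {0..real N} (\<lambda>_. 1) m \<alpha>" using A_le[OF P, of N] val_le[OF wN _ P a1] by simp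
    then have "q * (A N + 2 * c * real N) \<le> q * (cost {0..real N} (\<lambda>_. 1) m \<alpha> + 2 * c * real N)" using q0 by (intro mult_left_mono) auto
    ultimately show ?thesis by linarith
  qed
  ultimately show "q * (A N + 2 * c * real N) - 2 * c * real N + q * a \<le> cost {0..} ?w m \<alpha>"
    using cs(1) by simp
qed auto

text \<open>
  Follow a nearly optimal trajectory for the undiscounted problem up to time \<open>N\<close>, then one that is nearly
  optimal for the discounted problem.
\<close>

lemma V_upper:
  assumes \<delta>: "0 < \<delta>" and N: "1 \<le> N" and q: "q = exp (- \<delta> * real N)" and a: "\<And>m0. m0 \<in> prob_torus \<Longrightarrow> V \<delta> m0 \<le> a"
    and B: "\<And>m0. m0 \<in> prob_torus \<Longrightarrow> U (real N) m0 \<le> B" and P: "m0 \<in> prob_torus"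
  shows "V \<delta> m0 \<le> B + 2 * c * real N * (1 - q) + q * a"
proof (rule field_le_epsilon)
  fix e :: real assume e: "e > 0"
  let ?w = "\<lambda>t. exp (- \<delta> * t)"
  have w: "weight {0..} ?w" by (rule weight_exp[OF \<delta>])
  have wN: "weight {0..real N} (\<lambda>_. 1)" by (rule weight_one) simp
  have wN': "weight {0..real N} ?w" by (rule weight_Icc) (auto intro!: continuous_intros)
  have q0: "0 < q" "q \<le> 1" using \<delta> by (auto simp: q)
  have I: "{0..} = {0..real N} \<union> (+) (real N) ` {0..}" by (rule Ici_concat) simp
  obtain m \<alpha> where ad: "(m, \<alpha>) \<in> admissible {0..real N} (\<lambda>_. 1) m0" "cost {0..real N} (\<lambda>_. 1) m \<alpha> < U (real N) m0 + e / 2"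
    using val_near[OF wN _ P, of "e / 2"] e by auto
  have m: "prob_curve {0..real N} m" and m00: "m 0 = m0" using ad(1) by (auto simp: admissible_iff[OF wN])
  have P': "m (real N) \<in> prob_torus" by (rule prob_curveD[OF m]) simp
  have a1: "(\<lambda>t. m (0 + t), \<lambda>t. \<alpha> (0 + t)) \<in> admissible {0..real N} ?w (m 0)"
    by (rule admissible_shift[OF wN wN' ad(1), of _ 1]) (use \<delta> in auto)
  then have a1: "(m, \<alpha>) \<in> admissible {0..real N} ?w m0" by (simp add: m00)
  obtain m2 \<alpha>2 where ad2: "(m2, \<alpha>2) \<in> admissible {0..} ?w (m (real N))" "cost {0..} ?w m2 \<alpha>2 < V \<delta> (m (real N)) + e / 2"
    using val_near[OF w _ P', of "e / 2"] e by auto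
  have m20: "m2 0 = m (real N)" using ad2(1) by (simp add: admissible_def)
  have wsh: "?w (real N + t) = q * ?w t" for t by (simp add: q algebra_simps flip: exp_add)
  have wJ: "weight {0..} (\<lambda>t. ?w (real N + t))"
  proof -
    have "integrable (lb {0..}) (\<lambda>t. q * ?w t)" using integral_exp_lb(1)[OF \<delta>] by (rule integrable_mult_right)
    then show ?thesis unfolding weight_def by (auto simp: wsh[simplified] q0 intro!: continuous_intros)
  qed
  have "(\<lambda>t. m2 (0 + t), \<lambda>t. \<alpha>2 (0 + t)) \<in> admissible {0..} (\<lambda>t. ?w (real N + t)) (m2 0)"
    by (rule admissible_shift[OF w wJ ad2(1), of _ q]) (use wsh in auto)
  then have a2: "(m2, \<alpha>2) \<in> admissible {0..} (\<lambda>t. ?w (real N + t)) (m (real N))" by (simp add: m20)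
  have N0: "0 < real N" using N by simp
  note g = admissible_glue[OF N0 _ _ zero_less_one I wN' wJ a1 a2] and gc = cost_glue[OF N0 _ _ zero_less_one I wN' wJ a1 a2]
  have "V \<delta> m0 \<le> cost {0..} ?w (glue (real N) m m2) (glue (real N) \<alpha> \<alpha>2)"
    by (rule val_le[OF w _ P g(2)]) auto
  also have "\<dots> = cost {0..real N} ?w m \<alpha> + cost {0..} (\<lambda>t. ?w (real N + t)) m2 \<alpha>2" by (rule gc) auto
  also have "cost {0..} (\<lambda>t. ?w (real N + t)) m2 \<alpha>2 = q * cost {0..} ?w m2 \<alpha>2"
    by (simp only: cost_def LINT_lb[OF weightD(1)[OF w]] wsh mult.assoc integral_mult_right_zero)
  also have "cost {0..real N} ?w m \<alpha> \<le> cost {0..real N} (\<lambda>_. 1) m \<alpha> + 2 * c * real N * (1 - q)"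
  proof -
    have ir: "integrable (lb {0..real N}) (\<lambda>t. run_cost m \<alpha> t)" using admissible_costs(4)[OF wN ad(1)] by simp
    have ie: "integrable (lb {0..real N}) (\<lambda>t. ?w t * run_cost m \<alpha> t)" by (rule admissible_costs(4)[OF wN' a1])
    have "cost {0..real N} ?w m \<alpha> = (\<integral>t. ?w t * run_cost m \<alpha> t \<partial>lb {0..real N})" by (rule admissible_costs(5)[OF wN' a1])
    also have "\<dots> \<le> (\<integral>t. run_cost m \<alpha> t + 2 * c * (1 - q) \<partial>lb {0..real N})"
    proof (rule integral_mono[OF ie])
      show "integrable (lb {0..real N}) (\<lambda>t. run_cost m \<alpha> t + 2 * c * (1 - q))"
        by (intro Bochner_Integration.integrable_add ir integral_lb_const) auto
      fix t assume "t \<in> space (lb {0..real N})"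
      then have t: "0 \<le> t" "t \<le> real N" by auto
      have r: "- (2 * c) \<le> run_cost m \<alpha> t" by (rule run_cost_ge) (use prob_curveD[OF m] t in auto)
      have w1: "?w t \<le> 1" and wq: "q \<le> ?w t" using t \<delta> by (auto simp: q)
      have "?w t * (run_cost m \<alpha> t + 2 * c) \<le> 1 * (run_cost m \<alpha> t + 2 * c)" using r w1 by (intro mult_right_mono) auto
      moreover have "q * (2 * c) \<le> ?w t * (2 * c)" using wq c_pos by (intro mult_right_mono) auto
      ultimately show "?w t * run_cost m \<alpha> t \<le> run_cost m \<alpha> t + 2 * c * (1 - q)" by (simp add: algebra_simps)
    qed
    also have "\<dots> = cost {0..real N} (\<lambda>_. 1) m \<alpha> + 2 * c * real N * (1 - q)"
      unfolding admissible_costs(5)[OF wN ad(1)]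
      by (subst Bochner_Integration.integral_add[OF ir integral_lb_const(2)]) (simp_all add: measure_lb_Icc)
    finally show ?thesis .
  qed
  also have "q * cost {0..} ?w m2 \<alpha>2 \<le> q * (a + e / 2)" using ad2(2) a[OF P'] q0 by (intro mult_left_mono) auto
  also have "q * (a + e / 2) \<le> q * a + e / 2" using q0 e by (simp add: algebra_simps mult_left_le)
  finally show "V \<delta> m0 \<le> B + 2 * c * real N * (1 - q) + q * a + e"
    using ad(2) B[OF P] by simp
qed

text \<open>
  The window length \<open>N\<close> is fixed first. Applied to the infimum and the supremum of \<open>V \<delta>\<close> over all initial measures,
  the two dynamic programming inequalities close up to bounds for \<open>(1 - q) V \<delta>\<close>, and \<open>\<delta> / (1 - q) \<rightarrow> 1 / N\<close> as
  \<open>\<delta> \<rightarrow> 0\<close>.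
\<close>

theorem V_limit:
  assumes e: "e > 0"
  shows "\<forall>\<^sub>F \<delta> in at_right 0. \<forall>m0\<in>prob_torus. \<bar>\<delta> * V \<delta> m0 - L\<bar> \<le> e"
proof -
  have e4: "e / 4 > 0" using e by simp
  have "\<forall>\<^sub>F N in sequentially. N \<ge> (1::nat)" by (rule eventually_ge_at_top)
  with U_nat_limit[OF e4] A_asymptotic[OF e4] have "\<forall>\<^sub>F N in sequentially. N \<ge> 1 \<and> (L - e / 4) * real N \<le> A N \<and> (\<forall>m0\<in>prob_torus. U (real N) m0 \<le> (L + e / 4) * real N)"
    by eventually_elim auto
  then obtain N where N: "N \<ge> 1" "(L - e / 4) * real N \<le> A N" "\<And>m0. m0 \<in> prob_torus \<Longrightarrow> U (real N) m0 \<le> (L + e / 4) * real N"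
    unfolding eventually_sequentially by blast
  define n where "n = real N"
  have n0: "0 < n" using N by (simp add: n_def)
  define lo where "lo \<delta> = (\<delta> * (exp (- \<delta> * n) * ((L - e / 4) * n + 2 * c * n) - 2 * c * n)) / (1 - exp (- \<delta> * n))" for \<delta>
  define hi where "hi \<delta> = (\<delta> * ((L + e / 4) * n + 2 * c * n * (1 - exp (- \<delta> * n)))) / (1 - exp (- \<delta> * n))" for \<delta>
  have r: "((\<lambda>\<delta>. \<delta> / (1 - exp (- \<delta> * n))) \<longlongrightarrow> inverse n) (at_right 0)" using n0 by real_asymp
  then have r: "((\<lambda>\<delta>. \<delta> / (1 - exp (- \<delta> * n))) \<longlongrightarrow> 1 / n) (at_right 0)" by (simp add: inverse_eq_divide)
  have q1: "((\<lambda>\<delta>. exp (- \<delta> * n)) \<longlongrightarrow> 1) (at_right 0)" using n0 by real_asymp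
  have "((\<lambda>\<delta>. (\<delta> / (1 - exp (- \<delta> * n))) * (exp (- \<delta> * n) * ((L - e / 4) * n + 2 * c * n) - 2 * c * n)) \<longlongrightarrow> (1 / n) * (1 * ((L - e / 4) * n + 2 * c * n) - 2 * c * n)) (at_right 0)"
    by (intro tendsto_intros r q1)
  moreover have "(1 / n) * (1 * ((L - e / 4) * n + 2 * c * n) - 2 * c * n) = L - e / 4" using n0 by (simp add: field_simps)
  ultimately have lol: "(lo \<longlongrightarrow> L - e / 4) (at_right 0)" by (simp add: lo_def[abs_def])
  have "((\<lambda>\<delta>. (\<delta> / (1 - exp (- \<delta> * n))) * ((L + e / 4) * n + 2 * c * n * (1 - exp (- \<delta> * n)))) \<longlongrightarrow> (1 / n) * ((L + e / 4) * n + 2 * c * n * (1 - 1))) (at_right 0)"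
    by (intro tendsto_intros r q1)
  moreover have "(1 / n) * ((L + e / 4) * n + 2 * c * n * (1 - 1)) = L + e / 4" using n0 by (simp add: field_simps)
  ultimately have hil: "(hi \<longlongrightarrow> L + e / 4) (at_right 0)" by (simp add: hi_def[abs_def])
  have "\<forall>\<^sub>F \<delta> in at_right 0. L - e < lo \<delta>" by (rule order_tendstoD(1)[OF lol]) (use e in simp)
  moreover have "\<forall>\<^sub>F \<delta> in at_right 0. hi \<delta> < L + e" by (rule order_tendstoD(2)[OF hil]) (use e in simp)
  moreover have "\<forall>\<^sub>F \<delta> in at_right (0::real). 0 < \<delta>" by (auto simp: eventually_at_filter)
  ultimately show ?thesis
  proof eventually_elim
    case (elim \<delta>)
    then have \<delta>: "0 < \<delta>" by simp
    define q where "q = exp (- \<delta> * real N)"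
    have q: "0 < q" "q < 1" using \<delta> n0 by (auto simp: q_def n_def)
    define a where "a = (INF m0\<in>prob_torus. V \<delta> m0)"
    define b where "b = (SUP m0\<in>prob_torus. V \<delta> m0)"
    have aV: "a \<le> V \<delta> m0" if "m0 \<in> prob_torus" for m0
      unfolding a_def using that V_bounds(1)[OF \<delta>] by (intro cINF_lower bdd_belowI2[where m="- (2 * c / \<delta>)"]) auto
    have bV: "V \<delta> m0 \<le> b" if "m0 \<in> prob_torus" for m0
      unfolding b_def using that V_bounds(2)[OF \<delta>] by (intro cSUP_upper bdd_aboveI2[where M="2 * c / \<delta>"]) auto
    have "q * (A N + 2 * c * n) - 2 * c * n + q * a \<le> a"
      using V_lower[OF \<delta> q_def aV] prob_torus_nonempty unfolding n_def
      by (subst (2) a_def, intro cINF_greatest) (auto simp: a_def)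
    then have "q * (A N + 2 * c * n) - 2 * c * n \<le> a * (1 - q)" by (simp add: algebra_simps)
    moreover have "q * ((L - e / 4) * n + 2 * c * n) \<le> q * (A N + 2 * c * n)" using N(2) q by (intro mult_left_mono) (auto simp: n_def)
    ultimately have "q * ((L - e / 4) * n + 2 * c * n) - 2 * c * n \<le> a * (1 - q)" by linarith
    then have "\<delta> * (q * ((L - e / 4) * n + 2 * c * n) - 2 * c * n) \<le> \<delta> * (a * (1 - q))" using \<delta> by (intro mult_left_mono) auto
    moreover have "lo \<delta> = (\<delta> * (q * ((L - e / 4) * n + 2 * c * n) - 2 * c * n)) / (1 - q)" by (simp only: lo_def q_def n_def)
    ultimately have lo: "lo \<delta> \<le> \<delta> * a" using q by (simp only: pos_divide_le_eq diff_gt_0_iff_gt mult.assoc)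
    have "b \<le> (L + e / 4) * n + 2 * c * n * (1 - q) + q * b"
      using V_upper[OF \<delta> N(1) q_def bV N(3)] prob_torus_nonempty unfolding n_def
      by (subst (1) b_def, intro cSUP_least) (auto simp: b_def)
    then have "b * (1 - q) \<le> (L + e / 4) * n + 2 * c * n * (1 - q)" by (simp add: algebra_simps)
    then have "\<delta> * (b * (1 - q)) \<le> \<delta> * ((L + e / 4) * n + 2 * c * n * (1 - q))" using \<delta> by (intro mult_left_mono) auto
    moreover have "hi \<delta> = (\<delta> * ((L + e / 4) * n + 2 * c * n * (1 - q))) / (1 - q)" by (simp only: hi_def q_def n_def)
    ultimately have hi: "\<delta> * b \<le> hi \<delta>" using q by (simp only: pos_le_divide_eq diff_gt_0_iff_gt mult.assoc)
    show ?case
    proof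
      fix m0 :: "'n torus measure" assume P: "m0 \<in> prob_torus"
      have "\<delta> * a \<le> \<delta> * V \<delta> m0" "\<delta> * V \<delta> m0 \<le> \<delta> * b" using aV[OF P] bV[OF P] \<delta> by auto
      then show "\<bar>\<delta> * V \<delta> m0 - L\<bar> \<le> e" using lo hi elim(1,2) by linarith
    qed
  qed
qed

end

section \<open>Estimates on the Hamiltonian and its Legendre transform\<close>

lemma Ck2_continuous: "Ck 2 f \<Longrightarrow> continuous_on UNIV f"
  using Ck_Suc_imp_Ck[OF Ck_Suc_imp_Ck, of 0 f] by (simp only: numeral_2_eq_2 Ck.simps(1))

lemma twice_differentiable_of_Ck2:
  fixes f :: "real^'n \<Rightarrow> real"
  assumes "Ck 2 f"
  shows "twice_differentiable f"
proof -
  have 2: "Ck (Suc (Suc 0)) f" using assms by (simp add: numeral_2_eq_2)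
  have "(\<lambda>y. grad f y $ i) differentiable (at x)" for x i
    using Ck_SucD(1)[OF Ck_SucD(2)[OF 2, of "axis i 1"]] unfolding grad_nth differentiable_def by blast
  then have "grad f differentiable (at x)" for x by (simp add: differentiable_vec_components)
  moreover have "f differentiable (at x)" for x using Ck_SucD(1)[OF 2] unfolding differentiable_def by blast
  ultimately show ?thesis by (simp add: twice_differentiable_def)
qed

lemma second_order_Taylor:
  fixes f :: "real^'n \<Rightarrow> real"
  assumes "twice_differentiable f"
  shows "\<exists>s. f p = f 0 + grad f 0 \<bullet> p + (p \<bullet> (hessian f (s *\<^sub>R p) *v p)) / 2"
proof -
  have d: "(f has_derivative (\<lambda>v. grad f y \<bullet> v)) (at y)" for y
  proof -
    have d: "(f has_derivative frechet_derivative f (at y)) (at y)"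
      using assms by (simp add: twice_differentiable_def frechet_derivative_works)
    have "frechet_derivative f (at y) v = grad f y \<bullet> v" for v
    proof -
      have "v = (\<Sum>i\<in>UNIV. v $ i *\<^sub>R axis i 1)" by (simp add: vec_eq_iff axis_def if_distrib cong: if_cong)
      then have "frechet_derivative f (at y) v = frechet_derivative f (at y) (\<Sum>i\<in>UNIV. v $ i *\<^sub>R axis i 1)" by simp
      also have "\<dots> = (\<Sum>i\<in>UNIV. v $ i * grad f y $ i)"
        using has_derivative_linear[OF d] by (simp add: linear_sum linear_scale grad_nth)
      finally show ?thesis by (simp add: inner_vec_def mult.commute)
    qed
    then have "frechet_derivative f (at y) = (\<lambda>v. grad f y \<bullet> v)" by blast
    with d show ?thesis by (simp only:)
  qed
  have dd: "(grad f has_derivative (\<lambda>v. hessian f y *v v)) (at y)" for y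
    using assms unfolding twice_differentiable_def hessian_def by (simp add: jacobian_works)
  define diff :: "nat \<Rightarrow> real \<Rightarrow> real" where
    "diff m s = (if m = 0 then f (s *\<^sub>R p) else if m = 1 then grad f (s *\<^sub>R p) \<bullet> p else p \<bullet> (hessian f (s *\<^sub>R p) *v p))" for m s
  have aff: "((\<lambda>s. s *\<^sub>R p) has_derivative (\<lambda>h. h *\<^sub>R p)) (at s)" for s by (auto intro!: derivative_eq_intros)
  have "(diff m has_real_derivative diff (Suc m) s) (at s)" if "m < 2" for m s
  proof (cases "m = 0")
    case True
    have "((\<lambda>s. f (s *\<^sub>R p)) has_derivative (\<lambda>h. grad f (s *\<^sub>R p) \<bullet> (h *\<^sub>R p))) (at s)"
      using diff_chain_at[OF aff d] by (simp add: o_def)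
    moreover have "(\<lambda>h. grad f (s *\<^sub>R p) \<bullet> (h *\<^sub>R p)) = (*) (grad f (s *\<^sub>R p) \<bullet> p)" by (simp add: fun_eq_iff)
    ultimately show ?thesis unfolding has_field_derivative_def True diff_def by simp
  next
    case False
    have "((\<lambda>s. grad f (s *\<^sub>R p)) has_derivative (\<lambda>h. hessian f (s *\<^sub>R p) *v (h *\<^sub>R p))) (at s)"
      using diff_chain_at[OF aff dd] by (simp add: o_def)
    then have "((\<lambda>s. grad f (s *\<^sub>R p) \<bullet> p) has_derivative (\<lambda>h. (hessian f (s *\<^sub>R p) *v (h *\<^sub>R p)) \<bullet> p)) (at s)"
      by (rule has_derivative_inner_left)
    moreover have "m = 1" using False that by simp
    moreover have "(\<lambda>h. (hessian f (s *\<^sub>R p) *v (h *\<^sub>R p)) \<bullet> p) = (*) (p \<bullet> (hessian f (s *\<^sub>R p) *v p))"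
      by (simp add: fun_eq_iff inner_commute matrix_vector_mult_scaleR)
    ultimately show ?thesis unfolding has_field_derivative_def diff_def by simp
  qed
  then obtain s where "diff 0 1 = (\<Sum>m<2. diff m 0 / fact m * 1 ^ m) + diff 2 s / fact 2 * 1 ^ 2"
    using Maclaurin[of 1 2 diff "diff 0"] by auto
  then show ?thesis by (intro exI[of _ s]) (simp add: diff_def numeral_2_eq_2)
qed

text \<open>
  Taylor at \<open>p = 0\<close> with the two-sided bound on \<open>D\<^sub>p\<^sub>p H\<close>. The linear term is bounded without differentiating
  jointly in \<open>(x, p)\<close>: by convexity \<open>D\<^sub>p H(x, 0) \<bullet> v \<le> H(x, v) - H(x, 0)\<close>, and \<open>H\<close> is bounded for \<open>|v| \<le> 1\<close> by compactness.
\<close>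

lemma hamiltonian_quadratic_growth:
  fixes H :: "'n::finite torus \<Rightarrow> real^'n \<Rightarrow> real"
  assumes H_C2: "Ck 2 (\<lambda>(y, p). H (abs_torus y) p)"
    and H_pp: "Cbar > 0"
      "\<And>x p v. (1 / Cbar) * (v \<bullet> v) \<le> v \<bullet> (hessian (H x) p *v v)"
      "\<And>x p v. v \<bullet> (hessian (H x) p *v v) \<le> Cbar * (v \<bullet> v)"
  shows "\<exists>K\<ge>1. \<forall>x p. (norm p)\<^sup>2 / K - K \<le> H x p \<and> H x p \<le> K * (1 + (norm p)\<^sup>2)"
proof -
  note H_cont = Ck2_continuous[OF H_C2]
  have "continuous_on UNIV (\<lambda>(p, y). H (abs_torus y) p)"
    using continuous_on_compose2[OF H_cont continuous_on_swap, of UNIV] by (simp add: prod.swap_def case_prod_beta)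
  then have "continuous_on UNIV (\<lambda>(p, x). H x p)" by (rule continuous_on_torus_lift)
  then have "continuous_on (cball 0 1 \<times> UNIV) (\<lambda>(p, x). H x p)" by (rule continuous_on_subset) simp
  then have "compact ((\<lambda>(p, x). H x p) ` (cball 0 1 \<times> UNIV))"
    by (rule compact_continuous_image[OF _ compact_Times[OF compact_cball compact_torus]])
  then have "bounded ((\<lambda>(p, x). H x p) ` (cball 0 1 \<times> UNIV))" by (rule compact_imp_bounded)
  then obtain M where "\<forall>z\<in>(\<lambda>(p, x). H x p) ` (cball 0 1 \<times> UNIV). norm z \<le> M" unfolding bounded_iff by blast
  then have M: "\<bar>H x p\<bar> \<le> M" if "norm p \<le> 1" for x p using that by auto
  have M0: "0 \<le> M" using M[of 0 undefined] by simp
  have tw: "twice_differentiable (H x)" for x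
  proof -
    have "Ck 2 (\<lambda>p. (\<lambda>(y, p). H (abs_torus y) p) ((0, p) + (rep_torus x, 0)))"
      by (rule Ck_compose_affine[OF _ H_C2]) (auto intro!: bounded_linear_intros)
    then show ?thesis by (intro twice_differentiable_of_Ck2) simp
  qed
  have T: "H x 0 + grad (H x) 0 \<bullet> p + (norm p)\<^sup>2 / (2 * Cbar) \<le> H x p \<and>
      H x p \<le> H x 0 + grad (H x) 0 \<bullet> p + Cbar / 2 * (norm p)\<^sup>2" for x p
  proof -
    obtain s where "H x p = H x 0 + grad (H x) 0 \<bullet> p + (p \<bullet> (hessian (H x) (s *\<^sub>R p) *v p)) / 2"
      using second_order_Taylor[OF tw] by blast
    then show ?thesis using H_pp(2)[of p x "s *\<^sub>R p"] H_pp(3)[of p x "s *\<^sub>R p"] by (simp add: power2_norm_eq_inner)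
  qed
  have H0: "\<bar>H x 0\<bar> \<le> M" for x by (rule M) simp
  have g1: "grad (H x) 0 \<bullet> v \<le> 2 * M" if "norm v \<le> 1" for x v
  proof -
    have "0 \<le> (norm v)\<^sup>2 / (2 * Cbar)" using H_pp(1) by simp
    then show ?thesis using T[of x v] M[OF that, of x] H0[of x] by linarith
  qed
  have g: "\<bar>grad (H x) 0 \<bullet> p\<bar> \<le> 2 * M * norm p" for x p
  proof (cases "p = 0")
    case False
    have "grad (H x) 0 \<bullet> (p /\<^sub>R norm p) \<le> 2 * M" "grad (H x) 0 \<bullet> (- (p /\<^sub>R norm p)) \<le> 2 * M"
      using False by (auto intro!: g1 simp del: inner_minus_right inner_scaleR_right)
    then have "(grad (H x) 0 \<bullet> p) / norm p \<le> 2 * M" "- (grad (H x) 0 \<bullet> p) / norm p \<le> 2 * M"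
      by (auto simp: divide_inverse mult.commute)
    then have "grad (H x) 0 \<bullet> p \<le> 2 * M * norm p" "- (grad (H x) 0 \<bullet> p) \<le> 2 * M * norm p"
      using False by (simp_all only: pos_divide_le_eq zero_less_norm_iff not_False_eq_True)
    then show ?thesis by linarith
  qed simp
  define K where "K = 1 + 4 * Cbar + M + 4 * M\<^sup>2 * Cbar + Cbar / 2 + 2 * M"
  have K: "1 \<le> K" "4 * Cbar \<le> K" "M + 4 * M\<^sup>2 * Cbar \<le> K" "M + 2 * M \<le> K" "2 * M + Cbar / 2 \<le> K"
    using H_pp(1) M0 mult_nonneg_nonneg[OF zero_le_power2[of M] less_imp_le[OF H_pp(1)]] unfolding K_def by linarith+
  have "(norm p)\<^sup>2 / K - K \<le> H x p \<and> H x p \<le> K * (1 + (norm p)\<^sup>2)" for x p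
  proof
    have "2 * M * norm p \<le> (norm p)\<^sup>2 / (4 * Cbar) + 4 * M\<^sup>2 * Cbar"
    proof -
      have "0 \<le> (norm p / 2 - 2 * M * Cbar)\<^sup>2 / Cbar" using H_pp(1) by simp
      also have "\<dots> = (norm p)\<^sup>2 / (4 * Cbar) + 4 * M\<^sup>2 * Cbar - 2 * M * norm p"
        using H_pp(1) by (simp add: power2_eq_square field_simps)
      finally show ?thesis by simp
    qed
    moreover have "(norm p)\<^sup>2 / (2 * Cbar) = (norm p)\<^sup>2 / (4 * Cbar) + (norm p)\<^sup>2 / (4 * Cbar)"
      using H_pp(1) by (simp add: field_simps)
    moreover have "(norm p)\<^sup>2 / K \<le> (norm p)\<^sup>2 / (4 * Cbar)" using K H_pp(1) by (intro divide_left_mono) auto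
    ultimately show "(norm p)\<^sup>2 / K - K \<le> H x p"
      using conjunct1[OF T[of x p]] g[of x p] H0[of x] K(3) by linarith
    have "2 * norm p \<le> 1 + (norm p)\<^sup>2" using zero_le_power2[of "norm p - 1"] by (simp add: power2_diff)
    then have "M * (2 * norm p) \<le> M * (1 + (norm p)\<^sup>2)" using M0 by (rule mult_left_mono)
    then have m: "2 * M * norm p \<le> M + M * (norm p)\<^sup>2" by (simp add: algebra_simps)
    have "(2 * M + Cbar / 2) * (norm p)\<^sup>2 \<le> K * (norm p)\<^sup>2" using K by (intro mult_right_mono) auto
    then have "2 * (M * (norm p)\<^sup>2) + Cbar / 2 * (norm p)\<^sup>2 \<le> K * (norm p)\<^sup>2" by (simp add: algebra_simps)
    moreover have "0 \<le> M * (norm p)\<^sup>2" using M0 by simp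
    ultimately have "H x p \<le> K + K * (norm p)\<^sup>2"
      using conjunct2[OF T[of x p]] g[of x p] H0[of x] m K(4) M0 by linarith
    then show "H x p \<le> K * (1 + (norm p)\<^sup>2)" by (simp add: distrib_left)
  qed
  with K(1) show ?thesis by blast
qed

text \<open>
  The growth of \<open>D\<^sub>x\<^sub>x H\<close> is subquadratic; quadratic growth of the Lipschitz constant is all that is kept of it.
\<close>

lemma hamiltonian_lipschitz:
  fixes H :: "'n::finite torus \<Rightarrow> real^'n \<Rightarrow> real"
  assumes H_C2: "Ck 2 (\<lambda>(y, p). H (abs_torus y) p)" and growth: "\<theta> < 1" "C > 0"
      "\<And>x p. norm (torus_hessian (\<lambda>y. H y p) x) \<le> C * (1 + norm p) powr (1 + \<theta>)"
  shows "\<bar>H x p - H y p\<bar> \<le> (2 * real CARD('n) * C) * (1 + (norm p)\<^sup>2) * dist x y"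
proof -
  have "Ck 2 (\<lambda>y. (\<lambda>(y, p). H (abs_torus y) p) ((y, 0) + (0, p)))"
    by (rule Ck_compose_affine[OF _ H_C2]) (auto intro!: bounded_linear_intros)
  then have tw: "twice_differentiable (\<lambda>y. H (abs_torus y) p)" by (intro twice_differentiable_of_Ck2) simp
  have "(1 + norm p) powr (1 + \<theta>) \<le> (1 + norm p) powr 2" by (rule powr_mono) (use growth(1) in auto)
  also have "\<dots> = (1 + norm p)\<^sup>2" by simp
  also have "\<dots> \<le> 2 * (1 + (norm p)\<^sup>2)"
    using zero_le_power2[of "norm p - 1"] by (simp add: power2_diff power2_sum)
  finally have "C * (1 + norm p) powr (1 + \<theta>) \<le> C * (2 * (1 + (norm p)\<^sup>2))" using growth(2) by simp
  then have B: "norm (torus_hessian (\<lambda>y. H y p) x) \<le> C * (2 * (1 + (norm p)\<^sup>2))" for x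
    using growth(3) order.trans by blast
  show ?thesis using torus_lipschitz_of_hessian_bound[OF tw B, of x y] by (simp add: mult_ac)
qed

context
  fixes H :: "'n::finite torus \<Rightarrow> real^'n \<Rightarrow> real" and K :: real
  assumes K: "1 \<le> K" and H_lo: "\<And>x p. (norm p)\<^sup>2 / K - K \<le> H x p" and H_up: "\<And>x p. H x p \<le> K * (1 + (norm p)\<^sup>2)"
begin

lemma legendre_term_upper: "p \<bullet> q - H x p \<le> K * (1 + (norm q)\<^sup>2) - (norm p)\<^sup>2 / (2 * K)"
proof -
  have "0 \<le> (norm p - K * norm q)\<^sup>2 / (2 * K)" using K by simp
  also have "\<dots> = (norm p)\<^sup>2 / (2 * K) + K * (norm q)\<^sup>2 / 2 - norm p * norm q"
    using K by (simp add: power2_eq_square field_simps)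
  finally have "norm p * norm q \<le> (norm p)\<^sup>2 / (2 * K) + K * (norm q)\<^sup>2 / 2" by simp
  moreover have "(norm p)\<^sup>2 / K = (norm p)\<^sup>2 / (2 * K) + (norm p)\<^sup>2 / (2 * K)" using K by (simp add: field_simps)
  moreover have "K * (norm q)\<^sup>2 / 2 \<le> K * (norm q)\<^sup>2" using K by simp
  ultimately show ?thesis using H_lo[of p x] norm_cauchy_schwarz[of p q] by (simp add: distrib_left)
qed

lemma legendre_bdd: "bdd_above (range (\<lambda>p. p \<bullet> q - H x p))"
  and legendre_upper: "legendre H x q \<le> K * (1 + (norm q)\<^sup>2)"
proof -
  have *: "p \<bullet> q - H x p \<le> K * (1 + (norm q)\<^sup>2)" for p
  proof -
    have "0 \<le> (norm p)\<^sup>2 / (2 * K)" using K by simp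
    then show ?thesis using legendre_term_upper[of p q x] by linarith
  qed
  then show "bdd_above (range (\<lambda>p. p \<bullet> q - H x p))" by (rule bdd_aboveI2)
  show "legendre H x q \<le> K * (1 + (norm q)\<^sup>2)" unfolding legendre_def using * by (intro cSUP_least) auto
qed

lemma legendre_ge: "p \<bullet> q - H x p \<le> legendre H x q"
  unfolding legendre_def by (rule cSUP_upper[OF _ legendre_bdd]) simp

lemma legendre_lower: "(norm q)\<^sup>2 / (4 * K) - K \<le> legendre H x q"
proof -
  let ?p = "(1 / (2 * K)) *\<^sub>R q"
  have "K * (norm ?p)\<^sup>2 = (norm q)\<^sup>2 / (4 * K)" using K by (simp add: power2_eq_square field_simps)
  then have "H x ?p \<le> K + (norm q)\<^sup>2 / (4 * K)" using H_up[of x ?p] by (simp only: distrib_left mult_1_right)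
  moreover have "?p \<bullet> q = (norm q)\<^sup>2 / (4 * K) + (norm q)\<^sup>2 / (4 * K)"
    using K by (simp add: power2_norm_eq_inner field_simps)
  ultimately show ?thesis using legendre_ge[of ?p q x] by linarith
qed

text \<open>
  Only momenta with \<open>p \<bullet> q - H x p \<ge> -K\<close> compete in the supremum, since \<open>p = 0\<close> already achieves \<open>-K\<close>; for them
  \<open>|p|\<^sup>2\<close> is at most a multiple of \<open>1 + |q|\<^sup>2\<close>, and the Lipschitz bound on \<open>H\<close> passes to the transform.
\<close>

lemma legendre_lipschitz:
  assumes lip: "\<And>x y p. \<bar>H x p - H y p\<bar> \<le> K * (1 + (norm p)\<^sup>2) * dist x y"
  shows "\<bar>legendre H x q - legendre H y q\<bar> \<le> 5 * K ^ 3 * dist x y * (1 + (norm q)\<^sup>2)"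
proof -
  have "legendre H x q \<le> legendre H y q + 5 * K ^ 3 * dist x y * (1 + (norm q)\<^sup>2)" for x y
    unfolding legendre_def[of H x]
  proof (rule cSUP_least)
    fix p
    have nn: "0 \<le> 5 * K ^ 3 * dist x y * (1 + (norm q)\<^sup>2)" using K by simp
    show "p \<bullet> q - H x p \<le> legendre H y q + 5 * K ^ 3 * dist x y * (1 + (norm q)\<^sup>2)"
    proof (cases "p \<bullet> q - H x p < - K")
      case True
      then have "p \<bullet> q - H x p \<le> legendre H y q" using legendre_ge[of 0 q y] H_up[of y 0] by simp
      then show ?thesis using nn by linarith
    next
      case False
      then have "(norm p)\<^sup>2 / (2 * K) \<le> K * (1 + (norm q)\<^sup>2) + K" using legendre_term_upper[of p q x] by simp
      then have "(norm p)\<^sup>2 \<le> (K * (1 + (norm q)\<^sup>2) + K) * (2 * K)" using K by (simp add: pos_divide_le_eq)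
      moreover have "K\<^sup>2 * 1 \<le> K\<^sup>2 * (1 + (norm q)\<^sup>2)" by (intro mult_left_mono) auto
      ultimately have "(norm p)\<^sup>2 \<le> 4 * K\<^sup>2 * (1 + (norm q)\<^sup>2)" by (simp add: power2_eq_square algebra_simps)
      moreover have "1 * 1 \<le> K\<^sup>2 * (1 + (norm q)\<^sup>2)" using K by (intro mult_mono) (auto simp: one_le_power)
      ultimately have "1 + (norm p)\<^sup>2 \<le> 5 * K\<^sup>2 * (1 + (norm q)\<^sup>2)" by simp
      then have "K * (1 + (norm p)\<^sup>2) * dist y x \<le> K * (5 * K\<^sup>2 * (1 + (norm q)\<^sup>2)) * dist y x"
        using K by (intro mult_right_mono mult_left_mono) auto
      also have "\<dots> = 5 * K ^ 3 * dist x y * (1 + (norm q)\<^sup>2)" by (simp add: power2_eq_square power3_eq_cube dist_commute mult_ac)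
      finally show ?thesis using lip[of y p x] legendre_ge[of p q y] by linarith
    qed
  qed simp
  from this[of x y] this[of y x] show ?thesis by (simp add: dist_commute abs_le_iff)
qed

text \<open>
  By continuity in \<open>p\<close>, the supremum may be restricted to a countable dense set of momenta.
\<close>

lemma legendre_affine:
  assumes lip: "\<And>x y p. \<bar>H x p - H y p\<bar> \<le> K * (1 + (norm p)\<^sup>2) * dist x y"
    and cont: "\<And>x. continuous_on UNIV (H x)"
  shows "\<exists>p b. (\<forall>j::nat. continuous_on UNIV (b j)) \<and>
     (\<forall>x q. (\<forall>j. p j \<bullet> q - b j x \<le> legendre H x q) \<and> (\<forall>e>0. \<exists>j. legendre H x q - e < p j \<bullet> q - b j x))"
proof -
  obtain D :: "(real^'n) set" where D: "countable D" "\<And>X. open X \<Longrightarrow> X \<noteq> {} \<Longrightarrow> \<exists>d\<in>D. d \<in> X"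
    by (rule countable_dense_exists[where ?'a="real^'n", THEN exE]) blast
  have D0: "D \<noteq> {}" using D(2)[OF open_UNIV] by blast
  define p where "p = from_nat_into D"
  have "continuous_on UNIV (\<lambda>x. H x (p j))" for j
  proof (rule lipschitz_on_continuous_on[OF lipschitz_onI])
    show "dist (H x (p j)) (H y (p j)) \<le> K * (1 + (norm (p j))\<^sup>2) * dist x y" for x y using lip by (simp add: dist_real_def)
  qed (use K in simp)
  moreover have "\<exists>j. legendre H x q - e < p j \<bullet> q - H x (p j)" if "e > 0" for e x q
  proof -
    have "open {z. legendre H x q - e < z \<bullet> q - H x z}"
      by (intro open_Collect_less continuous_intros cont)
    moreover have "{z. legendre H x q - e < z \<bullet> q - H x z} \<noteq> {}"
    proof -
      have "\<exists>z\<in>UNIV. legendre H x q - e < z \<bullet> q - H x z"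
        using that by (subst less_cSUP_iff[symmetric, OF _ legendre_bdd]) (auto simp: legendre_def)
      then show ?thesis by blast
    qed
    ultimately obtain d where "d \<in> D" "legendre H x q - e < d \<bullet> q - H x d" using D(2) by blast
    moreover then obtain j where "d = p j" using from_nat_into_surj[OF D(1)] unfolding p_def by metis
    ultimately show ?thesis by blast
  qed
  ultimately show ?thesis
    using legendre_ge by (intro exI[of _ p] exI[of _ "\<lambda>j x. H x (p j)"]) blast
qed

end

text \<open>
  The derivative at a mixture, being \<open>L\<close>-Lipschitz in space, pairs with \<open>\<mu> - \<nu>\<close> to at most \<open>L\<close> times the
  Kantorovich-Rubinstein distance.
\<close>

lemma measure_deriv_lipschitz:
  fixes \<F> :: "'n::finite torus measure \<Rightarrow> real"
  assumes der: "has_measure_deriv \<F> D" and P: "\<mu> \<in> prob_torus" "\<nu> \<in> prob_torus"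
    and L: "\<And>m x y. m \<in> prob_torus \<Longrightarrow> \<bar>D m x - D m y\<bar> \<le> L * dist x y" "0 \<le> L"
  shows "\<bar>\<F> \<mu> - \<F> \<nu>\<bar> \<le> L * kr_dist \<mu> \<nu>"
proof -
  let ?g = "\<lambda>t. (\<integral>x. D (mix t \<nu> \<mu>) x \<partial>\<mu>) - (\<integral>x. D (mix t \<nu> \<mu>) x \<partial>\<nu>)"
  have k: "0 \<le> L * kr_dist \<mu> \<nu>" using mult_nonneg_nonneg[OF L(2) kr_dist_nonneg] .
  have "\<F> \<mu> - \<F> \<nu> = (\<integral>t. indicator {0..1} t *\<^sub>R ?g t \<partial>lborel)"
    using der P unfolding has_measure_deriv_def set_lebesgue_integral_def by blast
  also have "\<bar>\<dots>\<bar> \<le> (\<integral>t. \<bar>indicator {0..1} t *\<^sub>R ?g t\<bar> \<partial>lborel)" by (rule integral_abs_bound)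
  also have "\<dots> \<le> (\<integral>t. indicator {0..1} t *\<^sub>R (L * kr_dist \<mu> \<nu>) \<partial>(lborel :: real measure))"
  proof (rule integral_mono')
    fix t :: real
    have "\<bar>?g t\<bar> \<le> L * kr_dist \<mu> \<nu>" if "t \<in> {0..1}"
      using that P by (intro kr_dist_integral L) (auto intro!: mix_in_prob_torus L)
    then show "\<bar>indicator {0..1} t *\<^sub>R ?g t\<bar> \<le> indicator {0..1} t *\<^sub>R (L * kr_dist \<mu> \<nu>)"
      by (auto simp: indicator_def)
    show "integrable lborel (\<lambda>t::real. indicator {0..1} t *\<^sub>R (L * kr_dist \<mu> \<nu>))"
      by (intro integrable_scaleR_left integrable_real_indicator) auto
  qed (use k in \<open>auto simp: indicator_def\<close>)
  also have "\<dots> = L * kr_dist \<mu> \<nu>" by simp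
  finally show ?thesis .
qed

section \<open>The ergodic constant\<close>

theorem theorem1p8:
  fixes H :: "'n::finite torus \<Rightarrow> real^'n \<Rightarrow> real"
    and \<F> :: "'n torus measure \<Rightarrow> real"
    and F :: "'n torus \<Rightarrow> 'n torus measure \<Rightarrow> real"
    and L Cbar \<theta> C :: real
  assumes H_C2: "Ck 2 (\<lambda>(y, p). H (abs_torus y) p)"
    and H_pp_lipschitz: "\<And>x. L-lipschitz_on UNIV (\<lambda>p. hessian (H x) p)"
    and H_pp_bounds: "Cbar > 0"
      "\<And>x p v. (1 / Cbar) * (v \<bullet> v) \<le> v \<bullet> (hessian (H x) p *v v)"
      "\<And>x p v. v \<bullet> (hessian (H x) p *v v) \<le> Cbar * (v \<bullet> v)"
    and growth: "0 < \<theta>" "\<theta> < 1" "C > 0"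
      "\<And>x p. norm (torus_hessian (\<lambda>y. H y p) x) \<le> C * (1 + norm p) powr (1 + \<theta>)"
      "\<And>x p. norm (torus_jacobian (\<lambda>y. grad (H y) p) x) \<le> C * (1 + norm p) powr \<theta>"
    and \<F>_C2: "measure_C2 \<F>"
    and F_deriv: "has_measure_deriv \<F> (\<lambda>m x. F x m)"
    and F_twice_diff: "\<And>m. m \<in> prob_torus \<Longrightarrow> twice_differentiable (\<lambda>y. F (abs_torus y) m)"
    and F_xx_bounded: "\<exists>B. \<forall>m\<in>prob_torus. \<forall>x. norm (torus_hessian (\<lambda>y. F y m) x) \<le> B"
  shows "(\<exists>!lam :: real. \<exists>\<delta> :: nat \<Rightarrow> real. (\<forall>n. \<delta> n > 0) \<and> \<delta> \<longlonglongrightarrow> 0 \<and>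
            uniform_limit prob_torus (\<lambda>n m. \<delta> n * discounted_value H \<F> (\<delta> n) m)
              (\<lambda>_. - lam) sequentially)
       \<and> (\<forall>lam :: real. (\<exists>\<delta> :: nat \<Rightarrow> real. (\<forall>n. \<delta> n > 0) \<and> \<delta> \<longlonglongrightarrow> 0 \<and>
            uniform_limit prob_torus (\<lambda>n m. \<delta> n * discounted_value H \<F> (\<delta> n) m)
              (\<lambda>_. - lam) sequentially) \<longrightarrow>
            uniform_limit prob_torus (\<lambda>\<delta> m. \<delta> * discounted_value H \<F> \<delta> m)
              (\<lambda>_. - lam) (at_right 0) \<and>
            uniform_limit prob_torus (\<lambda>T m. finite_horizon_value H \<F> T m / T)
              (\<lambda>_. - lam) at_top)"
proof -
  let ?n = "real CARD('n)"
  obtain K0 where K0: "1 \<le> K0" "\<And>x p. (norm p)\<^sup>2 / K0 - K0 \<le> H x p" "\<And>x p. H x p \<le> K0 * (1 + (norm p)\<^sup>2)"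
    using hamiltonian_quadratic_growth[OF H_C2 H_pp_bounds] by auto
  define K where "K = max K0 (2 * ?n * C)"
  have K: "1 \<le> K" "K0 \<le> K" "2 * ?n * C \<le> K" using K0 by (auto simp: K_def)
  have lo: "(norm p)\<^sup>2 / K - K \<le> H x p" for x p
  proof -
    have "(norm p)\<^sup>2 / K \<le> (norm p)\<^sup>2 / K0" using K K0(1) by (intro divide_left_mono) auto
    then show ?thesis using K0(2)[of p x] K(2) by linarith
  qed
  have up: "H x p \<le> K * (1 + (norm p)\<^sup>2)" for x p
    using K0(3)[of x p] mult_right_mono[OF K(2), of "1 + (norm p)\<^sup>2"] by simp
  have lip: "\<bar>H x p - H y p\<bar> \<le> K * (1 + (norm p)\<^sup>2) * dist x y" for x y p
  proof -
    have "(2 * ?n * C) * (1 + (norm p)\<^sup>2) * dist x y \<le> K * (1 + (norm p)\<^sup>2) * dist x y"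
      using K(3) by (intro mult_right_mono) auto
    with hamiltonian_lipschitz[OF H_C2 growth(2,3,4), of x p y] show ?thesis by linarith
  qed
  have cont: "continuous_on UNIV (H x)" for x
  proof -
    from Ck2_continuous[OF H_C2] have "continuous_on UNIV ((\<lambda>(y, p). H (abs_torus y) p) \<circ> (\<lambda>p. (rep_torus x, p)))"
      by (intro continuous_on_compose continuous_intros) (auto intro: continuous_on_subset)
    then show ?thesis by (simp add: o_def)
  qed
  obtain B where B: "\<And>m x. m \<in> prob_torus \<Longrightarrow> norm (torus_hessian (\<lambda>y. F y m) x) \<le> B" using F_xx_bounded by blast
  obtain \<mu>0 :: "'n torus measure" where \<mu>0: "\<mu>0 \<in> prob_torus"
    using prob_torus_nonempty by blast
  have B0: "0 \<le> B" using order.trans[OF norm_ge_zero B[OF \<mu>0]] .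
  have F_lip: "\<bar>\<F> \<mu> - \<F> \<nu>\<bar> \<le> (?n * B) * kr_dist \<mu> \<nu>" if "\<mu> \<in> prob_torus" "\<nu> \<in> prob_torus" for \<mu> \<nu>
    by (rule measure_deriv_lipschitz[OF F_deriv that])
      (use B0 torus_lipschitz_of_hessian_bound[OF F_twice_diff B] in auto)
  obtain D where D: "0 \<le> D" "\<And>\<mu> \<nu>. \<mu> \<in> prob_torus \<Longrightarrow> \<nu> \<in> (prob_torus :: 'n torus measure set) \<Longrightarrow> kr_dist \<mu> \<nu> \<le> D"
    using kr_dist_bounded by blast
  define c where "c = 5 * K ^ 3 + ?n * B + (\<bar>\<F> \<mu>0\<bar> + ?n * B * D)"
  have nB: "0 \<le> ?n * B" "0 \<le> ?n * B * D" using B0 D(1) by auto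
  have "K \<le> K ^ 3" "1 \<le> K ^ 3" using K(1) by (auto simp: one_le_power self_le_power)
  then have c: "4 * K \<le> c" "K \<le> c" "1 \<le> c" "5 * K ^ 3 \<le> c" "?n * B \<le> c" "\<bar>\<F> \<mu>0\<bar> + ?n * B * D \<le> c"
    using nB K(1) by (auto simp: c_def)
  interpret G: mf_cost "legendre H" \<F> c
  proof
    show "1 \<le> c" by fact
    show "(norm q)\<^sup>2 / c - c \<le> legendre H x q" for q x
    proof -
      have "(norm q)\<^sup>2 / c \<le> (norm q)\<^sup>2 / (4 * K)" using c K by (intro divide_left_mono) auto
      then show ?thesis using legendre_lower[where H=H, OF K(1) lo up, where q=q and x=x] c(2) by linarith
    qed
    show "legendre H x q \<le> c * (1 + (norm q)\<^sup>2)" for q x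
      using legendre_upper[where H=H, OF K(1) lo up, where q=q and x=x] mult_right_mono[OF c(2), of "1 + (norm q)\<^sup>2"] by simp
    show "\<bar>legendre H x q - legendre H y q\<bar> \<le> c * dist x y * (1 + (norm q)\<^sup>2)" for x y q
    proof -
      have "5 * K ^ 3 * dist x y * (1 + (norm q)\<^sup>2) \<le> c * dist x y * (1 + (norm q)\<^sup>2)"
        using c(4) by (intro mult_right_mono) auto
      then show ?thesis using legendre_lipschitz[where H=H, OF K(1) lo up lip, where x=x and y=y and q=q] by linarith
    qed
    show "\<exists>p b. (\<forall>j::nat. continuous_on UNIV (b j)) \<and>
       (\<forall>x q. (\<forall>j. p j \<bullet> q - b j x \<le> legendre H x q) \<and> (\<forall>e>0. \<exists>j. legendre H x q - e < p j \<bullet> q - b j x))"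
      by (rule legendre_affine[where H=H, OF K(1) lo up lip cont])
    fix \<mu> assume \<mu>: "\<mu> \<in> (prob_torus :: 'n torus measure set)"
    show "\<bar>\<F> \<mu> - \<F> \<nu>\<bar> \<le> c * kr_dist \<mu> \<nu>" if "\<nu> \<in> prob_torus" for \<nu>
      using F_lip[OF \<mu> that] mult_right_mono[OF c(5) kr_dist_nonneg[of \<mu> \<nu>]] by linarith
    show "\<bar>\<F> \<mu>\<bar> \<le> c"
      using F_lip[OF \<mu> \<mu>0] mult_left_mono[OF D(2)[OF \<mu> \<mu>0] nB(1)] c(6) by linarith
  qed
  have U: "finite_horizon_value H \<F> T m = G.U T m" for T m
    by (simp add: finite_horizon_value_def G.val_def G.cost_def G.run_cost_def)
  have V: "discounted_value H \<F> \<delta> m = G.V \<delta> m" for \<delta> m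
    by (simp add: discounted_value_def G.val_def G.cost_def G.run_cost_def)
  have ud: "uniform_limit prob_torus (\<lambda>\<delta> m. \<delta> * discounted_value H \<F> \<delta> m) (\<lambda>_. G.L) (at_right 0)"
    unfolding uniform_limit_iff dist_real_def V
  proof (intro allI impI)
    fix e :: real assume "e > 0"
    then show "\<forall>\<^sub>F \<delta> in at_right 0. \<forall>m\<in>prob_torus. \<bar>\<delta> * G.V \<delta> m - G.L\<bar> < e"
      using G.V_limit[of "e / 2"] by (auto elim!: eventually_mono)
  qed
  have uT: "uniform_limit prob_torus (\<lambda>T m. finite_horizon_value H \<F> T m / T) (\<lambda>_. G.L) at_top"
    unfolding uniform_limit_iff dist_real_def U
  proof (intro allI impI)
    fix e :: real assume "e > 0"
    then show "\<forall>\<^sub>F T in at_top. \<forall>m\<in>prob_torus. \<bar>G.U T m / T - G.L\<bar> < e"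
      using G.U_limit[of "e / 2"] by (auto elim!: eventually_mono)
  qed
  \<comment> \<open>Uniform convergence as \<open>\<delta> \<rightarrow> 0\<close> covers every sequence of positive \<open>\<delta>\<close> tending to \<open>0\<close>, and this settles uniqueness.\<close>
  have seq: "uniform_limit prob_torus (\<lambda>n m. \<delta> n * discounted_value H \<F> (\<delta> n) m) (\<lambda>_. G.L) sequentially"
    if "\<forall>n. \<delta> n > 0" "\<delta> \<longlonglongrightarrow> 0" for \<delta> :: "nat \<Rightarrow> real"
  proof -
    have "\<delta> n \<noteq> 0" for n using that(1) by (metis less_irrefl)
    then have "filterlim \<delta> (at_right 0) sequentially" using that by (simp add: filterlim_at)
    then show ?thesis using ud unfolding uniform_limit_iff filterlim_iff by blast
  qed
  have uniq: "- lam = G.L"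
    if "\<forall>n. \<delta> n > 0" "\<delta> \<longlonglongrightarrow> 0" "uniform_limit prob_torus (\<lambda>n m. \<delta> n * discounted_value H \<F> (\<delta> n) m) (\<lambda>_. - lam) sequentially"
    for \<delta> :: "nat \<Rightarrow> real" and lam
    using tendsto_uniform_limitI[OF that(3) \<mu>0] tendsto_uniform_limitI[OF seq[OF that(1,2)] \<mu>0] by (rule LIMSEQ_unique)
  have "(\<lambda>n. 1 / real (Suc n)) \<longlonglongrightarrow> 0" using LIMSEQ_inverse_real_of_nat by (simp add: inverse_eq_divide)
  then have ex: "\<exists>\<delta> :: nat \<Rightarrow> real. (\<forall>n. \<delta> n > 0) \<and> \<delta> \<longlonglongrightarrow> 0 \<and>
      uniform_limit prob_torus (\<lambda>n m. \<delta> n * discounted_value H \<F> (\<delta> n) m) (\<lambda>_. - (- G.L)) sequentially"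
    using seq[of "\<lambda>n. 1 / real (Suc n)"] by (intro exI[of _ "\<lambda>n. 1 / real (Suc n)"]) auto
  show ?thesis
  proof (intro conjI allI impI)
    show "\<exists>!lam :: real. \<exists>\<delta> :: nat \<Rightarrow> real. (\<forall>n. \<delta> n > 0) \<and> \<delta> \<longlonglongrightarrow> 0 \<and>
        uniform_limit prob_torus (\<lambda>n m. \<delta> n * discounted_value H \<F> (\<delta> n) m) (\<lambda>_. - lam) sequentially"
    proof (rule ex1I[of _ "- G.L"])
      show "lam = - G.L" if "\<exists>\<delta> :: nat \<Rightarrow> real. (\<forall>n. \<delta> n > 0) \<and> \<delta> \<longlonglongrightarrow> 0 \<and>
        uniform_limit prob_torus (\<lambda>n m. \<delta> n * discounted_value H \<F> (\<delta> n) m) (\<lambda>_. - lam) sequentially" for lam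
        using that uniq by force
    qed (rule ex)
    fix lam :: real
    assume "\<exists>\<delta> :: nat \<Rightarrow> real. (\<forall>n. \<delta> n > 0) \<and> \<delta> \<longlonglongrightarrow> 0 \<and>
        uniform_limit prob_torus (\<lambda>n m. \<delta> n * discounted_value H \<F> (\<delta> n) m) (\<lambda>_. - lam) sequentially"
    then have "- lam = G.L" using uniq by blast
    then show "uniform_limit prob_torus (\<lambda>\<delta> m. \<delta> * discounted_value H \<F> \<delta> m) (\<lambda>_. - lam) (at_right 0)"
      "uniform_limit prob_torus (\<lambda>T m. finite_horizon_value H \<F> T m / T) (\<lambda>_. - lam) at_top"
      using ud uT by simp_all
  qed
qed

end
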